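(* Let $r\in(2,\infty)$, let $A$ be an operator on $L^2(\mathbb{R})$ satisfying assumptions A1--A6 (listed in the context), and suppose that a bounded sequence in $H^1(\mathbb{R})$ is given. Then one can extract a subsequence $(u_n)_{n\ge1}$, and for every $j\in\mathbb{N}$, $j\ge 1$, one can find $\psi_j\in H^1$ and standard sequences $(t^n_j)_{n\ge1},(x^n_j)_{n\ge1}\subset\mathbb{R}$ with the following properties. For $J\in\mathbb{N}$, $J\ge1$, define $R^n_J$ by $$u_n=\sum_{j=1}^{J}e^{it^n_jA}\tau_{x^n_j}\psi_j+R^n_J .$$ Then: (a) $|t^n_j-t^n_k|+|x^n_j-x^n_k|\to+\infty$ as $n\to+\infty$, for $j\ne k$; (b) $\limsup_n\|e^{-itA}R^n_J\|_{L^\infty L^\infty}\lesssim\|\psi_J\|_{L^2}^{1/2}\sup_n\|u_n\|_{H^1}^{1/2}\to0$ as $J\to\infty$; (c) for each $J$, as $n\to+\infty$, $$\|u_n\|_{L^2}^2=\sum_{j=1}^J\|\psi_j\|_{L^2}^2+\|R^n_J\|_{L^2}^2+o(1),$$ $$(Au_n,u_n)_{L^2}=\sum_{j=1}^J(A\tau_{x^n_j}\psi_j,\tau_{x^n_j}\psi_j)_{L^2}+(AR^n_J,R^n_J)_{L^2}+o(1),$$ $$\|u_n\|_{L^r}^r=\sum_{j=1}^J\|e^{it^n_jA}\tau_{x^n_j}\psi_j\|_{L^r}^r+\|R^n_J\|_{L^r}^r+o(1);$$ (d) if $\psi_J=0$ for some $J$ then $\psi_j=0$ for all $j\ge J$;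 (e) $\|\psi_j\|_{H^1}+\|R^n_J\|_{H^1}\lesssim\sup_n\|u_n\|_{H^1}$.
   Context: All function spaces are on $\mathbb{R}$; $(\cdot,\cdot)_{L^2}$ is the $L^2$ inner product, extended to the $H^{-1}$--$H^1$ duality. $L^\infty L^\infty=L^\infty(\mathbb{R}_t;L^\infty(\mathbb{R}_x))$. $X\lesssim Y$ means $X\le CY$ with a constant $C$ depending only on the operator $A$; $X\simeq Y$ means $X\lesssim Y\lesssim X$; $\rightharpoonup$ is weak convergence. Translations: $(\tau_zf)(x)=f(x+z)$, $A_z=\tau_{-z}A\tau_z$ for $z\in\mathbb{R}$, so $e^{-itA_z}=\tau_{-z}e^{-itA}\tau_z$. A sequence $(x_n)\subset\mathbb{R}$ is standard if either $x_n\to+\infty$, or $x_n\to-\infty$, or $x_n=0$ for all $n$. Assumptions (for all $\psi\in H^1$ and all sequences $(x_k),(s_k)\subset\mathbb{R}$): A1: $A$ is selfadjoint on $L^2(\mathbb{R})$ with $(Av,v)\ge0$ for $v\in D(A)$, $A$ extends to a bounded operator $H^1\to H^{-1}$, and for some $c_0>0$, $(A_zv,v)_{L^2}+c_0\|v\|_{L^2}^2\simeq\|v\|_{H^1}^2$ uniformly in $z\in\mathbb{R}$. A2: $\|e^{-itA}\psi\|_{H^1}\lesssim\|\psi\|_{H^1}$ uniformly in $t\in\mathbb{R}$. A3: $(A_{x_k}\psi)_{k\ge1}$ is precompact in $H^{-1}$. A4: if $s_k\to\overline{s}\in\mathbb{R}$, then $(e^{-is_kA_{x_k}}\psi)_{k\ge1}$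 is precompact in $H^1$. A5: $(e^{-is_kA_{x_k}}\psi)_{k\ge1}$ is precompact in $L^r$. A6: if $|s_k|\to+\infty$ then $e^{is_kA_{x_k}}\psi\rightharpoonup0$ in $H^1$ up to a subsequence. *)

theory Defs
  imports "HOL-Probability.Essential_Supremum"
begin

text \<open>
  Elements of the function spaces are represented by functions; the spaces are closed under
  equality almost everywhere (of Borel functions), and all the norms and pairings below ignore
  null sets.
\<close>

type_synonym cfun = "real \<Rightarrow> complex"


subsection \<open>Function spaces on the real line\<close>

definition Lp :: "real \<Rightarrow> cfun set" where
  "Lp p = {f. f \<in> borel_measurable lborel \<and> integrable lborel (\<lambda>x. cmod (f x) powr p)}"

definition Lp_norm :: "real \<Rightarrow> cfun \<Rightarrow> real" where
  "Lp_norm p f = (LINT x|lborel. cmod (f x) powr p) powr (1 / p)"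

definition L2_inner :: "cfun \<Rightarrow> cfun \<Rightarrow> complex" where
  "L2_inner f g = (LINT x|lborel. f x * cnj (g x))"

definition Linf_norm :: "cfun \<Rightarrow> ereal" where
  "Linf_norm f = esssup lborel (\<lambda>x. ereal (cmod (f x)))"

definition LinfLinf_norm :: "(real \<Rightarrow> cfun) \<Rightarrow> ereal" where
  "LinfLinf_norm F = esssup lborel (\<lambda>t. Linf_norm (F t))"

definition test_function :: "(real \<Rightarrow> real) \<Rightarrow> bool" where
  "test_function \<phi> \<longleftrightarrow>
     (\<forall>k x. (deriv ^^ k) \<phi> differentiable (at x)) \<and> compact (closure {x. \<phi> x \<noteq> 0})"

definition has_weak_deriv :: "cfun \<Rightarrow> cfun \<Rightarrow> bool" where
  "has_weak_deriv f g \<longleftrightarrow>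
     (\<forall>\<phi>. test_function \<phi> \<longrightarrow>
        (LINT x|lborel. f x * of_real (deriv \<phi> x)) = - (LINT x|lborel. g x * of_real (\<phi> x)))"

definition H1 :: "cfun set" where
  "H1 = {f \<in> Lp 2. \<exists>g \<in> Lp 2. has_weak_deriv f g}"

definition weak_deriv :: "cfun \<Rightarrow> cfun" where
  "weak_deriv f = (SOME g. g \<in> Lp 2 \<and> has_weak_deriv f g)"

definition H1_norm :: "cfun \<Rightarrow> real" where
  "H1_norm f = sqrt ((Lp_norm 2 f)\<^sup>2 + (Lp_norm 2 (weak_deriv f))\<^sup>2)"

text \<open>
  \<open>Hm1\<close> is the space $H^{-1}$, realised as the bounded conjugate-linear functionals on $H^1$: the
  value \<open>l v\<close> is the pairing $(l, v)_{L^2}$, and a function \<open>w\<close> in $L^2$ corresponds to the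
  functional \<open>L2_inner w\<close>.
\<close>

definition Hm1 :: "(cfun \<Rightarrow> complex) set" where
  "Hm1 = {l. (\<forall>a b. \<forall>u\<in>H1. \<forall>v\<in>H1. l (\<lambda>x. a * u x + b * v x) = cnj a * l u + cnj b * l v) \<and>
             (\<exists>C. \<forall>v\<in>H1. cmod (l v) \<le> C * H1_norm v)}"

definition Hm1_norm :: "(cfun \<Rightarrow> complex) \<Rightarrow> real" where
  "Hm1_norm l = (SUP v \<in> {v \<in> H1. H1_norm v \<le> 1}. cmod (l v))"

definition weakly_converges_H1 :: "(nat \<Rightarrow> cfun) \<Rightarrow> cfun \<Rightarrow> bool" where
  "weakly_converges_H1 f g \<longleftrightarrow> (\<forall>l\<in>Hm1. (\<lambda>n. l (f n)) \<longlonglongrightarrow> l g)"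

text \<open>
  Relative compactness of a set \<open>K\<close> in the (complete) space \<open>V\<close> with norm \<open>N\<close>. The type is
  general enough to cover both spaces of functions and the space \<open>Hm1\<close> of functionals.
\<close>

definition precompact_in ::
  "('b \<Rightarrow> complex) set \<Rightarrow> (('b \<Rightarrow> complex) \<Rightarrow> real) \<Rightarrow> ('b \<Rightarrow> complex) set \<Rightarrow> bool" where
  "precompact_in V N K \<longleftrightarrow> K \<subseteq> V \<and>
     (\<forall>y :: nat \<Rightarrow> 'b \<Rightarrow> complex. (\<forall>k. y k \<in> K) \<longrightarrow>
        (\<exists>l\<in>V. \<exists>\<rho> :: nat \<Rightarrow> nat. strict_mono \<rho> \<and> (\<lambda>k. N (\<lambda>z. y (\<rho> k) z - l z)) \<longlonglongrightarrow> 0))"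


subsection \<open>Self-adjoint operators and their unitary groups\<close>

definition L2_linear_on :: "cfun set \<Rightarrow> (cfun \<Rightarrow> cfun) \<Rightarrow> bool" where
  "L2_linear_on D T \<longleftrightarrow>
     (\<forall>u\<in>D. T u \<in> Lp 2) \<and>
     (\<forall>a b. \<forall>u\<in>D. \<forall>v\<in>D. (\<lambda>x. a * u x + b * v x) \<in> D \<and>
        (AE x in lborel. T (\<lambda>x. a * u x + b * v x) x = a * T u x + b * T v x))"

text \<open>
  \<open>adjoint_graph D A v w\<close> says that \<open>v\<close> is in the domain of the adjoint of \<open>(D, A)\<close> and that the
  adjoint maps \<open>v\<close> to \<open>w\<close>; self-adjointness says that this is the graph of \<open>A\<close> itself.
\<close>

definition adjoint_graph :: "cfun set \<Rightarrow> (cfun \<Rightarrow> cfun) \<Rightarrow> cfun \<Rightarrow> cfun \<Rightarrow> bool" where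
  "adjoint_graph D A v w \<longleftrightarrow>
     v \<in> Lp 2 \<and> w \<in> Lp 2 \<and> (\<forall>u\<in>D. L2_inner (A u) v = L2_inner u w)"

definition selfadjoint :: "cfun set \<Rightarrow> (cfun \<Rightarrow> cfun) \<Rightarrow> bool" where
  "selfadjoint D A \<longleftrightarrow>
     D \<subseteq> Lp 2 \<and>
     (\<forall>f\<in>Lp 2. \<forall>\<epsilon>>0. \<exists>g\<in>D. Lp_norm 2 (\<lambda>x. f x - g x) < \<epsilon>) \<and>
     L2_linear_on D A \<and>
     (\<forall>v w. adjoint_graph D A v w \<longleftrightarrow> v \<in> D \<and> w \<in> Lp 2 \<and> (AE x in lborel. w x = A v x))"

text \<open>
  \<open>schroedinger_group D A U\<close>: \<open>U t\<close> is $e^{-itA}$, that is, \<open>U\<close> is the strongly continuous unitary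
  group on $L^2$ whose infinitesimal generator is $-iA$ with domain \<open>D\<close>. For self-adjoint \<open>A\<close> such
  a group exists and is unique up to null sets.
\<close>

definition schroedinger_group ::
  "cfun set \<Rightarrow> (cfun \<Rightarrow> cfun) \<Rightarrow> (real \<Rightarrow> cfun \<Rightarrow> cfun) \<Rightarrow> bool" where
  "schroedinger_group D A U \<longleftrightarrow>
     (\<forall>t. L2_linear_on (Lp 2) (U t)) \<and>
     (\<forall>t. \<forall>f\<in>Lp 2. Lp_norm 2 (U t f) = Lp_norm 2 f) \<and>
     (\<forall>f\<in>Lp 2. AE x in lborel. U 0 f x = f x) \<and>
     (\<forall>s t. \<forall>f\<in>Lp 2. AE x in lborel. U (s + t) f x = U s (U t f) x) \<and>
     (\<forall>f\<in>Lp 2. ((\<lambda>t. Lp_norm 2 (\<lambda>x. U t f x - f x)) \<longlongrightarrow> 0) (at 0)) \<and>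
     (\<forall>f\<in>Lp 2. \<forall>g\<in>Lp 2.
        ((\<lambda>h. Lp_norm 2 (\<lambda>x. (U h f x - f x) / of_real h - (- \<i> * g x))) \<longlongrightarrow> 0) (at 0) \<longleftrightarrow>
        f \<in> D \<and> (AE x in lborel. g x = A f x))"

text \<open>
  \<open>H1_extension D A B\<close>: \<open>B\<close> is a bounded operator from $H^1$ to $H^{-1}$ extending \<open>A\<close>, so that
  \<open>B u v\<close> is $(Au, v)_{L^2}$ in the sense of the $H^{-1}$--$H^1$ duality.
\<close>

definition H1_extension ::
  "cfun set \<Rightarrow> (cfun \<Rightarrow> cfun) \<Rightarrow> (cfun \<Rightarrow> cfun \<Rightarrow> complex) \<Rightarrow> bool" where
  "H1_extension D A B \<longleftrightarrow>
     D \<subseteq> H1 \<and>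
     (\<forall>u\<in>H1. B u \<in> Hm1) \<and>
     (\<forall>a b. \<forall>u\<in>H1. \<forall>v\<in>H1. \<forall>w\<in>H1. B (\<lambda>x. a * u x + b * v x) w = a * B u w + b * B v w) \<and>
     (\<exists>C. \<forall>u\<in>H1. Hm1_norm (B u) \<le> C * H1_norm u) \<and>
     (\<forall>u\<in>D. \<forall>v\<in>H1. B u v = L2_inner (A u) v)"


subsection \<open>Translations\<close>

definition translate :: "real \<Rightarrow> cfun \<Rightarrow> cfun" where
  "translate z f = (\<lambda>x. f (x + z))"

definition conj_translate :: "real \<Rightarrow> (cfun \<Rightarrow> cfun) \<Rightarrow> cfun \<Rightarrow> cfun" where
  "conj_translate z T f = translate (- z) (T (translate z f))"

text \<open>
  The operator $A_z = \tau_{-z} A \tau_z$ from $H^1$ to $H^{-1}$, where $\tau_{-z}$ acts on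
  functionals as the dual of $\tau_z$, consistently with the embedding of $L^2$ into $H^{-1}$.
\<close>

definition conj_translate_form ::
  "real \<Rightarrow> (cfun \<Rightarrow> cfun \<Rightarrow> complex) \<Rightarrow> cfun \<Rightarrow> cfun \<Rightarrow> complex" where
  "conj_translate_form z B u = (\<lambda>v. B (translate z u) (translate z v))"

definition standard_seq :: "(nat \<Rightarrow> real) \<Rightarrow> bool" where
  "standard_seq x \<longleftrightarrow>
     filterlim x at_top sequentially \<or> filterlim x at_bot sequentially \<or> (\<forall>n. x n = 0)"


subsection \<open>The assumptions on the operator\<close>

text \<open>
  The quadratic forms are real-valued by self-adjointness of \<open>A\<close>; \<open>Re\<close> only adjusts the type.
\<close>

definition assumption_A1 ::
  "cfun set \<Rightarrow> (cfun \<Rightarrow> cfun) \<Rightarrow> (cfun \<Rightarrow> cfun \<Rightarrow> complex) \<Rightarrow> bool" where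
  "assumption_A1 D A B \<longleftrightarrow>
     selfadjoint D A \<and>
     (\<forall>v\<in>D. 0 \<le> Re (L2_inner (A v) v)) \<and>
     H1_extension D A B \<and>
     (\<exists>c0>0. \<exists>m>0. \<exists>M>0. \<forall>z. \<forall>v\<in>H1.
        m * (H1_norm v)\<^sup>2 \<le> Re (conj_translate_form z B v v) + c0 * (Lp_norm 2 v)\<^sup>2 \<and>
        Re (conj_translate_form z B v v) + c0 * (Lp_norm 2 v)\<^sup>2 \<le> M * (H1_norm v)\<^sup>2)"

definition assumption_A2 :: "(real \<Rightarrow> cfun \<Rightarrow> cfun) \<Rightarrow> bool" where
  "assumption_A2 U \<longleftrightarrow>
     (\<exists>C. \<forall>t. \<forall>\<psi>\<in>H1. U t \<psi> \<in> H1 \<and> H1_norm (U t \<psi>) \<le> C * H1_norm \<psi>)"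

definition assumption_A3 :: "(cfun \<Rightarrow> cfun \<Rightarrow> complex) \<Rightarrow> bool" where
  "assumption_A3 B \<longleftrightarrow>
     (\<forall>\<psi>\<in>H1. \<forall>x :: nat \<Rightarrow> real.
        precompact_in Hm1 Hm1_norm (range (\<lambda>k. conj_translate_form (x k) B \<psi>)))"

definition assumption_A4 :: "(real \<Rightarrow> cfun \<Rightarrow> cfun) \<Rightarrow> bool" where
  "assumption_A4 U \<longleftrightarrow>
     (\<forall>\<psi>\<in>H1. \<forall>(x :: nat \<Rightarrow> real) (s :: nat \<Rightarrow> real). convergent s \<longrightarrow>
        precompact_in H1 H1_norm (range (\<lambda>k. conj_translate (x k) (U (s k)) \<psi>)))"

definition assumption_A5 :: "real \<Rightarrow> (real \<Rightarrow> cfun \<Rightarrow> cfun) \<Rightarrow> bool" where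
  "assumption_A5 r U \<longleftrightarrow>
     (\<forall>\<psi>\<in>H1. \<forall>(x :: nat \<Rightarrow> real) (s :: nat \<Rightarrow> real).
        precompact_in (Lp r) (Lp_norm r) (range (\<lambda>k. conj_translate (x k) (U (s k)) \<psi>)))"

text \<open>Here the propagator is $e^{+isA}$, that is \<open>U (- s)\<close>.\<close>

definition assumption_A6 :: "(real \<Rightarrow> cfun \<Rightarrow> cfun) \<Rightarrow> bool" where
  "assumption_A6 U \<longleftrightarrow>
     (\<forall>\<psi>\<in>H1. \<forall>(x :: nat \<Rightarrow> real) (s :: nat \<Rightarrow> real).
        filterlim (\<lambda>k. \<bar>s k\<bar>) at_top sequentially \<longrightarrow>
        (\<exists>\<rho> :: nat \<Rightarrow> nat. strict_mono \<rho> \<and>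
           weakly_converges_H1 (\<lambda>k. conj_translate (x (\<rho> k)) (U (- s (\<rho> k))) \<psi>) (\<lambda>_. 0)))"


subsection \<open>The profile decomposition\<close>

text \<open>The profile $e^{it^n_j A}\tau_{x^n_j}\psi_j$, with \<open>t j n\<close> for $t^n_j$ and \<open>x j n\<close> for $x^n_j$.\<close>

definition profile ::
  "(real \<Rightarrow> cfun \<Rightarrow> cfun) \<Rightarrow> (nat \<Rightarrow> cfun) \<Rightarrow> (nat \<Rightarrow> nat \<Rightarrow> real) \<Rightarrow> (nat \<Rightarrow> nat \<Rightarrow> real) \<Rightarrow>
   nat \<Rightarrow> nat \<Rightarrow> cfun" where
  "profile U \<psi> t x j n = U (- t j n) (translate (x j n) (\<psi> j))"

definition remainder ::
  "(real \<Rightarrow> cfun \<Rightarrow> cfun) \<Rightarrow> (nat \<Rightarrow> cfun) \<Rightarrow> (nat \<Rightarrow> cfun) \<Rightarrow> (nat \<Rightarrow> nat \<Rightarrow> real) \<Rightarrow>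
   (nat \<Rightarrow> nat \<Rightarrow> real) \<Rightarrow> nat \<Rightarrow> nat \<Rightarrow> cfun" where
  "remainder U u \<psi> t x J n = (\<lambda>y. u n y - (\<Sum>j = 1..J. profile U \<psi> t x j n y))"

end

theory Submission
  imports Defs "HOL-Probability.Distributions"
begin

text \<open>
  All limits are taken along one free ultrafilter \<open>G\<close> on the natural numbers, along which every bounded
  sequence in \<open>H1\<close> converges weakly by the Riesz representation theorem; a subsequence is extracted only
  at the very end, from countably many \<open>G\<close>-large sets. Given the remainder \<open>w\<close> of a stage, let
  \<open>lam w\<close> be the supremum of the \<open>L\<^sup>2\<close> norms of the weak limits of the translates of \<open>U (t n) (w n)\<close>.
  The next profile is such a limit of norm at least \<open>lam w / 2\<close>, where a converging sequence of times or of
  positions may be replaced by \<open>0\<close> because of A4. Removing it splits the \<open>L\<^sup>2\<close> norm (the group is unitary),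
  the energy (by A3, since the form is invariant under the group) and the \<open>L\<^sup>r\<close> norm (Brezis and Lieb if
  the times vanish; by A5 and A6 the profile tends to \<open>0\<close> in \<open>L\<^sup>r\<close> otherwise). The bound
  \<open>\<bar>f x\<bar> \<le> 2 sqrt (\<parallel>f\<parallel>\<^sub>2 \<parallel>f\<parallel>\<^sub>H\<^sub>1)\<close>, applied to a weak limit at a nearly maximal point, controls the
  supremum norm of the remainder by \<open>lam\<close>.
  The bound on the remainder for every \<open>n\<close>, rather than for large \<open>n\<close>, needs care: for \<open>n < j\<close> the
  parameters of the profile \<open>j\<close> are those of a later index, at which it is almost orthogonal to the
  profiles chosen before it.
\<close>

subsection \<open>Ultrafilters and Hilbert spaces\<close>

text \<open>Passing to a subsequence at each stage would change the family of weak limits over which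
  \<open>lam\<close> is a supremum. With one fixed ultrafilter \<open>lam\<close> is a number
  attached to a remainder, it decreases from stage to stage, and
  \<open>Lp_norm 2 (\<psi> (Suc J))\<close> lies between half of \<open>lam (R J)\<close> and
  \<open>lam (R J)\<close>; this gives (d), and it lets (b) be stated with \<open>\<psi> J\<close>.
  The price is that A3 to A6 and dominated convergence concern ordinary sequences. Each transfer to
  \<open>G\<close> therefore argues by contradiction: a failure holds on a \<open>G\<close>-large
  set, and an ordinary sequence with finitely many prescribed properties at each index is selected
  from it. A second obstacle is the form: A1 gives \<open>D\<close> dense in
  \<open>L\<^sup>2\<close> only, whereas the energy splitting needs a form that is symmetric and
  invariant under the group on all of \<open>H1\<close>. Self-adjointness and coercivity yield the
  density of \<open>D\<close> in \<open>H1\<close>. The \<open>H1\<close> bounds on profiles and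
  remainders cannot be found by adding up profiles; they come from the \<open>L\<^sup>2\<close> and
  energy splittings, combined through the coercivity that is uniform in the translation.\<close>

definition ultra :: "'a filter \<Rightarrow> bool" where
  "ultra G \<longleftrightarrow> G \<noteq> bot \<and> (\<forall>P. eventually P G \<or> eventually (\<lambda>x. \<not> P x) G)"

text \<open>Zorn's lemma for the proper filters below \<open>F\<close>. The infimum of a chain stays
  proper because a property holds eventually in it only if it does so in some member of the
  chain.\<close>

lemma ultra_exists:
  assumes "F \<noteq> (bot :: 'a filter)"
  shows "\<exists>G\<le>F. ultra G"
proof -
  define A where "A = {G. G \<noteq> bot \<and> G \<le> F}"
  define R where "R = (\<lambda>a b :: 'a filter. b \<le> a)"
  have "\<exists>m\<in>A. \<forall>a\<in>A. R m a \<longrightarrow> a = m"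
  proof (rule predicate_Zorn)
    show "partial_order_on A (relation_of R A)"
      by (auto simp: partial_order_on_def preorder_on_def refl_on_def trans_def antisym_def
          relation_of_def R_def)
  next
    fix C assume C: "C \<in> Chains (relation_of R A)"
    then have CA: "C \<subseteq> A" and tot: "\<And>a b. a \<in> C \<Longrightarrow> b \<in> C \<Longrightarrow> a \<le> b \<or> b \<le> a"
      by (auto simp: Chains_def relation_of_def R_def)
    show "\<exists>u\<in>A. \<forall>a\<in>C. R a u"
    proof (cases "C = {}")
      case True
      then show ?thesis using assms by (auto simp: A_def)
    next
      case False
      have "\<exists>x\<in>C. x \<le> inf a b" if "a \<in> C" "b \<in> C" for a b
        using tot[OF that] that by (metis inf.absorb1 inf.absorb2 order_refl)
      then have ev: "eventually P (Inf C) \<longleftrightarrow> (\<exists>b\<in>C. eventually P b)" for P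
        using eventually_Inf_base[OF False] by blast
      have "Inf C \<noteq> bot"
        using ev[of "\<lambda>_. False"] CA by (auto simp: A_def trivial_limit_def)
      moreover have "Inf C \<le> F"
      proof -
        from False obtain c where "c \<in> C" by blast
        then have "Inf C \<le> c" "c \<le> F" using CA by (auto simp: A_def intro: Inf_lower)
        then show ?thesis by (rule order_trans)
      qed
      ultimately show ?thesis by (auto simp: A_def R_def intro!: bexI[of _ "Inf C"] Inf_lower)
    qed
  qed
  then obtain m where m: "m \<noteq> bot" "m \<le> F" and max: "\<And>a. a \<noteq> bot \<Longrightarrow> a \<le> m \<Longrightarrow> a = m"
    by (auto simp: A_def R_def intro: order_trans)
  have "eventually P m \<or> eventually (\<lambda>x. \<not> P x) m" for P
  proof (rule disjCI)
    assume "\<not> eventually (\<lambda>x. \<not> P x) m"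
    \<comment> \<open>Refining \<open>m\<close> by \<open>P\<close> keeps it proper, so maximality
      makes the refinement equal to \<open>m\<close>.\<close>
    then have "inf m (principal {x. P x}) \<noteq> bot"
      by (simp add: trivial_limit_def eventually_inf_principal)
    then have m_eq: "inf m (principal {x. P x}) = m" by (rule max) simp
    have "eventually P (inf m (principal {x. P x}))" by (simp add: eventually_inf_principal)
    then show "eventually P m" unfolding m_eq .
  qed
  with m show ?thesis by (auto simp: ultra_def)
qed

lemma ultra_cases: "ultra G \<Longrightarrow> eventually P G \<or> eventually (\<lambda>x. \<not> P x) G"
  by (auto simp: ultra_def)

text \<open>Compactness provides a cluster point, and a cluster point of an ultrafilter is a
  limit.\<close>

lemma ultra_bounded_tendsto:
  fixes f :: "'a \<Rightarrow> 'b :: {heine_borel, real_normed_vector}"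
  assumes G: "ultra G" and K: "eventually (\<lambda>x. norm (f x) \<le> K) G"
  shows "\<exists>l. (f \<longlongrightarrow> l) G"
proof -
  have nb: "filtermap f G \<noteq> bot" using G by (auto simp: ultra_def filtermap_bot_iff)
  have "eventually (\<lambda>y. y \<in> cball 0 K) (filtermap f G)"
    using K by (simp add: eventually_filtermap)
  with nb obtain l where l: "inf (nhds l) (filtermap f G) \<noteq> bot"
    using compact_cball[of "0 :: 'b" K] unfolding compact_filter by blast
  have "(f \<longlongrightarrow> l) G"
  proof (rule topological_tendstoI)
    fix S assume S: "open S" "l \<in> S"
    show "eventually (\<lambda>x. f x \<in> S) G"
    proof (rule ccontr)
      assume "\<not> eventually (\<lambda>x. f x \<in> S) G"
      then have "eventually (\<lambda>x. f x \<notin> S) G" using ultra_cases[OF G] by auto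
      then have "eventually (\<lambda>y. y \<notin> S) (filtermap f G)" by (simp add: eventually_filtermap)
      moreover have "eventually (\<lambda>y. y \<in> S) (nhds l)" using S by (rule eventually_nhds_in_open)
      ultimately have "eventually (\<lambda>y. False) (inf (nhds l) (filtermap f G))"
        unfolding eventually_inf by blast
      then show False using l by (simp add: trivial_limit_def)
    qed
  qed
  then show ?thesis ..
qed

text \<open>This trichotomy is the source of the standard sequences: a parameter either diverges
  with a definite sign or converges, and then it can be replaced by 0.\<close>

lemma ultra_tendsto_cases:
  fixes f :: "'a \<Rightarrow> real"
  assumes G: "ultra G"
  obtains "filterlim f at_top G" | "filterlim f at_bot G" | l where "(f \<longlongrightarrow> l) G"
proof (cases "\<exists>K. eventually (\<lambda>x. norm (f x) \<le> K) G")
  case True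
  then show ?thesis using ultra_bounded_tendsto[OF G] that by blast
next
  case False
  then have *: "eventually (\<lambda>x. \<bar>f x\<bar> > K) G" for K
    using ultra_cases[OF G, of "\<lambda>x. norm (f x) \<le> K"] by (auto simp: not_le)
  show ?thesis
  proof (cases "eventually (\<lambda>x. f x > 0) G")
    case True
    have "filterlim f at_top G"
      unfolding filterlim_at_top
    proof
      fix Z show "eventually (\<lambda>x. Z \<le> f x) G"
        using *[of Z] True by eventually_elim auto
    qed
    then show ?thesis using that by blast
  next
    case False
    then have F: "eventually (\<lambda>x. \<not> f x > 0) G" using ultra_cases[OF G] by blast
    have "filterlim f at_bot G"
      unfolding filterlim_at_bot
    proof
      fix Z show "eventually (\<lambda>x. f x \<le> Z) G"
        using *[of "-Z"] F by eventually_elim auto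
    qed
    then show ?thesis using that by blast
  qed
qed

lemma ultra_not_tendsto_abs_at_top:
  fixes f :: "'a \<Rightarrow> real"
  assumes G: "ultra G" and "\<not> filterlim (\<lambda>x. \<bar>f x\<bar>) at_top G"
  shows "\<exists>l. (f \<longlongrightarrow> l) G"
  using G
proof (cases rule: ultra_tendsto_cases[of G f])
  case 1
  then have "filterlim (\<lambda>x. \<bar>f x\<bar>) at_top G"
    by (rule filterlim_at_top_mono) (intro always_eventually allI abs_ge_self)
  with assms show ?thesis by simp
next
  case 2
  then have "filterlim (\<lambda>x. - f x) at_top G" by (simp add: filterlim_uminus_at_top)
  then have "filterlim (\<lambda>x. \<bar>f x\<bar>) at_top G"
    by (rule filterlim_at_top_mono) (rule always_eventually, rule allI, rule abs_ge_minus_self)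
  with assms show ?thesis by simp
qed auto

text \<open>Diagonal selection: at each stage only finitely many \<open>G\<close>-large conditions
  are imposed, so they can be met together. The condition \<open>Q k a j\<close> may depend on the
  index \<open>a\<close> already chosen at stage \<open>k\<close>; this serves to separate terms
  from earlier ones, and later to make profiles almost orthogonal to earlier ones.\<close>

lemma filter_select:
  fixes G :: "nat filter" and P :: "nat \<Rightarrow> nat \<Rightarrow> bool" and Q :: "nat \<Rightarrow> nat \<Rightarrow> nat \<Rightarrow> nat \<Rightarrow> bool"
  assumes G: "G \<le> sequentially" "G \<noteq> bot"
    and Q: "\<And>j k a. k < j \<Longrightarrow> eventually (Q k a j) G"
    and P: "\<And>j. eventually (P j) G"
  shows "\<exists>\<sigma>. strict_mono \<sigma> \<and> (\<forall>j. P j (\<sigma> j)) \<and> (\<forall>j k. k < j \<longrightarrow> Q k (\<sigma> k) j (\<sigma> j))"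
proof -
  define S where "S = (\<lambda>(f :: nat \<Rightarrow> nat) j m. P j m \<and> (\<forall>k<j. Q k (f k) j m \<and> f k < m))"
  have "\<exists>f. \<forall>j. S f j (f j)"
  proof (rule dependent_wf_choice[OF wf_less_than])
    fix f g :: "nat \<Rightarrow> nat" and x r
    assume "\<And>z. (z, x) \<in> less_than \<Longrightarrow> f z = g z"
    then show "S f x r = S g x r" by (auto simp: S_def)
  next
    fix j f
    have "eventually (\<lambda>m. \<forall>k\<in>{..<j}. Q k (f k) j m \<and> f k < m) G"
      using Q G(1) eventually_gt_at_top
      by (intro eventually_ball_finite) (auto intro!: eventually_conj intro: filter_leD[OF G(1)])
    with P[of j] have "eventually (S f j) G"
      by eventually_elim (auto simp: S_def)
    then show "\<exists>r. S f j r" using G(2) eventually_happens by blast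
  qed
  then obtain f where f: "\<And>j. S f j (f j)" by blast
  have "strict_mono f" using f by (auto simp: S_def strict_mono_def)
  with f show ?thesis by (auto simp: S_def)
qed

text \<open>Sequential precompactness does not give total boundedness of the whole family here, since only
  the index sequences satisfying \<open>P\<close> are known to be precompact; \<open>filter_select\<close> builds such
  sequences inside the ultrafilter.\<close>

lemma ultra_precompact_limit:
  fixes y :: "nat \<Rightarrow> 'b \<Rightarrow> complex" and P :: "nat \<Rightarrow> nat \<Rightarrow> bool"
  assumes G: "G \<le> sequentially" "ultra G"
    and P: "\<And>j. eventually (P j) G"
    and tri: "\<And>f g h. f \<in> V \<Longrightarrow> g \<in> V \<Longrightarrow> h \<in> V \<Longrightarrow>
      N (\<lambda>z. f z - h z) \<le> N (\<lambda>z. f z - g z) + N (\<lambda>z. g z - h z)"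
    and sym: "\<And>f g. f \<in> V \<Longrightarrow> g \<in> V \<Longrightarrow> N (\<lambda>z. f z - g z) = N (\<lambda>z. g z - f z)"
    and pos: "\<And>f g. f \<in> V \<Longrightarrow> g \<in> V \<Longrightarrow> 0 \<le> N (\<lambda>z. f z - g z)"
    and yV: "\<And>n. y n \<in> V"
    and pc: "\<And>\<sigma>. strict_mono \<sigma> \<Longrightarrow> (\<And>j. P j (\<sigma> j)) \<Longrightarrow> precompact_in V N (range (\<lambda>k. y (\<sigma> k)))"
  shows "\<exists>l\<in>V. ((\<lambda>n. N (\<lambda>z. y n z - l z)) \<longlongrightarrow> 0) G"
proof -
  have Gb: "G \<noteq> bot" using G by (auto simp: ultra_def)
  have seq: "\<exists>l\<in>V. \<exists>\<rho>::nat \<Rightarrow> nat. strict_mono \<rho> \<and> (\<lambda>k. N (\<lambda>z. y (\<sigma> (\<rho> k)) z - l z)) \<longlonglongrightarrow> 0"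
    if "strict_mono \<sigma>" "\<And>j. P j (\<sigma> j)" for \<sigma>
    by (rule pc[OF that, unfolded precompact_in_def, THEN conjunct2, THEN spec, THEN mp]) auto
  \<comment> \<open>If no ball of radius \<open>e\<close> about a term of the sequence were
    \<open>G\<close>-large, an \<open>e\<close>-separated sequence of terms could be selected,
    contradicting precompactness.\<close>
  have cover: "\<exists>c. eventually (\<lambda>n. N (\<lambda>z. y n z - y c z) < e) G" if e: "e > 0" for e
  proof (rule ccontr)
    assume "\<nexists>c. eventually (\<lambda>n. N (\<lambda>z. y n z - y c z) < e) G"
    then have "eventually (\<lambda>n. \<not> N (\<lambda>z. y n z - y c z) < e) G" for c
      using ultra_cases[OF G(2)] by blast
    then obtain \<sigma> where s: "strict_mono \<sigma>" "\<And>j. P j (\<sigma> j)"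
      and sep: "\<And>j k. k < j \<Longrightarrow> \<not> N (\<lambda>z. y (\<sigma> j) z - y (\<sigma> k) z) < e"
      using filter_select[OF G(1) Gb, of "\<lambda>k a j m. \<not> N (\<lambda>z. y m z - y a z) < e" P] P by blast
    obtain l \<rho> where l: "l \<in> V" "strict_mono \<rho>" "(\<lambda>k. N (\<lambda>z. y (\<sigma> (\<rho> k)) z - l z)) \<longlonglongrightarrow> 0"
      using seq[OF s] by blast
    have "eventually (\<lambda>k. N (\<lambda>z. y (\<sigma> (\<rho> k)) z - l z) < e/2) sequentially"
      using l(3) e by (intro order_tendstoD) auto
    then obtain k where k: "\<And>i. i \<ge> k \<Longrightarrow> N (\<lambda>z. y (\<sigma> (\<rho> i)) z - l z) < e/2"
      by (auto simp: eventually_sequentially)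
    have "N (\<lambda>z. y (\<sigma> (\<rho> (Suc k))) z - y (\<sigma> (\<rho> k)) z)
        \<le> N (\<lambda>z. y (\<sigma> (\<rho> (Suc k))) z - l z) + N (\<lambda>z. l z - y (\<sigma> (\<rho> k)) z)"
      by (intro tri yV l)
    also have "N (\<lambda>z. l z - y (\<sigma> (\<rho> k)) z) = N (\<lambda>z. y (\<sigma> (\<rho> k)) z - l z)"
      by (intro sym yV l)
    also have "N (\<lambda>z. y (\<sigma> (\<rho> (Suc k))) z - l z) + \<dots> < e/2 + e/2"
      using k[of k] k[of "Suc k"] by (intro add_strict_mono) auto
    finally show False using sep[of "\<rho> k" "\<rho> (Suc k)"] l(2) by (simp add: strict_mono_Suc_iff)
  qed
  define c where "c = (\<lambda>i::nat. SOME c. eventually (\<lambda>n. N (\<lambda>z. y n z - y c z) < 1 / real (Suc i)) G)"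
  have c: "eventually (\<lambda>n. N (\<lambda>z. y n z - y (c i) z) < 1 / real (Suc i)) G" for i
    unfolding c_def by (rule someI_ex, rule cover) simp
  \<comment> \<open>The candidate for the limit is a limit point of a selected sequence whose terms
    from stage \<open>i\<close> on lie in the ball about \<open>y (c i)\<close>. Since
    \<open>G\<close>-most terms lie in the same ball, the limit transfers to
    \<open>G\<close>.\<close>
  have "eventually (\<lambda>m. P j m \<and> (\<forall>i\<in>{..j}. N (\<lambda>z. y m z - y (c i) z) < 1 / real (Suc i))) G" for j
    by (intro eventually_conj P eventually_ball_finite ballI c) auto
  then obtain \<sigma> where s: "strict_mono \<sigma>" "\<And>j. P j (\<sigma> j)"
    and sc: "\<And>i j. i \<le> j \<Longrightarrow> N (\<lambda>z. y (\<sigma> j) z - y (c i) z) < 1 / real (Suc i)"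
    using filter_select[OF G(1) Gb, of "\<lambda>_ _ _ _. True"
        "\<lambda>j m. P j m \<and> (\<forall>i\<in>{..j}. N (\<lambda>z. y m z - y (c i) z) < 1 / real (Suc i))"] by auto
  obtain l \<rho> where l: "l \<in> V" "strict_mono \<rho>" "(\<lambda>k. N (\<lambda>z. y (\<sigma> (\<rho> k)) z - l z)) \<longlonglongrightarrow> 0"
    using seq[OF s] by blast
  have "((\<lambda>n. N (\<lambda>z. y n z - l z)) \<longlongrightarrow> 0) G"
  proof (rule tendstoI)
    fix e :: real assume e: "e > 0"
    obtain i where i: "1 / real (Suc i) < e/3"
      using reals_Archimedean[of "e/3"] e by (auto simp: inverse_eq_divide)
    have "eventually (\<lambda>k. N (\<lambda>z. y (\<sigma> (\<rho> k)) z - l z) < e/3) sequentially"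
      using l(3) e by (intro order_tendstoD) auto
    with eventually_ge_at_top[of i] have "eventually (\<lambda>k. k \<ge> i \<and> N (\<lambda>z. y (\<sigma> (\<rho> k)) z - l z) < e/3) sequentially"
      by eventually_elim auto
    then obtain k where k: "k \<ge> i" "N (\<lambda>z. y (\<sigma> (\<rho> k)) z - l z) < e/3"
      using eventually_happens by force
    let ?a = "y (\<sigma> (\<rho> k))"
    have "i \<le> \<rho> k" using k l(2) by (meson order_trans seq_suble)
    then have a: "N (\<lambda>z. ?a z - y (c i) z) < e/3" using sc[of i "\<rho> k"] i by simp
    show "eventually (\<lambda>n. dist (N (\<lambda>z. y n z - l z)) 0 < e) G"
      using c[of i]
    proof eventually_elim
      case (elim n)
      have "N (\<lambda>z. y n z - l z) \<le> N (\<lambda>z. y n z - y (c i) z) + N (\<lambda>z. y (c i) z - l z)"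
        by (intro tri yV l)
      also have "N (\<lambda>z. y (c i) z - l z) \<le> N (\<lambda>z. y (c i) z - ?a z) + N (\<lambda>z. ?a z - l z)"
        by (intro tri yV l)
      also have "N (\<lambda>z. y (c i) z - ?a z) = N (\<lambda>z. ?a z - y (c i) z)" by (intro sym yV)
      finally have "N (\<lambda>z. y n z - l z) < e" using elim a k i by linarith
      then show ?case using pos[OF yV l(1), of n] by (simp add: dist_real_def)
    qed
  qed
  with l show ?thesis by blast
qed

section \<open>Semi-inner products and the Riesz representation theorem\<close>

text \<open>The elements are functions and not classes modulo null sets, so the form is only
  semidefinite. The instances are \<open>L\<^sup>2\<close>, \<open>H1\<close>, and the shifted
  energy form \<open>af\<close>, first on \<open>V0\<close> and then on \<open>H1\<close>.\<close>

locale semi_hilbert =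
  fixes V :: "('a \<Rightarrow> complex) set" and ip :: "('a \<Rightarrow> complex) \<Rightarrow> ('a \<Rightarrow> complex) \<Rightarrow> complex"
  assumes ex: "V \<noteq> {}"
    and lin: "u \<in> V \<Longrightarrow> v \<in> V \<Longrightarrow> (\<lambda>x. a * u x + b * v x) \<in> V"
    and ip_lin: "u \<in> V \<Longrightarrow> v \<in> V \<Longrightarrow> w \<in> V \<Longrightarrow>
      ip (\<lambda>x. a * u x + b * v x) w = a * ip u w + b * ip v w"
    and ip_cnj: "u \<in> V \<Longrightarrow> v \<in> V \<Longrightarrow> ip v u = cnj (ip u v)"
    and ip_pos: "u \<in> V \<Longrightarrow> 0 \<le> Re (ip u u)"
begin

definition nrm :: "('a \<Rightarrow> complex) \<Rightarrow> real" where "nrm u = sqrt (Re (ip u u))"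

lemma nrm_sq: "u \<in> V \<Longrightarrow> (nrm u)\<^sup>2 = Re (ip u u)"
  by (simp add: nrm_def ip_pos)

lemma nrm_nonneg: "u \<in> V \<Longrightarrow> 0 \<le> nrm u"
  by (simp add: nrm_def ip_pos)

lemma ip_lin2:
  assumes "u \<in> V" "v \<in> V" "w \<in> V"
  shows "ip w (\<lambda>x. a * u x + b * v x) = cnj a * ip w u + cnj b * ip w v"
  using assms by (simp add: ip_cnj[of "\<lambda>x. a * u x + b * v x" w] ip_cnj[of u w] ip_cnj[of v w] lin ip_lin)

lemma ip_self: assumes "u \<in> V" shows "ip u u = of_real ((nrm u)\<^sup>2)"
proof -
  have "Im (ip u u) = 0" using ip_cnj[OF assms assms] by (metis Reals_cnj_iff complex_is_Real_iff)
  then show ?thesis by (simp add: nrm_sq assms complex_eq_iff)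
qed

lemma nrm_lin:
  assumes "u \<in> V" "v \<in> V"
  shows "(nrm (\<lambda>x. a * u x + b * v x))\<^sup>2 =
    (cmod a)\<^sup>2 * (nrm u)\<^sup>2 + (cmod b)\<^sup>2 * (nrm v)\<^sup>2 + 2 * Re (a * cnj b * ip u v)"
proof -
  let ?L = "\<lambda>x. a * u x + b * v x"
  have "ip ?L ?L = a * (cnj a * ip u u + cnj b * ip u v) + b * (cnj a * ip v u + cnj b * ip v v)"
    by (simp only: ip_lin ip_lin2 assms lin)
  also have "\<dots> = (a * cnj a) * ip u u + (b * cnj b) * ip v v + (a * cnj b * ip u v + cnj (a * cnj b * ip u v))"
    by (simp add: ip_cnj[OF assms] algebra_simps)
  also have "\<dots> = of_real ((cmod a)\<^sup>2) * of_real ((nrm u)\<^sup>2) + of_real ((cmod b)\<^sup>2) * of_real ((nrm v)\<^sup>2)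
      + (a * cnj b * ip u v + cnj (a * cnj b * ip u v))"
    by (simp only: complex_norm_square[symmetric] ip_self[OF assms(1)] ip_self[OF assms(2)])
  finally have "Re (ip ?L ?L) = (cmod a)\<^sup>2 * (nrm u)\<^sup>2 + (cmod b)\<^sup>2 * (nrm v)\<^sup>2 + 2 * Re (a * cnj b * ip u v)"
    by (simp only: plus_complex.sel Re_complex_of_real of_real_mult[symmetric] cnj.sel)
  then show ?thesis by (simp only: nrm_sq[OF lin[OF assms]])
qed

lemma diff_in: "u \<in> V \<Longrightarrow> v \<in> V \<Longrightarrow> (\<lambda>x. u x - v x) \<in> V"
  using lin[of u v 1 "-1"] by simp

lemma ip_diff: "u \<in> V \<Longrightarrow> v \<in> V \<Longrightarrow> w \<in> V \<Longrightarrow> ip (\<lambda>x. u x - v x) w = ip u w - ip v w"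
  using ip_lin[of u v w 1 "-1"] by simp

lemma nrm_diff: 
  assumes "u \<in> V" "v \<in> V"
  shows "(nrm (\<lambda>x. u x - v x))\<^sup>2 = (nrm u)\<^sup>2 + (nrm v)\<^sup>2 - 2 * Re (ip u v)"
  using nrm_lin[OF assms, of 1 "-1"] by simp

lemma cauchy_schwarz: assumes "u \<in> V" "v \<in> V" shows "cmod (ip u v) \<le> nrm u * nrm v"
proof -
  \<comment> \<open>The unimodular factor \<open>c\<close> rotates the inner product onto the
    nonnegative axis, so that real combinations of the vectors suffice.\<close>
  obtain c where c: "cmod c = 1" "c * ip u v = of_real (cmod (ip u v))"
  proof (cases "ip u v = 0")
    case False
    let ?z = "ip u v"
    have "?z * cnj ?z = of_real (cmod ?z) * of_real (cmod ?z)"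
      unfolding complex_norm_square[symmetric] by (simp add: power2_eq_square)
    then have "cnj ?z / of_real (cmod ?z) * ?z = of_real (cmod ?z)"
      using False by (simp add: field_simps)
    moreover have "cmod (cnj ?z / of_real (cmod ?z)) = 1" using False by (simp add: norm_divide)
    ultimately show ?thesis by (rule that[rotated])
  qed (auto intro: that[of 1])
  have *: "2 * s * t * cmod (ip u v) \<le> s\<^sup>2 * (nrm u)\<^sup>2 + t\<^sup>2 * (nrm v)\<^sup>2" for s t :: real
  proof -
    have "(nrm (\<lambda>x. (of_real s * c) * u x + of_real (-t) * v x))\<^sup>2 =
        s\<^sup>2 * (nrm u)\<^sup>2 + t\<^sup>2 * (nrm v)\<^sup>2 + 2 * Re (of_real (-s*t) * (c * ip u v))"
      using assms c(1) by (subst nrm_lin) (auto simp: norm_mult mult_ac)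
    also have "of_real (-s*t) * (c * ip u v) = of_real (-s*t*cmod (ip u v))" unfolding c by simp
    also have "2 * Re (of_real (-s*t*cmod (ip u v))) = - (2 * s * t * cmod (ip u v))"
      by (simp only: Re_complex_of_real)
    finally have "s\<^sup>2 * (nrm u)\<^sup>2 + t\<^sup>2 * (nrm v)\<^sup>2 + - (2 * s * t * cmod (ip u v)) \<ge> 0"
      by (metis zero_le_power2[of "nrm (\<lambda>x. (of_real s * c) * u x + of_real (-t) * v x)"])
    then show ?thesis by simp
  qed
  show ?thesis
  proof (cases "nrm u = 0 \<or> nrm v = 0")
    case True
    have "cmod (ip u v) \<le> 0"
    proof (rule ccontr)
      assume "\<not> cmod (ip u v) \<le> 0"
      then have p: "cmod (ip u v) > 0" by simp
      \<comment> \<open>A null vector may be scaled freely: with the factor \<open>k\<close> the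
        linear term outgrows the squared norm of the other vector.\<close>
      define k where "k = ((nrm u)\<^sup>2 + (nrm v)\<^sup>2 + 1) / cmod (ip u v)"
      have k: "k * cmod (ip u v) = (nrm u)\<^sup>2 + (nrm v)\<^sup>2 + 1" using p by (simp add: k_def)
      show False
      proof (cases "nrm u = 0")
        case True
        with *[of k 1] k show ?thesis by (simp add: mult.assoc) (smt (verit) zero_le_power2)
      next
        case False
        with \<open>nrm u = 0 \<or> nrm v = 0\<close> *[of 1 k] k show ?thesis
          by (simp add: mult.assoc) (smt (verit) zero_le_power2)
      qed
    qed
    then show ?thesis using nrm_nonneg assms by (meson mult_nonneg_nonneg order_trans)
  next
    case False
    then have p: "nrm u > 0" "nrm v > 0" using nrm_nonneg assms by (auto simp: less_le)
    have "2 * nrm v * nrm u * cmod (ip u v) \<le> 2 * nrm v * nrm u * (nrm u * nrm v)"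
      using *[of "nrm v" "nrm u"] by (simp add: power2_eq_square algebra_simps)
    then show ?thesis using p by simp
  qed
qed

lemma nrm_triangle:
  assumes "u \<in> V" "v \<in> V" shows "nrm (\<lambda>x. u x + v x) \<le> nrm u + nrm v"
proof -
  have "(nrm (\<lambda>x. u x + v x))\<^sup>2 = (nrm u)\<^sup>2 + (nrm v)\<^sup>2 + 2 * Re (ip u v)"
    using nrm_lin[OF assms, of 1 1] by simp
  also have "\<dots> \<le> (nrm u + nrm v)\<^sup>2"
    using cauchy_schwarz[OF assms] complex_Re_le_cmod[of "ip u v"] by (simp add: power2_sum)
  finally show ?thesis using nrm_nonneg assms by (meson add_nonneg_nonneg power2_le_imp_le)
qed

lemma nrm_scale: assumes "u \<in> V" shows "nrm (\<lambda>x. a * u x) = cmod a * nrm u"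
proof -
  have "(nrm (\<lambda>x. a * u x))\<^sup>2 = (cmod a * nrm u)\<^sup>2"
    using nrm_lin[OF assms assms, of a 0]
    by (simp only: power_mult_distrib norm_zero mult_zero_left mult_zero_right complex_cnj_zero
        add_0_right zero_power2 zero_complex.sel)
  moreover have "(\<lambda>x. a * u x) \<in> V" using lin[OF assms assms, of a 0] by simp
  ultimately show ?thesis
    by (rule power2_eq_imp_eq[OF _ nrm_nonneg mult_nonneg_nonneg[OF norm_ge_zero nrm_nonneg[OF assms]]])
qed

lemma nrm_diff_commute: assumes "u \<in> V" "v \<in> V" shows "nrm (\<lambda>x. u x - v x) = nrm (\<lambda>x. v x - u x)"
  using nrm_scale[OF diff_in[OF assms], of "-1"] by simp

lemma nrm_diff_triangle:
  assumes "u \<in> V" "v \<in> V" "w \<in> V"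
  shows "nrm (\<lambda>x. u x - w x) \<le> nrm (\<lambda>x. u x - v x) + nrm (\<lambda>x. v x - w x)"
  using nrm_triangle[OF diff_in[OF assms(1,2)] diff_in[OF assms(2,3)]] by simp

lemma nrm_le: assumes "u \<in> V" "v \<in> V" shows "nrm u \<le> nrm v + nrm (\<lambda>x. u x - v x)"
  using nrm_triangle[OF assms(2) diff_in[OF assms]] by simp

end

locale hilbert = semi_hilbert +
  assumes complete: "(\<And>n. f n \<in> V) \<Longrightarrow>
      (\<And>e. e > 0 \<Longrightarrow> \<exists>M. \<forall>m\<ge>M. \<forall>n\<ge>M. nrm (\<lambda>x. f m x - f n x) < e) \<Longrightarrow>
      \<exists>l\<in>V. (\<lambda>n. nrm (\<lambda>x. f n x - l x)) \<longlonglongrightarrow> 0"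
begin

text \<open>The representing vector is the minimiser of \<open>\<parallel>v\<parallel>\<^sup>2 - 2 Re (F v)\<close>; minimising sequences are
  Cauchy by the parallelogram law.\<close>

lemma riesz:
  assumes F: "\<And>a b u v. u \<in> V \<Longrightarrow> v \<in> V \<Longrightarrow> F (\<lambda>x. a * u x + b * v x) = a * F u + b * (F v :: complex)"
    and bd: "\<And>u. u \<in> V \<Longrightarrow> cmod (F u) \<le> C * nrm u"
  shows "\<exists>y\<in>V. \<forall>v\<in>V. F v = ip v y"
proof -
  define J where "J = (\<lambda>v. (nrm v)\<^sup>2 - 2 * Re (F v))"
  have Jlow: "- C\<^sup>2 \<le> J v" if "v \<in> V" for v
  proof -
    have "Re (F v) \<le> C * nrm v" using bd[OF that] complex_Re_le_cmod order_trans by blast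
    moreover have "(nrm v - C)\<^sup>2 \<ge> 0" by simp
    ultimately show ?thesis by (simp add: J_def power2_eq_square algebra_simps)
  qed
  define d where "d = (INF v\<in>V. J v)"
  have bdd: "bdd_below (J ` V)" by (rule bdd_belowI2[where m = "- C\<^sup>2"]) (rule Jlow)
  have dle: "d \<le> J v" if "v \<in> V" for v unfolding d_def by (rule cINF_lower[OF bdd that])
  have Fd: "F (\<lambda>x. u x - v x) = F u - F v" if "u \<in> V" "v \<in> V" for u v
    using F[OF that, of 1 "-1"] by simp
  have par: "(nrm (\<lambda>x. u x - v x))\<^sup>2 \<le> 2 * (J u - d) + 2 * (J v - d)" if "u \<in> V" "v \<in> V" for u v
  proof -
    have "J (\<lambda>x. (1/2) * u x + (1/2) * v x) = J u / 2 + J v / 2 - (nrm (\<lambda>x. u x - v x))\<^sup>2 / 4"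
      unfolding J_def nrm_lin[OF that] nrm_diff[OF that] F[OF that]
      by (simp add: power2_eq_square field_simps)
    with dle[OF lin[OF that, of "1/2" "1/2"]] show ?thesis by (simp add: field_simps)
  qed
  have "\<exists>v\<in>V. J v < d + 1 / real (Suc n)" for n
  proof -
    have "(INF v\<in>V. J v) < d + 1 / real (Suc n)" by (simp flip: d_def)
    then show ?thesis using cINF_less_iff[OF ex bdd] by blast
  qed
  then obtain f where f: "\<And>n. f n \<in> V" "\<And>n. J (f n) < d + 1 / real (Suc n)" by metis
  have "\<exists>l\<in>V. (\<lambda>n. nrm (\<lambda>x. f n x - l x)) \<longlonglongrightarrow> 0"
  proof (rule complete)
    fix e :: real assume e: "e > 0"
    obtain M where M: "1 / real (Suc M) < e\<^sup>2/4"
      using reals_Archimedean[of "e\<^sup>2/4"] e by (auto simp: inverse_eq_divide)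
    have sm: "J (f m) - d < e\<^sup>2/4" if "m \<ge> M" for m
    proof -
      have "1 / real (Suc m) \<le> 1 / real (Suc M)" using that by (simp add: frac_le)
      then show ?thesis using f(2)[of m] M by linarith
    qed
    have "nrm (\<lambda>x. f m x - f n x) < e" if "m \<ge> M" "n \<ge> M" for m n
    proof -
      note par[OF f(1) f(1), of m n]
      also have "2 * (J (f m) - d) + 2 * (J (f n) - d) < 2 * (e\<^sup>2/4) + 2 * (e\<^sup>2/4)"
        using sm[OF that(1)] sm[OF that(2)] by (intro add_strict_mono mult_strict_left_mono) auto
      also have "\<dots> = e\<^sup>2" by simp
      finally have "(nrm (\<lambda>x. f m x - f n x))\<^sup>2 < e\<^sup>2" .
      then show ?thesis using e by (simp add: power_less_imp_less_base)
    qed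
    then show "\<exists>M. \<forall>m\<ge>M. \<forall>n\<ge>M. nrm (\<lambda>x. f m x - f n x) < e" by blast
  qed (rule f)
  then obtain y where y: "y \<in> V" "(\<lambda>n. nrm (\<lambda>x. f n x - y x)) \<longlonglongrightarrow> 0" by blast
  have Fy: "(\<lambda>n. F (f n)) \<longlonglongrightarrow> F y"
  proof (rule Lim_transform2[OF tendsto_const])
    have "(\<lambda>n. F (f n) - F y) \<longlonglongrightarrow> 0"
    proof (rule Lim_null_comparison)
      show "\<forall>\<^sub>F n in sequentially. norm (F (f n) - F y) \<le> C * nrm (\<lambda>x. f n x - y x)"
        using bd[OF diff_in[OF f(1) y(1)]] by (simp add: Fd f y)
      show "(\<lambda>n. C * nrm (\<lambda>x. f n x - y x)) \<longlonglongrightarrow> 0" using tendsto_mult_right_zero[OF y(2)] .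
    qed
    then show "(\<lambda>n. F y - F (f n)) \<longlonglongrightarrow> 0" using tendsto_minus by fastforce
  qed
  have ny: "(\<lambda>n. nrm (f n)) \<longlonglongrightarrow> nrm y"
  proof -
    have "(\<lambda>n. nrm (f n) - nrm y) \<longlonglongrightarrow> 0"
    proof (rule Lim_null_comparison[OF always_eventually y(2)], rule allI)
      fix n
      show "norm (nrm (f n) - nrm y) \<le> nrm (\<lambda>x. f n x - y x)"
        using nrm_le[OF f(1) y(1), of n] nrm_le[OF y(1) f(1), of n] nrm_diff_commute[OF f(1) y(1), of n]
        by (simp add: abs_le_iff)
    qed
    then show ?thesis by (simp add: LIM_zero_iff)
  qed
  have "(\<lambda>n. J (f n)) \<longlonglongrightarrow> J y"
    unfolding J_def by (intro tendsto_intros ny Fy)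
  moreover have "(\<lambda>n. d + 1 / real (Suc n)) \<longlonglongrightarrow> d"
    using tendsto_add[OF tendsto_const LIMSEQ_inverse_real_of_nat] by (simp add: inverse_eq_divide)
  ultimately have Jy: "J y \<le> d"
    by (rule LIMSEQ_le) (use f(2) less_imp_le in blast)
  have re: "Re (ip v y) = Re (F v)" if v: "v \<in> V" for v
  proof -
    have *: "0 \<le> t\<^sup>2 * (nrm v)\<^sup>2 + 2 * t * (Re (ip v y) - Re (F v))" for t :: real
    proof -
      have "J y \<le> J (\<lambda>x. of_real t * v x + 1 * y x)" using Jy dle[OF lin[OF v y(1)]] order_trans by blast
      also have "\<dots> = t\<^sup>2 * (nrm v)\<^sup>2 + 2 * t * (Re (ip v y) - Re (F v)) + J y"
        unfolding J_def nrm_lin[OF v y(1)] F[OF v y(1)] by (simp add: algebra_simps)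
      finally show ?thesis by simp
    qed
    define c where "c = Re (ip v y) - Re (F v)"
    \<comment> \<open>The quadratic polynomial is evaluated near its minimum. The added 1 keeps the
      quotient \<open>c / N\<close> meaningful when \<open>v\<close> is a null vector.\<close>
    define N where "N = (nrm v)\<^sup>2 + 1"
    have N: "N > 0" "(nrm v)\<^sup>2 \<le> N" by (auto simp: N_def add_nonneg_pos)
    have "0 \<le> (- c/N)\<^sup>2 * (nrm v)\<^sup>2 + 2 * (- c / N) * c" unfolding c_def by (rule *)
    then have "0 \<le> (c/N)\<^sup>2 * (nrm v)\<^sup>2 - 2 * (c / N) * c" by simp
    also have "\<dots> \<le> (c/N)\<^sup>2 * N - 2 * (c / N) * c" using N by (simp add: mult_left_mono)
    also have "\<dots> = - (c\<^sup>2 / N)" using N by (simp add: power2_eq_square field_simps)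
    finally have "c\<^sup>2 / N \<le> 0" by simp
    then have "c = 0" using N by (simp add: divide_le_0_iff)
    then show ?thesis by (simp add: c_def)
  qed
  have "F v = ip v y" if v: "v \<in> V" for v
  proof (rule complex_eqI)
    show "Re (F v) = Re (ip v y)" using re[OF v] by simp
    have "(\<lambda>x. \<i> * v x) \<in> V" using lin[OF v v, of \<i> 0] by simp
    moreover have "F (\<lambda>x. \<i> * v x) = \<i> * F v" using F[OF v v, of \<i> 0] by simp
    moreover have "ip (\<lambda>x. \<i> * v x) y = \<i> * ip v y" using ip_lin[OF v v y(1), of \<i> 0] by simp
    ultimately show "Im (F v) = Im (ip v y)" using re[of "\<lambda>x. \<i> * v x"] by simp
  qed
  with y show ?thesis by blast
qed

end

subsection \<open>The space \<open>L\<^sup>2\<close>\<close>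

lemma borel_measurable_cnj[measurable (raw)]:
  "f \<in> borel_measurable M \<Longrightarrow> (\<lambda>x. cnj (f x)) \<in> borel_measurable M"
  by (rule borel_measurable_continuous_on[OF continuous_on_cnj[OF continuous_on_id]])

lemma Lp2_iff: "f \<in> Lp 2 \<longleftrightarrow> f \<in> borel_measurable borel \<and> integrable lborel (\<lambda>x. (cmod (f x))\<^sup>2)"
  by (simp add: Lp_def)

lemma Lp2_measurable[measurable_dest]: "f \<in> Lp 2 \<Longrightarrow> f \<in> borel_measurable borel"
  by (simp add: Lp2_iff)

lemma Lp2_integrable: "f \<in> Lp 2 \<Longrightarrow> integrable lborel (\<lambda>x. (cmod (f x))\<^sup>2)"
  by (simp add: Lp2_iff)

lemma Lp2_bound:
  assumes "f \<in> borel_measurable borel" "integrable lborel g" "\<And>x. (cmod (f x))\<^sup>2 \<le> g x"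
  shows "f \<in> Lp 2"
  unfolding Lp2_iff
proof (intro conjI assms(1) Bochner_Integration.integrable_bound[OF assms(2)])
  show "AE x in lborel. norm ((cmod (f x))\<^sup>2) \<le> norm (g x)"
    using assms(3) by (auto intro!: AE_I2 order_trans[OF _ abs_ge_self])
qed (use assms(1) in measurable)

lemma Lp2_lin:
  assumes f: "f \<in> Lp 2" and g: "g \<in> Lp 2" shows "(\<lambda>x. a * f x + b * g x) \<in> Lp 2"
proof (rule Lp2_bound)
  show "(\<lambda>x. a * f x + b * g x) \<in> borel_measurable borel" using f g by measurable
  show "integrable lborel (\<lambda>x. 2 * (cmod a)\<^sup>2 * (cmod (f x))\<^sup>2 + 2 * (cmod b)\<^sup>2 * (cmod (g x))\<^sup>2)"
    using f g by (intro Bochner_Integration.integrable_add integrable_mult_right Lp2_integrable)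
  fix x
  have "cmod (a * f x + b * g x) \<le> cmod a * cmod (f x) + cmod b * cmod (g x)"
    by (metis norm_mult norm_triangle_ineq)
  then have "(cmod (a * f x + b * g x))\<^sup>2 \<le> (cmod a * cmod (f x) + cmod b * cmod (g x))\<^sup>2"
    by (rule power_mono) simp
  also have "\<dots> \<le> 2 * (cmod a * cmod (f x))\<^sup>2 + 2 * (cmod b * cmod (g x))\<^sup>2"
    using zero_le_power2[of "cmod a * cmod (f x) - cmod b * cmod (g x)"]
    by (simp only: power2_sum power2_diff)
  finally show "(cmod (a * f x + b * g x))\<^sup>2 \<le> 2 * (cmod a)\<^sup>2 * (cmod (f x))\<^sup>2 + 2 * (cmod b)\<^sup>2 * (cmod (g x))\<^sup>2"
    by (simp add: power_mult_distrib)
qed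

lemma Lp2_mult_integrable:
  assumes f: "f \<in> Lp 2" and g: "g \<in> Lp 2" shows "integrable lborel (\<lambda>x. f x * cnj (g x))"
proof (rule Bochner_Integration.integrable_bound)
  show "integrable lborel (\<lambda>x. (cmod (f x))\<^sup>2 + (cmod (g x))\<^sup>2)"
    using f g by (intro Bochner_Integration.integrable_add Lp2_integrable)
  show "(\<lambda>x. f x * cnj (g x)) \<in> borel_measurable lborel" using f g by measurable
  have "norm (f x * cnj (g x)) \<le> norm ((cmod (f x))\<^sup>2 + (cmod (g x))\<^sup>2)" for x
  proof -
    have "2 * (cmod (f x) * cmod (g x)) \<le> (cmod (f x))\<^sup>2 + (cmod (g x))\<^sup>2"
      using sum_squares_bound[of "cmod (f x)" "cmod (g x)"] by (simp add: mult_ac)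
    moreover have "0 \<le> cmod (f x) * cmod (g x)" by simp
    ultimately have "cmod (f x) * cmod (g x) \<le> (cmod (f x))\<^sup>2 + (cmod (g x))\<^sup>2" by linarith
    then show ?thesis by (simp add: norm_mult)
  qed
  then show "AE x in lborel. norm (f x * cnj (g x)) \<le> norm ((cmod (f x))\<^sup>2 + (cmod (g x))\<^sup>2)"
    by simp
qed

lemma L2_inner_self: "L2_inner f f = of_real (LINT x|lborel. (cmod (f x))\<^sup>2)"
  unfolding L2_inner_def complex_norm_square[symmetric] integral_complex_of_real ..

lemma Lp2_norm_eq: "Lp_norm 2 f = sqrt (LINT x|lborel. (cmod (f x))\<^sup>2)"
  unfolding Lp_norm_def by (simp add: powr_half_sqrt)

lemma semi_hilbert_L2: "semi_hilbert (Lp 2) L2_inner"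
proof
  have "(\<lambda>x. 0) \<in> Lp 2" by (simp add: Lp2_iff)
  then show "Lp 2 \<noteq> {}" by blast
  show "(\<lambda>x. a * u x + b * v x) \<in> Lp 2" if "u \<in> Lp 2" "v \<in> Lp 2" for a b u v
    using that by (rule Lp2_lin)
  show "L2_inner (\<lambda>x. a * u x + b * v x) w = a * L2_inner u w + b * L2_inner v w"
    if "u \<in> Lp 2" "v \<in> Lp 2" "w \<in> Lp 2" for a b u v w
    using Lp2_mult_integrable[OF that(1,3)] Lp2_mult_integrable[OF that(2,3)]
    by (simp add: L2_inner_def distrib_right mult.assoc)
  show "L2_inner v u = cnj (L2_inner u v)" for u v
    unfolding L2_inner_def Bochner_Integration.integral_cnj[symmetric] complex_cnj_mult complex_cnj_cnj
    by (simp only: mult.commute)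
  show "0 \<le> Re (L2_inner u u)" for u by (simp add: L2_inner_self)
qed

lemma L2_nrm: "semi_hilbert.nrm L2_inner = Lp_norm 2"
  by (rule ext) (simp add: semi_hilbert.nrm_def[OF semi_hilbert_L2] L2_inner_self Lp2_norm_eq)

interpretation L2: semi_hilbert "Lp 2" L2_inner
  rewrites "semi_hilbert.nrm L2_inner = Lp_norm 2"
  by (rule semi_hilbert_L2) (rule L2_nrm)

lemma Lp2_norm_sq: "f \<in> Lp 2 \<Longrightarrow> (Lp_norm 2 f)\<^sup>2 = (LINT x|lborel. (cmod (f x))\<^sup>2)"
  by (simp add: Lp2_norm_eq)

lemma Lp2_norm_nonneg: "0 \<le> Lp_norm 2 f"
  by (simp add: Lp2_norm_eq)

lemma zero_in_Lp2: "(\<lambda>x. 0) \<in> Lp 2"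
  by (simp add: Lp2_iff)

lemma Lp2_cong_AE:
  assumes "f \<in> Lp 2" "g \<in> borel_measurable borel" "AE x in lborel. f x = g x"
  shows "g \<in> Lp 2"
  unfolding Lp2_iff
proof
  show "integrable lborel (\<lambda>x. (cmod (g x))\<^sup>2)"
    using Lp2_integrable[OF assms(1)]
    by (rule integrable_cong_AE_imp) (use assms(2,3) in auto)
qed fact

lemma L2_inner_cong_AE:
  assumes "f \<in> Lp 2" "f' \<in> Lp 2" "g \<in> Lp 2" "g' \<in> Lp 2"
    "AE x in lborel. f x = f' x" "AE x in lborel. g x = g' x"
  shows "L2_inner f g = L2_inner f' g'"
  unfolding L2_inner_def
proof (rule integral_cong_AE)
  show "AE x in lborel. f x * cnj (g x) = f' x * cnj (g' x)"
    using assms(5,6) by eventually_elim simp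
qed (use assms in measurable)

lemma Lp2_norm_cong_AE:
  assumes "f \<in> Lp 2" "g \<in> Lp 2" "AE x in lborel. f x = g x"
  shows "Lp_norm 2 f = Lp_norm 2 g"
  using L2_inner_cong_AE[OF assms(1,2,1,2,3,3)] by (simp flip: L2_nrm add: L2.nrm_def[unfolded L2_nrm[symmetric]])

lemma Lp2_norm_zero_iff:
  assumes "f \<in> Lp 2" shows "Lp_norm 2 f = 0 \<longleftrightarrow> (AE x in lborel. f x = 0)"
proof -
  have "(LINT x|lborel. (cmod (f x))\<^sup>2) = 0 \<longleftrightarrow> (AE x in lborel. (cmod (f x))\<^sup>2 = 0)"
    by (rule integral_nonneg_eq_0_iff_AE[OF Lp2_integrable[OF assms]]) simp
  then show ?thesis by (simp add: Lp2_norm_eq)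
qed

lemma L2_fatou:
  assumes h: "\<And>k. h k \<in> Lp 2" and le: "\<And>k. k \<ge> K \<Longrightarrow> Lp_norm 2 (h k) \<le> c"
    and m: "g \<in> borel_measurable borel" and lim: "AE x in lborel. (\<lambda>k::nat. h k x) \<longlonglongrightarrow> g x"
  shows "g \<in> Lp 2 \<and> Lp_norm 2 g \<le> c"
proof -
  have c: "0 \<le> c" using le[of K] Lp2_norm_nonneg[of "h K"] by linarith
  have nn: "(\<integral>\<^sup>+x. ennreal ((cmod (h k x))\<^sup>2) \<partial>lborel) = ennreal ((Lp_norm 2 (h k))\<^sup>2)" for k
    by (subst nn_integral_eq_integral[OF Lp2_integrable[OF h]]) (auto simp: Lp2_norm_sq h)
  have "(\<integral>\<^sup>+x. ennreal ((cmod (g x))\<^sup>2) \<partial>lborel) = (\<integral>\<^sup>+x. liminf (\<lambda>k. ennreal ((cmod (h k x))\<^sup>2)) \<partial>lborel)"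
  proof (rule nn_integral_cong_AE)
    show "AE x in lborel. ennreal ((cmod (g x))\<^sup>2) = liminf (\<lambda>k. ennreal ((cmod (h k x))\<^sup>2))"
      using lim
    proof eventually_elim
      case (elim x)
      have "(\<lambda>k. ennreal ((cmod (h k x))\<^sup>2)) \<longlonglongrightarrow> ennreal ((cmod (g x))\<^sup>2)"
        by (intro tendsto_intros elim)
      from lim_imp_Liminf[OF _ this] show ?case by simp
    qed
  qed
  also have "\<dots> \<le> liminf (\<lambda>k. \<integral>\<^sup>+x. ennreal ((cmod (h k x))\<^sup>2) \<partial>lborel)"
  proof (rule nn_integral_liminf)
    fix k
    have "h k \<in> borel_measurable borel" using h by (rule Lp2_measurable)
    then show "(\<lambda>x. ennreal ((cmod (h k x))\<^sup>2)) \<in> borel_measurable lborel" by measurable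
  qed
  also have "\<dots> \<le> liminf (\<lambda>k. ennreal (c\<^sup>2))"
  proof (rule Liminf_mono)
    show "\<forall>\<^sub>F k in sequentially. (\<integral>\<^sup>+x. ennreal ((cmod (h k x))\<^sup>2) \<partial>lborel) \<le> ennreal (c\<^sup>2)"
      unfolding nn using le Lp2_norm_nonneg
      by (intro eventually_sequentiallyI[of K] ennreal_leI power_mono) auto
  qed
  also have "\<dots> = ennreal (c\<^sup>2)" by (simp add: Liminf_const)
  finally have fin: "(\<integral>\<^sup>+x. ennreal ((cmod (g x))\<^sup>2) \<partial>lborel) \<le> ennreal (c\<^sup>2)" .
  have g: "g \<in> Lp 2"
    unfolding Lp2_iff
  proof (intro conjI m integrableI_bounded)
    show "(\<lambda>x. (cmod (g x))\<^sup>2) \<in> borel_measurable lborel" using m by measurable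
    show "(\<integral>\<^sup>+x. ennreal (norm ((cmod (g x))\<^sup>2)) \<partial>lborel) < \<infinity>"
      using fin by (simp add: le_less_trans[OF _ ennreal_less_top])
  qed
  have "ennreal ((Lp_norm 2 g)\<^sup>2) \<le> ennreal (c\<^sup>2)"
    using fin by (subst (asm) nn_integral_eq_integral[OF Lp2_integrable[OF g]]) (auto simp: Lp2_norm_sq g)
  then have "(Lp_norm 2 g)\<^sup>2 \<le> c\<^sup>2" by simp
  then have "Lp_norm 2 g \<le> c" using c power2_le_imp_le by blast
  with g show ?thesis by blast
qed

text \<open>Multiplying by a Gaussian turns an \<open>L\<^sup>2\<close>-Cauchy sequence into an \<open>L\<^sup>1\<close>-Cauchy sequence, which has an
  almost everywhere Cauchy subsequence.\<close>

lemma L2_complete: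
  assumes f: "\<And>n. f n \<in> Lp 2"
    and cau: "\<And>e. e > 0 \<Longrightarrow> \<exists>M. \<forall>m\<ge>M. \<forall>n\<ge>M. Lp_norm 2 (\<lambda>x. f m x - f n x) < e"
  shows "\<exists>l\<in>Lp 2. (\<lambda>n. Lp_norm 2 (\<lambda>x. f n x - l x)) \<longlonglongrightarrow> 0"
proof -
  \<comment> \<open>The square root of the Gaussian density lies in \<open>L\<^sup>2\<close>, so
    Cauchy-Schwarz controls the \<open>L\<^sup>1\<close> norm of the products; it has no zeros, so
    it can be divided out once pointwise limits exist.\<close>
  define w where "w = (\<lambda>x. of_real (sqrt (std_normal_density x)) :: complex)"
  have w: "w \<in> Lp 2"
    using integrable_normal_density[of 1 0] by (simp add: Lp2_iff w_def)
  have w0: "w x \<noteq> 0" for x using normal_density_pos[of 1 0 x] by (simp add: w_def)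
  have cw: "cnj (w x) = w x" for x by (simp add: w_def)
  define s where "s = (\<lambda>n x. f n x * w x)"
  have "integrable lborel (s n)" for n
    using Lp2_mult_integrable[OF f w, of n] by (simp add: s_def cw)
  moreover have "\<exists>N. \<forall>i\<ge>N. \<forall>j\<ge>N. (LINT x|lborel. norm (s i x - s j x)) < e" if e: "e > 0" for e
  proof -
    define d where "d = e / (Lp_norm 2 w + 1)"
    have wp: "Lp_norm 2 w + 1 > 0" using Lp2_norm_nonneg[of w] by linarith
    then have d: "d > 0" using e by (simp add: d_def)
    obtain N where N: "\<And>m n. m \<ge> N \<Longrightarrow> n \<ge> N \<Longrightarrow> Lp_norm 2 (\<lambda>x. f m x - f n x) < d"
      using cau[OF d] by blast
    have "(LINT x|lborel. norm (s i x - s j x)) < e" if "i \<ge> N" "j \<ge> N" for i j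
    proof -
      let ?g = "\<lambda>x. of_real (cmod (f i x - f j x)) :: complex"
      have d2: "(\<lambda>x. f i x - f j x) \<in> Lp 2" by (rule L2.diff_in[OF f f])
      have "?g \<in> borel_measurable borel"
        using Lp2_measurable[OF d2] by measurable
      moreover have "integrable lborel (\<lambda>x. (cmod (?g x))\<^sup>2)"
        using Lp2_integrable[OF d2] by simp
      ultimately have g: "?g \<in> Lp 2" unfolding Lp2_iff by blast
      have "complex_of_real (LINT x|lborel. norm (s i x - s j x)) = L2_inner ?g w"
        unfolding L2_inner_def integral_complex_of_real[symmetric] cw
        by (simp add: s_def norm_mult left_diff_distrib[symmetric]) (simp add: w_def)
      then have "(LINT x|lborel. norm (s i x - s j x)) \<le> cmod (L2_inner ?g w)"
        by (metis Re_complex_of_real complex_Re_le_cmod)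
      also have "\<dots> \<le> Lp_norm 2 ?g * Lp_norm 2 w" by (rule L2.cauchy_schwarz[OF g w])
      also have "Lp_norm 2 ?g = Lp_norm 2 (\<lambda>x. f i x - f j x)" by (simp add: Lp2_norm_eq)
      also have "\<dots> * Lp_norm 2 w \<le> d * Lp_norm 2 w"
        using N[OF that] Lp2_norm_nonneg by (intro mult_right_mono) auto
      also have "\<dots> < d * (Lp_norm 2 w + 1)" using d by simp
      also have "\<dots> = e" using wp by (simp add: d_def)
      finally show ?thesis .
    qed
    then show ?thesis by blast
  qed
  ultimately obtain r where r: "strict_mono r" "AE x in lborel. Cauchy (\<lambda>i. s (r i) x)"
    using cauchy_L1_AE_cauchy_subseq[of lborel s] by blast
  define l where "l = (\<lambda>x. lim (\<lambda>i. f (r i) x))"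
  have lm: "l \<in> borel_measurable borel"
    unfolding l_def by (intro borel_measurable_lim_metric) (simp add: Lp2_measurable[OF f])
  have conv: "AE x in lborel. (\<lambda>i. f (r i) x) \<longlonglongrightarrow> l x"
    using r(2)
  proof eventually_elim
    case (elim x)
    then obtain c where "(\<lambda>i. s (r i) x) \<longlonglongrightarrow> c" using Cauchy_convergent convergent_def by blast
    then have "(\<lambda>i. s (r i) x / w x) \<longlonglongrightarrow> c / w x" by (intro tendsto_intros w0)
    then have "(\<lambda>i. f (r i) x) \<longlonglongrightarrow> c / w x" using w0 by (simp add: s_def)
    then show ?case unfolding l_def by (simp add: limI)
  qed
  \<comment> \<open>Fatou's lemma in the subsequence index passes the Cauchy bound to the limit, and
    shows at the same time that \<open>f n - l\<close>, hence \<open>l\<close>, is square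
    integrable.\<close>
  have est: "(\<lambda>x. f n x - l x) \<in> Lp 2 \<and> Lp_norm 2 (\<lambda>x. f n x - l x) \<le> e"
    if c: "\<And>i j. i \<ge> M \<Longrightarrow> j \<ge> M \<Longrightarrow> Lp_norm 2 (\<lambda>x. f i x - f j x) < e" and "n \<ge> M" for n e M
  proof (rule L2_fatou)
    show "(\<lambda>x. f n x - f (r k) x) \<in> Lp 2" for k by (rule L2.diff_in[OF f f])
    show "Lp_norm 2 (\<lambda>x. f n x - f (r k) x) \<le> e" if "k \<ge> M" for k
      using that \<open>n \<ge> M\<close> seq_suble[OF r(1), of k] by (intro less_imp_le[OF c]) auto
    show "(\<lambda>x. f n x - l x) \<in> borel_measurable borel" using f[of n] lm by measurable
    show "AE x in lborel. (\<lambda>k. f n x - f (r k) x) \<longlonglongrightarrow> f n x - l x"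
      using conv by eventually_elim (intro tendsto_intros)
  qed
  obtain M where M: "\<And>i j. i \<ge> M \<Longrightarrow> j \<ge> M \<Longrightarrow> Lp_norm 2 (\<lambda>x. f i x - f j x) < 1"
    using cau[of 1] by auto
  have "(\<lambda>x. f M x - (f M x - l x)) \<in> Lp 2"
    by (rule L2.diff_in[OF f conjunct1[OF est[OF M order_refl]]])
  then have lL: "l \<in> Lp 2" by simp
  moreover have "(\<lambda>n. Lp_norm 2 (\<lambda>x. f n x - l x)) \<longlonglongrightarrow> 0"
  proof (rule LIMSEQ_I)
    fix e :: real assume e: "e > 0"
    then obtain M where M: "\<And>i j. i \<ge> M \<Longrightarrow> j \<ge> M \<Longrightarrow> Lp_norm 2 (\<lambda>x. f i x - f j x) < e / 2"
      using cau[of "e/2"] by auto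
    have "norm (Lp_norm 2 (\<lambda>x. f n x - l x) - 0) < e" if "n \<ge> M" for n
      using est[OF M that] Lp2_norm_nonneg[of "\<lambda>x. f n x - l x"] e by auto
    then show "\<exists>M. \<forall>n\<ge>M. norm (Lp_norm 2 (\<lambda>x. f n x - l x) - 0) < e" by blast
  qed
  ultimately show ?thesis by blast
qed

section \<open>Interval indicators and translations\<close>

text \<open>These indicators are the test vectors for weak limits: translations permute them, and
  pairing with all of them determines an \<open>L\<^sup>2\<close> function up to null sets.\<close>

definition ivl :: "real \<Rightarrow> real \<Rightarrow> cfun" where "ivl a b = indicator {a..b}"

lemma ivl_Lp2: "ivl a b \<in> Lp 2"
proof (rule Lp2_bound)
  show "ivl a b \<in> borel_measurable borel" unfolding ivl_def by measurable
  show "integrable lborel (indicator {a..b} :: real \<Rightarrow> real)" by (rule integrable_real_indicator) (auto simp: emeasure_lborel_Icc_eq)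
  show "(cmod (ivl a b x))\<^sup>2 \<le> indicator {a..b} x" for x by (simp add: ivl_def indicator_def)
qed

lemma ivl_norm: "a \<le> b \<Longrightarrow> Lp_norm 2 (ivl a b) = sqrt (b - a)"
proof -
  assume "a \<le> b"
  have "(\<lambda>x. (cmod (ivl a b x))\<^sup>2) = indicator {a..b}" by (auto simp: ivl_def indicator_def)
  then show ?thesis using \<open>a \<le> b\<close> by (simp add: Lp2_norm_eq)
qed

lemma cnj_ivl: "cnj (ivl a b x) = ivl a b x" by (simp add: ivl_def indicator_def)

lemma ivl_bound: "f \<in> Lp 2 \<Longrightarrow> a \<le> b \<Longrightarrow> cmod (L2_inner f (ivl a b)) \<le> Lp_norm 2 f * sqrt (b - a)"
  using L2.cauchy_schwarz[OF _ ivl_Lp2, of f a b] by (simp add: ivl_norm)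

text \<open>After truncation to a bounded interval the function is integrable. The sets over which
  its integral vanishes then form a Dynkin system containing the intersection-stable generator of
  all closed intervals.\<close>

lemma AE_zero_of_interval_integrals:
  assumes f: "f \<in> Lp 2" and z: "\<And>a b. a \<le> b \<Longrightarrow> L2_inner f (ivl a b) = 0"
  shows "AE x in lborel. f x = 0"
proof -
  have z': "L2_inner f (ivl a b) = 0" for a b
  proof (cases "a \<le> b")
    case False
    then show ?thesis by (simp add: L2_inner_def ivl_def)
  qed (rule z)
  have "AE x in lborel. ivl (-M) M x * f x = 0" for M
  proof -
    define g where "g = (\<lambda>x. f x * ivl (-M) M x)"
    have g: "integrable lborel g"
      using Lp2_mult_integrable[OF f ivl_Lp2, of "-M" M] by (simp add: g_def cnj_ivl)
    have gs: "set_integrable lborel A g" if "A \<in> sets borel" for A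
      unfolding set_integrable_def using that g by (intro integrable_mult_indicator) auto
    have gi: "(LINT x:{a..b}|lborel. g x) = 0" for a b
    proof -
      have "(LINT x:{a..b}|lborel. g x) = L2_inner f (ivl (max a (-M)) (min b M))"
        unfolding set_lebesgue_integral_def L2_inner_def cnj_ivl g_def
        by (intro Bochner_Integration.integral_cong) (auto simp: ivl_def indicator_def)
      then show ?thesis by (simp add: z')
    qed
    have gU: "(LINT x:UNIV|lborel. g x) = 0"
    proof -
      have "(LINT x:UNIV|lborel. g x) = (LINT x:{-M..M}|lborel. g x)"
        unfolding set_lebesgue_integral_def g_def
        by (intro Bochner_Integration.integral_cong) (auto simp: ivl_def indicator_def)
      then show ?thesis by (simp add: gi)
    qed
    define E where "E = range (\<lambda>(a,b). {a..b::real})"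
    have bE: "sets borel = sigma_sets UNIV E" unfolding borel_eq_atLeastAtMost E_def by simp
    have ist: "Int_stable E"
      by (auto simp: Int_stable_def E_def)
    have "(LINT x:A|lborel. g x) = 0" if "A \<in> sigma_sets UNIV E" for A
      using ist subset_UNIV[of E, unfolded Pow_UNIV[symmetric]] that
    proof (induct rule: sigma_sets_induct_disjoint)
      case (basic A)
      then show ?case using gi by (auto simp: E_def)
    next
      case empty
      then show ?case by (simp add: set_lebesgue_integral_def)
    next
      case (compl A)
      then have A: "A \<in> sets borel" by (simp add: bE)
      have "(LINT x:A \<union> (UNIV - A)|lborel. g x) = (LINT x:A|lborel. g x) + (LINT x:(UNIV - A)|lborel. g x)"
        by (rule set_integral_Un) (use A gs in auto)
      then show ?case using compl(2) gU by simp
    next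
      case (union A)
      then have A: "range A \<subseteq> sets borel" by (simp add: bE)
      have "(LINT x:(\<Union>i. A i)|lborel. g x) = (\<Sum>i. (LINT x:(A i)|lborel. g x))"
        using union(1) A
        by (intro lebesgue_integral_countable_add gs) (auto simp: disjoint_family_on_def)
      then show ?case using union(3) by simp
    qed
    then have 0: "(LINT x:A|lborel. g x) = 0" if "A \<in> sets lborel" for A using that bE by simp
    have Re0: "AE x in lborel. Re (g x) = 0"
    proof (rule density_unique_real)
      fix A :: "real set" assume A: "A \<in> sets lborel"
      have "(LINT x:A|lborel. Re (g x)) = Re (LINT x:A|lborel. g x)"
        using gs[of A] A unfolding set_lebesgue_integral_def set_integrable_def
        by (subst integral_Re[symmetric]) auto
      then show "(LINT x:A|lborel. Re (g x)) = (LINT x:A|lborel. 0)" using 0[OF A] by simp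
    qed (use g in auto)
    have Im0: "AE x in lborel. Im (g x) = 0"
    proof (rule density_unique_real)
      fix A :: "real set" assume A: "A \<in> sets lborel"
      have "(LINT x:A|lborel. Im (g x)) = Im (LINT x:A|lborel. g x)"
        using gs[of A] A unfolding set_lebesgue_integral_def set_integrable_def
        by (subst integral_Im[symmetric]) auto
      then show "(LINT x:A|lborel. Im (g x)) = (LINT x:A|lborel. 0)" using 0[OF A] by simp
    qed (use g in auto)
    show ?thesis using Re0 Im0
      by eventually_elim (simp add: g_def complex_eq_iff mult.commute)
  qed
  then have "AE x in lborel. \<forall>n::nat. ivl (- real n) (real n) x * f x = 0" unfolding AE_all_countable by blast
  then show ?thesis
  proof eventually_elim
    case (elim x)
    obtain n :: nat where "\<bar>x\<bar> \<le> real n" using real_arch_simple by blast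
    then have "ivl (- real n) (real n) x = 1" by (auto simp: ivl_def indicator_def)
    with elim[rule_format, of n] show ?case by simp
  qed
qed

lemma translate_Lp2: assumes "f \<in> Lp 2" shows "translate z f \<in> Lp 2"
  unfolding Lp2_iff translate_def
proof
  have "f \<in> borel_measurable borel" using assms by (rule Lp2_measurable)
  then show "(\<lambda>x. f (x + z)) \<in> borel_measurable borel" by measurable
  show "integrable lborel (\<lambda>x. (cmod (f (x + z)))\<^sup>2)"
    using lborel_integrable_real_affine[OF Lp2_integrable[OF assms], of 1 z] by (simp add: add.commute)
qed

lemma lborel_integral_shift: "(LINT x|lborel. f (x + z)) = (LINT x|lborel. f x :: 'b :: {banach, second_countable_topology})"
  for z :: real
  using lborel_integral_real_affine[of 1 f z] by (simp add: add.commute)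

lemma translate_L2_inner: "L2_inner (translate z f) (translate z g) = L2_inner f g"
  unfolding L2_inner_def translate_def by (rule lborel_integral_shift)

lemma translate_L2_norm: "Lp_norm 2 (translate z f) = Lp_norm 2 f"
  unfolding Lp2_norm_eq translate_def by (subst lborel_integral_shift[of _ z]) simp

lemma translate_translate[simp]: "translate y (translate z f) = translate (y + z) f"
  by (simp add: translate_def add.assoc)

lemma translate_0[simp]: "translate 0 f = f"
  by (simp add: translate_def)

lemma translate_ivl: "translate z (ivl a b) = ivl (a - z) (b - z)"
  by (simp add: translate_def ivl_def indicator_def fun_eq_iff algebra_simps)

lemma L2_inner_translate_ivl: "L2_inner (translate z f) (ivl a b) = L2_inner f (ivl (a + z) (b + z))"
  using translate_L2_inner[of z f "ivl (a + z) (b + z)"] by (simp add: translate_ivl)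

lemma AE_translate:
  assumes "AE x in lborel. P x" shows "AE x in lborel. P (x + z :: real)"
proof -
  obtain N where N: "N \<in> null_sets lborel" "{x. \<not> P x} \<subseteq> N"
    using assms by (auto simp: eventually_ae_filter)
  then have "AE x in lborel. x \<notin> N" by (simp add: AE_not_in)
  then have "AE x in lborel. z + 1 * x \<notin> N"
    by (intro AE_borel_affine) (use N in \<open>auto simp: null_sets_def\<close>)
  then show ?thesis
    by eventually_elim (use N(2) in \<open>auto simp: add.commute\<close>)
qed

subsection \<open>Test functions\<close>

definition smooth :: "(real \<Rightarrow> real) \<Rightarrow> bool" where
  "smooth \<phi> \<longleftrightarrow> (\<forall>k x. (deriv ^^ k) \<phi> differentiable (at x))"

text \<open>Smoothness by coinduction: it is enough to exhibit a set of functions that is closed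
  under differentiation, and no formula for higher derivatives is required.\<close>

lemma smooth_coinduct:
  assumes S: "\<phi> \<in> S" "\<And>f. f \<in> S \<Longrightarrow> \<exists>f'\<in>S. \<forall>x. (f has_real_derivative f' x) (at x)"
  shows "smooth \<phi>"
proof -
  have "(deriv ^^ k) \<phi> \<in> S" for k
  proof (induction k)
    case (Suc k)
    from S(2)[OF Suc] obtain f' where f': "f' \<in> S" "\<And>x. ((deriv ^^ k) \<phi> has_real_derivative f' x) (at x)"
      by blast
    have "deriv ((deriv ^^ k) \<phi>) = f'" by (rule ext) (rule DERIV_imp_deriv[OF f'(2)])
    with f'(1) show ?case by simp
  qed (simp add: S(1))
  then show ?thesis
    unfolding smooth_def using S(2) real_differentiable_def by blast
qed

lemma smooth_DERIV: "smooth \<phi> \<Longrightarrow> (\<phi> has_real_derivative deriv \<phi> x) (at x)"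
  unfolding smooth_def by (metis DERIV_deriv_iff_real_differentiable funpow_0)

lemma smooth_deriv: "smooth \<phi> \<Longrightarrow> smooth (deriv \<phi>)"
  unfolding smooth_def by (metis comp_apply funpow_Suc_right)

lemma smooth_continuous: "smooth \<phi> \<Longrightarrow> continuous_on UNIV \<phi>"
  by (meson DERIV_isCont continuous_at_imp_continuous_on smooth_DERIV)

lemma smooth_lin: assumes "smooth p" "smooth q" shows "smooth (\<lambda>x. a * p x + b * q x)"
proof (rule smooth_coinduct)
  let ?S = "{\<lambda>x. a * p x + b * q x |p q. smooth p \<and> smooth q}"
  show "(\<lambda>x. a * p x + b * q x) \<in> ?S" using assms by blast
  fix f assume "f \<in> ?S"
  then obtain p q where f: "f = (\<lambda>x. a * p x + b * q x)" "smooth p" "smooth q" by blast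
  have "\<forall>x. (f has_real_derivative a * deriv p x + b * deriv q x) (at x)"
    unfolding f(1) by (intro allI DERIV_add DERIV_cmult smooth_DERIV f)
  moreover have "(\<lambda>x. a * deriv p x + b * deriv q x) \<in> ?S" using f smooth_deriv by blast
  ultimately show "\<exists>f'\<in>?S. \<forall>x. (f has_real_derivative f' x) (at x)"
    by (intro bexI[of _ "\<lambda>x. a * deriv p x + b * deriv q x"])
qed

lemma smooth_shift: assumes "smooth p" shows "smooth (\<lambda>x. p (x + c))"
  and "deriv (\<lambda>x. p (x + c)) = (\<lambda>x. deriv p (x + c))"
proof -
  have D: "((\<lambda>x. p (x + c)) has_real_derivative deriv p (x + c)) (at x)" if "smooth p" for p x
    using smooth_DERIV[OF that, of "x + c"] by (simp add: DERIV_shift)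
  show "smooth (\<lambda>x. p (x + c))"
  proof (rule smooth_coinduct)
    let ?S = "{\<lambda>x. p (x + c) |p. smooth p}"
    show "(\<lambda>x. p (x + c)) \<in> ?S" using assms by blast
    fix f assume "f \<in> ?S"
    then obtain p where p: "f = (\<lambda>x. p (x + c))" "smooth p" by blast
    have "(\<lambda>x. deriv p (x + c)) \<in> ?S" using smooth_deriv[OF p(2)] by blast
    then show "\<exists>f'\<in>?S. \<forall>x. (f has_real_derivative f' x) (at x)"
      unfolding p(1) using D[OF p(2)] by (intro bexI[of _ "\<lambda>x. deriv p (x + c)"] allI)
  qed
  show "deriv (\<lambda>x. p (x + c)) = (\<lambda>x. deriv p (x + c))"
    by (rule ext) (rule DERIV_imp_deriv[OF D[OF assms]])
qed

lemma test_function_iff: "test_function \<phi> \<longleftrightarrow> smooth \<phi> \<and> bounded {x. \<phi> x \<noteq> 0}"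
  by (simp add: test_function_def smooth_def)

section \<open>Construction of test functions\<close>

text \<open>The powers in the denominator appear because differentiating the classical flat function
  produces them; with all \<open>n\<close> allowed the family is closed under differentiation up to
  linear combinations.\<close>

definition flat_exp :: "real \<Rightarrow> nat \<Rightarrow> real \<Rightarrow> real" where
  "flat_exp e n x = (if x > 0 then exp (- e / x) / x ^ n else 0)"

lemma flat_exp_DERIV:
  assumes e: "e > 0"
  shows "(flat_exp e n has_real_derivative e * flat_exp e (n + 2) x - real n * flat_exp e (n + 1) x) (at x)"
proof (cases x "0 :: real" rule: linorder_cases)
  case less
  have "((\<lambda>x. 0) has_real_derivative 0) (at x)" by simp
  then have "(flat_exp e n has_real_derivative 0) (at x)"
    by (rule has_field_derivative_transform_within_open[where S = "{..<0}"])
      (use less in \<open>auto simp: flat_exp_def\<close>)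
  then show ?thesis using less by (simp add: flat_exp_def)
next
  case greater
  have "((\<lambda>x. exp (- e / x) / x ^ n) has_real_derivative
      e * (exp (- e / x) / x ^ (n + 2)) - real n * (exp (- e / x) / x ^ (n + 1))) (at x)"
  proof (cases n)
    case 0
    then show ?thesis using greater
      by (auto intro!: derivative_eq_intros simp: field_simps power2_eq_square)
  next
    case (Suc k)
    have 1: "((\<lambda>x. exp (- e / x)) has_real_derivative exp (- e / x) * (e / x\<^sup>2)) (at x)"
      using greater by (auto intro!: derivative_eq_intros simp: power2_eq_square)
    have 2: "((\<lambda>x. x ^ Suc k) has_real_derivative real (Suc k) * x ^ k) (at x)"
      using DERIV_pow[of "Suc k" x] by simp
    have eq: "(E * (e / x\<^sup>2) * (y * x) - E * ((1 + c) * y)) / ((y * x) * (y * x)) =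
        e * (E / (y * x ^ 3)) - (1 + c) * (E / (y * x\<^sup>2))" if "y \<noteq> 0" for E y c :: real
      using that greater by (simp add: field_simps power2_eq_square power3_eq_cube)
    have "((\<lambda>x. exp (- e / x) / x ^ Suc k) has_real_derivative
      (exp (- e / x) * (e / x\<^sup>2) * x ^ Suc k - exp (- e / x) * (real (Suc k) * x ^ k)) / (x ^ Suc k * x ^ Suc k)) (at x)"
      by (rule DERIV_divide[OF 1 2]) (use greater in auto)
    then show ?thesis
      using greater eq[of "x ^ k" "exp (- e / x)" "real k"]
      by (simp add: Suc power2_eq_square power3_eq_cube mult_ac)
  qed
  then have "(flat_exp e n has_real_derivative
      e * (exp (- e / x) / x ^ (n + 2)) - real n * (exp (- e / x) / x ^ (n + 1))) (at x)"
    by (rule has_field_derivative_transform_within_open[where S = "{0<..}"])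
      (use greater in \<open>auto simp: flat_exp_def\<close>)
  then show ?thesis using greater by (simp add: flat_exp_def)
next
  case equal
  \<comment> \<open>At the origin the difference quotient is studied through
    \<open>u = 1 / y\<close>, where the exponential beats every power.\<close>
  have "((\<lambda>u. u ^ Suc n / exp u) \<longlongrightarrow> (0::real)) at_top" by (rule tendsto_power_div_exp_0)
  moreover have "filterlim (\<lambda>u. e * u) at_top at_top"
    by (rule filterlim_tendsto_pos_mult_at_top[OF tendsto_const e filterlim_ident])
  ultimately have "((\<lambda>u. (e * u) ^ Suc n / exp (e * u)) \<longlongrightarrow> 0) at_top"
    by (rule filterlim_compose)
  then have "((\<lambda>u. (1 / e ^ Suc n) * ((e * u) ^ Suc n / exp (e * u))) \<longlongrightarrow> 0) at_top"
    by (rule tendsto_mult_right_zero)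
  also have "(\<lambda>u. (1 / e ^ Suc n) * ((e * u) ^ Suc n / exp (e * u))) = (\<lambda>u. exp (- e / inverse u) / inverse u ^ Suc n)"
    using e by (auto simp: field_simps power_mult_distrib exp_minus power_inverse)
  finally have R: "((\<lambda>y. exp (- e / y) / y ^ Suc n) \<longlongrightarrow> 0) (at_right 0)"
    unfolding filterlim_at_right_to_top .
  have "((\<lambda>y. flat_exp e n y / y) \<longlongrightarrow> 0) (at_right 0)"
    by (rule Lim_transform_eventually[OF R])
      (auto simp: flat_exp_def eventually_at_right_less eventually_at_filter)
  moreover have "((\<lambda>y. flat_exp e n y / y) \<longlongrightarrow> 0) (at_left 0)"
    by (rule Lim_transform_eventually[OF tendsto_const])
      (auto simp: flat_exp_def eventually_at_filter)
  ultimately have "((\<lambda>y. flat_exp e n y / y) \<longlongrightarrow> 0) (at 0)"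
    by (simp add: filterlim_split_at)
  then have "(flat_exp e n has_real_derivative 0) (at 0)"
    by (simp add: has_field_derivative_iff flat_exp_def)
  then show ?thesis using equal by (simp add: flat_exp_def)
qed

text \<open>The span of products that are flat at both ends \<open>a\<close> and \<open>b\<close>.
  By the product rule it is closed under differentiation, which is what
  \<open>smooth_coinduct\<close> asks for.\<close>

inductive_set flat_products :: "real \<Rightarrow> real \<Rightarrow> real \<Rightarrow> (real \<Rightarrow> real) set" for e a b where
  base: "(\<lambda>x. flat_exp e n (x - a) * flat_exp e m (b - x)) \<in> flat_products e a b"
| lin: "f \<in> flat_products e a b \<Longrightarrow> g \<in> flat_products e a b \<Longrightarrow>
    (\<lambda>x. p * f x + q * g x) \<in> flat_products e a b"

lemma flat_products_DERIV:
  assumes e: "e > 0" and f: "f \<in> flat_products e a b"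
  shows "\<exists>f'\<in>flat_products e a b. \<forall>x. (f has_real_derivative f' x) (at x)"
  using f
proof induction
  case (base n m)
  define h where "h = (\<lambda>n m x. flat_exp e n (x - a) * flat_exp e m (b - x))"
  have h: "h n m \<in> flat_products e a b" for n m unfolding h_def by (rule flat_products.base)
  define f' where "f' = (\<lambda>x. 1 * (e * h (n+2) m x + (- real n) * h (n+1) m x)
      + 1 * ((- e) * h n (m+2) x + real m * h n (m+1) x))"
  have "f' \<in> flat_products e a b" unfolding f'_def by (intro flat_products.lin h)
  moreover have "((\<lambda>x. flat_exp e n (x - a) * flat_exp e m (b - x)) has_real_derivative f' x) (at x)" for x
  proof -
    have 1: "((\<lambda>x. flat_exp e n (x - a)) has_real_derivative
        e * flat_exp e (n + 2) (x - a) - real n * flat_exp e (n + 1) (x - a)) (at x)"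
      using flat_exp_DERIV[OF e, of n "x + - a"] unfolding DERIV_shift by simp
    have 2: "((\<lambda>x. flat_exp e m (b - x)) has_real_derivative
        (e * flat_exp e (m + 2) (b - x) - real m * flat_exp e (m + 1) (b - x)) * (-1)) (at x)"
      by (rule DERIV_chain2[where f = "flat_exp e m" and g = "\<lambda>x. b - x", OF flat_exp_DERIV[OF e]])
        (auto intro!: derivative_eq_intros)
    show ?thesis
      by (rule DERIV_cong[OF DERIV_mult[OF 1 2]]) (simp add: f'_def h_def algebra_simps)
  qed
  ultimately show ?case by blast
next
  case (lin f g p q)
  then obtain f' g' where fg: "f' \<in> flat_products e a b" "\<forall>x. (f has_real_derivative f' x) (at x)"
    "g' \<in> flat_products e a b" "\<forall>x. (g has_real_derivative g' x) (at x)" by blast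
  have "\<forall>x. ((\<lambda>x. p * f x + q * g x) has_real_derivative p * f' x + q * g' x) (at x)"
    using fg by (intro allI DERIV_add DERIV_cmult) auto
  then show ?case
    by (intro bexI[of _ "\<lambda>x. p * f' x + q * g' x"] flat_products.lin fg)
qed

text \<open>As \<open>e\<close> tends to 0 the bump tends to the indicator of the open interval
  while staying below that of the closed one, so it plays the part of a mollified indicator.\<close>

definition bump :: "real \<Rightarrow> real \<Rightarrow> real \<Rightarrow> real \<Rightarrow> real" where
  "bump e a b x = flat_exp e 0 (x - a) * flat_exp e 0 (b - x)"

lemma bump_range: assumes "e > 0" shows "0 \<le> bump e a b x" "bump e a b x \<le> indicator {a..b} x"
proof -
  have *: "0 \<le> flat_exp e 0 y" "flat_exp e 0 y \<le> 1" for y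
    using assms by (auto simp: flat_exp_def)
  show "0 \<le> bump e a b x" unfolding bump_def by (intro mult_nonneg_nonneg *)
  show "bump e a b x \<le> indicator {a..b} x"
  proof (cases "x \<in> {a..b}")
    case True
    then show ?thesis unfolding bump_def using * by (simp add: mult_le_one)
  next
    case False
    then show ?thesis by (auto simp: bump_def flat_exp_def indicator_def)
  qed
qed

lemma bump_test: assumes "e > 0" shows "test_function (bump e a b)"
  unfolding test_function_iff
proof
  have "bump e a b \<in> flat_products e a b"
    using flat_products.base[of e 0 a 0 b] by (simp add: bump_def[abs_def])
  then show "smooth (bump e a b)"
    by (rule smooth_coinduct) (rule flat_products_DERIV[OF assms])
  have "{x. bump e a b x \<noteq> 0} \<subseteq> {a..b}"
    by (auto simp: bump_def flat_exp_def split: if_splits)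
  then show "bounded {x. bump e a b x \<noteq> 0}" using bounded_subset bounded_closed_interval by blast
qed

lemma bump_limit: "(\<lambda>n. bump (1 / real (Suc n)) a b x) \<longlonglongrightarrow> indicator {a<..<b} x"
proof (cases "a < x \<and> x < b")
  case True
  have "(\<lambda>n. exp (- (1 / real (Suc n)) / y)) \<longlonglongrightarrow> exp (- 0 / y)" if "y > 0" for y :: real
    using LIMSEQ_inverse_real_of_nat that by (intro tendsto_intros) (simp_all add: inverse_eq_divide)
  from tendsto_mult[OF this[of "x - a"] this[of "b - x"]] show ?thesis using True
    by (simp add: bump_def flat_exp_def)
next
  case False
  then have "bump (1 / real (Suc n)) a b x = 0" for n by (auto simp: bump_def flat_exp_def)
  then show ?thesis using False by simp
qed

lemma test_support: assumes "test_function \<phi>" obtains M where "M > 0" "\<And>x. \<bar>x\<bar> \<ge> M \<Longrightarrow> \<phi> x = 0"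
proof -
  obtain B where B: "\<And>x. \<phi> x \<noteq> 0 \<Longrightarrow> \<bar>x\<bar> \<le> B"
    using assms unfolding test_function_iff bounded_iff by auto
  show ?thesis by (rule that[of "\<bar>B\<bar> + 1"]) (use B in \<open>force+\<close>)
qed

lemma test_deriv: assumes "test_function \<phi>" shows "test_function (deriv \<phi>)"
  unfolding test_function_iff
proof
  show "smooth (deriv \<phi>)" using assms smooth_deriv by (auto simp: test_function_iff)
  obtain M where M: "M > 0" "\<And>x. \<bar>x\<bar> \<ge> M \<Longrightarrow> \<phi> x = 0" using test_support[OF assms] by blast
  have "deriv \<phi> x = 0" if "\<bar>x\<bar> > M" for x
  proof -
    have "((\<lambda>x. 0) has_real_derivative 0) (at x)" by simp
    then have "(\<phi> has_real_derivative 0) (at x)"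
      by (rule has_field_derivative_transform_within_open[where S = "{x. \<bar>x\<bar> > M}"])
        (use that M in \<open>auto intro!: open_Collect_less continuous_intros\<close>)
    then show ?thesis by (rule DERIV_imp_deriv)
  qed
  then have "{x. deriv \<phi> x \<noteq> 0} \<subseteq> {-M..M}" by force
  then show "bounded {x. deriv \<phi> x \<noteq> 0}" using bounded_subset bounded_closed_interval by blast
qed

lemma test_continuous: "test_function \<phi> \<Longrightarrow> continuous_on A \<phi>"
  by (rule continuous_on_subset[OF smooth_continuous]) (auto simp: test_function_iff)

lemma test_bounded: assumes "test_function \<phi>"
  obtains M K where "M > 0" "K \<ge> 0" "\<And>x. \<bar>x\<bar> \<ge> M \<Longrightarrow> \<phi> x = 0" "\<And>x. \<bar>\<phi> x\<bar> \<le> K * indicator {-M..M} x"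
proof -
  obtain M where M: "M > 0" "\<And>x. \<bar>x\<bar> \<ge> M \<Longrightarrow> \<phi> x = 0" using test_support[OF assms] by blast
  have "compact (\<phi> ` {-M..M})" by (intro compact_continuous_image test_continuous assms) auto
  then obtain K where K: "\<And>x. x \<in> {-M..M} \<Longrightarrow> \<bar>\<phi> x\<bar> \<le> K"
    using compact_imp_bounded bounded_iff by (metis imageI real_norm_def)
  have "\<bar>\<phi> x\<bar> \<le> \<bar>K\<bar> * indicator {-M..M} x" for x
  proof (cases "x \<in> {-M..M}")
    case True then show ?thesis using K[OF True] by simp
  next
    case False then show ?thesis using M(2)[of x] by auto
  qed
  then show ?thesis using M that[of M "\<bar>K\<bar>"] by auto
qed

lemma test_integrable: assumes "test_function \<phi>" shows "integrable lborel \<phi>"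
proof -
  obtain M K where MK: "\<And>x. \<bar>\<phi> x\<bar> \<le> K * indicator {-M..M} x" using test_bounded[OF assms] by metis
  show ?thesis
  proof (rule Bochner_Integration.integrable_bound)
    show "integrable lborel (\<lambda>x. K * indicator {-M..M} x :: real)"
      by (intro integrable_mult_right integrable_real_indicator) (auto simp: emeasure_lborel_Icc_eq)
    show "\<phi> \<in> borel_measurable lborel"
      using borel_measurable_continuous_onI[OF test_continuous[OF assms]] by simp
    show "AE x in lborel. norm (\<phi> x) \<le> norm (K * indicator {- M..M} x)"
      using MK by (auto intro!: AE_I2 order_trans[OF _ abs_ge_self])
  qed
qed

lemma test_integral_interval:
  assumes "test_function \<phi>" "\<And>x. \<bar>x\<bar> \<ge> M \<Longrightarrow> \<phi> x = 0"
  shows "(LINT x|lborel. \<phi> x) = integral {-M..M} \<phi>"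
proof -
  have "(LINT x|lborel. \<phi> x) = (LINT x:{-M..M}|lborel. \<phi> x)"
    unfolding set_lebesgue_integral_def
  proof (intro Bochner_Integration.integral_cong refl)
    fix x show "\<phi> x = indicator {-M..M} x *\<^sub>R \<phi> x"
      using assms(2)[of x] by (cases "\<bar>x\<bar> \<ge> M") (auto simp: indicator_def)
  qed
  also have "\<dots> = integral {-M..M} \<phi>"
  proof (rule set_borel_integral_eq_integral)
    show "set_integrable lborel {-M..M} \<phi>"
      unfolding set_integrable_def using test_integrable[OF assms(1)] by (intro integrable_mult_indicator) auto
  qed
  finally show ?thesis .
qed

lemma test_Lp2: assumes "test_function \<phi>" shows "(\<lambda>x. of_real (\<phi> x)) \<in> Lp 2"
proof -
  obtain M K where MK: "\<And>x. \<bar>\<phi> x\<bar> \<le> K * indicator {-M..M} x" "K \<ge> 0" using test_bounded[OF assms] by metis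
  show ?thesis
  proof (rule Lp2_bound)
    have [measurable]: "\<phi> \<in> borel_measurable borel" by (rule borel_measurable_continuous_onI[OF test_continuous[OF assms]])
    show "(\<lambda>x. complex_of_real (\<phi> x)) \<in> borel_measurable borel" by measurable
    show "integrable lborel (\<lambda>x. K * \<bar>\<phi> x\<bar>)" using test_integrable[OF assms] by simp
    fix x
    have "\<bar>\<phi> x\<bar> * \<bar>\<phi> x\<bar> \<le> K * \<bar>\<phi> x\<bar>"
      using MK(1)[of x] MK(2) by (intro mult_right_mono) (cases "x \<in> {-M..M}"; simp)+
    then show "(cmod (complex_of_real (\<phi> x)))\<^sup>2 \<le> K * \<bar>\<phi> x\<bar>" by (simp add: power2_eq_square)
  qed
qed

lemma test_pairing: "(LINT x|lborel. f x * of_real (\<phi> x)) = L2_inner f (\<lambda>x. of_real (\<phi> x))"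
  by (simp add: L2_inner_def)

section \<open>Locally square integrable functions and the lemma of du Bois-Reymond\<close>

text \<open>Constants and primitives of \<open>L\<^sup>2\<close> functions are square integrable
  only locally, and the lemma of du Bois-Reymond has to be applied to differences involving
  them.\<close>

definition locL2 :: "cfun \<Rightarrow> bool" where
  "locL2 h \<longleftrightarrow> h \<in> borel_measurable borel \<and> (\<forall>N. (\<lambda>x. h x * ivl (-N) N x) \<in> Lp 2)"

lemma Lp2_locL2: assumes "f \<in> Lp 2" shows "locL2 f"
  unfolding locL2_def
proof (intro conjI allI)
  have [measurable]: "f \<in> borel_measurable borel" "ivl a b \<in> borel_measurable borel" for a b
    using assms ivl_Lp2 by (auto intro: Lp2_measurable)
  show "f \<in> borel_measurable borel" by measurable
  fix N :: real
  show "(\<lambda>x. f x * ivl (-N) N x) \<in> Lp 2"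
    by (rule Lp2_bound[OF _ Lp2_integrable[OF assms]])
      (measurable, auto simp: ivl_def indicator_def)
qed

lemma continuous_locL2: assumes "continuous_on UNIV (F :: cfun)" shows "locL2 F"
  unfolding locL2_def
proof (intro conjI allI)
  show [measurable]: "F \<in> borel_measurable borel" by (rule borel_measurable_continuous_onI[OF assms])
  fix N :: real
  have [measurable]: "ivl a b \<in> borel_measurable borel" for a b
    using ivl_Lp2 by (auto intro: Lp2_measurable)
  have "compact (F ` {-N..N})" using assms by (intro compact_continuous_image) (auto intro: continuous_on_subset)
  then obtain K where K: "\<And>x. x \<in> {-N..N} \<Longrightarrow> norm (F x) \<le> K"
    using compact_imp_bounded bounded_iff by (metis imageI)
  show "(\<lambda>x. F x * ivl (-N) N x) \<in> Lp 2"
  proof (rule Lp2_bound)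
    show "integrable lborel (\<lambda>x. K\<^sup>2 * indicator {-N..N} x :: real)"
      by (intro integrable_mult_right integrable_real_indicator) (auto simp: emeasure_lborel_Icc_eq)
    show "(cmod (F x * ivl (- N) N x))\<^sup>2 \<le> K\<^sup>2 * indicator {- N..N} x" for x
      using K[of x] by (auto simp: ivl_def indicator_def intro!: power_mono)
  qed measurable
qed

lemma locL2_lin: assumes "locL2 f" "locL2 g" shows "locL2 (\<lambda>x. a * f x + b * g x)"
  unfolding locL2_def
proof (intro conjI allI)
  have [measurable]: "f \<in> borel_measurable borel" "g \<in> borel_measurable borel" using assms by (auto simp: locL2_def)
  show "(\<lambda>x. a * f x + b * g x) \<in> borel_measurable borel" by measurable
  fix N
  have "(\<lambda>x. a * (f x * ivl (-N) N x) + b * (g x * ivl (-N) N x)) \<in> Lp 2"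
    using assms by (intro Lp2_lin) (auto simp: locL2_def)
  then show "(\<lambda>x. (a * f x + b * g x) * ivl (-N) N x) \<in> Lp 2" by (simp add: algebra_simps)
qed

lemma locL2_test_integrable:
  assumes h: "locL2 h" and t: "test_function \<phi>"
  shows "integrable lborel (\<lambda>x. h x * of_real (\<phi> x))"
proof -
  obtain M where M: "\<And>x. \<bar>x\<bar> \<ge> M \<Longrightarrow> \<phi> x = 0" using test_support[OF t] by metis
  have "integrable lborel (\<lambda>x. (h x * ivl (-M) M x) * cnj (of_real (\<phi> x)))"
    using h by (intro Lp2_mult_integrable test_Lp2 t) (auto simp: locL2_def)
  moreover have "(\<lambda>x. (h x * ivl (-M) M x) * cnj (of_real (\<phi> x))) = (\<lambda>x. h x * of_real (\<phi> x))"
  proof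
    fix x
    show "(h x * ivl (-M) M x) * cnj (of_real (\<phi> x)) = h x * of_real (\<phi> x)"
      using M[of x] by (cases "\<bar>x\<bar> \<ge> M") (auto simp: ivl_def indicator_def)
  qed
  ultimately show ?thesis by simp
qed

text \<open>Dominated convergence along bumps that approach an interval indicator reduces the claim
  to functions all of whose interval integrals vanish.\<close>

lemma locL2_weak_zero:
  assumes h: "locL2 h" and z: "\<And>\<phi>. test_function \<phi> \<Longrightarrow> (LINT x|lborel. h x * of_real (\<phi> x)) = 0"
  shows "AE x in lborel. h x = 0"
proof -
  have [measurable]: "h \<in> borel_measurable borel" using h by (auto simp: locL2_def)
  have iz: "(LINT x|lborel. h x * ivl a b x) = 0" if ab: "a < b" for a b
  proof -
    define N where "N = max \<bar>a\<bar> \<bar>b\<bar>"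
    have "integrable lborel (\<lambda>x. (h x * ivl (-N) N x) * cnj (ivl a b x))"
      using h by (intro Lp2_mult_integrable ivl_Lp2) (auto simp: locL2_def)
    moreover have "(\<lambda>x. (h x * ivl (-N) N x) * cnj (ivl a b x)) = (\<lambda>x. h x * ivl a b x)"
      by (auto simp: ivl_def indicator_def N_def fun_eq_iff)
    ultimately have int: "integrable lborel (\<lambda>x. h x * ivl a b x)" by simp
    have "(\<lambda>n. LINT x|lborel. h x * of_real (bump (1 / real (Suc n)) a b x)) \<longlonglongrightarrow> (LINT x|lborel. h x * ivl a b x)"
    proof (rule integral_dominated_convergence)
      show "integrable lborel (\<lambda>x. norm (h x * ivl a b x))" using int by simp
      show "(\<lambda>x. h x * ivl a b x) \<in> borel_measurable lborel" using int by simp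
      show "(\<lambda>x. h x * of_real (bump (1 / real (Suc n)) a b x)) \<in> borel_measurable lborel" for n
        using locL2_test_integrable[OF h bump_test[of "1 / real (Suc n)" a b]] by simp
      show "AE x in lborel. norm (h x * of_real (bump (1 / real (Suc n)) a b x)) \<le> norm (h x * ivl a b x)" for n
      proof (rule AE_I2)
        fix x
        have "norm (h x * of_real (bump (1 / real (Suc n)) a b x)) = norm (h x) * bump (1 / real (Suc n)) a b x"
          using bump_range(1)[of "1 / real (Suc n)" a b x] by (simp add: norm_mult)
        also have "\<dots> \<le> norm (h x) * indicator {a..b} x"
          by (intro mult_left_mono bump_range(2)) auto
        also have "\<dots> = norm (h x * ivl a b x)" by (simp add: norm_mult ivl_def indicator_def)
        finally show "norm (h x * of_real (bump (1 / real (Suc n)) a b x)) \<le> norm (h x * ivl a b x)" .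
      qed
      \<comment> \<open>The bumps converge to the indicator of the open interval while
        \<open>ivl\<close> is that of the closed one; the two endpoints form a null set.\<close>
      have "AE x in lborel. x \<noteq> a" "AE x in lborel. x \<noteq> b"
        by (auto intro: AE_lborel_singleton)
      then show "AE x in lborel. (\<lambda>n. h x * of_real (bump (1 / real (Suc n)) a b x)) \<longlonglongrightarrow> h x * ivl a b x"
      proof eventually_elim
        case (elim x)
        have "(\<lambda>n. h x * of_real (bump (1 / real (Suc n)) a b x)) \<longlonglongrightarrow> h x * of_real (indicator {a<..<b} x)"
          by (intro tendsto_intros bump_limit)
        moreover have "of_real (indicator {a<..<b} x) = ivl a b x"
          using elim by (auto simp: ivl_def indicator_def)
        ultimately show ?case by simp
      qed
    qed
    moreover have "(LINT x|lborel. h x * of_real (bump (1 / real (Suc n)) a b x)) = 0" for n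
      by (rule z[OF bump_test]) simp
    ultimately show ?thesis by (simp add: LIMSEQ_const_iff)
  qed
  have "AE x in lborel. h x * ivl (-N) N x = 0" for N
  proof (rule AE_zero_of_interval_integrals)
    show "(\<lambda>x. h x * ivl (-N) N x) \<in> Lp 2" using h by (auto simp: locL2_def)
    fix a b :: real
    let ?a = "max a (-N)" and ?b = "min b N"
    have "L2_inner (\<lambda>x. h x * ivl (-N) N x) (ivl a b) = (LINT x|lborel. h x * ivl ?a ?b x)"
      unfolding L2_inner_def
      by (intro Bochner_Integration.integral_cong) (auto simp: ivl_def indicator_def)
    also have "\<dots> = 0"
    proof (cases ?a ?b rule: linorder_cases)
      case equal
      show ?thesis
      proof (rule integral_eq_zero_AE)
        have "AE x in lborel. x \<noteq> ?a" by (rule AE_lborel_singleton)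
        then show "AE x in lborel. h x * ivl ?a ?b x = 0"
          unfolding equal[symmetric] by eventually_elim (auto simp: ivl_def)
      qed
    next
      case greater
      then have "ivl ?a ?b = (\<lambda>x. 0)" unfolding ivl_def by (auto simp: indicator_def fun_eq_iff)
      then show ?thesis by simp
    qed (rule iz)
    finally show "L2_inner (\<lambda>x. h x * ivl (-N) N x) (ivl a b) = 0" .
  qed
  then have "AE x in lborel. \<forall>n::nat. h x * ivl (- real n) (real n) x = 0" unfolding AE_all_countable by blast
  then show ?thesis
  proof eventually_elim
    case (elim x)
    obtain n :: nat where "\<bar>x\<bar> \<le> real n" using real_arch_simple by blast
    then have "ivl (- real n) (real n) x = 1" by (auto simp: ivl_def indicator_def)
    with elim[rule_format, of n] show ?case by simp
  qed
qed

text \<open>The vanishing integral is what makes the primitive return to 0 on the right of the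
  support of \<open>k\<close>.\<close>

lemma test_primitive:
  assumes t: "test_function k" and z: "(LINT x|lborel. k x) = 0"
  shows "\<exists>\<phi>. test_function \<phi> \<and> deriv \<phi> = k"
proof -
  obtain M where M: "M > 0" "\<And>x. \<bar>x\<bar> \<ge> M \<Longrightarrow> k x = 0" using test_support[OF t] by metis
  have int: "k integrable_on {a..b}" for a b
    by (intro integrable_continuous_interval test_continuous t)
  define \<phi> where "\<phi> = (\<lambda>x. if x < -M then 0 else integral {-M..x} k)"
  have eq: "\<phi> x = integral {-B..x} k" if "B \<ge> M" "x \<ge> -B" for B x
  proof (cases "x < -M")
    case True
    have "integral {-B..x} k = integral {-B..x} (\<lambda>x. 0)"
      by (rule integral_cong) (use True M in auto)
    then show ?thesis using True by (simp add: \<phi>_def)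
  next
    case False
    have "integral {-B..-M} k + integral {-M..x} k = integral {-B..x} k"
      by (rule Henstock_Kurzweil_Integration.integral_combine) (use that False int in auto)
    moreover have "integral {-B..-M} k = integral {-B..-M} (\<lambda>x. 0)"
      by (rule integral_cong) (use M in auto)
    ultimately show ?thesis using False by (simp add: \<phi>_def)
  qed
  have D: "(\<phi> has_real_derivative k x) (at x)" for x
  proof -
    define B where "B = \<bar>x\<bar> + M + 1"
    have "((\<lambda>u. integral {-B..u} k) has_real_derivative k x) (at x within {-B..B})"
      by (rule integral_has_real_derivative) (use M in \<open>auto simp: B_def intro!: test_continuous t\<close>)
    then have "((\<lambda>u. integral {-B..u} k) has_real_derivative k x) (at x)"
      using M(1) by (subst (asm) at_within_Icc_at) (auto simp: B_def)
    then show ?thesis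
      by (rule has_field_derivative_transform_within_open[where S = "{-B<..}"])
        (use M eq[of B] in \<open>auto simp: B_def\<close>)
  qed
  have der: "deriv \<phi> = k" by (rule ext) (rule DERIV_imp_deriv[OF D])
  have "smooth \<phi>"
  \<comment> \<open>Adjoining \<open>\<phi>\<close> to the smooth functions gives a set closed under
    differentiation, since its derivative \<open>k\<close> is smooth.\<close>
  proof (rule smooth_coinduct[of _ "insert \<phi> {f. smooth f}"])
    fix f assume "f \<in> insert \<phi> {f. smooth f}"
    then show "\<exists>f'\<in>insert \<phi> {f. smooth f}. \<forall>x. (f has_real_derivative f' x) (at x)"
    proof
      assume "f = \<phi>"
      then show ?thesis using D t by (intro bexI[of _ k]) (auto simp: test_function_iff)
    next
      assume "f \<in> {f. smooth f}"
      then show ?thesis using smooth_deriv smooth_DERIV by (intro bexI[of _ "deriv f"]) auto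
    qed
  qed simp
  moreover have "\<phi> x = 0" if "\<bar>x\<bar> > M" for x
  proof (cases "x < -M")
    case False
    then have x: "x > M" using that by auto
    have "\<phi> x = integral {-M..x} k" using False by (simp add: \<phi>_def)
    also have "\<dots> = integral {-M..M} k + integral {M..x} k"
      by (rule Henstock_Kurzweil_Integration.integral_combine[symmetric]) (use x M int in auto)
    also have "integral {M..x} k = integral {M..x} (\<lambda>x. 0)"
      by (rule integral_cong) (use M in auto)
    also have "integral {-M..M} k = 0" using test_integral_interval[OF t M(2)] z by simp
    finally show ?thesis by simp
  qed (simp add: \<phi>_def)
  then have "{x. \<phi> x \<noteq> 0} \<subseteq> {-M..M}" by force
  then have "bounded {x. \<phi> x \<noteq> 0}" using bounded_subset bounded_closed_interval by blast
  ultimately show ?thesis using der by (auto simp: test_function_iff)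
qed

text \<open>A test function minus the multiple of a fixed bump with the same integral is the
  derivative of a test function, so \<open>h\<close> annihilates it; the pairing with
  \<open>h\<close> is thus a constant times the integral.\<close>

lemma du_Bois_Reymond:
  assumes h: "locL2 h" and z: "\<And>\<phi>. test_function \<phi> \<Longrightarrow> (LINT x|lborel. h x * of_real (deriv \<phi> x)) = 0"
  shows "\<exists>c. AE x in lborel. h x = c"
proof -
  define \<eta> where "\<eta> = bump 1 0 1"
  have \<eta>: "test_function \<eta>" unfolding \<eta>_def by (rule bump_test) simp
  define I where "I = (LINT x|lborel. \<eta> x)"
  have I0: "I \<noteq> 0"
  proof
    assume "I = 0"
    then have "AE x in lborel. \<eta> x = 0"
      unfolding I_def using integral_nonneg_eq_0_iff_AE[OF test_integrable[OF \<eta>]] bump_range(1)[of 1 0 1]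
      by (auto simp: \<eta>_def)
    then obtain N where N: "N \<in> null_sets lborel" "{x. \<eta> x \<noteq> 0} \<subseteq> N" by (auto simp: eventually_ae_filter)
    have "{0<..<1} \<subseteq> {x. \<eta> x \<noteq> 0}" by (auto simp: \<eta>_def bump_def flat_exp_def)
    then have "emeasure lborel {0<..<1::real} \<le> emeasure lborel N"
      using N by (intro emeasure_mono) auto
    then show False using N by (simp add: null_setsD1)
  qed
  define c where "c = (LINT x|lborel. h x * of_real (\<eta> x)) / of_real I"
  have "AE x in lborel. 1 * h x + (-1) * c = 0"
  proof (rule locL2_weak_zero)
    have lc: "locL2 (\<lambda>x. c)" by (rule continuous_locL2) simp
    show "locL2 (\<lambda>x. 1 * h x + (-1) * c)" by (rule locL2_lin[OF h lc])
    fix \<phi> assume t: "test_function \<phi>"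
    define d where "d = (LINT x|lborel. \<phi> x) / I"
    define k where "k = (\<lambda>x. 1 * \<phi> x + (-d) * \<eta> x)"
    have "smooth k" unfolding k_def using t \<eta> by (intro smooth_lin) (auto simp: test_function_iff)
    moreover have "bounded {x. k x \<noteq> 0}"
    proof (rule bounded_subset)
      show "bounded ({x. \<phi> x \<noteq> 0} \<union> {x. \<eta> x \<noteq> 0})" using t \<eta> by (auto simp: test_function_iff)
    qed (auto simp: k_def)
    ultimately have k: "test_function k" by (simp add: test_function_iff)
    have "(LINT x|lborel. k x) = (LINT x|lborel. \<phi> x) - d * I"
      unfolding k_def I_def using test_integrable[OF t] test_integrable[OF \<eta>] by simp
    then have "(LINT x|lborel. k x) = 0" using I0 by (simp add: d_def)
    from test_primitive[OF k this] have "(LINT x|lborel. h x * of_real (k x)) = 0" using z by blast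
    moreover have "(\<lambda>x. h x * of_real (k x)) = (\<lambda>x. h x * of_real (\<phi> x) - of_real d * (h x * of_real (\<eta> x)))"
      by (auto simp: k_def algebra_simps)
    ultimately have "(LINT x|lborel. h x * of_real (\<phi> x)) = of_real d * (LINT x|lborel. h x * of_real (\<eta> x))"
      using locL2_test_integrable[OF h t] locL2_test_integrable[OF h \<eta>] by simp
    also have "\<dots> = c * of_real (LINT x|lborel. \<phi> x)" using I0 by (simp add: c_def d_def)
    also have "\<dots> = (LINT x|lborel. c * of_real (\<phi> x))" by simp
    finally have "(LINT x|lborel. h x * of_real (\<phi> x)) - (LINT x|lborel. c * of_real (\<phi> x)) = 0" by simp
    then show "(LINT x|lborel. (1 * h x + (-1) * c) * of_real (\<phi> x)) = 0"
      using locL2_test_integrable[OF h t] locL2_test_integrable[OF lc t]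
      by (simp add: left_diff_distrib)
  qed
  then show ?thesis by auto
qed

subsection \<open>The space \<open>H\<^sup>1\<close>\<close>

lemma L2_inner_ivl_gt: "b < a \<Longrightarrow> L2_inner g (ivl a b) = 0"
  by (simp add: L2_inner_def ivl_def)

lemma L2_inner_ivl_refl: "g \<in> Lp 2 \<Longrightarrow> L2_inner g (ivl a a) = 0"
  using ivl_bound[of g a a] by simp

lemma L2_inner_ivl_add:
  assumes g: "g \<in> Lp 2" and le: "a \<le> b" "b \<le> c"
  shows "L2_inner g (ivl a c) = L2_inner g (ivl a b) + L2_inner g (ivl b c)"
proof -
  have "L2_inner g (ivl a c) = L2_inner g (\<lambda>x. 1 * ivl a b x + 1 * ivl b c x)"
  proof (rule L2_inner_cong_AE[OF g g ivl_Lp2 L2.lin[OF ivl_Lp2 ivl_Lp2] AE_I2])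
    have "AE x in lborel. x \<noteq> b" by (rule AE_lborel_singleton)
    then show "AE x in lborel. ivl a c x = 1 * ivl a b x + 1 * ivl b c x"
      by eventually_elim (use le in \<open>auto simp: ivl_def indicator_def\<close>)
  qed simp
  also have "\<dots> = L2_inner g (ivl a b) + L2_inner g (ivl b c)"
    using L2.ip_lin2[OF ivl_Lp2 ivl_Lp2 g, of 1 a b 1 b c] by simp
  finally show ?thesis .
qed

text \<open>The signed integral of \<open>g\<close> from \<open>0\<close> to \<open>y\<close>: one of the two intervals is empty or a point.\<close>

definition prim :: "cfun \<Rightarrow> cfun" where
  "prim g y = L2_inner g (ivl 0 y) - L2_inner g (ivl y 0)"

lemma prim_diff:
  assumes g: "g \<in> Lp 2" and le: "a \<le> b" shows "prim g b - prim g a = L2_inner g (ivl a b)"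
proof -
  have pos: "L2_inner g (ivl y 0) = 0" if "y \<ge> 0" for y
    using that L2_inner_ivl_gt[of 0 y g] L2_inner_ivl_refl[OF g, of 0] by (cases "y = 0") auto
  have neg: "L2_inner g (ivl 0 y) = 0" if "y \<le> 0" for y
    using that L2_inner_ivl_gt[of y 0 g] L2_inner_ivl_refl[OF g, of 0] by (cases "y = 0") auto
  consider "0 \<le> a" | "b \<le> 0" | "a \<le> 0" "0 \<le> b" by linarith
  then show ?thesis
  proof cases
    case 1
    then show ?thesis using L2_inner_ivl_add[OF g 1 le] pos[OF 1] pos[of b] le by (simp add: prim_def)
  next
    case 2
    then show ?thesis using L2_inner_ivl_add[OF g le 2] neg[OF 2] neg[of a] le by (simp add: prim_def)
  next
    case 3
    then show ?thesis using L2_inner_ivl_add[OF g 3] neg[OF 3(1)] pos[OF 3(2)] by (simp add: prim_def)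
  qed
qed

lemma prim_holder:
  assumes g: "g \<in> Lp 2" shows "cmod (prim g b - prim g a) \<le> Lp_norm 2 g * sqrt \<bar>b - a\<bar>"
proof (cases "a \<le> b")
  case True
  then show ?thesis using ivl_bound[OF g True] prim_diff[OF g True] by simp
next
  case False
  then have "b \<le> a" by simp
  then show ?thesis using ivl_bound[OF g \<open>b \<le> a\<close>] prim_diff[OF g \<open>b \<le> a\<close>] by (simp add: norm_minus_commute)
qed

lemma holder_half_continuous:
  fixes F :: cfun
  assumes "\<And>a b. cmod (F b - F a) \<le> K * sqrt \<bar>b - a\<bar>"
  shows "continuous_on UNIV F"
  unfolding continuous_on_def
proof
  fix x :: real
  have "((\<lambda>y. K * sqrt \<bar>y - x\<bar>) \<longlongrightarrow> K * sqrt \<bar>x - x\<bar>) (at x)"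
    by (intro tendsto_intros)
  then have "((\<lambda>y. F y - F x) \<longlongrightarrow> 0) (at x)"
    by (intro Lim_null_comparison[of "\<lambda>y. F y - F x" "\<lambda>y. K * sqrt \<bar>y - x\<bar>"]) (use assms in auto)
  then show "(F \<longlongrightarrow> F x) (at x within UNIV)" by (simp add: LIM_zero_iff)
qed

lemma prim_continuous: "g \<in> Lp 2 \<Longrightarrow> continuous_on UNIV (prim g)"
  by (rule holder_half_continuous[OF prim_holder])

lemma test_deriv_integral_interval:
  assumes t: "test_function \<phi>" and "a \<le> b"
  shows "(LINT y|lborel. deriv \<phi> y * indicator {a..b} y) = \<phi> b - \<phi> a"
proof (rule integral_FTC_Icc_real[OF assms(2)])
  show "DERIV \<phi> x :> deriv \<phi> x" for x using t by (intro smooth_DERIV) (auto simp: test_function_iff)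
  show "isCont (deriv \<phi>) x" for x
    using test_continuous[OF test_deriv[OF t], of UNIV] by (simp add: continuous_on_eq_continuous_at)
qed

lemma integrable_product:
  fixes u v :: "real \<Rightarrow> complex"
  assumes u: "integrable lborel u" and v: "integrable lborel v"
  shows "integrable (lborel \<Otimes>\<^sub>M lborel) (\<lambda>(s, y). u s * v y)"
proof (rule lborel_pair.Fubini_integrable)
  have [measurable]: "u \<in> borel_measurable borel" "v \<in> borel_measurable borel"
    using u v borel_measurable_integrable by fastforce+
  show "(\<lambda>(s, y). u s * v y) \<in> borel_measurable (lborel \<Otimes>\<^sub>M lborel)" by measurable
  show "integrable lborel (\<lambda>x. LINT y|lborel. norm (case (x, y) of (s, y) \<Rightarrow> u s * v y))"
    using u by (simp add: norm_mult)
  show "AE x in lborel. integrable lborel (\<lambda>y. case (x, y) of (s, y) \<Rightarrow> u s * v y)"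
    using v by simp
qed

text \<open>Fubini's theorem for \<open>g s\<close> times the derivative of \<open>\<phi>\<close> at
  \<open>y\<close>, over the region \<open>s \<le> y\<close>. Truncation to an interval containing
  the supports makes the product integrable.\<close>

lemma prim_weak_deriv:
  assumes g: "g \<in> Lp 2" and t: "test_function \<phi>"
  shows "(LINT x|lborel. prim g x * of_real (deriv \<phi> x)) = - (LINT x|lborel. g x * of_real (\<phi> x))"
proof -
  obtain M1 where M1: "M1 > 0" "\<And>x. \<bar>x\<bar> \<ge> M1 \<Longrightarrow> \<phi> x = 0" using test_support[OF t] by metis
  obtain M2 where M2: "M2 > 0" "\<And>x. \<bar>x\<bar> \<ge> M2 \<Longrightarrow> deriv \<phi> x = 0" using test_support[OF test_deriv[OF t]] by metis
  define M where "M = max M1 M2"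
  have M: "M > 0" "\<And>x. \<bar>x\<bar> \<ge> M \<Longrightarrow> \<phi> x = 0" "\<And>x. \<bar>x\<bar> \<ge> M \<Longrightarrow> deriv \<phi> x = 0"
    using M1 M2 by (auto simp: M_def)
  have [measurable]: "deriv \<phi> \<in> borel_measurable borel" "\<phi> \<in> borel_measurable borel"
    using test_continuous[OF test_deriv[OF t]] test_continuous[OF t] by (auto intro: borel_measurable_continuous_onI)
  have [measurable]: "g \<in> borel_measurable borel" "ivl a b \<in> borel_measurable borel" for a b
    using g ivl_Lp2 by (auto intro: Lp2_measurable)
  define G where "G = (\<lambda>s. g s * ivl (-M) M s)"
  have [measurable]: "G \<in> borel_measurable borel" unfolding G_def by measurable
  have G: "integrable lborel G"
    using Lp2_mult_integrable[OF g ivl_Lp2, of "-M" M] by (simp add: G_def cnj_ivl)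
  define d where "d = (\<lambda>y. complex_of_real (deriv \<phi> y))"
  have [measurable]: "d \<in> borel_measurable borel" unfolding d_def by measurable
  have dint: "integrable lborel d" unfolding d_def using test_integrable[OF test_deriv[OF t]] by simp
  \<comment> \<open>The integration in \<open>s\<close> starts at \<open>-M\<close> and the
    primitive at 0; the resulting constant \<open>prim g (-M)\<close> drops out because the
    derivative of \<open>\<phi>\<close> has integral zero.\<close>
  have d0: "(LINT y|lborel. d y) = 0"
  proof -
    have "(LINT y|lborel. deriv \<phi> y) = (LINT y|lborel. deriv \<phi> y * indicator {-M..M} y)"
    proof (rule Bochner_Integration.integral_cong[OF refl])
      fix x show "deriv \<phi> x = deriv \<phi> x * indicator {-M..M} x"
        using M(3)[of x] by (cases "\<bar>x\<bar> \<ge> M") (auto simp: indicator_def)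
    qed
    also have "\<dots> = 0" using test_deriv_integral_interval[OF t, of "-M" M] M by simp
    finally show ?thesis unfolding d_def integral_complex_of_real by simp
  qed
  define f where "f = (\<lambda>s y. G s * d y * (if s \<le> y then 1 else 0))"
  have "integrable (lborel \<Otimes>\<^sub>M lborel) (case_prod f)"
  proof (rule Bochner_Integration.integrable_bound[OF integrable_product[OF G dint]])
    show "case_prod f \<in> borel_measurable (lborel \<Otimes>\<^sub>M lborel)" unfolding f_def by measurable
    show "AE x in lborel \<Otimes>\<^sub>M lborel. norm (case_prod f x) \<le> norm (case x of (s, y) \<Rightarrow> G s * d y)"
      by (intro AE_I2) (auto simp: f_def)
  qed
  from lborel_pair.Fubini_integral[OF this]
  have fub: "(LINT y|lborel. LINT s|lborel. f s y) = (LINT s|lborel. LINT y|lborel. f s y)" .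
  have 1: "(LINT s|lborel. f s y) = (prim g y - prim g (-M)) * d y" for y
  proof (cases "\<bar>y\<bar> \<ge> M")
    case True
    then show ?thesis using M(3)[OF True] by (simp add: f_def d_def)
  next
    case False
    then have y: "-M \<le> y" "y \<le> M" by auto
    have "(LINT s|lborel. f s y) = (LINT s|lborel. (g s * cnj (ivl (-M) y s)) * d y)"
      unfolding f_def G_def cnj_ivl
      by (intro Bochner_Integration.integral_cong) (use y in \<open>auto simp: ivl_def indicator_def\<close>)
    also have "\<dots> = L2_inner g (ivl (-M) y) * d y"
      by (simp add: L2_inner_def)
    also have "L2_inner g (ivl (-M) y) = prim g y - prim g (-M)" using prim_diff[OF g y(1)] by simp
    finally show ?thesis .
  qed
  have 2: "(LINT y|lborel. f s y) = - (g s * of_real (\<phi> s))" for s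
  proof (cases "\<bar>s\<bar> > M")
    case True
    then have "G s = 0" by (auto simp: G_def ivl_def indicator_def)
    then show ?thesis using M(2)[of s] True by (simp add: f_def)
  next
    case False
    then have s: "-M \<le> s" "s \<le> M" by auto
    have "(LINT y|lborel. f s y) = (LINT y|lborel. G s * of_real (deriv \<phi> y * indicator {s..M} y))"
    proof (rule Bochner_Integration.integral_cong[OF refl])
      fix y show "f s y = G s * of_real (deriv \<phi> y * indicator {s..M} y)"
        using M(3)[of y] M(1) by (cases "y \<ge> M") (auto simp: f_def d_def indicator_def)
    qed
    also have "\<dots> = G s * of_real (LINT y|lborel. deriv \<phi> y * indicator {s..M} y)"
      by (simp only: Bochner_Integration.integral_mult_right_zero integral_complex_of_real)
    also have "\<dots> = G s * of_real (\<phi> M - \<phi> s)" by (simp only: test_deriv_integral_interval[OF t s(2)])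
    also have "\<dots> = - (g s * of_real (\<phi> s))" using M(1,2) s by (simp add: G_def ivl_def)
    finally show ?thesis .
  qed
  have pi: "integrable lborel (\<lambda>x. prim g x * d x)"
    unfolding d_def by (intro locL2_test_integrable continuous_locL2 prim_continuous g test_deriv t)
  have "(LINT y|lborel. prim g y * d y) = (LINT y|lborel. (prim g y - prim g (-M)) * d y)"
    using pi dint d0 by (simp add: left_diff_distrib)
  also have "\<dots> = (LINT s|lborel. - (g s * of_real (\<phi> s)))"
    using fub unfolding 1 2 .
  finally show ?thesis by (simp add: d_def)
qed

section \<open>Weak derivatives and completeness\<close>

lemma has_weak_deriv_alt:
  "has_weak_deriv f g \<longleftrightarrow> (\<forall>\<phi>. test_function \<phi> \<longrightarrow>
    L2_inner f (\<lambda>x. of_real (deriv \<phi> x)) = - L2_inner g (\<lambda>x. of_real (\<phi> x)))"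
  by (simp add: has_weak_deriv_def test_pairing)

lemma weak_deriv_unique:
  assumes "g \<in> Lp 2" "g' \<in> Lp 2" "has_weak_deriv f g" "has_weak_deriv f g'"
  shows "AE x in lborel. g x = g' x"
proof -
  have "AE x in lborel. g x - g' x = 0"
  proof (rule locL2_weak_zero)
    show "locL2 (\<lambda>x. g x - g' x)" by (intro Lp2_locL2 L2.diff_in assms)
    fix \<phi> assume t: "test_function \<phi>"
    have "L2_inner g (\<lambda>x. of_real (\<phi> x)) = L2_inner g' (\<lambda>x. of_real (\<phi> x))"
      using assms(3,4) t unfolding has_weak_deriv_alt by fastforce
    then show "(LINT x|lborel. (g x - g' x) * of_real (\<phi> x)) = 0"
      unfolding test_pairing using assms test_Lp2[OF t] by (simp add: L2.ip_diff)
  qed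
  then show ?thesis by simp
qed

lemma H1_D:
  assumes "f \<in> H1"
  shows H1_Lp2: "f \<in> Lp 2" and weak_deriv_Lp2: "weak_deriv f \<in> Lp 2"
    and has_weak_deriv: "has_weak_deriv f (weak_deriv f)"
proof -
  show "f \<in> Lp 2" using assms by (simp add: H1_def)
  have "\<exists>g. g \<in> Lp 2 \<and> has_weak_deriv f g" using assms by (auto simp: H1_def)
  from someI_ex[OF this] show "weak_deriv f \<in> Lp 2" "has_weak_deriv f (weak_deriv f)"
    by (auto simp: weak_deriv_def)
qed

lemma H1_I:
  assumes "f \<in> Lp 2" "g \<in> Lp 2" "has_weak_deriv f g"
  shows "f \<in> H1" "AE x in lborel. weak_deriv f x = g x"
proof -
  show f: "f \<in> H1" using assms by (auto simp: H1_def)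
  show "AE x in lborel. weak_deriv f x = g x"
    by (rule weak_deriv_unique[OF weak_deriv_Lp2 assms(2) has_weak_deriv assms(3)]) (rule f)+
qed

lemma H1_lin:
  assumes u: "u \<in> H1" and v: "v \<in> H1"
  shows "(\<lambda>x. a * u x + b * v x) \<in> H1"
    and "AE x in lborel. weak_deriv (\<lambda>x. a * u x + b * v x) x = a * weak_deriv u x + b * weak_deriv v x"
proof -
  have w: "has_weak_deriv (\<lambda>x. a * u x + b * v x) (\<lambda>x. a * weak_deriv u x + b * weak_deriv v x)"
    unfolding has_weak_deriv_alt
  proof (intro allI impI)
    fix \<phi> assume t: "test_function \<phi>"
    show "L2_inner (\<lambda>x. a * u x + b * v x) (\<lambda>x. of_real (deriv \<phi> x)) =
      - L2_inner (\<lambda>x. a * weak_deriv u x + b * weak_deriv v x) (\<lambda>x. of_real (\<phi> x))"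
      using has_weak_deriv[OF u] has_weak_deriv[OF v] t
      by (simp add: has_weak_deriv_alt L2.ip_lin H1_Lp2[OF u] H1_Lp2[OF v] weak_deriv_Lp2[OF u]
          weak_deriv_Lp2[OF v] test_Lp2[OF t] test_Lp2[OF test_deriv[OF t]])
  qed
  have "(\<lambda>x. a * u x + b * v x) \<in> Lp 2" "(\<lambda>x. a * weak_deriv u x + b * weak_deriv v x) \<in> Lp 2"
    by (rule Lp2_lin[OF H1_Lp2[OF u] H1_Lp2[OF v]], rule Lp2_lin[OF weak_deriv_Lp2[OF u] weak_deriv_Lp2[OF v]])
  from H1_I[OF this w] show "(\<lambda>x. a * u x + b * v x) \<in> H1"
    "AE x in lborel. weak_deriv (\<lambda>x. a * u x + b * v x) x = a * weak_deriv u x + b * weak_deriv v x" by auto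
qed

lemma zero_H1: "(\<lambda>x. 0) \<in> H1"
  by (rule H1_I(1)[OF zero_in_Lp2 zero_in_Lp2]) (simp add: has_weak_deriv_def)

definition ipH :: "cfun \<Rightarrow> cfun \<Rightarrow> complex" where
  "ipH u v = L2_inner u v + L2_inner (weak_deriv u) (weak_deriv v)"

lemma semi_hilbert_H1: "semi_hilbert H1 ipH"
proof
  show "H1 \<noteq> {}" using zero_H1 by blast
  show "(\<lambda>x. a * u x + b * v x) \<in> H1" if "u \<in> H1" "v \<in> H1" for a b u v
    using H1_lin(1)[OF that] .
  show "ipH (\<lambda>x. a * u x + b * v x) w = a * ipH u w + b * ipH v w"
    if uvw: "u \<in> H1" "v \<in> H1" "w \<in> H1" for a b u v w
  proof -
    have "L2_inner (weak_deriv (\<lambda>x. a * u x + b * v x)) (weak_deriv w)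
        = L2_inner (\<lambda>x. a * weak_deriv u x + b * weak_deriv v x) (weak_deriv w)"
      using uvw H1_lin[OF uvw(1,2)] by (intro L2_inner_cong_AE Lp2_lin weak_deriv_Lp2) auto
    then show ?thesis using uvw
      by (simp add: ipH_def L2.ip_lin H1_Lp2 weak_deriv_Lp2 algebra_simps)
  qed
  show "ipH v u = cnj (ipH u v)" if "u \<in> H1" "v \<in> H1" for u v
    using that by (simp add: ipH_def L2.ip_cnj[of u v] L2.ip_cnj[of "weak_deriv u" "weak_deriv v"] H1_Lp2 weak_deriv_Lp2)
  show "0 \<le> Re (ipH u u)" for u by (simp add: ipH_def L2_inner_self)
qed

lemma H1_nrm: "semi_hilbert.nrm ipH = H1_norm"
  by (rule ext) (simp add: semi_hilbert.nrm_def[OF semi_hilbert_H1] ipH_def H1_norm_def L2_inner_self Lp2_norm_eq)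

lemma H1_norm_nonneg: "0 \<le> H1_norm f"
  by (simp add: H1_norm_def)

lemma L2_norm_le_H1_norm: "Lp_norm 2 f \<le> H1_norm f"
  unfolding H1_norm_def by (rule real_le_rsqrt) simp

lemma weak_deriv_norm_le_H1_norm: "Lp_norm 2 (weak_deriv f) \<le> H1_norm f"
  unfolding H1_norm_def by (rule real_le_rsqrt) simp

lemma H1_cong_AE:
  assumes f: "f \<in> H1" and g: "g \<in> borel_measurable borel" and eq: "AE x in lborel. f x = g x"
  shows "g \<in> H1" "H1_norm g = H1_norm f"
proof -
  have gL: "g \<in> Lp 2" by (rule Lp2_cong_AE[OF H1_Lp2[OF f] g eq])
  have ge: "AE x in lborel. g x = f x" using eq by eventually_elim simp
  have "has_weak_deriv g (weak_deriv f)"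
    unfolding has_weak_deriv_alt
  proof (intro allI impI)
    fix \<phi> assume t: "test_function \<phi>"
    have "L2_inner g (\<lambda>x. of_real (deriv \<phi> x)) = L2_inner f (\<lambda>x. of_real (deriv \<phi> x))"
      by (rule L2_inner_cong_AE[OF gL H1_Lp2[OF f] test_Lp2 test_Lp2 ge AE_I2]) (simp_all add: test_deriv t)
    then show "L2_inner g (\<lambda>x. of_real (deriv \<phi> x)) = - L2_inner (weak_deriv f) (\<lambda>x. of_real (\<phi> x))"
      using has_weak_deriv[OF f] t by (simp add: has_weak_deriv_alt)
  qed
  from H1_I[OF gL weak_deriv_Lp2[OF f] this]
  have gH: "g \<in> H1" and wd: "AE x in lborel. weak_deriv g x = weak_deriv f x" by auto
  then show "g \<in> H1" by simp
  show "H1_norm g = H1_norm f"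
    using Lp2_norm_cong_AE[OF gL H1_Lp2[OF f] ge] Lp2_norm_cong_AE[OF weak_deriv_Lp2[OF gH] weak_deriv_Lp2[OF f] wd]
    by (simp add: H1_norm_def)
qed

text \<open>Completeness of \<open>L\<^sup>2\<close> is applied to the functions and to their weak
  derivatives. Testing against smooth functions shows that the second limit is the weak derivative
  of the first.\<close>

interpretation HH: hilbert H1 ipH
  rewrites "semi_hilbert.nrm ipH = H1_norm"
proof -
  interpret S: semi_hilbert H1 ipH
    rewrites "semi_hilbert.nrm ipH = H1_norm" by (rule semi_hilbert_H1) (rule H1_nrm)
  show "hilbert H1 ipH"
  proof (unfold_locales, unfold H1_nrm)
    fix f :: "nat \<Rightarrow> cfun" assume f: "\<And>n. f n \<in> H1"
      and cau: "\<And>e. e > 0 \<Longrightarrow> \<exists>M. \<forall>m\<ge>M. \<forall>n\<ge>M. H1_norm (\<lambda>x. f m x - f n x) < e"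
    have wd: "Lp_norm 2 (weak_deriv (\<lambda>x. f m x - f n x)) = Lp_norm 2 (\<lambda>x. weak_deriv (f m) x - weak_deriv (f n) x)" for m n
    proof (rule Lp2_norm_cong_AE)
      show "AE x in lborel. weak_deriv (\<lambda>x. f m x - f n x) x = weak_deriv (f m) x - weak_deriv (f n) x"
        using H1_lin(2)[OF f f, of 1 m "-1" n] by simp
    qed (use f S.diff_in in \<open>auto intro: weak_deriv_Lp2 L2.diff_in\<close>)
    have "\<exists>l\<in>Lp 2. (\<lambda>n. Lp_norm 2 (\<lambda>x. f n x - l x)) \<longlonglongrightarrow> 0"
    proof (rule L2_complete)
      show "f n \<in> Lp 2" for n by (rule H1_Lp2[OF f])
      show "\<exists>M. \<forall>m\<ge>M. \<forall>n\<ge>M. Lp_norm 2 (\<lambda>x. f m x - f n x) < e" if "e > 0" for e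
        using cau[OF that] L2_norm_le_H1_norm le_less_trans by metis
    qed
    then obtain l where l: "l \<in> Lp 2" "(\<lambda>n. Lp_norm 2 (\<lambda>x. f n x - l x)) \<longlonglongrightarrow> 0" by blast
    have "\<exists>l\<in>Lp 2. (\<lambda>n. Lp_norm 2 (\<lambda>x. weak_deriv (f n) x - l x)) \<longlonglongrightarrow> 0"
    proof (rule L2_complete)
      show "weak_deriv (f n) \<in> Lp 2" for n by (rule weak_deriv_Lp2[OF f])
      show "\<exists>M. \<forall>m\<ge>M. \<forall>n\<ge>M. Lp_norm 2 (\<lambda>x. weak_deriv (f m) x - weak_deriv (f n) x) < e" if "e > 0" for e
        using cau[OF that] weak_deriv_norm_le_H1_norm le_less_trans unfolding wd[symmetric] by metis
    qed
    then obtain l' where l': "l' \<in> Lp 2" "(\<lambda>n. Lp_norm 2 (\<lambda>x. weak_deriv (f n) x - l' x)) \<longlonglongrightarrow> 0" by blast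
    have lim: "(\<lambda>n. L2_inner (u n) w) \<longlonglongrightarrow> L2_inner m w"
      if "\<And>n. u n \<in> Lp 2" "m \<in> Lp 2" "w \<in> Lp 2" "(\<lambda>n. Lp_norm 2 (\<lambda>x. u n x - m x)) \<longlonglongrightarrow> 0" for u m w
    proof -
      have "(\<lambda>n. L2_inner (u n) w - L2_inner m w) \<longlonglongrightarrow> 0"
      proof (rule Lim_null_comparison)
        show "\<forall>\<^sub>F n in sequentially. norm (L2_inner (u n) w - L2_inner m w) \<le> Lp_norm 2 (\<lambda>x. u n x - m x) * Lp_norm 2 w"
          using L2.cauchy_schwarz[OF L2.diff_in[OF that(1,2)] that(3)] by (simp add: L2.ip_diff that)
        show "(\<lambda>n. Lp_norm 2 (\<lambda>x. u n x - m x) * Lp_norm 2 w) \<longlonglongrightarrow> 0"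
          using tendsto_mult_left_zero[OF that(4)] .
      qed
      then show ?thesis by (simp add: LIM_zero_iff)
    qed
    have w: "has_weak_deriv l l'"
      unfolding has_weak_deriv_alt
    proof (intro allI impI)
      fix \<phi> assume t: "test_function \<phi>"
      have "(\<lambda>n. L2_inner (f n) (\<lambda>x. of_real (deriv \<phi> x))) \<longlonglongrightarrow> L2_inner l (\<lambda>x. of_real (deriv \<phi> x))"
        by (rule lim[OF H1_Lp2[OF f] l(1) test_Lp2[OF test_deriv[OF t]] l(2)])
      moreover have "L2_inner (f n) (\<lambda>x. of_real (deriv \<phi> x)) = - L2_inner (weak_deriv (f n)) (\<lambda>x. of_real (\<phi> x))" for n
        using has_weak_deriv[OF f] t by (simp add: has_weak_deriv_alt)
      moreover have "(\<lambda>n. - L2_inner (weak_deriv (f n)) (\<lambda>x. of_real (\<phi> x))) \<longlonglongrightarrow> - L2_inner l' (\<lambda>x. of_real (\<phi> x))"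
        by (rule tendsto_minus[OF lim[OF weak_deriv_Lp2[OF f] l'(1) test_Lp2[OF t] l'(2)]])
      ultimately show "L2_inner l (\<lambda>x. of_real (deriv \<phi> x)) = - L2_inner l' (\<lambda>x. of_real (\<phi> x))"
        using LIMSEQ_unique by simp
    qed
    have lH: "l \<in> H1" and wl: "AE x in lborel. weak_deriv l x = l' x" using H1_I[OF l(1) l'(1) w] by auto
    have wdl: "Lp_norm 2 (weak_deriv (\<lambda>x. f n x - l x)) = Lp_norm 2 (\<lambda>x. weak_deriv (f n) x - l' x)" for n
    proof (rule Lp2_norm_cong_AE)
      have "AE x in lborel. weak_deriv (\<lambda>x. f n x - l x) x = weak_deriv (f n) x - weak_deriv l x"
        using H1_lin(2)[OF f lH, of 1 n "-1"] by simp
      with wl show "AE x in lborel. weak_deriv (\<lambda>x. f n x - l x) x = weak_deriv (f n) x - l' x"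
        by eventually_elim simp
    qed (use f lH l' S.diff_in in \<open>auto intro: weak_deriv_Lp2 L2.diff_in\<close>)
    have "(\<lambda>n. sqrt ((Lp_norm 2 (\<lambda>x. f n x - l x))\<^sup>2 + (Lp_norm 2 (\<lambda>x. weak_deriv (f n) x - l' x))\<^sup>2)) \<longlonglongrightarrow> sqrt (0\<^sup>2 + 0\<^sup>2)"
      by (intro tendsto_intros l l')
    then have "(\<lambda>n. H1_norm (\<lambda>x. f n x - l x)) \<longlonglongrightarrow> 0" by (simp add: H1_norm_def wdl)
    with lH show "\<exists>l\<in>H1. (\<lambda>n. H1_norm (\<lambda>x. f n x - l x)) \<longlonglongrightarrow> 0" by blast
  qed
  show "semi_hilbert.nrm ipH = H1_norm" by (rule H1_nrm)
qed

section \<open>The continuous representative\<close>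

text \<open>Evaluation of the continuous representative at a point is a bounded functional on
  \<open>H1\<close>, so weak convergence implies convergence of \<open>ev\<close> at every
  point.\<close>

definition ev :: "cfun \<Rightarrow> cfun" where
  "ev f = (SOME F. continuous_on UNIV F \<and> (AE x in lborel. f x = F x))"

lemma continuous_AE_eq:
  fixes F G :: cfun
  assumes "continuous_on UNIV F" "continuous_on UNIV G" "AE x in lborel. F x = G x"
  shows "F = G"
proof (rule ccontr)
  assume "F \<noteq> G"
  define S where "S = {x. F x \<noteq> G x}"
  have S: "open S" "S \<noteq> {}"
    using assms \<open>F \<noteq> G\<close> by (auto simp: S_def intro: open_Collect_neq)
  obtain N where N: "N \<in> null_sets lborel" "S \<subseteq> N"
    using assms(3) by (auto simp: eventually_ae_filter S_def)
  then have "negligible N" by (simp add: negligible_iff_null_sets null_sets_completionI)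
  then show False using open_not_negligible[OF S] negligible_subset[OF _ N(2)] by blast
qed

text \<open>The lemma of du Bois-Reymond applies to the difference of \<open>f\<close> and the
  primitive of its weak derivative.\<close>

lemma H1_rep:
  assumes f: "f \<in> H1"
  shows "\<exists>c. AE x in lborel. f x = prim (weak_deriv f) x + c"
proof -
  let ?F = "prim (weak_deriv f)"
  have F: "locL2 ?F" by (intro continuous_locL2 prim_continuous weak_deriv_Lp2 f)
  have fl: "locL2 f" by (rule Lp2_locL2[OF H1_Lp2[OF f]])
  have "\<exists>c. AE x in lborel. 1 * f x + (-1) * ?F x = c"
  proof (rule du_Bois_Reymond)
    show "locL2 (\<lambda>x. 1 * f x + (-1) * ?F x)" by (rule locL2_lin[OF fl F])
    fix \<phi> assume t: "test_function \<phi>"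
    note td = test_deriv[OF t]
    have "(LINT x|lborel. (1 * f x + (-1) * ?F x) * of_real (deriv \<phi> x)) =
      (LINT x|lborel. f x * of_real (deriv \<phi> x)) - (LINT x|lborel. ?F x * of_real (deriv \<phi> x))"
      using locL2_test_integrable[OF fl td] locL2_test_integrable[OF F td] by (simp add: left_diff_distrib)
    also have "\<dots> = 0"
      using has_weak_deriv[OF f] t prim_weak_deriv[OF weak_deriv_Lp2[OF f] t] by (simp add: has_weak_deriv_def)
    finally show "(LINT x|lborel. (1 * f x + (-1) * ?F x) * of_real (deriv \<phi> x)) = 0" .
  qed
  then obtain c where "AE x in lborel. f x - ?F x = c" by auto
  then have "AE x in lborel. f x = ?F x + c" by eventually_elim (simp add: algebra_simps)
  then show ?thesis by blast
qed

lemma ev_continuous_AE: assumes "f \<in> H1" shows ev_cont: "continuous_on UNIV (ev f)" and ev_AE: "AE x in lborel. f x = ev f x"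
proof -
  obtain c where "AE x in lborel. f x = prim (weak_deriv f) x + c" using H1_rep[OF assms] by blast
  moreover have "continuous_on UNIV (\<lambda>x. prim (weak_deriv f) x + c)"
    by (intro continuous_intros prim_continuous weak_deriv_Lp2 assms)
  ultimately have "\<exists>F. continuous_on UNIV F \<and> (AE x in lborel. f x = F x)" by blast
  from someI_ex[OF this] show "continuous_on UNIV (ev f)" "AE x in lborel. f x = ev f x"
    by (auto simp: ev_def)
qed

lemma ev_eqI:
  assumes "f \<in> H1" "continuous_on UNIV F" "AE x in lborel. f x = F x" shows "ev f = F"
proof (rule continuous_AE_eq[OF ev_cont[OF assms(1)] assms(2)])
  show "AE x in lborel. ev f x = F x" using ev_AE[OF assms(1)] assms(3) by eventually_elim simp
qed

lemma ev_holder: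
  assumes "f \<in> H1" shows "cmod (ev f b - ev f a) \<le> Lp_norm 2 (weak_deriv f) * sqrt \<bar>b - a\<bar>"
proof -
  obtain c where "AE x in lborel. f x = prim (weak_deriv f) x + c" using H1_rep[OF assms] by blast
  moreover have "continuous_on UNIV (\<lambda>x. prim (weak_deriv f) x + c)"
    by (intro continuous_intros prim_continuous weak_deriv_Lp2 assms)
  ultimately have "ev f = (\<lambda>x. prim (weak_deriv f) x + c)" by (intro ev_eqI assms)
  then show ?thesis using prim_holder[OF weak_deriv_Lp2[OF assms]] by simp
qed

lemma ev_lin:
  assumes "u \<in> H1" "v \<in> H1"
  shows "ev (\<lambda>x. a * u x + b * v x) = (\<lambda>x. a * ev u x + b * ev v x)"
proof (rule ev_eqI[OF H1_lin(1)[OF assms]])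
  show "continuous_on UNIV (\<lambda>x. a * ev u x + b * ev v x)"
    by (intro continuous_intros ev_cont assms)
  show "AE x in lborel. a * u x + b * v x = a * ev u x + b * ev v x"
    using ev_AE[OF assms(1)] ev_AE[OF assms(2)] by eventually_elim simp
qed

text \<open>The value at \<open>x\<close> is compared with the mean over an interval of length
  \<open>h\<close> starting at \<open>x\<close>: the mean is at most
  \<open>Lp_norm 2 f / sqrt h\<close> and the oscillation at most \<open>H1_norm f * sqrt h\<close>.
  The choice \<open>h = Lp_norm 2 f / H1_norm f\<close> balances the two.\<close>

lemma ev_bound:
  assumes f: "f \<in> H1" shows "cmod (ev f x) \<le> 2 * sqrt (Lp_norm 2 f * H1_norm f)"
proof (cases "Lp_norm 2 f = 0")
  case True
  then have "AE x in lborel. f x = 0" using Lp2_norm_zero_iff[OF H1_Lp2[OF f]] by simp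
  then have "ev f = (\<lambda>x. 0)" by (intro ev_eqI f) auto
  then show ?thesis by (simp add: Lp2_norm_nonneg H1_norm_nonneg)
next
  case False
  then have n: "Lp_norm 2 f > 0" using Lp2_norm_nonneg[of f] by simp
  then have m: "H1_norm f > 0" using L2_norm_le_H1_norm[of f] by linarith
  define h where "h = Lp_norm 2 f / H1_norm f"
  have h: "h > 0" using n m by (simp add: h_def)
  define c where "c = ev f x"
  let ?N = "Lp_norm 2 (weak_deriv f)"
  have i1: "integrable lborel (\<lambda>y. f y * cnj (ivl x (x+h) y))" by (rule Lp2_mult_integrable[OF H1_Lp2[OF f] ivl_Lp2])
  have i3: "integrable lborel (indicator {x..x+h} :: real \<Rightarrow> real)"
    by (rule integrable_real_indicator) (auto simp: emeasure_lborel_Icc_eq)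
  have i2: "integrable lborel (\<lambda>y. c * cnj (ivl x (x+h) y))"
  proof -
    have e: "ivl x (x+h) = (\<lambda>y. of_real (indicator {x..x+h} y))" by (auto simp: ivl_def indicator_def)
    show ?thesis unfolding cnj_ivl unfolding e by (intro integrable_mult_right integrable_of_real i3)
  qed
  have h2: "(LINT y|lborel. indicator {x..x+h} y :: real) = h" using h by simp
  have "(LINT y|lborel. ivl x (x+h) y) = of_real (LINT y|lborel. indicator {x..x+h} y :: real)"
    unfolding integral_complex_of_real[symmetric]
    by (intro Bochner_Integration.integral_cong) (auto simp: ivl_def indicator_def)
  then have h3: "(LINT y|lborel. ivl x (x+h) y) = of_real h" using h2 by simp
  have "c * of_real h = L2_inner f (ivl x (x+h)) - (LINT y|lborel. (f y - c) * cnj (ivl x (x+h) y))"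
    using i1 i2 by (simp add: L2_inner_def left_diff_distrib cnj_ivl h3)
  then have "cmod (c * of_real h) \<le> cmod (L2_inner f (ivl x (x+h))) + cmod (LINT y|lborel. (f y - c) * cnj (ivl x (x+h) y))"
    by (metis norm_triangle_ineq4)
  also have "cmod (L2_inner f (ivl x (x+h))) \<le> Lp_norm 2 f * sqrt h"
    using ivl_bound[OF H1_Lp2[OF f], of x "x + h"] h by simp
  also have "cmod (LINT y|lborel. (f y - c) * cnj (ivl x (x+h) y)) \<le> (LINT y|lborel. cmod ((f y - c) * cnj (ivl x (x+h) y)))"
    by (rule integral_norm_bound)
  also have "\<dots> \<le> (LINT y|lborel. (?N * sqrt h) * indicator {x..x+h} y)"
  proof (rule integral_mono_AE)
    show "integrable lborel (\<lambda>y. cmod ((f y - c) * cnj (ivl x (x+h) y)))"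
      using Bochner_Integration.integrable_diff[OF i1 i2] by (intro integrable_norm) (simp add: left_diff_distrib)
    show "integrable lborel (\<lambda>y. (?N * sqrt h) * indicator {x..x+h} y)"
      by (rule integrable_mult_right[OF i3])
    show "AE y in lborel. cmod ((f y - c) * cnj (ivl x (x+h) y)) \<le> (?N * sqrt h) * indicator {x..x+h} y"
      using ev_AE[OF f]
    proof eventually_elim
      case (elim y)
      show ?case
      proof (cases "y \<in> {x..x+h}")
        case True
        have "cmod (f y - c) \<le> ?N * sqrt \<bar>y - x\<bar>" unfolding elim c_def by (rule ev_holder[OF f])
        also have "\<dots> \<le> ?N * sqrt h" using True Lp2_norm_nonneg by (intro mult_left_mono) auto
        finally show ?thesis using True by (simp add: ivl_def)
      next
        case False then show ?thesis by (simp add: ivl_def)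
      qed
    qed
  qed
  also have "\<dots> = ?N * sqrt h * h" using h2 by simp
  also have "?N * sqrt h * h \<le> H1_norm f * sqrt h * h"
    using weak_deriv_norm_le_H1_norm h by (intro mult_right_mono) auto
  finally have "cmod c * h \<le> Lp_norm 2 f * sqrt h + H1_norm f * sqrt h * h"
    using h by (simp add: norm_mult)
  also have "H1_norm f * sqrt h * h = Lp_norm 2 f * sqrt h" using m by (simp add: h_def)
  also have "Lp_norm 2 f * sqrt h + Lp_norm 2 f * sqrt h = 2 * (Lp_norm 2 f * sqrt h)" by simp
  also have "\<dots> = 2 * (Lp_norm 2 f / sqrt h) * h"
    using h by (simp add: field_simps flip: real_sqrt_mult)
  finally have "cmod c * h \<le> 2 * (Lp_norm 2 f / sqrt h) * h" .
  then have "cmod c \<le> 2 * (Lp_norm 2 f / sqrt h)" by (rule mult_right_le_imp_le[OF _ h])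
  also have "Lp_norm 2 f / sqrt h = sqrt (Lp_norm 2 f * H1_norm f)"
  proof -
    have "Lp_norm 2 f = sqrt (Lp_norm 2 f * H1_norm f) * sqrt h"
      unfolding real_sqrt_mult[symmetric] using n m by (simp add: h_def)
    then show ?thesis using h by (simp add: field_simps)
  qed
  finally show ?thesis by (simp add: c_def)
qed

lemma ev_le_H1_norm: assumes f: "f \<in> H1" shows "cmod (ev f x) \<le> 2 * H1_norm f"
proof -
  have "sqrt (Lp_norm 2 f * H1_norm f) \<le> sqrt (H1_norm f * H1_norm f)"
    using L2_norm_le_H1_norm H1_norm_nonneg by (intro real_sqrt_le_mono mult_right_mono) auto
  then show ?thesis using ev_bound[OF f, of x] H1_norm_nonneg[of f] by simp
qed

lemma test_shift: "test_function \<phi> \<Longrightarrow> test_function (\<lambda>x. \<phi> (x + c))"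
proof -
  assume t: "test_function \<phi>"
  then obtain M where M: "\<And>x. \<bar>x\<bar> \<ge> M \<Longrightarrow> \<phi> x = 0" using test_support by metis
  have "{x. \<phi> (x + c) \<noteq> 0} \<subseteq> {-(\<bar>M\<bar> + \<bar>c\<bar>)..\<bar>M\<bar> + \<bar>c\<bar>}"
  proof
    fix x assume "x \<in> {x. \<phi> (x + c) \<noteq> 0}"
    then have "\<not> \<bar>x + c\<bar> \<ge> M" using M by auto
    then show "x \<in> {-(\<bar>M\<bar> + \<bar>c\<bar>)..\<bar>M\<bar> + \<bar>c\<bar>}" by auto
  qed
  then have "bounded {x. \<phi> (x + c) \<noteq> 0}" using bounded_subset bounded_closed_interval by blast
  with t smooth_shift show ?thesis by (auto simp: test_function_iff)
qed

lemma H1_translate: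
  assumes f: "f \<in> H1" shows "translate z f \<in> H1" "H1_norm (translate z f) = H1_norm f"
    "ev (translate z f) = (\<lambda>x. ev f (x + z))"
proof -
  have "has_weak_deriv (translate z f) (translate z (weak_deriv f))"
    unfolding has_weak_deriv_alt
  proof (intro allI impI)
    fix \<phi> assume t: "test_function \<phi>"
    let ?p = "\<lambda>x. \<phi> (x + - z)"
    have "L2_inner (translate z f) (\<lambda>x. of_real (deriv \<phi> x)) = L2_inner (translate z f) (translate z (\<lambda>x. of_real (deriv ?p x)))"
      using t by (subst smooth_shift(2)) (auto simp: test_function_iff translate_def)
    also have "\<dots> = - L2_inner (weak_deriv f) (\<lambda>x. of_real (?p x))"
      unfolding translate_L2_inner
      by (rule has_weak_deriv[OF f, unfolded has_weak_deriv_alt, rule_format, OF test_shift[OF t, of "-z"]])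
    also have "L2_inner (weak_deriv f) (\<lambda>x. of_real (?p x)) = L2_inner (translate z (weak_deriv f)) (translate z (\<lambda>x. of_real (?p x)))"
      by (rule translate_L2_inner[symmetric])
    finally show "L2_inner (translate z f) (\<lambda>x. of_real (deriv \<phi> x)) = - L2_inner (translate z (weak_deriv f)) (\<lambda>x. of_real (\<phi> x))"
      by (simp add: translate_def)
  qed
  from H1_I[OF translate_Lp2[OF H1_Lp2[OF f]] translate_Lp2[OF weak_deriv_Lp2[OF f]] this]
  have tH: "translate z f \<in> H1" and w: "AE x in lborel. weak_deriv (translate z f) x = translate z (weak_deriv f) x" by auto
  then show "translate z f \<in> H1" by simp
  show "H1_norm (translate z f) = H1_norm f"
    using Lp2_norm_cong_AE[OF weak_deriv_Lp2[OF tH] translate_Lp2[OF weak_deriv_Lp2[OF f]] w]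
    by (simp add: H1_norm_def translate_L2_norm)
  show "ev (translate z f) = (\<lambda>x. ev f (x + z))"
  proof (rule ev_eqI[OF tH])
    show "continuous_on UNIV (\<lambda>x. ev f (x + z))"
      by (rule continuous_on_compose2[OF ev_cont[OF f]]) (auto intro!: continuous_intros)
    show "AE x in lborel. translate z f x = ev f (x + z)"
      using AE_translate[OF ev_AE[OF f], of z] by (simp add: translate_def)
  qed
qed

subsection \<open>The space \<open>H\<^sup>-\<^sup>1\<close> and the form of the operator\<close>

lemma Hm1_lin: "l \<in> Hm1 \<Longrightarrow> u \<in> H1 \<Longrightarrow> v \<in> H1 \<Longrightarrow>
    l (\<lambda>x. a * u x + b * v x) = cnj a * l u + cnj b * l v"
  by (simp add: Hm1_def)

lemma Hm1_ex: "l \<in> Hm1 \<Longrightarrow> \<exists>C. \<forall>v\<in>H1. cmod (l v) \<le> C * H1_norm v"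
  by (simp add: Hm1_def)

lemma Hm1_diff: "l \<in> Hm1 \<Longrightarrow> u \<in> H1 \<Longrightarrow> v \<in> H1 \<Longrightarrow> l (\<lambda>x. u x - v x) = l u - l v"
  using Hm1_lin[of l u v 1 "-1"] by simp

lemma Hm1_I:
  assumes "\<And>a b u v. u \<in> H1 \<Longrightarrow> v \<in> H1 \<Longrightarrow> l (\<lambda>x. a * u x + b * v x) = cnj a * l u + cnj b * l v"
    "\<And>v. v \<in> H1 \<Longrightarrow> cmod (l v) \<le> C * H1_norm v"
  shows "l \<in> Hm1"
  unfolding Hm1_def using assms(1) assms(2) by (intro CollectI conjI allI ballI exI[of _ C])

lemma H1_norm_zero: "H1_norm (\<lambda>x. 0) = 0"
  using HH.nrm_scale[OF zero_H1, of 0] by simp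

lemma Hm1_bdd: assumes "l \<in> Hm1" shows "bdd_above ((\<lambda>v. cmod (l v)) ` {v \<in> H1. H1_norm v \<le> 1})"
proof -
  obtain C where C: "\<And>v. v \<in> H1 \<Longrightarrow> cmod (l v) \<le> C * H1_norm v" using Hm1_ex[OF assms] by blast
  have "cmod (l v) \<le> \<bar>C\<bar>" if "v \<in> H1" "H1_norm v \<le> 1" for v
  proof -
    have "cmod (l v) \<le> \<bar>C\<bar> * H1_norm v"
      using C[OF that(1)] H1_norm_nonneg[of v] by (meson abs_ge_self mult_right_mono order_trans)
    also have "\<dots> \<le> \<bar>C\<bar> * 1" using that by (intro mult_left_mono) auto
    finally show ?thesis by simp
  qed
  then show ?thesis by (intro bdd_aboveI2[where M = "\<bar>C\<bar>"]) auto
qed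

lemma Hm1_bound: assumes l: "l \<in> Hm1" and v: "v \<in> H1" shows "cmod (l v) \<le> Hm1_norm l * H1_norm v"
proof (cases "H1_norm v = 0")
  case True
  \<comment> \<open>A vector of norm zero cannot be normalised to the unit sphere; the bound
    contained in the definition of \<open>Hm1\<close> settles this case.\<close>
  obtain C where "\<And>v. v \<in> H1 \<Longrightarrow> cmod (l v) \<le> C * H1_norm v" using Hm1_ex[OF l] by blast
  from this[OF v] show ?thesis using True by simp
next
  case False
  then have p: "H1_norm v > 0" using H1_norm_nonneg[of v] by simp
  define c where "c = complex_of_real (1 / H1_norm v)"
  have w: "(\<lambda>x. c * v x) \<in> H1" using HH.lin[OF v v, of c 0] by simp
  have "H1_norm (\<lambda>x. c * v x) = 1" using p HH.nrm_scale[OF v, of c] by (simp add: c_def norm_divide)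
  then have "cmod (l (\<lambda>x. c * v x)) \<le> Hm1_norm l"
    unfolding Hm1_norm_def by (intro cSUP_upper Hm1_bdd l) (use w in auto)
  moreover have e: "l (\<lambda>x. c * v x) = cnj c * l v" using Hm1_lin[OF l v v, of c 0] by simp
  have "cmod (l (\<lambda>x. c * v x)) = cmod (l v) / H1_norm v"
    unfolding e using p by (simp add: c_def norm_mult norm_divide)
  ultimately show ?thesis using p by (simp add: field_simps)
qed

lemma Hm1_norm_le:
  assumes "C \<ge> 0" "\<And>v. v \<in> H1 \<Longrightarrow> cmod (l v) \<le> C * H1_norm v" shows "Hm1_norm l \<le> C"
  unfolding Hm1_norm_def
proof (rule cSUP_least)
  have "(\<lambda>x. 0) \<in> {v \<in> H1. H1_norm v \<le> 1}" using zero_H1 by (simp add: H1_norm_zero)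
  then show "{v \<in> H1. H1_norm v \<le> 1} \<noteq> {}" by blast
  fix v assume "v \<in> {v \<in> H1. H1_norm v \<le> 1}"
  then have "cmod (l v) \<le> C * H1_norm v" "C * H1_norm v \<le> C * 1"
    using assms(2)[of v] mult_left_mono[of "H1_norm v" 1 C] assms(1) by auto
  then show "cmod (l v) \<le> C" by simp
qed

lemma Hm1_norm_nonneg: assumes "l \<in> Hm1" shows "0 \<le> Hm1_norm l"
proof -
  have "cmod (l (\<lambda>x. 0)) \<le> Hm1_norm l"
    unfolding Hm1_norm_def by (intro cSUP_upper Hm1_bdd assms) (simp add: zero_H1 H1_norm_zero)
  then show ?thesis using norm_ge_zero order_trans by blast
qed

lemma Hm1_diff_in: assumes f: "f \<in> Hm1" and g: "g \<in> Hm1" shows "(\<lambda>z. f z - g z) \<in> Hm1"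
proof (rule Hm1_I)
  show "f (\<lambda>x. a * u x + b * v x) - g (\<lambda>x. a * u x + b * v x) = cnj a * (f u - g u) + cnj b * (f v - g v)"
    if "u \<in> H1" "v \<in> H1" for a b u v
    using that f g by (simp add: Hm1_lin algebra_simps)
  show "cmod (f v - g v) \<le> (Hm1_norm f + Hm1_norm g) * H1_norm v" if "v \<in> H1" for v
    using norm_triangle_ineq4[of "f v" "g v"] Hm1_bound[OF f that] Hm1_bound[OF g that]
    by (simp add: distrib_right)
qed

lemma Hm1_triangle:
  assumes "f \<in> Hm1" "g \<in> Hm1" "h \<in> Hm1"
  shows "Hm1_norm (\<lambda>z. f z - h z) \<le> Hm1_norm (\<lambda>z. f z - g z) + Hm1_norm (\<lambda>z. g z - h z)"
proof (rule Hm1_norm_le)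
  note d = Hm1_diff_in[OF assms(1,2)] Hm1_diff_in[OF assms(2,3)]
  show "0 \<le> Hm1_norm (\<lambda>z. f z - g z) + Hm1_norm (\<lambda>z. g z - h z)" using d by (simp add: Hm1_norm_nonneg)
  fix v assume v: "v \<in> H1"
  have "cmod (f v - h v) \<le> cmod (f v - g v) + cmod (g v - h v)"
    using norm_triangle_ineq[of "f v - g v" "g v - h v"] by simp
  also have "\<dots> \<le> (Hm1_norm (\<lambda>z. f z - g z) + Hm1_norm (\<lambda>z. g z - h z)) * H1_norm v"
    using Hm1_bound[OF d(1) v] Hm1_bound[OF d(2) v] by (simp add: distrib_right)
  finally show "cmod (f v - h v) \<le> (Hm1_norm (\<lambda>z. f z - g z) + Hm1_norm (\<lambda>z. g z - h z)) * H1_norm v" .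
qed

lemma Hm1_norm_sym: "Hm1_norm (\<lambda>z. f z - g z) = Hm1_norm (\<lambda>z. g z - f z)"
  unfolding Hm1_norm_def by (simp add: norm_minus_commute)

lemma H1_norm_AE_zero: assumes "f \<in> H1" "AE x in lborel. f x = 0" shows "H1_norm f = 0"
proof -
  have "H1_norm (\<lambda>x. 0 :: complex) = H1_norm f" by (rule H1_cong_AE(2)) (use assms in auto)
  then show ?thesis by (simp add: H1_norm_zero)
qed

lemma H1_norm_diff_AE: assumes "f \<in> H1" "g \<in> H1" "AE x in lborel. f x = g x" shows "H1_norm (\<lambda>x. f x - g x) = 0"
  using assms(3) by (intro H1_norm_AE_zero HH.diff_in assms(1,2)) auto

lemma Hm1_cong_AE:
  assumes "l \<in> Hm1" "f \<in> H1" "g \<in> H1" "AE x in lborel. f x = g x" shows "l f = l g"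
  using Hm1_bound[OF assms(1) HH.diff_in[OF assms(2,3)]] H1_norm_diff_AE[OF assms(2-4)]
  by (simp add: Hm1_diff assms)

lemma L2_inner_Hm1: assumes g: "g \<in> Lp 2" shows "(\<lambda>v. L2_inner g v) \<in> Hm1"
proof (rule Hm1_I)
  show "L2_inner g (\<lambda>x. a * u x + b * v x) = cnj a * L2_inner g u + cnj b * L2_inner g v"
    if "u \<in> H1" "v \<in> H1" for a b u v
    by (rule L2.ip_lin2[OF H1_Lp2[OF that(1)] H1_Lp2[OF that(2)] g])
  show "cmod (L2_inner g v) \<le> Lp_norm 2 g * H1_norm v" if "v \<in> H1" for v
    using L2.cauchy_schwarz[OF g H1_Lp2[OF that]] L2_norm_le_H1_norm[of v] Lp2_norm_nonneg[of g]
    by (meson mult_left_mono order_trans)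
qed

lemma ev_Hm1: "(\<lambda>v. cnj (ev v x)) \<in> Hm1"
proof (rule Hm1_I)
  show "cnj (ev (\<lambda>x. a * u x + b * v x) x) = cnj a * cnj (ev u x) + cnj b * cnj (ev v x)"
    if "u \<in> H1" "v \<in> H1" for a b u v
    by (simp add: ev_lin[OF that])
  show "cmod (cnj (ev v x)) \<le> 2 * H1_norm v" if "v \<in> H1" for v
    using ev_le_H1_norm[OF that] by simp
qed

section \<open>The energy form and its domain\<close>

text \<open>The constants of A1 and A2 are fixed as parameters, so that the final constant is an
  expression in them. A5 stays outside because it involves the exponent \<open>r\<close>, which must
  not influence that constant.\<close>

locale operator_setting =
  fixes D :: "cfun set" and A :: "cfun \<Rightarrow> cfun" and B :: "cfun \<Rightarrow> cfun \<Rightarrow> complex"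
    and U :: "real \<Rightarrow> cfun \<Rightarrow> cfun" and C2 c0 m M CB :: real
  assumes sa: "selfadjoint D A"
    and Apos: "\<And>v. v \<in> D \<Longrightarrow> 0 \<le> Re (L2_inner (A v) v)"
    and H1ext: "H1_extension D A B"
    and const_signs: "c0 > 0" "m > 0" "M > 0" "C2 \<ge> 1" "CB \<ge> 0"
    and coercive: "\<And>z v. v \<in> H1 \<Longrightarrow>
       m * (H1_norm v)\<^sup>2 \<le> Re (conj_translate_form z B v v) + c0 * (Lp_norm 2 v)\<^sup>2"
      "\<And>z v. v \<in> H1 \<Longrightarrow>
       Re (conj_translate_form z B v v) + c0 * (Lp_norm 2 v)\<^sup>2 \<le> M * (H1_norm v)\<^sup>2"
    and B_bound: "\<And>u v. u \<in> H1 \<Longrightarrow> v \<in> H1 \<Longrightarrow> cmod (B u v) \<le> CB * H1_norm u * H1_norm v"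
    and grp: "schroedinger_group D A U"
    and U_H1: "\<And>t f. f \<in> H1 \<Longrightarrow> U t f \<in> H1"
    and U_H1_norm: "\<And>t f. f \<in> H1 \<Longrightarrow> H1_norm (U t f) \<le> C2 * H1_norm f"
    and A3: "assumption_A3 B" and A4: "assumption_A4 U" and A6: "assumption_A6 U"
begin

lemma D_H1: "u \<in> D \<Longrightarrow> u \<in> H1" and B_Hm1: "u \<in> H1 \<Longrightarrow> B u \<in> Hm1"
  and B_lin: "u \<in> H1 \<Longrightarrow> v \<in> H1 \<Longrightarrow> w \<in> H1 \<Longrightarrow> B (\<lambda>x. a * u x + b * v x) w = a * B u w + b * B v w"
  and B_D: "u \<in> D \<Longrightarrow> v \<in> H1 \<Longrightarrow> B u v = L2_inner (A u) v"
  using H1ext unfolding H1_extension_def by blast+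

lemma A_Lp2: "u \<in> D \<Longrightarrow> A u \<in> Lp 2"
  and D_lin: "u \<in> D \<Longrightarrow> v \<in> D \<Longrightarrow> (\<lambda>x. a * u x + b * v x) \<in> D"
  using sa unfolding selfadjoint_def L2_linear_on_def by blast+

lemma A_sym: assumes "u \<in> D" "v \<in> D" shows "L2_inner (A u) v = L2_inner u (A v)"
proof -
  have "adjoint_graph D A v (A v)" using sa assms A_Lp2 unfolding selfadjoint_def by auto
  then show ?thesis using assms by (simp add: adjoint_graph_def)
qed

lemma adjoint_D:
  assumes "v \<in> Lp 2" "w \<in> Lp 2" "\<And>u. u \<in> D \<Longrightarrow> L2_inner (A u) v = L2_inner u w"
  shows "v \<in> D" "AE x in lborel. w x = A v x"
proof -
  have "adjoint_graph D A v w" using assms by (simp add: adjoint_graph_def)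
  then show "v \<in> D" "AE x in lborel. w x = A v x" using sa unfolding selfadjoint_def by auto
qed

lemma B_sym_D: assumes "u \<in> D" "v \<in> D" shows "B u v = cnj (B v u)"
proof -
  have "B u v = L2_inner u (A v)" using A_sym[OF assms] B_D[OF assms(1) D_H1[OF assms(2)]] by simp
  also have "\<dots> = cnj (L2_inner (A v) u)" using assms by (intro L2.ip_cnj A_Lp2 H1_Lp2 D_H1)
  finally show ?thesis using B_D[OF assms(2) D_H1[OF assms(1)]] by simp
qed

lemma B_tendsto1:
  assumes "\<And>n. u n \<in> H1" "l \<in> H1" "v \<in> H1" "((\<lambda>n. H1_norm (\<lambda>x. u n x - l x)) \<longlongrightarrow> 0) F"
  shows "((\<lambda>n. B (u n) v) \<longlongrightarrow> B l v) F"
proof -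
  have "((\<lambda>n. B (u n) v - B l v) \<longlongrightarrow> 0) F"
  proof (rule Lim_null_comparison)
    have "B (\<lambda>x. u n x - l x) v = B (u n) v - B l v" for n
      using B_lin[OF assms(1,2,3), of 1 n "-1"] by simp
    then show "\<forall>\<^sub>F n in F. norm (B (u n) v - B l v) \<le> CB * H1_norm (\<lambda>x. u n x - l x) * H1_norm v"
      using B_bound[OF HH.diff_in[OF assms(1,2)] assms(3)] by simp
    have "((\<lambda>n. CB * H1_norm (\<lambda>x. u n x - l x) * H1_norm v) \<longlongrightarrow> CB * 0 * H1_norm v) F"
      by (intro tendsto_intros assms(4))
    then show "((\<lambda>n. CB * H1_norm (\<lambda>x. u n x - l x) * H1_norm v) \<longlongrightarrow> 0) F" by simp
  qed
  then show ?thesis by (simp add: LIM_zero_iff)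
qed

lemma Hm1_tendsto:
  assumes "\<And>n. u n \<in> H1" "v \<in> H1" "l \<in> Hm1" "((\<lambda>n. H1_norm (\<lambda>x. u n x - v x)) \<longlongrightarrow> 0) F"
  shows "((\<lambda>n. l (u n)) \<longlongrightarrow> l v) F"
proof -
  have "((\<lambda>n. l (u n) - l v) \<longlongrightarrow> 0) F"
  proof (rule Lim_null_comparison)
    show "\<forall>\<^sub>F n in F. norm (l (u n) - l v) \<le> Hm1_norm l * H1_norm (\<lambda>x. u n x - v x)"
      using Hm1_bound[OF assms(3) HH.diff_in[OF assms(1,2)]] by (simp add: Hm1_diff assms)
    show "((\<lambda>n. Hm1_norm l * H1_norm (\<lambda>x. u n x - v x)) \<longlongrightarrow> 0) F"
      using tendsto_mult_right_zero[OF assms(4)] .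
  qed
  then show ?thesis by (simp add: LIM_zero_iff)
qed

text \<open>By the coercivity in A1, the shift by \<open>c0\<close> turns the energy into an inner
  product whose norm is equivalent to that of \<open>H1\<close>.\<close>

definition af :: "cfun \<Rightarrow> cfun \<Rightarrow> complex" where
  "af u v = B u v + of_real c0 * L2_inner u v"

lemma af_lin: "u \<in> H1 \<Longrightarrow> v \<in> H1 \<Longrightarrow> w \<in> H1 \<Longrightarrow> af (\<lambda>x. a * u x + b * v x) w = a * af u w + b * af v w"
  by (simp add: af_def B_lin L2.ip_lin H1_Lp2 algebra_simps)

lemma af_bounds:
  assumes "v \<in> H1"
  shows "m * (H1_norm v)\<^sup>2 \<le> Re (af v v)" "Re (af v v) \<le> M * (H1_norm v)\<^sup>2"
  using coercive[OF assms, of 0]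
  by (simp_all add: af_def conj_translate_form_def Lp2_norm_sq H1_Lp2[OF assms] L2_inner_self)

text \<open>The closure of \<open>D\<close> in \<open>H1\<close>. Symmetry of the form is inherited
  from \<open>D\<close> by continuity only on this space, until \<open>V0_eq_H1\<close> identifies
  it with \<open>H1\<close>.\<close>

definition V0 :: "cfun set" where
  "V0 = {u \<in> H1. \<exists>d. (\<forall>n. d n \<in> D) \<and> (\<lambda>n. H1_norm (\<lambda>x. d n x - u x)) \<longlonglongrightarrow> 0}"

lemma V0_H1: "u \<in> V0 \<Longrightarrow> u \<in> H1" by (simp add: V0_def)

lemma V0_ex: "u \<in> V0 \<Longrightarrow> \<exists>d. (\<forall>n. d n \<in> D) \<and> (\<lambda>n. H1_norm (\<lambda>x. d n x - u x)) \<longlonglongrightarrow> 0"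
  by (simp add: V0_def)

text \<open>Self-adjointness gives symmetry on \<open>D\<close>; approximation replaces one argument
  at a time.\<close>

lemma V0_sym: assumes u: "u \<in> V0" and v: "v \<in> V0" shows "B u v = cnj (B v u)"
proof -
  have 1: "B u w = cnj (B w u)" if w: "w \<in> D" for w
  proof -
    obtain d where d: "\<And>n. d n \<in> D" "(\<lambda>n. H1_norm (\<lambda>x. d n x - u x)) \<longlonglongrightarrow> 0" using V0_ex[OF u] by blast
    have "(\<lambda>n. B (d n) w) \<longlonglongrightarrow> B u w"
      by (rule B_tendsto1[OF D_H1[OF d(1)] V0_H1[OF u] D_H1[OF w] d(2)])
    moreover have "(\<lambda>n. cnj (B w (d n))) \<longlonglongrightarrow> cnj (B w u)"
      by (intro tendsto_cnj Hm1_tendsto[OF D_H1[OF d(1)] V0_H1[OF u] B_Hm1[OF D_H1[OF w]] d(2)])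
    ultimately show ?thesis using LIMSEQ_unique B_sym_D[OF d(1) w] by simp
  qed
  obtain d where d: "\<And>n. d n \<in> D" "(\<lambda>n. H1_norm (\<lambda>x. d n x - v x)) \<longlonglongrightarrow> 0" using V0_ex[OF v] by blast
  have "(\<lambda>n. B u (d n)) \<longlonglongrightarrow> B u v"
    by (rule Hm1_tendsto[OF D_H1[OF d(1)] V0_H1[OF v] B_Hm1[OF V0_H1[OF u]] d(2)])
  moreover have "(\<lambda>n. cnj (B (d n) u)) \<longlonglongrightarrow> cnj (B v u)"
    by (intro tendsto_cnj B_tendsto1[OF D_H1[OF d(1)] V0_H1[OF v] V0_H1[OF u] d(2)])
  ultimately show ?thesis using LIMSEQ_unique 1[OF d(1)] by simp
qed

lemma V0_lin: assumes u: "u \<in> V0" and v: "v \<in> V0" shows "(\<lambda>x. a * u x + b * v x) \<in> V0"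
proof -
  obtain d where d: "\<And>n. d n \<in> D" "(\<lambda>n. H1_norm (\<lambda>x. d n x - u x)) \<longlonglongrightarrow> 0" using V0_ex[OF u] by blast
  obtain e where e: "\<And>n. e n \<in> D" "(\<lambda>n. H1_norm (\<lambda>x. e n x - v x)) \<longlonglongrightarrow> 0" using V0_ex[OF v] by blast
  have "(\<lambda>n. H1_norm (\<lambda>x. (a * d n x + b * e n x) - (a * u x + b * v x))) \<longlonglongrightarrow> 0"
  proof (rule Lim_null_comparison)
    have "H1_norm (\<lambda>x. (a * d n x + b * e n x) - (a * u x + b * v x))
        \<le> cmod a * H1_norm (\<lambda>x. d n x - u x) + cmod b * H1_norm (\<lambda>x. e n x - v x)" for n
    proof -
      have du: "(\<lambda>x. d n x - u x) \<in> H1" by (rule HH.diff_in[OF D_H1[OF d(1)] V0_H1[OF u]])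
      have ev: "(\<lambda>x. e n x - v x) \<in> H1" by (rule HH.diff_in[OF D_H1[OF e(1)] V0_H1[OF v]])
      have 1: "(\<lambda>x. a * (d n x - u x)) \<in> H1" using HH.lin[OF du du, of a 0] by simp
      have 2: "(\<lambda>x. b * (e n x - v x)) \<in> H1" using HH.lin[OF ev ev, of b 0] by simp
      have "(\<lambda>x. (a * d n x + b * e n x) - (a * u x + b * v x)) = (\<lambda>x. a * (d n x - u x) + b * (e n x - v x))"
        by (auto simp: algebra_simps)
      then show ?thesis using HH.nrm_triangle[OF 1 2] HH.nrm_scale[OF du, of a] HH.nrm_scale[OF ev, of b] by simp
    qed
    then show "\<forall>\<^sub>F n in sequentially. norm (H1_norm (\<lambda>x. (a * d n x + b * e n x) - (a * u x + b * v x)))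
        \<le> cmod a * H1_norm (\<lambda>x. d n x - u x) + cmod b * H1_norm (\<lambda>x. e n x - v x)"
      by (simp add: H1_norm_nonneg)
    have "(\<lambda>n. cmod a * H1_norm (\<lambda>x. d n x - u x) + cmod b * H1_norm (\<lambda>x. e n x - v x)) \<longlonglongrightarrow> cmod a * 0 + cmod b * 0"
      by (intro tendsto_intros d e)
    then show "(\<lambda>n. cmod a * H1_norm (\<lambda>x. d n x - u x) + cmod b * H1_norm (\<lambda>x. e n x - v x)) \<longlonglongrightarrow> 0" by simp
  qed
  then show ?thesis using D_lin[OF d(1) e(1)] HH.lin[OF V0_H1[OF u] V0_H1[OF v]]
    unfolding V0_def by (auto intro!: exI[of _ "\<lambda>n x. a * d n x + b * e n x"])
qed

lemma D_V0: "u \<in> D \<Longrightarrow> u \<in> V0"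
  unfolding V0_def by (auto intro!: D_H1 exI[of _ "\<lambda>n. u"] simp: H1_norm_zero)

lemma D_ex: "\<exists>d. d \<in> D"
proof -
  have "\<forall>f\<in>Lp 2. \<forall>\<epsilon>>0. \<exists>g\<in>D. Lp_norm 2 (\<lambda>x. f x - g x) < \<epsilon>" using sa by (auto simp: selfadjoint_def)
  from this[rule_format, OF zero_in_Lp2 zero_less_one] show ?thesis by blast
qed

lemma V0_closed:
  assumes f: "\<And>n. f n \<in> V0" and l: "l \<in> H1" and lim: "(\<lambda>n. H1_norm (\<lambda>x. f n x - l x)) \<longlonglongrightarrow> 0"
  shows "l \<in> V0"
proof -
  have "\<exists>d\<in>D. H1_norm (\<lambda>x. d x - f n x) < inverse (real (Suc n))" for n
  proof -
    obtain d where d: "\<And>n. d n \<in> D" "(\<lambda>k. H1_norm (\<lambda>x. d k x - f n x)) \<longlonglongrightarrow> 0" using V0_ex[OF f] by blast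
    have "eventually (\<lambda>k. H1_norm (\<lambda>x. d k x - f n x) < inverse (real (Suc n))) sequentially"
      by (rule order_tendstoD(2)[OF d(2)]) simp
    then show ?thesis using d(1) eventually_happens by force
  qed
  then obtain d where d: "\<And>n. d n \<in> D" "\<And>n. H1_norm (\<lambda>x. d n x - f n x) < inverse (real (Suc n))" by metis
  have "(\<lambda>n. H1_norm (\<lambda>x. d n x - l x)) \<longlonglongrightarrow> 0"
  proof (rule Lim_null_comparison)
    have "H1_norm (\<lambda>x. d n x - l x) \<le> inverse (real (Suc n)) + H1_norm (\<lambda>x. f n x - l x)" for n
      using HH.nrm_diff_triangle[OF D_H1[OF d(1)] V0_H1[OF f] l, of n n] d(2)[of n] by linarith
    then show "\<forall>\<^sub>F n in sequentially. norm (H1_norm (\<lambda>x. d n x - l x)) \<le> inverse (real (Suc n)) + H1_norm (\<lambda>x. f n x - l x)"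
      by (simp add: H1_norm_nonneg)
    show "(\<lambda>n. inverse (real (Suc n)) + H1_norm (\<lambda>x. f n x - l x)) \<longlonglongrightarrow> 0"
      using tendsto_add[OF LIMSEQ_inverse_real_of_nat lim] by simp
  qed
  with l d(1) show ?thesis by (auto simp: V0_def)
qed

lemma semi_hilbert_V0: "semi_hilbert V0 af"
proof
  show "V0 \<noteq> {}" using D_ex D_V0 by blast
  show "(\<lambda>x. a * u x + b * v x) \<in> V0" if "u \<in> V0" "v \<in> V0" for a b u v using V0_lin[OF that] .
  show "af (\<lambda>x. a * u x + b * v x) w = a * af u w + b * af v w" if "u \<in> V0" "v \<in> V0" "w \<in> V0" for a b u v w
    using that by (intro af_lin V0_H1)
  show "af v u = cnj (af u v)" if "u \<in> V0" "v \<in> V0" for u v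
    using V0_sym[OF that(2,1)] L2.ip_cnj[of u v] that by (simp add: af_def H1_Lp2 V0_H1)
  show "0 \<le> Re (af u u)" if "u \<in> V0" for u
    using af_bounds(1)[OF V0_H1[OF that]] const_signs by (meson mult_nonneg_nonneg order_trans less_imp_le zero_le_power2)
qed

text \<open>The form norm is equivalent to the \<open>H1\<close> norm and \<open>V0\<close> is
  closed, so completeness is inherited from \<open>H1\<close>.\<close>

lemma hilbert_V0: "hilbert V0 af"
proof -
  interpret S: semi_hilbert V0 af by (rule semi_hilbert_V0)
  have lo: "sqrt m * H1_norm v \<le> S.nrm v" and hi: "S.nrm v \<le> sqrt M * H1_norm v" if "v \<in> V0" for v
  proof -
    have "sqrt (m * (H1_norm v)\<^sup>2) \<le> S.nrm v" unfolding S.nrm_def by (intro real_sqrt_le_mono af_bounds V0_H1 that)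
    then show "sqrt m * H1_norm v \<le> S.nrm v" using H1_norm_nonneg by (simp add: real_sqrt_mult)
    have "S.nrm v \<le> sqrt (M * (H1_norm v)\<^sup>2)" unfolding S.nrm_def by (intro real_sqrt_le_mono af_bounds V0_H1 that)
    then show "S.nrm v \<le> sqrt M * H1_norm v" using H1_norm_nonneg by (simp add: real_sqrt_mult)
  qed
  show ?thesis
  proof
    fix f :: "nat \<Rightarrow> cfun" assume f: "\<And>n. f n \<in> V0"
      and cau: "\<And>e. e > 0 \<Longrightarrow> \<exists>M. \<forall>m\<ge>M. \<forall>n\<ge>M. S.nrm (\<lambda>x. f m x - f n x) < e"
    have "\<exists>l\<in>H1. (\<lambda>n. H1_norm (\<lambda>x. f n x - l x)) \<longlonglongrightarrow> 0"
    proof (rule HH.complete)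
      show "f n \<in> H1" for n by (rule V0_H1[OF f])
      fix e :: real assume "e > 0"
      then have "sqrt m * e > 0" using const_signs by simp
      from cau[OF this] obtain K where K: "\<And>i j. i \<ge> K \<Longrightarrow> j \<ge> K \<Longrightarrow> S.nrm (\<lambda>x. f i x - f j x) < sqrt m * e" by blast
      have "H1_norm (\<lambda>x. f i x - f j x) < e" if "i \<ge> K" "j \<ge> K" for i j
      proof -
        have "sqrt m * H1_norm (\<lambda>x. f i x - f j x) < sqrt m * e"
          using lo[OF S.diff_in[OF f f]] K[OF that] le_less_trans by blast
        then show ?thesis using const_signs by simp
      qed
      then show "\<exists>M. \<forall>m\<ge>M. \<forall>n\<ge>M. H1_norm (\<lambda>x. f m x - f n x) < e" by blast
    qed
    then obtain l where l: "l \<in> H1" "(\<lambda>n. H1_norm (\<lambda>x. f n x - l x)) \<longlonglongrightarrow> 0" by blast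
    have lV: "l \<in> V0" by (rule V0_closed[OF f l])
    have "(\<lambda>n. S.nrm (\<lambda>x. f n x - l x)) \<longlonglongrightarrow> 0"
    proof (rule Lim_null_comparison)
      show "\<forall>\<^sub>F n in sequentially. norm (S.nrm (\<lambda>x. f n x - l x)) \<le> sqrt M * H1_norm (\<lambda>x. f n x - l x)"
        using hi[OF S.diff_in[OF f lV]] S.nrm_nonneg[OF S.diff_in[OF f lV]] by simp
      show "(\<lambda>n. sqrt M * H1_norm (\<lambda>x. f n x - l x)) \<longlonglongrightarrow> 0" using tendsto_mult_right_zero[OF l(2)] .
    qed
    with lV show "\<exists>l\<in>V0. (\<lambda>n. S.nrm (\<lambda>x. f n x - l x)) \<longlonglongrightarrow> 0" by blast
  qed
qed

text \<open>If \<open>y\<close> represents \<open>v \<mapsto> ((A + c0) v, g)\<close> on the closure of \<open>D\<close>, then \<open>g - y\<close> is in the kernel of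
  \<open>A* + c0 = A + c0\<close>, which is trivial.\<close>

lemma V0_eq_H1: "V0 = H1"
proof
  interpret S: hilbert V0 af by (rule hilbert_V0)
  show "V0 \<subseteq> H1" using V0_H1 by blast
  show "H1 \<subseteq> V0"
  proof
    fix g assume g: "g \<in> H1"
    have lo: "sqrt m * H1_norm v \<le> S.nrm v" if "v \<in> V0" for v
    proof -
      have "sqrt (m * (H1_norm v)\<^sup>2) \<le> S.nrm v" unfolding S.nrm_def by (intro real_sqrt_le_mono af_bounds V0_H1 that)
      then show ?thesis using H1_norm_nonneg by (simp add: real_sqrt_mult)
    qed
    \<comment> \<open>Although \<open>g\<close> is not yet known to lie in \<open>V0\<close>, it
      defines a bounded functional on it, and this functional has a representative in
      \<open>V0\<close>.\<close>
    have "\<exists>y\<in>V0. \<forall>v\<in>V0. af v g = af v y"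
    proof (rule S.riesz)
      show "af (\<lambda>x. a * u x + b * v x) g = a * af u g + b * af v g" if "u \<in> V0" "v \<in> V0" for a b u v
        by (intro af_lin V0_H1 that g)
      fix u assume u: "u \<in> V0"
      have "cmod (af u g) \<le> CB * H1_norm u * H1_norm g + c0 * (H1_norm u * H1_norm g)"
      proof -
        have "cmod (L2_inner u g) \<le> Lp_norm 2 u * Lp_norm 2 g" by (intro L2.cauchy_schwarz H1_Lp2 V0_H1 u g)
        also have "\<dots> \<le> H1_norm u * H1_norm g"
          by (intro mult_mono L2_norm_le_H1_norm H1_norm_nonneg Lp2_norm_nonneg)
        finally have "cmod (of_real c0 * L2_inner u g) \<le> c0 * (H1_norm u * H1_norm g)"
          using const_signs by (simp add: norm_mult)
        then show ?thesis using B_bound[OF V0_H1[OF u] g] norm_triangle_ineq[of "B u g" "of_real c0 * L2_inner u g"]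
          unfolding af_def by linarith
      qed
      also have "\<dots> = ((CB + c0) * H1_norm g / sqrt m) * (sqrt m * H1_norm u)"
        using const_signs by (simp add: field_simps)
      also have "\<dots> \<le> ((CB + c0) * H1_norm g / sqrt m) * S.nrm u"
        using const_signs lo[OF u] H1_norm_nonneg[of g] by (intro mult_left_mono) auto
      finally show "cmod (af u g) \<le> ((CB + c0) * H1_norm g / sqrt m) * S.nrm u" .
    qed
    then obtain y where y: "y \<in> V0" "\<And>v. v \<in> V0 \<Longrightarrow> af v g = af v y" by blast
    define h where "h = (\<lambda>x. g x - y x)"
    have h: "h \<in> H1" unfolding h_def by (rule HH.diff_in[OF g V0_H1[OF y(1)]])
    note hL = H1_Lp2[OF h]
    define w where "w = (\<lambda>x. of_real (- c0) * h x)"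
    have wL: "w \<in> Lp 2" using L2.lin[OF hL hL, of "of_real (- c0)" 0] by (simp add: w_def)
    have adj: "L2_inner (A u) h = L2_inner u w" if u: "u \<in> D" for u
    proof -
      have uL: "u \<in> Lp 2" by (rule H1_Lp2[OF D_H1[OF u]])
      have "af u h = af u g - af u y"
      proof -
        have "B u h = B u g - B u y" unfolding h_def by (rule Hm1_diff[OF B_Hm1[OF D_H1[OF u]] g V0_H1[OF y(1)]])
        moreover have "L2_inner u h = L2_inner u g - L2_inner u y"
          using L2.ip_lin2[OF H1_Lp2[OF g] H1_Lp2[OF V0_H1[OF y(1)]] uL, of 1 "-1"] by (simp add: h_def)
        ultimately show ?thesis by (simp add: af_def right_diff_distrib)
      qed
      then have "af u h = 0" using y(2)[OF D_V0[OF u]] by simp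
      then have "L2_inner (A u) h = - (of_real c0 * L2_inner u h)"
        using B_D[OF u h] by (simp add: af_def eq_neg_iff_add_eq_0)
      moreover have "L2_inner u w = - (of_real c0 * L2_inner u h)"
        using L2.ip_lin2[OF hL hL uL, of "of_real (- c0)" 0] by (simp add: w_def)
      ultimately show ?thesis by simp
    qed
    from adjoint_D[OF hL wL adj] have hD: "h \<in> D" and wA: "AE x in lborel. w x = A h x" by auto
    have "L2_inner (A h) h = L2_inner w h"
      by (rule L2_inner_cong_AE[OF A_Lp2[OF hD] wL hL hL]) (use wA in \<open>auto elim: eventually_mono\<close>)
    also have "\<dots> = - of_real c0 * L2_inner h h"
      using L2.ip_lin[OF hL hL hL, of "of_real (- c0)" 0] by (simp add: w_def)
    also have "\<dots> = of_real (- c0 * (Lp_norm 2 h)\<^sup>2)" using L2.ip_self[OF hL] by simp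
    finally have "0 \<le> - c0 * (Lp_norm 2 h)\<^sup>2" using Apos[OF hD] by simp
    then have "c0 * (Lp_norm 2 h)\<^sup>2 \<le> 0" by simp
    then have "Lp_norm 2 h = 0" using const_signs(1) by (simp add: mult_le_0_iff)
    then have "AE x in lborel. h x = 0" using Lp2_norm_zero_iff[OF hL] by simp
    then have "H1_norm h = 0" by (rule H1_norm_AE_zero[OF h])
    then have "H1_norm (\<lambda>x. y x - g x) = 0" using HH.nrm_diff_commute[OF g V0_H1[OF y(1)]] by (simp add: h_def)
    then show "g \<in> V0" using V0_closed[of "\<lambda>n. y" g] y(1) g by simp
  qed
qed

lemma B_sym: "u \<in> H1 \<Longrightarrow> v \<in> H1 \<Longrightarrow> B u v = cnj (B v u)"
  by (rule V0_sym) (simp_all only: V0_eq_H1)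

sublocale AF: semi_hilbert H1 af
  using semi_hilbert_V0 unfolding V0_eq_H1 .

section \<open>The unitary group and the invariance of the form\<close>

lemma U_Lp2: "f \<in> Lp 2 \<Longrightarrow> U t f \<in> Lp 2"
  and U_lin: "f \<in> Lp 2 \<Longrightarrow> g \<in> Lp 2 \<Longrightarrow>
    AE x in lborel. U t (\<lambda>x. a * f x + b * g x) x = a * U t f x + b * U t g x"
  using grp unfolding schroedinger_group_def L2_linear_on_def by blast+

lemma U_norm: "f \<in> Lp 2 \<Longrightarrow> Lp_norm 2 (U t f) = Lp_norm 2 f"
  and U_0: "f \<in> Lp 2 \<Longrightarrow> AE x in lborel. U 0 f x = f x"
  and U_add: "f \<in> Lp 2 \<Longrightarrow> AE x in lborel. U (s + t) f x = U s (U t f) x"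
  and U_cont: "f \<in> Lp 2 \<Longrightarrow> ((\<lambda>t. Lp_norm 2 (\<lambda>x. U t f x - f x)) \<longlongrightarrow> 0) (at 0)"
  and U_gen: "f \<in> Lp 2 \<Longrightarrow> g \<in> Lp 2 \<Longrightarrow>
      ((\<lambda>h. Lp_norm 2 (\<lambda>x. (U h f x - f x) / of_real h - (- \<i> * g x))) \<longlongrightarrow> 0) (at 0) \<longleftrightarrow>
        f \<in> D \<and> (AE x in lborel. g x = A f x)"
  using grp unfolding schroedinger_group_def by blast+

lemma U_diff: "f \<in> Lp 2 \<Longrightarrow> g \<in> Lp 2 \<Longrightarrow> AE x in lborel. U t (\<lambda>x. f x - g x) x = U t f x - U t g x"
  using U_lin[of f g t 1 "-1"] by simp

text \<open>Polarisation: the norms of \<open>f + c * g\<close> for \<open>c = 1\<close> and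
  \<open>c = \<i>\<close> determine the inner product.\<close>

lemma U_inner: assumes f: "f \<in> Lp 2" and g: "g \<in> Lp 2" shows "L2_inner (U t f) (U t g) = L2_inner f g"
proof -
  have *: "Re (cnj c * L2_inner (U t f) (U t g)) = Re (cnj c * L2_inner f g)" for c
  proof -
    have "Lp_norm 2 (\<lambda>x. 1 * U t f x + c * U t g x) = Lp_norm 2 (U t (\<lambda>x. 1 * f x + c * g x))"
      by (rule Lp2_norm_cong_AE[OF L2.lin[OF U_Lp2[OF f] U_Lp2[OF g]] U_Lp2[OF L2.lin[OF f g]]])
        (use U_lin[OF f g, of t 1 c] in \<open>auto elim: eventually_mono\<close>)
    also have "\<dots> = Lp_norm 2 (\<lambda>x. 1 * f x + c * g x)" by (rule U_norm[OF L2.lin[OF f g]])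
    finally have "(Lp_norm 2 (\<lambda>x. 1 * U t f x + c * U t g x))\<^sup>2 = (Lp_norm 2 (\<lambda>x. 1 * f x + c * g x))\<^sup>2" by simp
    then show ?thesis
      unfolding L2.nrm_lin[OF U_Lp2[OF f] U_Lp2[OF g]] L2.nrm_lin[OF f g] U_norm[OF f] U_norm[OF g] by simp
  qed
  from *[of 1] *[of \<i>] show ?thesis by (simp add: complex_eq_iff)
qed

lemma U_inv: assumes "f \<in> Lp 2" shows "AE x in lborel. U (- t) (U t f) x = f x"
proof -
  have "AE x in lborel. U 0 f x = U (- t) (U t f) x" using U_add[OF assms, of "-t" t] by simp
  then show ?thesis using U_0[OF assms] by eventually_elim simp
qed

lemma U_adj: assumes f: "f \<in> Lp 2" and g: "g \<in> Lp 2" shows "L2_inner (U t f) g = L2_inner f (U (- t) g)"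
proof -
  have "L2_inner (U t f) g = L2_inner (U (- t) (U t f)) (U (- t) g)" by (rule U_inner[symmetric]) (auto intro: U_Lp2 f g)
  also have "\<dots> = L2_inner f (U (- t) g)"
    by (rule L2_inner_cong_AE) (auto intro: U_Lp2 f g U_inv)
  finally show ?thesis .
qed

text \<open>The difference quotient of the group at \<open>U t f\<close> is the image under
  \<open>U t\<close> of the one at \<open>f\<close>, and \<open>U t\<close> is isometric, so the
  characterisation of the generator carries over.\<close>

lemma U_D: assumes f: "f \<in> D" shows "U t f \<in> D" "AE x in lborel. U t (A f) x = A (U t f) x"
proof -
  have fL: "f \<in> Lp 2" and AL: "A f \<in> Lp 2" using f by (auto intro: A_Lp2 H1_Lp2 D_H1)
  let ?q = "\<lambda>h x. (U h f x - f x) / of_real h - (- \<i> * A f x)"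
  let ?r = "\<lambda>h x. (U h (U t f) x - U t f x) / of_real h - (- \<i> * U t (A f) x)"
  have q_alt: "?q h = (\<lambda>x. 1 * (inverse (of_real h) * U h f x + (- inverse (of_real h)) * f x) + \<i> * A f x)" for h
    by (rule ext) (simp add: divide_inverse algebra_simps)
  have dL: "(\<lambda>x. inverse (of_real h) * U h f x + (- inverse (of_real h)) * f x) \<in> Lp 2" for h
    by (rule L2.lin[OF U_Lp2[OF fL] fL])
  have qL: "?q h \<in> Lp 2" for h unfolding q_alt by (rule L2.lin[OF dL AL])
  have r_alt: "?r h = (\<lambda>x. 1 * (inverse (of_real h) * U h (U t f) x + (- inverse (of_real h)) * U t f x) + \<i> * U t (A f) x)" for h
    by (rule ext) (simp add: divide_inverse algebra_simps)
  have rL: "?r h \<in> Lp 2" for h unfolding r_alt by (intro L2.lin U_Lp2 fL AL)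
  have "Lp_norm 2 (?r h) = Lp_norm 2 (?q h)" for h
  proof -
    have "AE x in lborel. ?r h x = U t (?q h) x"
      using U_lin[OF dL AL, of t 1 h \<i>] U_lin[OF U_Lp2[OF fL] fL, of t "inverse (of_real h)" h "- inverse (of_real h)"]
        U_add[OF fL, of t h] U_add[OF fL, of h t]
      unfolding q_alt r_alt
      by eventually_elim (simp add: divide_inverse algebra_simps)
    then have "Lp_norm 2 (?r h) = Lp_norm 2 (U t (?q h))" by (rule Lp2_norm_cong_AE[OF rL U_Lp2[OF qL]])
    then show ?thesis by (simp only: U_norm[OF qL])
  qed
  moreover have "((\<lambda>h. Lp_norm 2 (?q h)) \<longlongrightarrow> 0) (at 0)" using U_gen[OF fL AL] f by simp
  ultimately have "((\<lambda>h. Lp_norm 2 (?r h)) \<longlongrightarrow> 0) (at 0)" by simp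
  then have "U t f \<in> D \<and> (AE x in lborel. U t (A f) x = A (U t f) x)"
    using U_gen[OF U_Lp2[OF fL] U_Lp2[OF AL]] by blast
  then show "U t f \<in> D" "AE x in lborel. U t (A f) x = A (U t f) x" by auto
qed

lemma U_H1_diff: assumes "f \<in> H1" "g \<in> H1" shows "H1_norm (\<lambda>x. U t f x - U t g x) \<le> C2 * H1_norm (\<lambda>x. f x - g x)"
proof -
  have "H1_norm (\<lambda>x. U t f x - U t g x) = H1_norm (U t (\<lambda>x. f x - g x))"
    by (rule H1_cong_AE(2)[OF U_H1[OF HH.diff_in[OF assms]]])
      (use U_diff[OF H1_Lp2[OF assms(1)] H1_Lp2[OF assms(2)], of t] Lp2_measurable[OF H1_Lp2[OF HH.diff_in[OF U_H1[OF assms(1)] U_H1[OF assms(2)]]]] in auto)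
  then show ?thesis using U_H1_norm[OF HH.diff_in[OF assms]] by simp
qed

text \<open>For \<open>f\<close> in \<open>D\<close> the form is an inner product with
  \<open>A f\<close>, and the unitary group commutes with \<open>A\<close>. The density of
  \<open>D\<close> in \<open>H1\<close> and the uniform \<open>H1\<close> bound A2 extend this to
  all \<open>f\<close>.\<close>

lemma B_inv: assumes f: "f \<in> H1" and g: "g \<in> H1" shows "B (U t f) (U t g) = B f g"
proof -
  have 1: "B (U t d) (U t g) = B d g" if d: "d \<in> D" for d
  proof -
    have "B (U t d) (U t g) = L2_inner (A (U t d)) (U t g)" by (rule B_D[OF U_D(1)[OF d] U_H1[OF g]])
    also have "\<dots> = L2_inner (U t (A d)) (U t g)"
      by (rule L2_inner_cong_AE)
        (use U_D[OF d, of t] d g in \<open>auto intro: A_Lp2 U_Lp2 H1_Lp2 elim: eventually_mono\<close>)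
    also have "\<dots> = L2_inner (A d) g" by (rule U_inner[OF A_Lp2[OF d] H1_Lp2[OF g]])
    finally show ?thesis by (simp add: B_D[OF d g])
  qed
  have "f \<in> V0" using f V0_eq_H1 by simp
  then obtain d where d: "\<And>n. d n \<in> D" "(\<lambda>n. H1_norm (\<lambda>x. d n x - f x)) \<longlonglongrightarrow> 0" using V0_ex by blast
  have "(\<lambda>n. H1_norm (\<lambda>x. U t (d n) x - U t f x)) \<longlonglongrightarrow> 0"
  proof (rule Lim_null_comparison)
    show "\<forall>\<^sub>F n in sequentially. norm (H1_norm (\<lambda>x. U t (d n) x - U t f x)) \<le> C2 * H1_norm (\<lambda>x. d n x - f x)"
      using U_H1_diff[OF D_H1[OF d(1)] f] by (simp add: H1_norm_nonneg)
    show "(\<lambda>n. C2 * H1_norm (\<lambda>x. d n x - f x)) \<longlonglongrightarrow> 0" using tendsto_mult_right_zero[OF d(2)] .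
  qed
  from B_tendsto1[OF U_H1[OF D_H1[OF d(1)]] U_H1[OF f] U_H1[OF g, of t] this]
  have "(\<lambda>n. B (d n) g) \<longlonglongrightarrow> B (U t f) (U t g)" unfolding 1[OF d(1)] .
  moreover have "(\<lambda>n. B (d n) g) \<longlonglongrightarrow> B f g" by (rule B_tendsto1[OF D_H1[OF d(1)] f g d(2)])
  ultimately show ?thesis using LIMSEQ_unique by blast
qed

end

subsection \<open>Weak limits along an ultrafilter\<close>

definition bddH :: "(nat \<Rightarrow> cfun) \<Rightarrow> bool" where
  "bddH w \<longleftrightarrow> (\<forall>n. w n \<in> H1) \<and> (\<exists>K. \<forall>n. H1_norm (w n) \<le> K)"

lemma bddH_I: "(\<And>n. w n \<in> H1) \<Longrightarrow> (\<And>n. H1_norm (w n) \<le> K) \<Longrightarrow> bddH w"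
  by (auto simp: bddH_def)

lemma bddH_D: "bddH w \<Longrightarrow> w n \<in> H1" by (simp add: bddH_def)

lemma bddH_ex: "bddH w \<Longrightarrow> \<exists>K\<ge>0. \<forall>n. H1_norm (w n) \<le> K"
  by (meson H1_norm_nonneg bddH_def order_trans)

lemma bddH_const: "\<psi> \<in> H1 \<Longrightarrow> bddH (\<lambda>n. \<psi>)" by (auto simp: bddH_def)

lemma bddH_diff: assumes "bddH u" "bddH v" shows "bddH (\<lambda>n x. u n x - v n x)"
proof -
  obtain K L where KL: "\<And>n. H1_norm (u n) \<le> K" "\<And>n. H1_norm (v n) \<le> L"
    using assms unfolding bddH_def by blast
  show ?thesis
  proof (rule bddH_I)
    fix n
    note u = bddH_D[OF assms(1), of n] and v = bddH_D[OF assms(2), of n]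
    show "(\<lambda>x. u n x - v n x) \<in> H1" by (rule HH.diff_in[OF u v])
    show "H1_norm (\<lambda>x. u n x - v n x) \<le> K + L"
      using HH.nrm_triangle[OF u HH.diff_in[OF zero_H1 v]] HH.nrm_diff_commute[OF zero_H1 v] KL[of n] by simp
  qed
qed

lemma bddH_translate: "bddH w \<Longrightarrow> bddH (\<lambda>n. translate (y n) (w n))"
  by (auto simp: bddH_def H1_translate)

definition wconv :: "nat filter \<Rightarrow> (nat \<Rightarrow> cfun) \<Rightarrow> cfun \<Rightarrow> bool" where
  "wconv G w \<psi> \<longleftrightarrow> (\<forall>l\<in>Hm1. ((\<lambda>n. l (w n)) \<longlongrightarrow> l \<psi>) G)"

lemma wconv_D: "wconv G w \<psi> \<Longrightarrow> l \<in> Hm1 \<Longrightarrow> ((\<lambda>n. l (w n)) \<longlongrightarrow> l \<psi>) G"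
  by (simp add: wconv_def)

lemma wconv_inner: assumes "wconv G w \<psi>" "bddH w" "\<psi> \<in> H1" "g \<in> Lp 2"
  shows "((\<lambda>n. L2_inner (w n) g) \<longlongrightarrow> L2_inner \<psi> g) G"
proof -
  have "((\<lambda>n. cnj (L2_inner g (w n))) \<longlongrightarrow> cnj (L2_inner g \<psi>)) G"
    by (intro tendsto_cnj wconv_D[OF assms(1)] L2_inner_Hm1 assms)
  moreover have "cnj (L2_inner g f) = L2_inner f g" if "f \<in> H1" for f
    using L2.ip_cnj[OF assms(4) H1_Lp2[OF that]] by simp
  ultimately show ?thesis using bddH_D[OF assms(2)] assms(3) by simp
qed

lemma wconv_ev: assumes "wconv G w \<psi>" shows "((\<lambda>n. ev (w n) x) \<longlongrightarrow> ev \<psi> x) G"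
  using tendsto_cnj[OF wconv_D[OF assms ev_Hm1[of x]]] by simp

lemma wconv_cong:
  assumes "wconv G w \<psi>" "\<And>n. w n \<in> H1" "\<And>n. w' n \<in> H1" "\<And>n. AE x in lborel. w n x = w' n x"
    "\<psi> \<in> H1" "\<psi>' \<in> H1" "AE x in lborel. \<psi> x = \<psi>' x"
  shows "wconv G w' \<psi>'"
  unfolding wconv_def
proof
  fix l assume l: "l \<in> Hm1"
  have "l (w n) = l (w' n)" for n by (rule Hm1_cong_AE[OF l assms(2,3,4)])
  moreover have "l \<psi> = l \<psi>'" by (rule Hm1_cong_AE[OF l assms(5,6,7)])
  ultimately show "((\<lambda>n. l (w' n)) \<longlongrightarrow> l \<psi>') G" using wconv_D[OF assms(1) l] by simp
qed

lemma wconv_diff: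
  assumes "wconv G w \<psi>" "wconv G w' \<psi>'" "\<And>n. w n \<in> H1" "\<And>n. w' n \<in> H1" "\<psi> \<in> H1" "\<psi>' \<in> H1"
  shows "wconv G (\<lambda>n x. w n x - w' n x) (\<lambda>x. \<psi> x - \<psi>' x)"
  unfolding wconv_def
proof
  fix l assume l: "l \<in> Hm1"
  show "((\<lambda>n. l (\<lambda>x. w n x - w' n x)) \<longlongrightarrow> l (\<lambda>x. \<psi> x - \<psi>' x)) G"
    unfolding Hm1_diff[OF l assms(3,4)] Hm1_diff[OF l assms(5,6)]
    by (intro tendsto_diff wconv_D[OF _ l] assms)
qed

lemma wconv_strong:
  assumes "wconv G w' \<psi>" "\<And>n. w n \<in> H1" "\<And>n. w' n \<in> H1"
    "((\<lambda>n. H1_norm (\<lambda>x. w n x - w' n x)) \<longlongrightarrow> 0) G"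
  shows "wconv G w \<psi>"
  unfolding wconv_def
proof
  fix l assume l: "l \<in> Hm1"
  have "((\<lambda>n. l (w n) - l (w' n)) \<longlongrightarrow> 0) G"
  proof (rule Lim_null_comparison)
    show "\<forall>\<^sub>F n in G. norm (l (w n) - l (w' n)) \<le> Hm1_norm l * H1_norm (\<lambda>x. w n x - w' n x)"
      using Hm1_bound[OF l HH.diff_in[OF assms(2,3)]] by (simp add: Hm1_diff[OF l assms(2,3)])
    show "((\<lambda>n. Hm1_norm l * H1_norm (\<lambda>x. w n x - w' n x)) \<longlongrightarrow> 0) G"
      using tendsto_mult_right_zero[OF assms(4)] .
  qed
  from tendsto_add[OF this wconv_D[OF assms(1) l]] show "((\<lambda>n. l (w n)) \<longlongrightarrow> l \<psi>) G" by simp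
qed

text \<open>Norm convergence of the functionals, which A3 supplies, makes up for the merely weak
  convergence of the functions.\<close>

lemma wconv_pairing_strong:
  assumes w: "wconv G w \<psi>" "bddH w" and L: "\<And>n. L n \<in> Hm1" "l \<in> Hm1"
    and lim: "((\<lambda>n. Hm1_norm (\<lambda>z. L n z - l z)) \<longlongrightarrow> 0) G"
  shows "((\<lambda>n. L n (w n)) \<longlongrightarrow> l \<psi>) G"
proof -
  obtain K where K: "K \<ge> 0" "\<And>n. H1_norm (w n) \<le> K" using bddH_ex[OF w(2)] by blast
  have "((\<lambda>n. L n (w n) - l (w n)) \<longlongrightarrow> 0) G"
  proof (rule Lim_null_comparison)
    have "norm (L n (w n) - l (w n)) \<le> Hm1_norm (\<lambda>z. L n z - l z) * K" for n
      using Hm1_bound[OF Hm1_diff_in[OF L(1)[of n] L(2)] bddH_D[OF w(2), of n]]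
        mult_left_mono[OF K(2)[of n] Hm1_norm_nonneg[OF Hm1_diff_in[OF L(1)[of n] L(2)]]] by linarith
    then show "\<forall>\<^sub>F n in G. norm (L n (w n) - l (w n)) \<le> Hm1_norm (\<lambda>z. L n z - l z) * K" by simp
    show "((\<lambda>n. Hm1_norm (\<lambda>z. L n z - l z) * K) \<longlongrightarrow> 0) G" using tendsto_mult_left_zero[OF lim] .
  qed
  from tendsto_add[OF this wconv_D[OF w(1) L(2)]] show ?thesis by simp
qed

lemma ipH_Hm1: assumes "g \<in> H1" shows "(\<lambda>v. ipH g v) \<in> Hm1"
proof (rule Hm1_I)
  show "ipH g (\<lambda>x. a * u x + b * v x) = cnj a * ipH g u + cnj b * ipH g v" if "u \<in> H1" "v \<in> H1" for a b u v
    by (rule HH.ip_lin2[OF that assms])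
  show "cmod (ipH g v) \<le> H1_norm g * H1_norm v" if "v \<in> H1" for v
    by (rule HH.cauchy_schwarz[OF assms that])
qed

lemma wconv_norm_le:
  assumes G: "G \<noteq> bot" and w: "wconv G w \<psi>" "bddH w" "\<psi> \<in> H1" and K: "((\<lambda>n. H1_norm (w n)) \<longlongrightarrow> K) G"
  shows "H1_norm \<psi> \<le> K"
proof -
  have "((\<lambda>n. ipH \<psi> (w n)) \<longlongrightarrow> ipH \<psi> \<psi>) G" by (rule wconv_D[OF w(1) ipH_Hm1[OF w(3)]])
  then have 1: "((\<lambda>n. cmod (ipH \<psi> (w n))) \<longlongrightarrow> cmod (ipH \<psi> \<psi>)) G" by (rule tendsto_norm)
  have 2: "((\<lambda>n. H1_norm \<psi> * H1_norm (w n)) \<longlongrightarrow> H1_norm \<psi> * K) G" by (intro tendsto_intros K)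
  have "cmod (ipH \<psi> \<psi>) \<le> H1_norm \<psi> * K"
    by (rule tendsto_le[OF G 2 1]) (simp add: HH.cauchy_schwarz[OF w(3) bddH_D[OF w(2)]])
  moreover have "cmod (ipH \<psi> \<psi>) = H1_norm \<psi> * H1_norm \<psi>"
    unfolding HH.ip_self[OF w(3)] norm_of_real by (simp add: power2_eq_square H1_norm_nonneg)
  ultimately have "H1_norm \<psi> * H1_norm \<psi> \<le> H1_norm \<psi> * K" by simp
  moreover have "0 \<le> K"
    by (rule tendsto_le[OF G K tendsto_const]) (simp add: H1_norm_nonneg)
  ultimately show ?thesis using H1_norm_nonneg[of \<psi>] by (metis mult_le_cancel_left_pos order_le_less)
qed

text \<open>Riesz representation is used twice: the limits of \<open>ipH v (w n)\<close> form a
  bounded functional, whose representative is the weak limit, and every functional in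
  \<open>Hm1\<close> is itself an inner product, so these limits control all of them.\<close>

lemma wconv_exists:
  assumes G: "ultra G" and w: "bddH w" shows "\<exists>\<psi>\<in>H1. wconv G w \<psi>"
proof -
  obtain K where K: "K \<ge> 0" "\<And>n. H1_norm (w n) \<le> K" using bddH_ex[OF w] by blast
  note wH = bddH_D[OF w]
  have Gb: "G \<noteq> bot" using G by (simp add: ultra_def)
  have bd: "cmod (ipH v (w n)) \<le> K * H1_norm v" if v: "v \<in> H1" for v n
  proof -
    have "cmod (ipH v (w n)) \<le> H1_norm v * H1_norm (w n)" by (rule HH.cauchy_schwarz[OF v wH])
    also have "\<dots> \<le> H1_norm v * K" by (intro mult_left_mono K H1_norm_nonneg)
    finally show ?thesis by (simp add: mult.commute)
  qed
  have "\<exists>l. ((\<lambda>n. ipH v (w n)) \<longlongrightarrow> l) G" if v: "v \<in> H1" for v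
    by (rule ultra_bounded_tendsto[OF G, where K = "K * H1_norm v"]) (simp add: bd[OF v])
  then obtain F where F: "\<And>v. v \<in> H1 \<Longrightarrow> ((\<lambda>n. ipH v (w n)) \<longlongrightarrow> F v) G" by metis
  have "\<exists>y\<in>H1. \<forall>v\<in>H1. F v = ipH v y"
  proof (rule HH.riesz)
    fix a b u v assume uv: "u \<in> H1" "v \<in> H1"
    have "((\<lambda>n. a * ipH u (w n) + b * ipH v (w n)) \<longlongrightarrow> a * F u + b * F v) G"
      by (intro tendsto_intros F uv)
    then have "((\<lambda>n. ipH (\<lambda>x. a * u x + b * v x) (w n)) \<longlongrightarrow> a * F u + b * F v) G"
      unfolding HH.ip_lin[OF uv wH] .
    then show "F (\<lambda>x. a * u x + b * v x) = a * F u + b * F v"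
      using tendsto_unique[OF Gb F[OF HH.lin[OF uv]]] by blast
  next
    fix u assume u: "u \<in> H1"
    show "cmod (F u) \<le> K * H1_norm u"
      by (rule tendsto_le[OF Gb tendsto_const tendsto_norm[OF F[OF u]]]) (simp add: bd[OF u])
  qed
  then obtain y where y: "y \<in> H1" "\<And>v. v \<in> H1 \<Longrightarrow> F v = ipH v y" by blast
  have "wconv G w y"
    unfolding wconv_def
  proof
    fix l assume l: "l \<in> Hm1"
    have "\<exists>g\<in>H1. \<forall>v\<in>H1. cnj (l v) = ipH v g"
    proof (rule HH.riesz)
      show "cnj (l (\<lambda>x. a * u x + b * v x)) = a * cnj (l u) + b * cnj (l v)" if "u \<in> H1" "v \<in> H1" for a b u v
        by (simp add: Hm1_lin[OF l that])
      show "cmod (cnj (l u)) \<le> Hm1_norm l * H1_norm u" if "u \<in> H1" for u using Hm1_bound[OF l that] by simp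
    qed
    then obtain g where g: "g \<in> H1" "\<And>v. v \<in> H1 \<Longrightarrow> cnj (l v) = ipH v g" by blast
    have lv: "l v = ipH g v" if "v \<in> H1" for v
    proof -
      have "l v = cnj (ipH v g)" using g(2)[OF that] by (metis complex_cnj_cnj)
      then show ?thesis using HH.ip_cnj[OF that g(1)] by simp
    qed
    show "((\<lambda>n. l (w n)) \<longlongrightarrow> l y) G"
      using F[OF g(1)] unfolding lv[OF wH] lv[OF y(1)] y(2)[OF g(1)] .
  qed
  with y show ?thesis by blast
qed

text \<open>Some weak limit exists by compactness, and the pairings with intervals identify it; in
  this way the density of the test vectors is bypassed.\<close>

lemma wconv_I:
  assumes G: "ultra G" and w: "bddH w" "\<psi> \<in> H1"
    and lim: "\<And>a b. a \<le> b \<Longrightarrow> ((\<lambda>n. L2_inner (w n) (ivl a b)) \<longlongrightarrow> L2_inner \<psi> (ivl a b)) G"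
  shows "wconv G w \<psi>"
proof -
  have Gb: "G \<noteq> bot" using G by (simp add: ultra_def)
  obtain \<psi>' where p: "\<psi>' \<in> H1" "wconv G w \<psi>'" using wconv_exists[OF G w(1)] by blast
  have "AE x in lborel. \<psi>' x - \<psi> x = 0"
  proof (rule AE_zero_of_interval_integrals)
    show "(\<lambda>x. \<psi>' x - \<psi> x) \<in> Lp 2" using p w by (intro L2.diff_in H1_Lp2)
    fix a b :: real assume "a \<le> b"
    have "L2_inner \<psi>' (ivl a b) = L2_inner \<psi> (ivl a b)"
      by (rule tendsto_unique[OF Gb wconv_inner[OF p(2) w(1) p(1) ivl_Lp2] lim[OF \<open>a \<le> b\<close>]])
    then show "L2_inner (\<lambda>x. \<psi>' x - \<psi> x) (ivl a b) = 0"
      using L2.ip_diff[OF H1_Lp2[OF p(1)] H1_Lp2[OF w(2)] ivl_Lp2] by simp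
  qed
  then have "AE x in lborel. \<psi>' x = \<psi> x" by simp
  then show ?thesis using p w bddH_D[OF w(1)] by (intro wconv_cong[OF p(2)]) auto
qed

lemma wconv_0_I:
  assumes G: "ultra G" and w: "bddH w"
    and lim: "\<And>a b. a \<le> b \<Longrightarrow> ((\<lambda>n. L2_inner (w n) (ivl a b)) \<longlongrightarrow> 0) G"
  shows "wconv G w (\<lambda>x. 0)"
  by (rule wconv_I[OF G w zero_H1]) (use lim in \<open>simp add: L2_inner_def\<close>)

lemma wconv_unique:
  assumes G: "G \<noteq> bot" and w: "bddH w" "\<psi> \<in> H1" "\<psi>' \<in> H1" "wconv G w \<psi>" "wconv G w \<psi>'"
  shows "AE x in lborel. \<psi> x = \<psi>' x"
proof -
  have "AE x in lborel. \<psi> x - \<psi>' x = 0"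
  proof (rule AE_zero_of_interval_integrals)
    show "(\<lambda>x. \<psi> x - \<psi>' x) \<in> Lp 2" using w by (intro L2.diff_in H1_Lp2)
    fix a b :: real
    have "L2_inner \<psi> (ivl a b) = L2_inner \<psi>' (ivl a b)"
      by (rule tendsto_unique[OF G wconv_inner[OF w(4,1,2) ivl_Lp2] wconv_inner[OF w(5,1,3) ivl_Lp2]])
    then show "L2_inner (\<lambda>x. \<psi> x - \<psi>' x) (ivl a b) = 0"
      using L2.ip_diff[OF H1_Lp2[OF w(2)] H1_Lp2[OF w(3)] ivl_Lp2] by simp
  qed
  then show ?thesis by simp
qed

lemma wconv_const: "wconv G (\<lambda>n. \<psi>) \<psi>" by (simp add: wconv_def)

text \<open>A translation moves the endpoints of the testing interval. The primitives of the
  \<open>w n\<close> are uniformly Hoelder continuous of order 1/2, so a converging shift may be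
  replaced by its limit.\<close>

lemma wconv_translate:
  assumes G: "ultra G" and w: "wconv G w \<psi>" "bddH w" "\<psi> \<in> H1" and y: "(y \<longlongrightarrow> c) G"
  shows "wconv G (\<lambda>n. translate (y n) (w n)) (translate c \<psi>)"
proof (rule wconv_I[OF G bddH_translate[OF w(2)] H1_translate(1)[OF w(3)]])
  fix a b :: real assume ab: "a \<le> b"
  obtain K where K: "K \<ge> 0" "\<And>n. H1_norm (w n) \<le> K" using bddH_ex[OF w(2)] by blast
  have wL: "w n \<in> Lp 2" for n by (rule H1_Lp2[OF bddH_D[OF w(2)]])
  let ?d = "\<lambda>n. L2_inner (w n) (ivl (a + y n) (b + y n)) - L2_inner (w n) (ivl (a + c) (b + c))"
  have "(?d \<longlongrightarrow> 0) G"
  proof (rule Lim_null_comparison)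
    have "norm (?d n) \<le> 2 * (K * sqrt \<bar>y n - c\<bar>)" for n
    proof -
      have "?d n = (prim (w n) (b + y n) - prim (w n) (b + c)) - (prim (w n) (a + y n) - prim (w n) (a + c))"
        using ab by (simp add: prim_diff[OF wL, symmetric])
      also have "cmod \<dots> \<le> Lp_norm 2 (w n) * sqrt \<bar>(b + y n) - (b + c)\<bar> + Lp_norm 2 (w n) * sqrt \<bar>(a + y n) - (a + c)\<bar>"
        by (rule order_trans[OF norm_triangle_ineq4 add_mono[OF prim_holder[OF wL] prim_holder[OF wL]]])
      also have "\<dots> = 2 * (Lp_norm 2 (w n) * sqrt \<bar>y n - c\<bar>)" by simp
      also have "\<dots> \<le> 2 * (K * sqrt \<bar>y n - c\<bar>)"
        using K(2)[of n] L2_norm_le_H1_norm[of "w n"] by (intro mult_left_mono mult_right_mono) auto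
      finally show ?thesis .
    qed
    then show "\<forall>\<^sub>F n in G. norm (?d n) \<le> 2 * (K * sqrt \<bar>y n - c\<bar>)" by simp
    have "((\<lambda>n. 2 * (K * sqrt \<bar>y n - c\<bar>)) \<longlongrightarrow> 2 * (K * sqrt \<bar>c - c\<bar>)) G"
      by (intro tendsto_intros y)
    then show "((\<lambda>n. 2 * (K * sqrt \<bar>y n - c\<bar>)) \<longlongrightarrow> 0) G" by simp
  qed
  from tendsto_add[OF this wconv_inner[OF w ivl_Lp2[of "a + c" "b + c"]]]
  show "((\<lambda>n. L2_inner (translate (y n) (w n)) (ivl a b)) \<longlongrightarrow> L2_inner (translate c \<psi>) (ivl a b)) G"
    by (simp add: L2_inner_translate_ivl)
qed

lemma L2_tail:
  assumes g: "g \<in> Lp 2" and e: "e > 0"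
  shows "\<exists>K. Lp_norm 2 (\<lambda>x. g x - g x * ivl (- K) K x) < e"
proof -
  note [measurable] = Lp2_measurable[OF g] Lp2_measurable[OF ivl_Lp2]
  let ?h = "\<lambda>(k::nat) x. g x - g x * ivl (- real k) (real k) x"
  have "(\<lambda>k. LINT x|lborel. (cmod (?h k x))\<^sup>2) \<longlonglongrightarrow> (LINT x|(lborel :: real measure). (0::real))"
  proof (rule integral_dominated_convergence)
    show "integrable lborel (\<lambda>x. (cmod (g x))\<^sup>2)" by (rule Lp2_integrable[OF g])
    show "(\<lambda>x. (cmod (?h k x))\<^sup>2) \<in> borel_measurable lborel" for k by measurable
    show "AE x in lborel. norm ((cmod (?h k x))\<^sup>2) \<le> (cmod (g x))\<^sup>2" for k
      by (intro AE_I2) (auto simp: ivl_def indicator_def)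
    show "AE x in lborel. (\<lambda>k. (cmod (?h k x))\<^sup>2) \<longlonglongrightarrow> 0"
    proof (rule AE_I2)
      fix x :: real
      obtain n :: nat where n: "\<bar>x\<bar> \<le> real n" using real_arch_simple by blast
      have "?h k x = 0" if "k \<ge> n" for k
      proof -
        have "\<bar>x\<bar> \<le> real k" using n that by (meson of_nat_mono order_trans)
        then show ?thesis by (auto simp: ivl_def indicator_def)
      qed
      then have "eventually (\<lambda>k. (cmod (?h k x))\<^sup>2 = 0) sequentially"
        unfolding eventually_sequentially by auto
      then show "(\<lambda>k. (cmod (?h k x))\<^sup>2) \<longlonglongrightarrow> 0" by (rule tendsto_eventually)
    qed
  qed simp
  then have "(\<lambda>k. sqrt (LINT x|lborel. (cmod (?h k x))\<^sup>2)) \<longlonglongrightarrow> sqrt 0"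
    by (intro tendsto_real_sqrt) simp
  then have "(\<lambda>k. Lp_norm 2 (?h k)) \<longlonglongrightarrow> 0" by (simp add: Lp2_norm_eq)
  from order_tendstoD(2)[OF this e] show ?thesis
    by (auto simp: eventually_sequentially)
qed

text \<open>Pairing a translate of \<open>g\<close> with a fixed interval sees \<open>g\<close> only
  on an interval that leaves every bounded set, where its tail is small.\<close>

lemma wconv_translate_infinity:
  assumes G: "ultra G" and g: "g \<in> H1" and y: "filterlim (\<lambda>n. \<bar>y n\<bar>) at_top G"
  shows "wconv G (\<lambda>n. translate (y n) g) (\<lambda>x. 0)"
proof (rule wconv_0_I[OF G bddH_translate[OF bddH_const[OF g]]])
  fix a b :: real assume ab: "a \<le> b"
  note gL = H1_Lp2[OF g]
  show "((\<lambda>n. L2_inner (translate (y n) g) (ivl a b)) \<longlongrightarrow> 0) G"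
  proof (rule tendstoI)
    fix e :: real assume e: "e > 0"
    define d where "d = e / (sqrt (b - a) + 1)"
    have d: "d > 0" using e ab by (simp add: d_def add_nonneg_pos)
    obtain K where K: "Lp_norm 2 (\<lambda>x. g x - g x * ivl (- K) K x) < d" using L2_tail[OF gL d] by blast
    have "eventually (\<lambda>n. \<bar>y n\<bar> > \<bar>K\<bar> + \<bar>a\<bar> + \<bar>b\<bar>) G"
      using y by (simp add: filterlim_at_top_dense)
    then show "\<forall>\<^sub>F n in G. dist (L2_inner (translate (y n) g) (ivl a b)) 0 < e"
    proof eventually_elim
      case (elim n)
      let ?I = "ivl (a + y n) (b + y n)"
      have gK: "(\<lambda>x. g x - g x * ivl (- K) K x) \<in> Lp 2"
        using Lp2_locL2[OF gL] by (intro L2.diff_in gL) (simp add: locL2_def)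
      have "L2_inner g ?I = L2_inner (\<lambda>x. g x - g x * ivl (- K) K x) ?I"
        unfolding L2_inner_def
      proof (rule Bochner_Integration.integral_cong[OF refl])
        fix x
        show "g x * cnj (?I x) = (g x - g x * ivl (- K) K x) * cnj (?I x)"
          using elim by (auto simp: ivl_def indicator_def)
      qed
      also have "cmod \<dots> \<le> Lp_norm 2 (\<lambda>x. g x - g x * ivl (- K) K x) * sqrt (b - a)"
        using ivl_bound[OF gK, of "a + y n" "b + y n"] ab by simp
      also have "\<dots> \<le> d * sqrt (b - a)" using K ab by (intro mult_right_mono) auto
      also have "\<dots> < d * (sqrt (b - a) + 1)" using d by simp
      also have "\<dots> = e"
      proof -
        have "sqrt (b - a) + 1 \<noteq> 0" using ab by (metis add_nonneg_pos diff_ge_0_iff_ge less_irrefl real_sqrt_ge_zero zero_less_one)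
        then show ?thesis by (simp add: d_def)
      qed
      finally show ?case by (simp add: L2_inner_translate_ivl)
    qed
  qed
qed

section \<open>Powers of the L^r norm\<close>

definition Lr :: "real \<Rightarrow> cfun \<Rightarrow> real" where "Lr r f = (LINT x|lborel. cmod (f x) powr r)"

lemma Lr_nonneg: "0 \<le> Lr r f" unfolding Lr_def by (rule Bochner_Integration.integral_nonneg) simp

lemma Lp_norm_powr: "r > 0 \<Longrightarrow> Lp_norm r f powr r = Lr r f"
  using Lr_nonneg[of r f] by (simp add: Lp_norm_def Lr_def[symmetric] powr_powr)

text \<open>Interpolation: \<open>r - 2\<close> powers are absorbed by the supremum bound, and the
  remaining two give the \<open>L\<^sup>2\<close> norm.\<close>

lemma H1_Lr_integrable:
  assumes r: "r > 2" and f: "f \<in> H1" shows "integrable lborel (\<lambda>x. cmod (f x) powr r)"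
    and H1_Lr_le: "Lr r f \<le> (2 * H1_norm f) powr (r - 2) * (H1_norm f)\<^sup>2"
proof -
  note [measurable] = Lp2_measurable[OF H1_Lp2[OF f]]
  let ?c = "(2 * H1_norm f) powr (r - 2)"
  have i: "integrable lborel (\<lambda>x. ?c * (cmod (f x))\<^sup>2)"
    using Lp2_integrable[OF H1_Lp2[OF f]] by simp
  have le: "AE x in lborel. cmod (f x) powr r \<le> ?c * (cmod (f x))\<^sup>2"
    using ev_AE[OF f]
  proof eventually_elim
    case (elim x)
    show ?case
    proof (cases "f x = 0")
      case False
      have "cmod (f x) powr r = cmod (f x) powr (r - 2) * cmod (f x) powr 2"
        by (simp only: powr_add[symmetric]) simp
      also have "\<dots> \<le> ?c * cmod (f x) powr 2"
        using ev_le_H1_norm[OF f, of x] r elim by (intro mult_right_mono powr_mono2) auto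
      finally show ?thesis by simp
    qed simp
  qed
  show int: "integrable lborel (\<lambda>x. cmod (f x) powr r)"
    by (rule Bochner_Integration.integrable_bound[OF i]) (use le in \<open>measurable, auto elim!: eventually_mono\<close>)
  have "Lr r f \<le> (LINT x|lborel. ?c * (cmod (f x))\<^sup>2)"
    unfolding Lr_def by (rule integral_mono_AE[OF int i le])
  also have "\<dots> = ?c * (Lp_norm 2 f)\<^sup>2" by (simp add: Lp2_norm_sq H1_Lp2[OF f])
  also have "\<dots> \<le> ?c * (H1_norm f)\<^sup>2"
    by (intro mult_left_mono power_mono L2_norm_le_H1_norm Lp2_norm_nonneg) auto
  finally show "Lr r f \<le> ?c * (H1_norm f)\<^sup>2" .
qed

lemma Lr_cong_AE:
  assumes "f \<in> Lp 2" "g \<in> Lp 2" "AE x in lborel. f x = g x" shows "Lr r f = Lr r g"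
  unfolding Lr_def
proof (rule Bochner_Integration.integral_cong_AE)
  note [measurable] = Lp2_measurable[OF assms(1)] Lp2_measurable[OF assms(2)]
  show "(\<lambda>x. cmod (f x) powr r) \<in> borel_measurable lborel" by measurable
  show "(\<lambda>x. cmod (g x) powr r) \<in> borel_measurable lborel" by measurable
  show "AE x in lborel. cmod (f x) powr r = cmod (g x) powr r" using assms(3) by eventually_elim simp
qed

lemma Lr_translate: "Lr r (translate z f) = Lr r f"
  unfolding Lr_def translate_def by (rule lborel_integral_shift[of "\<lambda>x. cmod (f x) powr r"])

text \<open>The values are split at the level \<open>e\<close>: smaller ones contribute at most
  \<open>e * (b - a)\<close>, and a larger value is at most \<open>e powr (1 - r)\<close> times its
  own \<open>r\<close>-th power.\<close>

lemma ivl_Lr_bound: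
  assumes r: "r > 2" and f: "f \<in> H1" and e: "e > 0" and ab: "a \<le> b"
  shows "cmod (L2_inner f (ivl a b)) \<le> e * (b - a) + e powr (1 - r) * Lr r f"
proof -
  have i3: "integrable lborel (indicator {a..b} :: real \<Rightarrow> real)"
    by (rule integrable_real_indicator) (auto simp: emeasure_lborel_Icc_eq)
  have "cmod (L2_inner f (ivl a b)) \<le> (LINT x|lborel. cmod (f x * cnj (ivl a b x)))"
    unfolding L2_inner_def by (rule integral_norm_bound)
  also have "\<dots> \<le> (LINT x|lborel. e * indicator {a..b} x + e powr (1 - r) * cmod (f x) powr r)"
  proof (rule integral_mono)
    show "integrable lborel (\<lambda>x. cmod (f x * cnj (ivl a b x)))"
      by (intro integrable_norm Lp2_mult_integrable H1_Lp2 f ivl_Lp2)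
    show "integrable lborel (\<lambda>x. e * indicator {a..b} x + e powr (1 - r) * cmod (f x) powr r)"
      using i3 H1_Lr_integrable[OF r f] by simp
    fix x
    have "cmod (f x) \<le> e + e powr (1 - r) * cmod (f x) powr r"
    proof (cases "cmod (f x) \<le> e")
      case False
      then have p: "cmod (f x) > 0" using e by linarith
      have "cmod (f x) = cmod (f x) powr (1 - r) * cmod (f x) powr r" using p by (simp flip: powr_add)
      also have "\<dots> \<le> e powr (1 - r) * cmod (f x) powr r"
        using False e r by (intro mult_right_mono powr_mono2') auto
      finally show ?thesis using e by linarith
    qed (simp add: add_increasing2)
    then show "cmod (f x * cnj (ivl a b x)) \<le> e * indicator {a..b} x + e powr (1 - r) * cmod (f x) powr r"
      by (auto simp: ivl_def indicator_def norm_mult)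
  qed
  also have "\<dots> = e * (b - a) + e powr (1 - r) * Lr r f"
    using i3 H1_Lr_integrable[OF r f] ab by (simp add: Lr_def)
  finally show ?thesis .
qed

lemma wconv_of_Lr_tendsto_0:
  assumes G: "ultra G" and r: "r > 2" and w: "bddH w" and lim: "((\<lambda>n. Lr r (w n)) \<longlongrightarrow> 0) G"
  shows "wconv G w (\<lambda>x. 0)"
proof (rule wconv_0_I[OF G w])
  fix a b :: real assume ab: "a \<le> b"
  show "((\<lambda>n. L2_inner (w n) (ivl a b)) \<longlongrightarrow> 0) G"
  proof (rule tendstoI)
    fix e :: real assume e: "e > 0"
    define d where "d = e / (2 * (b - a + 1))"
    have d: "d > 0" using e ab by (simp add: d_def)
    have "((\<lambda>n. d * (b - a) + d powr (1 - r) * Lr r (w n)) \<longlongrightarrow> d * (b - a) + d powr (1 - r) * 0) G"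
      by (intro tendsto_intros lim)
    moreover have "d * (b - a) + d powr (1 - r) * 0 < e"
    proof -
      have "d * (b - a) \<le> d * (b - a + 1)" using d by simp
      also have "\<dots> = e / 2"
      proof -
        have "b - a + 1 > 0" using ab by simp
        then show ?thesis unfolding d_def by (metis less_numeral_extra(3) mult.commute nonzero_mult_divide_mult_cancel_right times_divide_eq_right)
      qed
      finally show ?thesis using e by simp
    qed
    ultimately have "eventually (\<lambda>n. d * (b - a) + d powr (1 - r) * Lr r (w n) < e) G"
      by (rule order_tendstoD)
    then show "\<forall>\<^sub>F n in G. dist (L2_inner (w n) (ivl a b)) 0 < e"
    proof eventually_elim
      case (elim n)
      then show ?case using ivl_Lr_bound[OF r bddH_D[OF w] d ab, of n] by simp
    qed
  qed
qed

subsection \<open>Weak limits of translated solutions\<close>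

lemma powr_add_le:
  fixes a b r :: real
  assumes "a \<ge> 0" "b \<ge> 0" "r > 0" shows "(a + b) powr r \<le> 2 powr r * (a powr r + b powr r)"
proof -
  have "(a + b) powr r \<le> (2 * max a b) powr r" using assms by (intro powr_mono2) auto
  also have "\<dots> = 2 powr r * max a b powr r" using assms by (simp add: powr_mult)
  also have "\<dots> \<le> 2 powr r * (a powr r + b powr r)" by (intro mult_left_mono) (auto simp: max_def)
  finally show ?thesis .
qed

lemma Lp_diff_integrable:
  assumes "f \<in> Lp r" "g \<in> Lp r" "r > 0" shows "integrable lborel (\<lambda>x. cmod (f x - g x) powr r)"
proof (rule Bochner_Integration.integrable_bound)
  have [measurable]: "f \<in> borel_measurable borel" "g \<in> borel_measurable borel" using assms by (auto simp: Lp_def)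
  show "integrable lborel (\<lambda>x. 2 powr r * (cmod (f x) powr r + cmod (g x) powr r))"
    using assms by (auto simp: Lp_def)
  show "(\<lambda>x. cmod (f x - g x) powr r) \<in> borel_measurable lborel" by measurable
  have "cmod (f x - g x) powr r \<le> 2 powr r * (cmod (f x) powr r + cmod (g x) powr r)" for x
    using powr_add_le[of "cmod (f x)" "cmod (g x)" r] norm_triangle_ineq4[of "f x" "g x"] assms(3)
      powr_mono2[of r "cmod (f x - g x)" "cmod (f x) + cmod (g x)"] by simp
  then show "AE x in lborel. norm (cmod (f x - g x) powr r) \<le> norm (2 powr r * (cmod (f x) powr r + cmod (g x) powr r))"
    by (intro AE_I2) (auto intro: order_trans[OF _ abs_ge_self])
qed

text \<open>Pointwise, \<open>\<bar>f k - l\<bar> powr r\<close> tends to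
  \<open>\<bar>l\<bar> powr r\<close>, while its integral tends to 0. Fatou's lemma then forces
  \<open>l\<close> to vanish almost everywhere.\<close>

lemma Lr_tendsto_0_of_ev:
  assumes r: "r > 2" and f: "\<And>k. f k \<in> H1" and l: "l \<in> Lp r"
    and lim: "(\<lambda>k. Lp_norm r (\<lambda>x. f k x - l x)) \<longlonglongrightarrow> 0"
    and ev0: "\<And>x. (\<lambda>k::nat. ev (f k) x) \<longlonglongrightarrow> 0"
  shows "(\<lambda>k. Lr r (f k)) \<longlonglongrightarrow> 0"
proof -
  have fr: "f k \<in> Lp r" for k
    using H1_Lr_integrable[OF r f] Lp2_measurable[OF H1_Lp2[OF f]] by (simp add: Lp_def)
  have [measurable]: "l \<in> borel_measurable borel" using l by (simp add: Lp_def)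
  have [measurable]: "f k \<in> borel_measurable borel" for k by (rule Lp2_measurable[OF H1_Lp2[OF f]])
  have "(\<lambda>k. Lp_norm r (\<lambda>x. f k x - l x) powr r) \<longlonglongrightarrow> 0"
    by (rule tendsto_zero_powrI[OF lim tendsto_const]) (use r in \<open>auto simp: Lp_norm_def\<close>)
  then have L: "(\<lambda>k. Lr r (\<lambda>x. f k x - l x)) \<longlonglongrightarrow> 0" using r by (simp add: Lp_norm_powr)
  have nn: "(\<integral>\<^sup>+x. ennreal (cmod (f k x - l x) powr r) \<partial>lborel) = ennreal (Lr r (\<lambda>x. f k x - l x))" for k
    unfolding Lr_def by (rule nn_integral_eq_integral[OF Lp_diff_integrable[OF fr l]]) (use r in auto)
  have "(\<integral>\<^sup>+x. ennreal (cmod (l x) powr r) \<partial>lborel) = (\<integral>\<^sup>+x. liminf (\<lambda>k. ennreal (cmod (f k x - l x) powr r)) \<partial>lborel)"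
  proof (rule nn_integral_cong_AE)
    have "AE x in lborel. \<forall>k. f k x = ev (f k) x" unfolding AE_all_countable using ev_AE[OF f] by blast
    then show "AE x in lborel. ennreal (cmod (l x) powr r) = liminf (\<lambda>k. ennreal (cmod (f k x - l x) powr r))"
    proof eventually_elim
      case (elim x)
      have "(\<lambda>k. f k x) \<longlonglongrightarrow> 0" using ev0[of x] elim by simp
      then have "(\<lambda>k. cmod (f k x - l x)) \<longlonglongrightarrow> cmod (0 - l x)" by (intro tendsto_intros)
      then have "(\<lambda>k. cmod (f k x - l x) powr r) \<longlonglongrightarrow> cmod (l x) powr r"
        by (intro tendsto_powr') (use r in auto)
      then have "(\<lambda>k. ennreal (cmod (f k x - l x) powr r)) \<longlonglongrightarrow> ennreal (cmod (l x) powr r)"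
        by (rule tendsto_ennrealI)
      from lim_imp_Liminf[OF _ this] show ?case by simp
    qed
  qed
  also have "\<dots> \<le> liminf (\<lambda>k. \<integral>\<^sup>+x. ennreal (cmod (f k x - l x) powr r) \<partial>lborel)"
    by (rule nn_integral_liminf) measurable
  also have "\<dots> = 0"
  proof -
    have "(\<lambda>k. ennreal (Lr r (\<lambda>x. f k x - l x))) \<longlonglongrightarrow> ennreal 0" by (rule tendsto_ennrealI[OF L])
    from lim_imp_Liminf[OF _ this] show ?thesis unfolding nn by simp
  qed
  finally have "(\<integral>\<^sup>+x. ennreal (cmod (l x) powr r) \<partial>lborel) = 0" by simp
  then have l0: "AE x in lborel. l x = 0" by (subst (asm) nn_integral_0_iff_AE) auto
  have "Lr r (f k) = Lr r (\<lambda>x. f k x - l x)" for k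
    unfolding Lr_def
  proof (rule Bochner_Integration.integral_cong_AE)
    show "AE x in lborel. cmod (f k x) powr r = cmod (f k x - l x) powr r"
      using l0 by eventually_elim simp
  qed measurable
  with L show ?thesis by simp
qed

context operator_setting
begin

definition cj :: "real \<Rightarrow> real \<Rightarrow> cfun \<Rightarrow> cfun" where "cj x t f = conj_translate x (U t) f"

lemma cj_alt: "cj x t f = translate (- x) (U t (translate x f))"
  by (simp add: cj_def conj_translate_def)

lemma cj_Lp2: "f \<in> Lp 2 \<Longrightarrow> cj x t f \<in> Lp 2"
  by (simp add: cj_alt translate_Lp2 U_Lp2)

lemma cj_H1: "f \<in> H1 \<Longrightarrow> cj x t f \<in> H1"
  by (simp add: cj_alt H1_translate U_H1)

lemma cj_norm: "f \<in> Lp 2 \<Longrightarrow> Lp_norm 2 (cj x t f) = Lp_norm 2 f"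
  by (simp add: cj_alt translate_L2_norm U_norm translate_Lp2)

lemma translate_adj: "L2_inner (translate z f) g = L2_inner f (translate (- z) g)"
  using translate_L2_inner[of z f "translate (- z) g"] by simp

lemma cj_adj: "f \<in> Lp 2 \<Longrightarrow> g \<in> Lp 2 \<Longrightarrow> L2_inner (cj x t f) g = L2_inner f (cj x (- t) g)"
  by (simp add: cj_alt translate_adj U_adj translate_Lp2)

lemma C2_nonneg: "0 \<le> C2" using const_signs by simp

lemma bddH_U: assumes "bddH w" shows "bddH (\<lambda>n. U (t n) (w n))"
proof -
  obtain K where K: "\<And>n. H1_norm (w n) \<le> K" using bddH_ex[OF assms] by blast
  show ?thesis
  proof (rule bddH_I)
    show "U (t n) (w n) \<in> H1" for n by (rule U_H1[OF bddH_D[OF assms]])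
    show "H1_norm (U (t n) (w n)) \<le> C2 * K" for n
      using U_H1_norm[OF bddH_D[OF assms], of "t n" n] mult_left_mono[OF K[of n] C2_nonneg] by linarith
  qed
qed

lemma bddH_cj: "bddH w \<Longrightarrow> bddH (\<lambda>n. cj (x n) (t n) (w n))"
  unfolding cj_alt by (intro bddH_translate bddH_U)

text \<open>The map \<open>sh x t\<close> undoes the formation of a profile with parameters
  \<open>x\<close> and \<open>t\<close>, and weak limits are taken in these coordinates. Passing to
  other parameters composes it with a translation and with \<open>cj\<close>, the evolution of a
  translated operator; see \<open>sh_change\<close>.\<close>

definition sh :: "real \<Rightarrow> real \<Rightarrow> cfun \<Rightarrow> cfun" where "sh x t f = translate (- x) (U t f)"

lemma sh_H1: "f \<in> H1 \<Longrightarrow> sh x t f \<in> H1"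
  by (simp add: sh_def H1_translate U_H1)

lemma bddH_sh: "bddH w \<Longrightarrow> bddH (\<lambda>n. sh (x n) (t n) (w n))"
  unfolding sh_def by (intro bddH_translate bddH_U)

lemma sh_diff: assumes "f \<in> Lp 2" "g \<in> Lp 2"
  shows "AE y in lborel. sh x t (\<lambda>z. f z - g z) y = sh x t f y - sh x t g y"
  using AE_translate[OF U_diff[OF assms, of t], of "- x"] by (simp add: sh_def translate_def)

lemma sh_profile:
  assumes "\<psi> \<in> Lp 2"
  shows "AE y in lborel. sh x' t' (U (- t) (translate x \<psi>)) y = translate (x - x') (cj x (t' - t) \<psi>) y"
proof -
  have "AE y in lborel. U (t' - t) (translate x \<psi>) y = U t' (U (- t) (translate x \<psi>)) y"
    using U_add[OF translate_Lp2[OF assms], of t' "- t" x] by simp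
  from AE_translate[OF this, of "- x'"] show ?thesis
    unfolding sh_def cj_alt translate_def by eventually_elim simp
qed

lemma sh_change:
  assumes "f \<in> Lp 2"
  shows "AE y in lborel. sh x' t' f y = translate (x - x') (cj x (t' - t) (sh x t f)) y"
proof -
  have "AE y in lborel. U ((t' - t) + t) f y = U (t' - t) (U t f) y" by (rule U_add[OF assms])
  from AE_translate[OF this, of "- x'"] show ?thesis
    by (simp add: sh_def cj_alt translate_def)
qed

end

section \<open>Compactness assumptions along the ultrafilter\<close>

locale profile_setting = operator_setting D A B U C2 c0 m M CB
  for D A B U C2 c0 m M CB +
  fixes G :: "nat filter"
  assumes Gs: "G \<le> sequentially" and Gu: "ultra G"
begin

lemma Gb: "G \<noteq> bot" using Gu by (simp add: ultra_def)

lemma select: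
  assumes "\<And>j :: nat. eventually (P j) G" shows "\<exists>\<sigma>. strict_mono \<sigma> \<and> (\<forall>j. P j (\<sigma> j))"
proof -
  from filter_select[OF Gs Gb, of "\<lambda>_ _ _ _. True" P, OF eventually_True assms] show ?thesis by auto
qed

text \<open>A4 speaks of times that converge as an ordinary sequence. The selection condition
  \<open>\<bar>s m - sb\<bar> < 1 / real (Suc j)\<close> at stage \<open>j\<close> guarantees this
  for all sequences that are selected.\<close>

lemma A4_limit:
  assumes \<psi>: "\<psi> \<in> H1" and s: "(s \<longlongrightarrow> sb) G"
  shows "\<exists>l\<in>H1. ((\<lambda>n. H1_norm (\<lambda>z. cj (x n) (s n) \<psi> z - l z)) \<longlongrightarrow> 0) G"
proof (rule ultra_precompact_limit[OF Gs Gu, where P = "\<lambda>j m. \<bar>s m - sb\<bar> < 1 / real (Suc j)"])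
  show "\<forall>\<^sub>F m in G. \<bar>s m - sb\<bar> < 1 / real (Suc j)" for j
    using tendstoD[OF s, of "1 / real (Suc j)"] by (simp add: dist_real_def)
  show "H1_norm (\<lambda>z. f z - h z) \<le> H1_norm (\<lambda>z. f z - g z) + H1_norm (\<lambda>z. g z - h z)"
    if "f \<in> H1" "g \<in> H1" "h \<in> H1" for f g h by (rule HH.nrm_diff_triangle[OF that])
  show "H1_norm (\<lambda>z. f z - g z) = H1_norm (\<lambda>z. g z - f z)" if "f \<in> H1" "g \<in> H1" for f g
    by (rule HH.nrm_diff_commute[OF that])
  show "0 \<le> H1_norm (\<lambda>z. f z - g z)" for f g :: cfun by (rule H1_norm_nonneg)
  show "cj (x n) (s n) \<psi> \<in> H1" for n by (rule cj_H1[OF \<psi>])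
  fix \<sigma> :: "nat \<Rightarrow> nat" assume P: "\<And>j. \<bar>s (\<sigma> j) - sb\<bar> < 1 / real (Suc j)"
  have "(\<lambda>j. s (\<sigma> j) - sb) \<longlonglongrightarrow> 0"
  proof (rule Lim_null_comparison[OF _ LIMSEQ_inverse_real_of_nat], rule always_eventually, rule allI)
    fix j show "norm (s (\<sigma> j) - sb) \<le> inverse (real (Suc j))"
      using P[of j] by (simp add: inverse_eq_divide)
  qed
  then have "(\<lambda>j. s (\<sigma> j)) \<longlonglongrightarrow> sb" by (simp add: LIM_zero_iff)
  then have "convergent (\<lambda>j. s (\<sigma> j))" by (auto simp: convergent_def)
  from A4[unfolded assumption_A4_def, rule_format, OF \<psi> this, of "\<lambda>j. x (\<sigma> j)"]
  show "precompact_in H1 H1_norm (range (\<lambda>k. cj (x (\<sigma> k)) (s (\<sigma> k)) \<psi>))" by (simp add: cj_def)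
qed

lemma conj_form_Hm1: assumes "\<psi> \<in> H1" shows "conj_translate_form z B \<psi> \<in> Hm1"
proof -
  note l = B_Hm1[OF H1_translate(1)[OF assms, of z]]
  show ?thesis
  proof (rule Hm1_I)
    show "conj_translate_form z B \<psi> (\<lambda>x. a * u x + b * v x) = cnj a * conj_translate_form z B \<psi> u + cnj b * conj_translate_form z B \<psi> v"
      if "u \<in> H1" "v \<in> H1" for a b u v
      using Hm1_lin[OF l H1_translate(1)[OF that(1)] H1_translate(1)[OF that(2)], of a z b z]
      by (simp add: conj_translate_form_def translate_def)
    show "cmod (conj_translate_form z B \<psi> v) \<le> Hm1_norm (B (translate z \<psi>)) * H1_norm v" if "v \<in> H1" for v
      using Hm1_bound[OF l H1_translate(1)[OF that, of z]] that
      by (simp add: conj_translate_form_def H1_translate)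
  qed
qed

lemma A3_limit:
  assumes \<psi>: "\<psi> \<in> H1"
  shows "\<exists>l\<in>Hm1. ((\<lambda>n. Hm1_norm (\<lambda>v. conj_translate_form (x n) B \<psi> v - l v)) \<longlongrightarrow> 0) G"
proof (rule ultra_precompact_limit[OF Gs Gu, where P = "\<lambda>j m. True"])
  show "Hm1_norm (\<lambda>z. f z - h z) \<le> Hm1_norm (\<lambda>z. f z - g z) + Hm1_norm (\<lambda>z. g z - h z)"
    if "f \<in> Hm1" "g \<in> Hm1" "h \<in> Hm1" for f g h by (rule Hm1_triangle[OF that])
  show "Hm1_norm (\<lambda>z. f z - g z) = Hm1_norm (\<lambda>z. g z - f z)" for f g by (rule Hm1_norm_sym)
  show "0 \<le> Hm1_norm (\<lambda>z. f z - g z)" if "f \<in> Hm1" "g \<in> Hm1" for f g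
    by (rule Hm1_norm_nonneg[OF Hm1_diff_in[OF that]])
  show "conj_translate_form (x n) B \<psi> \<in> Hm1" for n by (rule conj_form_Hm1[OF \<psi>])
  show "precompact_in Hm1 Hm1_norm (range (\<lambda>k. conj_translate_form (x (\<sigma> k)) B \<psi>))" for \<sigma> :: "nat \<Rightarrow> nat"
    by (rule A3[unfolded assumption_A3_def, rule_format, OF \<psi>])
qed simp

text \<open>A failure along \<open>G\<close> yields an ordinary sequence with times of modulus at
  least \<open>j\<close> and \<open>Lr\<close> bounded below. On a subsequence A6 gives weak, hence
  pointwise, convergence to 0, and on a further one A5 gives a limit in L^r, which must therefore be
  0.\<close>

lemma A5_limit:
  assumes r: "r > 2" and A5: "assumption_A5 r U" and \<psi>: "\<psi> \<in> H1"
    and s: "filterlim (\<lambda>n. \<bar>s n\<bar>) at_top G"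
  shows "((\<lambda>n. Lr r (cj (x n) (s n) \<psi>)) \<longlongrightarrow> 0) G"
proof (rule ccontr)
  assume "\<not> ((\<lambda>n. Lr r (cj (x n) (s n) \<psi>)) \<longlongrightarrow> 0) G"
  then obtain e where e: "e > 0" "\<not> eventually (\<lambda>n. Lr r (cj (x n) (s n) \<psi>) < e) G"
    using Lr_nonneg by (auto simp: tendsto_iff dist_real_def)
  then have "eventually (\<lambda>n. \<not> Lr r (cj (x n) (s n) \<psi>) < e) G" using ultra_cases[OF Gu] by blast
  moreover have "eventually (\<lambda>n. real j \<le> \<bar>s n\<bar>) G" for j using s by (simp add: filterlim_at_top)
  ultimately have "eventually (\<lambda>n. real j \<le> \<bar>s n\<bar> \<and> \<not> Lr r (cj (x n) (s n) \<psi>) < e) G" for j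
    by (simp add: eventually_conj)
  from select[of "\<lambda>j n. real j \<le> \<bar>s n\<bar> \<and> \<not> Lr r (cj (x n) (s n) \<psi>) < e", OF this]
  obtain \<sigma> where \<sigma>: "strict_mono \<sigma>" "\<And>j. real j \<le> \<bar>s (\<sigma> j)\<bar>" "\<And>j. \<not> Lr r (cj (x (\<sigma> j)) (s (\<sigma> j)) \<psi>) < e"
    by blast
  \<comment> \<open>A6 is formulated for the propagator \<open>U (- s)\<close>, so it is applied to
    the negated times.\<close>
  have "filterlim (\<lambda>j. \<bar>- s (\<sigma> j)\<bar>) at_top sequentially"
    by (rule filterlim_at_top_mono[OF filterlim_real_sequentially]) (use \<sigma>(2) in auto)
  from A6[unfolded assumption_A6_def, rule_format, OF \<psi> this, of "\<lambda>j. x (\<sigma> j)"]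
  obtain \<rho> :: "nat \<Rightarrow> nat" where \<rho>: "strict_mono \<rho>"
    "weakly_converges_H1 (\<lambda>k. cj (x (\<sigma> (\<rho> k))) (s (\<sigma> (\<rho> k))) \<psi>) (\<lambda>_. 0)"
    by (auto simp: cj_def)
  have "precompact_in (Lp r) (Lp_norm r) (range (\<lambda>k. cj (x (\<sigma> (\<rho> k))) (s (\<sigma> (\<rho> k))) \<psi>))"
    using A5[unfolded assumption_A5_def, rule_format, OF \<psi>, of "\<lambda>k. x (\<sigma> (\<rho> k))" "\<lambda>k. s (\<sigma> (\<rho> k))"]
    by (simp add: cj_def)
  then have "\<exists>l\<in>Lp r. \<exists>\<tau> :: nat \<Rightarrow> nat. strict_mono \<tau> \<and>
      (\<lambda>k. Lp_norm r (\<lambda>z. cj (x (\<sigma> (\<rho> (\<tau> k)))) (s (\<sigma> (\<rho> (\<tau> k)))) \<psi> z - l z)) \<longlonglongrightarrow> 0"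
    by (rule precompact_in_def[THEN iffD1, THEN conjunct2, THEN spec, THEN mp]) auto
  then obtain l and \<tau> :: "nat \<Rightarrow> nat" where l: "l \<in> Lp r" "strict_mono \<tau>"
    "(\<lambda>k. Lp_norm r (\<lambda>z. cj (x (\<sigma> (\<rho> (\<tau> k)))) (s (\<sigma> (\<rho> (\<tau> k)))) \<psi> z - l z)) \<longlonglongrightarrow> 0"
    by blast
  define f where "f = (\<lambda>k. cj (x (\<sigma> (\<rho> (\<tau> k)))) (s (\<sigma> (\<rho> (\<tau> k)))) \<psi>)"
  have "(\<lambda>k. Lr r (f k)) \<longlonglongrightarrow> 0"
  proof (rule Lr_tendsto_0_of_ev[OF r])
    show "f k \<in> H1" for k unfolding f_def by (rule cj_H1[OF \<psi>])
    show "l \<in> Lp r" by fact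
    show "(\<lambda>k. Lp_norm r (\<lambda>x. f k x - l x)) \<longlonglongrightarrow> 0" using l(3) by (simp add: f_def)
    fix y
    have ev0: "ev (\<lambda>x. 0) y = 0" using ev_le_H1_norm[OF zero_H1, of y] by (simp add: H1_norm_zero)
    have "(\<lambda>k. cnj (ev (cj (x (\<sigma> (\<rho> k))) (s (\<sigma> (\<rho> k))) \<psi>) y)) \<longlonglongrightarrow> cnj (ev (\<lambda>x. 0) y)"
      using \<rho>(2)[unfolded weakly_converges_H1_def, rule_format, OF ev_Hm1[of y]] .
    from tendsto_cnj[OF this] have "(\<lambda>k. ev (cj (x (\<sigma> (\<rho> k))) (s (\<sigma> (\<rho> k))) \<psi>) y) \<longlonglongrightarrow> 0" by (simp add: ev0)
    from LIMSEQ_subseq_LIMSEQ[OF this l(2)] show "(\<lambda>k. ev (f k) y) \<longlonglongrightarrow> 0" by (simp add: o_def f_def)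
  qed
  from order_tendstoD(2)[OF this e(1)] obtain k where "Lr r (f k) < e"
    using eventually_happens by force
  then show False using \<sigma>(3) by (simp add: f_def)
qed

text \<open>Diverging times make the functions small in L^r. Otherwise the times converge along
  \<open>G\<close>, A4 gives a strong limit, and the positions carry this fixed function to
  infinity.\<close>

lemma wconv_far:
  assumes r: "r > 2" and A5: "assumption_A5 r U" and \<psi>: "\<psi> \<in> H1"
    and far: "filterlim (\<lambda>n. \<bar>s n\<bar> + \<bar>y n\<bar>) at_top G"
  shows "wconv G (\<lambda>n. translate (y n) (cj (x n) (s n) \<psi>)) (\<lambda>x. 0)"
proof (cases "filterlim (\<lambda>n. \<bar>s n\<bar>) at_top G")
  case True
  have "((\<lambda>n. Lr r (translate (y n) (cj (x n) (s n) \<psi>))) \<longlongrightarrow> 0) G"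
    unfolding Lr_translate by (rule A5_limit[OF r A5 \<psi> True])
  then show ?thesis by (intro wconv_of_Lr_tendsto_0[OF Gu r] bddH_translate bddH_cj bddH_const \<psi>)
next
  case False
  then obtain sb where s: "(s \<longlongrightarrow> sb) G" using ultra_not_tendsto_abs_at_top[OF Gu] by blast
  obtain l where l: "l \<in> H1" "((\<lambda>n. H1_norm (\<lambda>z. cj (x n) (s n) \<psi> z - l z)) \<longlongrightarrow> 0) G"
    using A4_limit[OF \<psi> s] by blast
  have y: "filterlim (\<lambda>n. \<bar>y n\<bar>) at_top G"
  proof -
    have "((\<lambda>n. - \<bar>s n\<bar>) \<longlongrightarrow> - \<bar>sb\<bar>) G" by (intro tendsto_intros s)
    from filterlim_tendsto_add_at_top[OF this far] show ?thesis by simp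
  qed
  show ?thesis
  proof (rule wconv_strong[OF wconv_translate_infinity[OF Gu l(1) y]])
    show "translate (y n) (cj (x n) (s n) \<psi>) \<in> H1" for n by (intro H1_translate cj_H1 \<psi>)
    show "translate (y n) l \<in> H1" for n by (intro H1_translate l)
    have "H1_norm (\<lambda>z. translate (y n) (cj (x n) (s n) \<psi>) z - translate (y n) l z) = H1_norm (\<lambda>z. cj (x n) (s n) \<psi> z - l z)" for n
      using H1_translate(2)[OF HH.diff_in[OF cj_H1[OF \<psi>] l(1)], of "y n" "x n" "s n"] by (simp add: translate_def)
    then show "((\<lambda>n. H1_norm (\<lambda>z. translate (y n) (cj (x n) (s n) \<psi>) z - translate (y n) l z)) \<longlongrightarrow> 0) G"
      using l(2) by simp
  qed
qed

text \<open>The evolution is moved by adjunction from the weakly converging \<open>w n\<close> to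
  the fixed vector \<open>\<psi>'\<close>, where A4 provides a strong limit \<open>p\<close> of the
  same norm. Then the squared norm of \<open>\<psi>'\<close> is the inner product of
  \<open>\<psi>\<close> and \<open>p\<close>, and Cauchy-Schwarz concludes. The positions
  \<open>x n\<close> may be arbitrary.\<close>

lemma cj_wlim:
  assumes w: "bddH w" "wconv G w \<psi>" "\<psi> \<in> H1" and s: "(s \<longlongrightarrow> sb) G"
    and w': "wconv G (\<lambda>n. cj (x n) (s n) (w n)) \<psi>'" "\<psi>' \<in> H1"
  shows "Lp_norm 2 \<psi>' \<le> Lp_norm 2 \<psi>"
proof -
  have ms: "((\<lambda>n. - s n) \<longlongrightarrow> - sb) G" by (intro tendsto_intros s)
  obtain p where p: "p \<in> H1" "((\<lambda>n. H1_norm (\<lambda>z. cj (x n) (- s n) \<psi>' z - p z)) \<longlongrightarrow> 0) G"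
    using A4_limit[OF w'(2) ms] by blast
  note L = H1_Lp2[OF w'(2)] H1_Lp2[OF p(1)] H1_Lp2[OF w(3)]
  obtain K where K: "K \<ge> 0" "\<And>n. H1_norm (w n) \<le> K" using bddH_ex[OF w(1)] by blast
  have wL: "w n \<in> Lp 2" for n by (rule H1_Lp2[OF bddH_D[OF w(1)]])
  let ?c = "\<lambda>n. cj (x n) (- s n) \<psi>'"
  have np: "Lp_norm 2 p = Lp_norm 2 \<psi>'"
  proof -
    have "((\<lambda>n. Lp_norm 2 (?c n) - Lp_norm 2 p) \<longlongrightarrow> 0) G"
    proof (rule Lim_null_comparison[OF _ p(2)], rule always_eventually, rule allI)
      fix n
      have "\<bar>Lp_norm 2 (?c n) - Lp_norm 2 p\<bar> \<le> Lp_norm 2 (\<lambda>z. ?c n z - p z)"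
        using L2.nrm_le[OF cj_Lp2[OF L(1)] L(2), of "x n" "- s n"] L2.nrm_le[OF L(2) cj_Lp2[OF L(1)], of "x n" "- s n"]
          L2.nrm_diff_commute[OF L(2) cj_Lp2[OF L(1)], of "x n" "- s n"] by simp
      then show "norm (Lp_norm 2 (?c n) - Lp_norm 2 p) \<le> H1_norm (\<lambda>z. ?c n z - p z)"
        using L2_norm_le_H1_norm[of "\<lambda>z. ?c n z - p z"] by simp
    qed
    then have "((\<lambda>n. Lp_norm 2 \<psi>' - Lp_norm 2 p) \<longlongrightarrow> 0) G" by (simp add: cj_norm[OF L(1)])
    from tendsto_unique[OF Gb tendsto_const this] show ?thesis by simp
  qed
  have "((\<lambda>n. L2_inner (w n) (?c n) - L2_inner (w n) p) \<longlongrightarrow> 0) G"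
  proof (rule Lim_null_comparison)
    have "norm (L2_inner (w n) (?c n) - L2_inner (w n) p) \<le> K * H1_norm (\<lambda>z. ?c n z - p z)" for n
    proof -
      have d: "(\<lambda>z. ?c n z - p z) \<in> Lp 2" by (rule L2.diff_in[OF cj_Lp2[OF L(1)] L(2)])
      have "L2_inner (w n) (?c n) - L2_inner (w n) p = L2_inner (w n) (\<lambda>z. ?c n z - p z)"
        using L2.ip_lin2[OF cj_Lp2[OF L(1)] L(2) wL, where a = 1 and b = "-1"] by simp
      also have "cmod \<dots> \<le> Lp_norm 2 (w n) * Lp_norm 2 (\<lambda>z. ?c n z - p z)" by (rule L2.cauchy_schwarz[OF wL d])
      also have "\<dots> \<le> K * H1_norm (\<lambda>z. ?c n z - p z)"
        using K(2)[of n] L2_norm_le_H1_norm[of "w n"]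
        by (intro mult_mono L2_norm_le_H1_norm K Lp2_norm_nonneg) auto
      finally show ?thesis .
    qed
    then show "\<forall>\<^sub>F n in G. norm (L2_inner (w n) (?c n) - L2_inner (w n) p) \<le> K * H1_norm (\<lambda>z. ?c n z - p z)" by simp
    show "((\<lambda>n. K * H1_norm (\<lambda>z. ?c n z - p z)) \<longlongrightarrow> 0) G" using tendsto_mult_right_zero[OF p(2)] .
  qed
  from tendsto_add[OF this wconv_inner[OF w(2,1,3) L(2)]]
  have "((\<lambda>n. L2_inner (w n) (?c n)) \<longlongrightarrow> L2_inner \<psi> p) G" by simp
  moreover have "((\<lambda>n. L2_inner (cj (x n) (s n) (w n)) \<psi>') \<longlongrightarrow> L2_inner \<psi>' \<psi>') G"
    by (rule wconv_inner[OF w'(1) bddH_cj[OF w(1)] w'(2) L(1)])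
  ultimately have "L2_inner \<psi>' \<psi>' = L2_inner \<psi> p"
    unfolding cj_adj[OF wL L(1)] by (rule tendsto_unique[OF Gb, rotated])
  then have "(Lp_norm 2 \<psi>')\<^sup>2 = cmod (L2_inner \<psi> p)"
    unfolding L2.ip_self[OF L(1)] by (metis abs_of_nonneg norm_of_real zero_le_power2)
  also have "\<dots> \<le> Lp_norm 2 \<psi> * Lp_norm 2 \<psi>'" using L2.cauchy_schwarz[OF L(3,2)] np by simp
  finally show ?thesis
    using Lp2_norm_nonneg[of \<psi>'] Lp2_norm_nonneg[of \<psi>] by (simp add: power2_eq_square mult_le_cancel_right) force
qed

lemma far_or_close:
  fixes t t' x x' :: "nat \<Rightarrow> real"
  obtains "filterlim (\<lambda>n. \<bar>t' n - t n\<bar> + \<bar>x' n - x n\<bar>) at_top G"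
  | sb yb where "((\<lambda>n. t' n - t n) \<longlongrightarrow> sb) G" "((\<lambda>n. x n - x' n) \<longlongrightarrow> yb) G"
proof (cases "filterlim (\<lambda>n. \<bar>t' n - t n\<bar> + \<bar>x' n - x n\<bar>) at_top G")
  case False
  have "(\<lambda>n. \<bar>\<bar>t' n - t n\<bar> + \<bar>x' n - x n\<bar>\<bar>) = (\<lambda>n. \<bar>t' n - t n\<bar> + \<bar>x' n - x n\<bar>)" by auto
  with False obtain l where "((\<lambda>n. \<bar>t' n - t n\<bar> + \<bar>x' n - x n\<bar>) \<longlongrightarrow> l) G"
    using ultra_not_tendsto_abs_at_top[OF Gu, of "\<lambda>n. \<bar>t' n - t n\<bar> + \<bar>x' n - x n\<bar>"] by auto
  from order_tendstoD(2)[OF this, of "l + 1"]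
  have ev: "eventually (\<lambda>n. \<bar>t' n - t n\<bar> + \<bar>x' n - x n\<bar> < l + 1) G" by simp
  have e1: "eventually (\<lambda>n. norm (t' n - t n) \<le> l + 1) G" and e2: "eventually (\<lambda>n. norm (x n - x' n) \<le> l + 1) G"
    using ev by (auto elim!: eventually_mono)
  then obtain sb yb where "((\<lambda>n. t' n - t n) \<longlongrightarrow> sb) G" "((\<lambda>n. x n - x' n) \<longlongrightarrow> yb) G"
    using ultra_bounded_tendsto[OF Gu e1] ultra_bounded_tendsto[OF Gu e2] by blast
  then show ?thesis by (rule that(2))
qed (rule that(1))

text \<open>This comparison has two uses: it lets converging parameters be replaced by 0 without
  loss of norm, and it shows that parameters close to those of a vanishing limit see
  nothing.\<close>

lemma close_norm_le:
  assumes w: "bddH w" and c: "((\<lambda>n. t' n - t n) \<longlongrightarrow> sb) G" "((\<lambda>n. x n - x' n) \<longlongrightarrow> yb) G"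
    and l: "wconv G (\<lambda>n. sh (x n) (t n) (w n)) \<psi>" "\<psi> \<in> H1"
    and l': "wconv G (\<lambda>n. sh (x' n) (t' n) (w n)) \<psi>'" "\<psi>' \<in> H1"
  shows "Lp_norm 2 \<psi>' \<le> Lp_norm 2 \<psi>"
proof -
  let ?v = "\<lambda>n. cj (x n) (t' n - t n) (sh (x n) (t n) (w n))"
  have bv: "bddH ?v" by (intro bddH_cj bddH_sh w)
  obtain q where q: "q \<in> H1" "wconv G ?v q" using wconv_exists[OF Gu bv] by blast
  have le: "Lp_norm 2 q \<le> Lp_norm 2 \<psi>" by (rule cj_wlim[OF bddH_sh[OF w] l c(1) q(2,1)])
  have "wconv G (\<lambda>n. translate (x n - x' n) (?v n)) (translate yb q)"
    by (rule wconv_translate[OF Gu q(2) bv q(1) c(2)])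
  then have "wconv G (\<lambda>n. sh (x' n) (t' n) (w n)) (translate yb q)"
  proof (rule wconv_cong)
    fix n
    show "translate (x n - x' n) (?v n) \<in> H1" by (rule H1_translate(1)[OF bddH_D[OF bv]])
    show "sh (x' n) (t' n) (w n) \<in> H1" by (rule sh_H1[OF bddH_D[OF w]])
    show "AE y in lborel. translate (x n - x' n) (?v n) y = sh (x' n) (t' n) (w n) y"
      using sh_change[OF H1_Lp2[OF bddH_D[OF w]], of "x' n" "t' n" n "x n" "t n"] by eventually_elim simp
  qed (use H1_translate(1)[OF q(1)] in auto)
  then have "AE y in lborel. \<psi>' y = translate yb q y"
    by (rule wconv_unique[OF Gb bddH_sh[OF w] l'(2) H1_translate(1)[OF q(1)] l'(1)])
  then have "Lp_norm 2 \<psi>' = Lp_norm 2 (translate yb q)"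
    by (rule Lp2_norm_cong_AE[OF H1_Lp2[OF l'(2)] H1_Lp2[OF H1_translate(1)[OF q(1)]]])
  with le show ?thesis by (simp add: translate_L2_norm)
qed

section \<open>Nearly maximal weak limits and the choice of parameters\<close>

definition wlims :: "(nat \<Rightarrow> cfun) \<Rightarrow> cfun set" where
  "wlims w = {\<psi> \<in> H1. \<exists>x t. wconv G (\<lambda>n. sh (x n) (t n) (w n)) \<psi>}"

definition lam :: "(nat \<Rightarrow> cfun) \<Rightarrow> real" where "lam w = (SUP \<psi>\<in>wlims w. Lp_norm 2 \<psi>)"

lemma wlims_I: "\<psi> \<in> H1 \<Longrightarrow> wconv G (\<lambda>n. sh (x n) (t n) (w n)) \<psi> \<Longrightarrow> \<psi> \<in> wlims w"
  unfolding wlims_def by (intro CollectI conjI exI[of _ x] exI[of _ t])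

lemma wlims_norm:
  assumes w: "bddH w" and K: "\<And>n. H1_norm (w n) \<le> K" and \<psi>: "\<psi> \<in> wlims w"
  shows "Lp_norm 2 \<psi> \<le> C2 * K"
proof -
  obtain x t where p: "\<psi> \<in> H1" "wconv G (\<lambda>n. sh (x n) (t n) (w n)) \<psi>" using \<psi> by (auto simp: wlims_def)
  have b: "H1_norm (sh (x n) (t n) (w n)) \<le> C2 * K" for n
    using U_H1_norm[OF bddH_D[OF w], of "t n" n] mult_left_mono[OF K[of n] C2_nonneg]
    by (simp add: sh_def H1_translate U_H1[OF bddH_D[OF w]])
  obtain k where k: "((\<lambda>n. H1_norm (sh (x n) (t n) (w n))) \<longlongrightarrow> k) G"
    using ultra_bounded_tendsto[OF Gu, of "\<lambda>n. H1_norm (sh (x n) (t n) (w n))" "C2 * K"] b by (auto simp: H1_norm_nonneg)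
  have "H1_norm \<psi> \<le> k" by (rule wconv_norm_le[OF Gb p(2) bddH_sh[OF w] p(1) k])
  moreover have "k \<le> C2 * K" by (rule tendsto_le[OF Gb tendsto_const k]) (simp add: b)
  ultimately show ?thesis using L2_norm_le_H1_norm[of \<psi>] by linarith
qed

lemma wlims_bdd: assumes "bddH w" shows "bdd_above (Lp_norm 2 ` wlims w)"
proof -
  obtain K where K: "\<And>n. H1_norm (w n) \<le> K" using bddH_ex[OF assms] by blast
  show ?thesis using wlims_norm[OF assms K] by (intro bdd_aboveI2[where M = "C2 * K"])
qed

lemma wlims_ex: assumes "bddH w" shows "\<exists>\<psi>\<in>H1. wconv G (\<lambda>n. sh (x n) (t n) (w n)) \<psi>"
  by (rule wconv_exists[OF Gu bddH_sh[OF assms]])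

lemma wlims_nonempty: assumes "bddH w" shows "wlims w \<noteq> {}"
proof -
  obtain \<psi> where "\<psi> \<in> H1" "wconv G (\<lambda>n. sh 0 0 (w n)) \<psi>" using wlims_ex[OF assms, of "\<lambda>n. 0" "\<lambda>n. 0"] by blast
  then have "\<psi> \<in> wlims w" by (rule wlims_I[where x = "\<lambda>n. 0" and t = "\<lambda>n. 0"])
  then show ?thesis by blast
qed

lemma lam_upper: assumes "bddH w" "\<psi> \<in> H1" "wconv G (\<lambda>n. sh (x n) (t n) (w n)) \<psi>" shows "Lp_norm 2 \<psi> \<le> lam w"
  unfolding lam_def by (rule cSUP_upper[OF wlims_I[OF assms(2,3)] wlims_bdd[OF assms(1)]])

lemma lam_nonneg: assumes "bddH w" shows "0 \<le> lam w"
proof -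
  obtain \<psi> where "\<psi> \<in> H1" "wconv G (\<lambda>n. sh 0 0 (w n)) \<psi>" using wlims_ex[OF assms, of "\<lambda>n. 0" "\<lambda>n. 0"] by blast
  then show ?thesis using lam_upper[OF assms, where \<psi> = \<psi> and x = "\<lambda>n. 0" and t = "\<lambda>n. 0"] Lp2_norm_nonneg[of \<psi>] by simp
qed

text \<open>The analogue of \<open>standard_seq\<close> along \<open>G\<close>; it becomes genuine
  standardness on the subsequence selected at the end.\<close>

definition gstd :: "(nat \<Rightarrow> real) \<Rightarrow> bool" where
  "gstd t \<longleftrightarrow> filterlim t at_top G \<or> filterlim t at_bot G \<or> (\<forall>n. t n = 0)"

lemma gstd_approx: obtains t' l where "gstd t'" "((\<lambda>n. t n - t' n) \<longlongrightarrow> l) G"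
proof (cases rule: ultra_tendsto_cases[OF Gu, of t])
  case 1 then show ?thesis using that[of t 0] by (simp add: gstd_def)
next
  case 2 then show ?thesis using that[of t 0] by (simp add: gstd_def)
next
  case (3 l) then show ?thesis using that[of "\<lambda>n. 0" l] by (simp add: gstd_def)
qed

text \<open>The vanishing limits at the earlier parameters drive the new parameters away from them:
  near one of them, \<open>close_norm_le\<close> would make the new limit null, although its norm is
  at least half of \<open>lam w\<close>.\<close>

lemma extraction:
  assumes w: "bddH w" and fin: "finite S"
    and S: "\<And>j. j \<in> S \<Longrightarrow> wconv G (\<lambda>n. sh (xs j n) (ts j n) (w n)) (\<lambda>x. 0)"
  shows "\<exists>\<psi> x t. \<psi> \<in> H1 \<and> gstd x \<and> gstd t \<and> wconv G (\<lambda>n. sh (x n) (t n) (w n)) \<psi> \<and>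
    lam w \<le> 2 * Lp_norm 2 \<psi> \<and> (\<forall>j\<in>S. filterlim (\<lambda>n. \<bar>t n - ts j n\<bar> + \<bar>x n - xs j n\<bar>) at_top G)"
proof (cases "lam w > 0")
  case True
  then have "lam w / 2 < (SUP \<psi>\<in>wlims w. Lp_norm 2 \<psi>)" by (simp flip: lam_def)
  then obtain p where "p \<in> wlims w" "lam w / 2 < Lp_norm 2 p"
    using less_cSUP_iff[OF wlims_nonempty[OF w] wlims_bdd[OF w]] by blast
  then obtain x0 t0 where p: "p \<in> H1" "wconv G (\<lambda>n. sh (x0 n) (t0 n) (w n)) p" "lam w / 2 < Lp_norm 2 p"
    by (auto simp: wlims_def)
  obtain t lt where t: "gstd t" "((\<lambda>n. t0 n - t n) \<longlongrightarrow> lt) G" by (rule gstd_approx)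
  obtain x lx where x: "gstd x" "((\<lambda>n. x0 n - x n) \<longlongrightarrow> lx) G" by (rule gstd_approx)
  have x': "((\<lambda>n. x n - x0 n) \<longlongrightarrow> - lx) G" using tendsto_minus[OF x(2)] by simp
  obtain \<psi> where \<psi>: "\<psi> \<in> H1" "wconv G (\<lambda>n. sh (x n) (t n) (w n)) \<psi>" using wlims_ex[OF w] by blast
  have "Lp_norm 2 p \<le> Lp_norm 2 \<psi>" by (rule close_norm_le[OF w t(2) x' \<psi>(2,1) p(2,1)])
  with p(3) have big: "lam w < 2 * Lp_norm 2 \<psi>" by simp
  have "filterlim (\<lambda>n. \<bar>t n - ts j n\<bar> + \<bar>x n - xs j n\<bar>) at_top G" if j: "j \<in> S" for j
  proof (rule far_or_close[of t "ts j" x "xs j"])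
    fix sb yb assume c: "((\<lambda>n. t n - ts j n) \<longlongrightarrow> sb) G" "((\<lambda>n. xs j n - x n) \<longlongrightarrow> yb) G"
    have "Lp_norm 2 \<psi> \<le> Lp_norm 2 (\<lambda>x. 0)" by (rule close_norm_le[OF w c S[OF j] zero_H1 \<psi>(2,1)])
    then have "Lp_norm 2 \<psi> \<le> 0" by (simp add: Lp2_norm_eq)
    with big True show ?thesis by simp
  qed
  with big \<psi> x(1) t(1) show ?thesis by (intro exI[of _ \<psi>] exI[of _ x] exI[of _ t]) auto
next
  case False
  then have l0: "lam w = 0" using lam_nonneg[OF w] by simp
  \<comment> \<open>The new profile is null here, but its parameters must still diverge from all
    earlier ones; the sum makes \<open>t n\<close> exceed each \<open>\<bar>ts j n\<bar>\<close> by
    at least \<open>n\<close>.\<close>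
  define t where "t = (\<lambda>n. real n + (\<Sum>j\<in>S. \<bar>ts j n\<bar>))"
  have rt: "filterlim (\<lambda>n. real n) at_top G" by (rule filterlim_mono[OF filterlim_real_sequentially order_refl Gs])
  have "filterlim t at_top G"
    by (rule filterlim_at_top_mono[OF rt]) (auto simp: t_def intro!: always_eventually sum_nonneg)
  moreover have "filterlim (\<lambda>n. \<bar>t n - ts j n\<bar> + \<bar>0 - xs j n\<bar>) at_top G" if j: "j \<in> S" for j
  proof (rule filterlim_at_top_mono[OF rt], rule always_eventually, rule allI)
    fix n
    have "\<bar>ts j n\<bar> \<le> (\<Sum>j\<in>S. \<bar>ts j n\<bar>)" by (rule member_le_sum[OF j _ fin]) simp
    then show "real n \<le> \<bar>t n - ts j n\<bar> + \<bar>0 - xs j n\<bar>" by (simp add: t_def)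
  qed
  moreover obtain \<psi> where "\<psi> \<in> H1" "wconv G (\<lambda>n. sh 0 (t n) (w n)) \<psi>" using wlims_ex[OF w, of "\<lambda>n. 0" t] by blast
  ultimately show ?thesis
    using l0 Lp2_norm_nonneg[of \<psi>] by (intro exI[of _ \<psi>] exI[of _ "\<lambda>n. 0"] exI[of _ t]) (auto simp: gstd_def)
qed

end

subsection \<open>Brezis-Lieb splitting and the supremum norm\<close>

text \<open>The elementary inequality behind the theorem of Brezis and Lieb. If
  \<open>cmod b\<close> is at most \<open>d\<close> times \<open>cmod a\<close>, continuity of the
  power at 1 gives the error \<open>e\<close>; otherwise both powers are dominated by that of
  \<open>b\<close>.\<close>

lemma powr_perturbation:
  assumes r: "r > 1" and e: "e > (0::real)"
  shows "\<exists>C\<ge>0. \<forall>a b :: complex. \<bar>cmod (a + b) powr r - cmod a powr r\<bar> \<le> e * cmod a powr r + C * cmod b powr r"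
proof -
  have "((\<lambda>d. (1 + d) powr r) \<longlongrightarrow> (1 + 0) powr r) (at_right 0)"
    "((\<lambda>d. (1 - d) powr r) \<longlongrightarrow> (1 - 0) powr r) (at_right 0)"
    by (intro tendsto_intros; simp)+
  then have "eventually (\<lambda>d. (1 + d) powr r < 1 + e) (at_right 0)" "eventually (\<lambda>d. (1 - d) powr r > 1 - e) (at_right 0)"
    using e by (auto intro: order_tendstoD)
  moreover have "eventually (\<lambda>d::real. 0 < d) (at_right 0)" by (simp add: eventually_at_right_less)
  moreover have "eventually (\<lambda>d::real. d < 1) (at_right 0)" by (rule eventually_at_right_real[THEN eventually_mono]) auto
  ultimately have "eventually (\<lambda>d::real. 0 < d \<and> d < 1 \<and> (1 + d) powr r < 1 + e \<and> (1 - d) powr r > 1 - e) (at_right 0)"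
    by eventually_elim auto
  then obtain d :: real where d: "0 < d" "d < 1" "(1 + d) powr r < 1 + e" "(1 - d) powr r > 1 - e"
    using eventually_happens[of _ "at_right (0::real)"] by (auto simp: trivial_limit_at_right_real)
  define C where "C = (1 + 1 / d) powr r"
  have "\<bar>cmod (a + b) powr r - cmod a powr r\<bar> \<le> e * cmod a powr r + C * cmod b powr r" for a b :: complex
  proof (cases "cmod b \<le> d * cmod a")
    case True
    have "cmod (a + b) \<le> (1 + d) * cmod a" using True norm_triangle_ineq[of a b] by (simp add: algebra_simps)
    then have "cmod (a + b) powr r \<le> ((1 + d) * cmod a) powr r" using r by (intro powr_mono2) auto
    also have "\<dots> = (1 + d) powr r * cmod a powr r" using d by (simp add: powr_mult)
    also have "\<dots> \<le> (1 + e) * cmod a powr r" using d by (intro mult_right_mono) auto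
    finally have 1: "cmod (a + b) powr r \<le> (1 + e) * cmod a powr r" .
    have "(1 - d) * cmod a \<le> cmod (a + b)" using True norm_triangle_ineq2[of a "- b"] by (simp add: algebra_simps)
    then have "((1 - d) * cmod a) powr r \<le> cmod (a + b) powr r" using r d by (intro powr_mono2) auto
    moreover have "((1 - d) * cmod a) powr r = (1 - d) powr r * cmod a powr r" using d by (simp add: powr_mult)
    moreover have "(1 - e) * cmod a powr r \<le> (1 - d) powr r * cmod a powr r" using d by (intro mult_right_mono) auto
    ultimately have 2: "(1 - e) * cmod a powr r \<le> cmod (a + b) powr r" by linarith
    have "0 \<le> C * cmod b powr r" by (simp add: C_def)
    with 1 2 show ?thesis by (simp add: abs_le_iff algebra_simps)
  next
    case False
    then have ab: "cmod a \<le> cmod b / d" using d by (simp add: field_simps)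
    have le: "(1 + 1 / d) * cmod b = cmod b + cmod b / d" by (simp add: algebra_simps)
    have "cmod (a + b) \<le> (1 + 1 / d) * cmod b" "cmod a \<le> (1 + 1 / d) * cmod b"
      unfolding le using ab norm_triangle_ineq[of a b] norm_ge_zero[of b] by linarith+
    then have "cmod (a + b) powr r \<le> ((1 + 1 / d) * cmod b) powr r" "cmod a powr r \<le> ((1 + 1 / d) * cmod b) powr r"
      using r by (auto intro!: powr_mono2)
    moreover have "((1 + 1 / d) * cmod b) powr r = C * cmod b powr r" using d by (simp add: C_def powr_mult)
    moreover have "0 \<le> e * cmod a powr r" using e by simp
    moreover have "0 \<le> cmod (a + b) powr r" "0 \<le> cmod a powr r" by auto
    ultimately show ?thesis by linarith
  qed
  moreover have "C \<ge> 0" by (simp add: C_def)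
  ultimately show ?thesis by blast
qed

lemma Lr_perturbation:
  assumes r: "r > 2" and f: "f \<in> H1" and g: "g \<in> H1" and h: "h \<in> H1" and hfg: "\<And>x. h x = f x + g x"
    and C: "\<And>a b :: complex. \<bar>cmod (a + b) powr r - cmod a powr r\<bar> \<le> e * cmod a powr r + C * cmod b powr r"
  shows "\<bar>Lr r h - Lr r f\<bar> \<le> e * Lr r f + C * Lr r g"
proof -
  note i = H1_Lr_integrable[OF r]
  have "Lr r h - Lr r f = (LINT x|lborel. cmod (h x) powr r - cmod (f x) powr r)"
    unfolding Lr_def using i[OF h] i[OF f] by simp
  also have "\<bar>\<dots>\<bar> \<le> (LINT x|lborel. \<bar>cmod (h x) powr r - cmod (f x) powr r\<bar>)"
    by (rule integral_abs_bound)
  also have "\<dots> \<le> (LINT x|lborel. e * cmod (f x) powr r + C * cmod (g x) powr r)"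
    using i[OF f] i[OF g] i[OF h] by (intro integral_mono) (auto simp: hfg intro: C)
  also have "\<dots> = e * Lr r f + C * Lr r g" using i[OF f] i[OF g] by (simp add: Lr_def)
  finally show ?thesis .
qed

lemma Lr_bounded: assumes "r > 2" "bddH w" shows "\<exists>K>0. \<forall>n. Lr r (w n) \<le> K"
proof -
  obtain K where K: "K \<ge> 0" "\<And>n. H1_norm (w n) \<le> K" using bddH_ex[OF assms(2)] by blast
  have "Lr r (w n) \<le> (2 * K) powr (r - 2) * K\<^sup>2 + 1" for n
  proof -
    have "Lr r (w n) \<le> (2 * H1_norm (w n)) powr (r - 2) * (H1_norm (w n))\<^sup>2"
      by (rule H1_Lr_le[OF assms(1) bddH_D[OF assms(2)]])
    also have "\<dots> \<le> (2 * K) powr (r - 2) * K\<^sup>2"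
      using K assms(1) H1_norm_nonneg[of "w n"] by (intro mult_mono powr_mono2 power_mono) auto
    finally show ?thesis by simp
  qed
  moreover have "(2 * K) powr (r - 2) * K\<^sup>2 + 1 > 0" by (simp add: add_nonneg_pos)
  ultimately show ?thesis by blast
qed

lemma brezis_lieb:
  assumes r: "r > 2" and f: "bddH f" and b: "b \<in> H1" and lim: "\<And>x. (\<lambda>k. ev (f k) x) \<longlonglongrightarrow> ev b x"
  shows "(\<lambda>k. Lr r (f k) - Lr r (\<lambda>x. f k x - b x) - Lr r b) \<longlonglongrightarrow> 0"
proof (rule LIMSEQ_I)
  fix \<epsilon> :: real assume eps: "\<epsilon> > 0"
  define a where "a = (\<lambda>k x. f k x - b x)"
  have ba: "bddH a" unfolding a_def by (rule bddH_diff[OF f bddH_const[OF b]])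
  note fH = bddH_D[OF f] and aH = bddH_D[OF ba]
  note i = H1_Lr_integrable[OF r]
  note [measurable] = Lp2_measurable[OF H1_Lp2[OF fH]] Lp2_measurable[OF H1_Lp2[OF aH]] Lp2_measurable[OF H1_Lp2[OF b]]
  obtain K where K: "K > 0" "\<And>k. Lr r (a k) \<le> K" using Lr_bounded[OF r ba] by blast
  define e where "e = \<epsilon> / (2 * K)"
  have e: "e > 0" "e * K = \<epsilon> / 2" using eps K by (auto simp: e_def)
  obtain C where C: "C \<ge> 0" "\<And>a b :: complex. \<bar>cmod (a + b) powr r - cmod a powr r\<bar> \<le> e * cmod a powr r + C * cmod b powr r"
    using powr_perturbation[of r e] r e by auto
  define W where "W = (\<lambda>k x. \<bar>cmod (f k x) powr r - cmod (a k x) powr r - cmod (b x) powr r\<bar>)"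
  \<comment> \<open>The excess of \<open>W\<close> over \<open>e * cmod (a k x) powr r\<close> is
    dominated by a multiple of the fixed function \<open>cmod (b x) powr r\<close>, so dominated
    convergence applies to it. The part cut off has integral at most half of the tolerance.\<close>
  define V where "V = (\<lambda>k x. max 0 (W k x - e * cmod (a k x) powr r))"
  have [measurable]: "W k \<in> borel_measurable borel" "V k \<in> borel_measurable borel" for k
    unfolding W_def V_def by measurable
  have Vb: "0 \<le> V k x" "V k x \<le> (C + 1) * cmod (b x) powr r" for k x
  proof -
    have "W k x \<le> \<bar>cmod (a k x + b x) powr r - cmod (a k x) powr r\<bar> + cmod (b x) powr r"
      using abs_triangle_ineq4[of "cmod (f k x) powr r - cmod (f k x - b x) powr r" "cmod (b x) powr r"]
      by (simp add: W_def a_def)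
    also have "\<dots> \<le> e * cmod (a k x) powr r + C * cmod (b x) powr r + cmod (b x) powr r" using C(2) by simp
    finally show "V k x \<le> (C + 1) * cmod (b x) powr r" using C(1) by (simp add: V_def algebra_simps)
  qed (simp add: V_def)
  have "(\<lambda>k. LINT x|lborel. V k x) \<longlonglongrightarrow> (LINT x|(lborel :: real measure). (0::real))"
  proof (rule integral_dominated_convergence)
    show "integrable lborel (\<lambda>x. (C + 1) * cmod (b x) powr r)" using i[OF b] by simp
    show "AE x in lborel. norm (V k x) \<le> (C + 1) * cmod (b x) powr r" for k using Vb by simp
    have "AE x in lborel. \<forall>k. f k x = ev (f k) x" unfolding AE_all_countable using ev_AE[OF fH] by blast
    then show "AE x in lborel. (\<lambda>k. V k x) \<longlonglongrightarrow> 0"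
      using ev_AE[OF b]
    proof eventually_elim
      case (elim x)
      have fl: "(\<lambda>k. f k x) \<longlonglongrightarrow> b x" using lim[of x] elim by simp
      have "(\<lambda>k. cmod (f k x)) \<longlonglongrightarrow> cmod (b x)" by (intro tendsto_intros fl)
      then have 1: "(\<lambda>k. cmod (f k x) powr r) \<longlonglongrightarrow> cmod (b x) powr r"
        by (intro tendsto_powr') (use r in auto)
      have "(\<lambda>k. cmod (a k x)) \<longlonglongrightarrow> cmod (b x - b x)" unfolding a_def by (intro tendsto_intros fl)
      then have "(\<lambda>k. cmod (a k x) powr r) \<longlonglongrightarrow> cmod (b x - b x) powr r"
        by (intro tendsto_powr') (use r in auto)
      then have 2: "(\<lambda>k. cmod (a k x) powr r) \<longlonglongrightarrow> 0" by simp
      have "(\<lambda>k. V k x) \<longlonglongrightarrow> max 0 (\<bar>cmod (b x) powr r - 0 - cmod (b x) powr r\<bar> - e * 0)"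
        unfolding V_def W_def by (intro tendsto_intros 1 2)
      then show ?case by simp
    qed
  qed measurable
  then have V0: "(\<lambda>k. LINT x|lborel. V k x) \<longlonglongrightarrow> 0" by simp
  have Vi: "integrable lborel (V k)" for k
  proof (rule Bochner_Integration.integrable_bound)
    show "integrable lborel (\<lambda>x. (C + 1) * cmod (b x) powr r)" using i[OF b] by simp
    show "AE x in lborel. norm (V k x) \<le> norm ((C + 1) * cmod (b x) powr r)"
      using Vb by (intro AE_I2) (auto intro: order_trans[OF _ abs_ge_self])
  qed measurable
  have bound: "\<bar>Lr r (f k) - Lr r (a k) - Lr r b\<bar> \<le> (LINT x|lborel. V k x) + \<epsilon> / 2" for k
  proof -
    have "Lr r (f k) - Lr r (a k) - Lr r b = (LINT x|lborel. cmod (f k x) powr r - cmod (a k x) powr r - cmod (b x) powr r)"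
      unfolding Lr_def using i[OF fH] i[OF aH] i[OF b] by simp
    also have "\<bar>\<dots>\<bar> \<le> (LINT x|lborel. W k x)" unfolding W_def by (rule integral_abs_bound)
    also have "\<dots> \<le> (LINT x|lborel. V k x + e * cmod (a k x) powr r)"
    proof (rule integral_mono)
      show "integrable lborel (W k)" unfolding W_def using i[OF fH] i[OF aH] i[OF b] by simp
      show "integrable lborel (\<lambda>x. V k x + e * cmod (a k x) powr r)" using Vi i[OF aH] by simp
      show "W k x \<le> V k x + e * cmod (a k x) powr r" for x by (simp add: V_def)
    qed
    also have "\<dots> = (LINT x|lborel. V k x) + e * Lr r (a k)" using Vi i[OF aH] by (simp add: Lr_def)
    also have "e * Lr r (a k) \<le> \<epsilon> / 2" using mult_left_mono[OF K(2)[of k], of e] e by simp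
    finally show ?thesis by simp
  qed
  have "eventually (\<lambda>k. (LINT x|lborel. V k x) < \<epsilon> / 2) sequentially"
    by (rule order_tendstoD(2)[OF V0]) (use eps in simp)
  then obtain N where N: "\<And>k. k \<ge> N \<Longrightarrow> (LINT x|lborel. V k x) < \<epsilon> / 2" by (auto simp: eventually_sequentially)
  have "norm (Lr r (f k) - Lr r (\<lambda>x. f k x - b x) - Lr r b - 0) < \<epsilon>" if "k \<ge> N" for k
    using bound[of k] N[OF that] by (simp add: a_def)
  then show "\<exists>N. \<forall>k\<ge>N. norm (Lr r (f k) - Lr r (\<lambda>x. f k x - b x) - Lr r b - 0) < \<epsilon>" by blast
qed

text \<open>Bounded sequences in \<open>H1\<close> are equicontinuous, so countably many points
  suffice; a diagonal selection can handle only that many.\<close>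

lemma ev_tendsto_of_rat:
  assumes f: "bddH f" and b: "b \<in> H1" and lim: "\<And>q. (\<lambda>k. ev (f k) (real_of_rat q)) \<longlonglongrightarrow> ev b (real_of_rat q)"
  shows "(\<lambda>k. ev (f k) x) \<longlonglongrightarrow> ev b x"
proof (rule LIMSEQ_I)
  fix e :: real assume e: "e > 0"
  obtain K where K: "K \<ge> 0" "\<And>n. H1_norm (f n) \<le> K" using bddH_ex[OF f] by blast
  define K' where "K' = K + H1_norm b + 1"
  have K': "K' > 0" using K H1_norm_nonneg[of b] by (simp add: K'_def)
  have hold: "cmod (ev g y - ev g z) \<le> K' * sqrt \<bar>y - z\<bar>" if "g \<in> H1" "H1_norm g \<le> K'" for g y z
    using ev_holder[OF that(1), of y z] weak_deriv_norm_le_H1_norm[of g] that(2)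
    by (meson mult_right_mono order_trans real_sqrt_ge_zero abs_ge_zero)
  define d where "d = (e / (3 * K'))\<^sup>2"
  have d: "d > 0" using e K' by (simp add: d_def)
  obtain q where q: "x < real_of_rat q" "real_of_rat q < x + d" using of_rat_dense[of x "x + d"] d by auto
  let ?q = "real_of_rat q"
  have sq: "K' * sqrt \<bar>x - ?q\<bar> < e / 3"
  proof -
    have "sqrt \<bar>x - ?q\<bar> < sqrt d" using q by (intro real_sqrt_less_mono) auto
    also have "sqrt d = e / (3 * K')" using e K' by (simp add: d_def)
    finally show ?thesis using K' by (simp add: field_simps)
  qed
  obtain N where N: "\<And>k. k \<ge> N \<Longrightarrow> norm (ev (f k) ?q - ev b ?q) < e / 3"
    using LIMSEQ_D[OF lim[of q], of "e / 3"] e by auto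
  have "norm (ev (f k) x - ev b x) < e" if "k \<ge> N" for k
  proof -
    have fk: "H1_norm (f k) \<le> K'" "H1_norm b \<le> K'" using K(1) K(2)[of k] H1_norm_nonneg[of b] by (auto simp: K'_def)
    have "ev (f k) x - ev b x = (ev (f k) x - ev (f k) ?q) + (ev (f k) ?q - ev b ?q) + (ev b ?q - ev b x)" by simp
    also have "norm \<dots> \<le> norm (ev (f k) x - ev (f k) ?q) + norm (ev (f k) ?q - ev b ?q) + norm (ev b ?q - ev b x)"
      by (rule order_trans[OF norm_triangle_ineq add_right_mono[OF norm_triangle_ineq]])
    also have "\<dots> < e / 3 + e / 3 + e / 3"
      using hold[OF bddH_D[OF f] fk(1), of x ?q] hold[OF b fk(2), of ?q x] sq N[OF that]
      by (simp add: abs_minus_commute)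
    finally show ?thesis by simp
  qed
  then show "\<exists>N. \<forall>k\<ge>N. norm (ev (f k) x - ev b x) < e" by blast
qed

section \<open>The supremum norm in space and time\<close>

text \<open>A real-valued form of \<open>Linf_norm\<close>, with which it agrees on
  \<open>H1\<close> by \<open>Linf_norm_H1\<close>.\<close>

definition supev :: "cfun \<Rightarrow> real" where "supev f = (SUP x. cmod (ev f x))"

lemma supev_bdd: "f \<in> H1 \<Longrightarrow> bdd_above (range (\<lambda>x. cmod (ev f x)))"
  using ev_le_H1_norm by (intro bdd_aboveI2[where M = "2 * H1_norm f"]) auto

lemma supev_upper: "f \<in> H1 \<Longrightarrow> cmod (ev f x) \<le> supev f"
  unfolding supev_def by (rule cSUP_upper[OF UNIV_I supev_bdd])

lemma supev_le: "(\<And>x. cmod (ev f x) \<le> c) \<Longrightarrow> supev f \<le> c"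
  unfolding supev_def by (rule cSUP_least) auto

lemma supev_nonneg: "f \<in> H1 \<Longrightarrow> 0 \<le> supev f"
  using supev_upper[of f 0] norm_ge_zero order_trans by blast

lemma supev_diff_le:
  assumes f: "f \<in> H1" and g: "g \<in> H1"
  shows "\<bar>supev f - supev g\<bar> \<le> 2 * sqrt (Lp_norm 2 (\<lambda>x. f x - g x) * H1_norm (\<lambda>x. f x - g x))"
proof -
  let ?c = "2 * sqrt (Lp_norm 2 (\<lambda>x. f x - g x) * H1_norm (\<lambda>x. f x - g x))"
  have d: "cmod (ev f x - ev g x) \<le> ?c" for x
    using ev_bound[OF HH.diff_in[OF f g], of x] ev_lin[OF f g, of 1 "-1"] by simp
  have "cmod (ev f x) \<le> supev g + ?c" for x
    using d[of x] supev_upper[OF g, of x] norm_triangle_ineq2[of "ev f x" "ev g x"] by linarith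
  then have "supev f \<le> supev g + ?c" by (rule supev_le)
  moreover have "cmod (ev g x) \<le> supev f + ?c" for x
    using d[of x] supev_upper[OF f, of x] norm_triangle_ineq3[of "ev f x" "ev g x"] by linarith
  then have "supev g \<le> supev f + ?c" by (rule supev_le)
  ultimately show ?thesis by linarith
qed

text \<open>If the essential supremum were smaller, the continuous representative would exceed some
  intermediate level on a nonempty open set, and such a set is not null.\<close>

lemma Linf_norm_H1: assumes f: "f \<in> H1" shows "Linf_norm f = ereal (supev f)"
proof (rule antisym)
  have fm: "(\<lambda>x. ereal (cmod (f x))) \<in> borel_measurable lborel"
    using Lp2_measurable[OF H1_Lp2[OF f]] by simp
  show "Linf_norm f \<le> ereal (supev f)"
    unfolding Linf_norm_def
  proof (rule esssup_I[OF fm])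
    show "AE x in lborel. ereal (cmod (f x)) \<le> ereal (supev f)"
      using ev_AE[OF f] by eventually_elim (simp add: supev_upper[OF f])
  qed
  show "ereal (supev f) \<le> Linf_norm f"
  proof (rule ccontr)
    assume "\<not> ereal (supev f) \<le> Linf_norm f"
    then obtain c where c: "Linf_norm f < c" "c < ereal (supev f)" using ereal_dense2 by (metis not_le)
    have AEc: "AE x in lborel. ereal (cmod (f x)) < c"
      using esssup_AE[of "\<lambda>x. ereal (cmod (f x))" lborel] c(1) by (auto simp: Linf_norm_def elim!: eventually_mono)
    define S where "S = {x. ereal (cmod (ev f x)) > c}"
    have "open S" unfolding S_def
      using ev_cont[OF f] by (intro open_Collect_less continuous_intros continuous_on_ereal) auto
    moreover have "S \<noteq> {}"
    proof
      assume "S = {}"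
      then have le: "ereal (cmod (ev f x)) \<le> c" for x by (auto simp: S_def not_less)
      show False
      proof (cases c)
        case (real k)
        then have "supev f \<le> k" using le by (intro supev_le) simp
        then show ?thesis using c(2) real by simp
      qed (use c(2) le[of 0] in auto)
    qed
    moreover obtain N where "N \<in> null_sets lborel" "S \<subseteq> N"
    proof -
      have "AE x in lborel. x \<notin> S" using AEc ev_AE[OF f] by eventually_elim (auto simp: S_def)
      then show ?thesis using that by (auto simp: eventually_ae_filter)
    qed
    then have "negligible S"
      by (meson negligible_iff_null_sets negligible_subset null_sets_completionI)
    ultimately show False using open_not_negligible by blast
  qed
qed

context profile_setting
begin

lemma U_norm_diff: assumes "f \<in> Lp 2" shows "Lp_norm 2 (\<lambda>x. U (s + h) f x - U s f x) = Lp_norm 2 (\<lambda>x. U h f x - f x)"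
proof -
  note d = L2.diff_in[OF U_Lp2[OF assms, of h] assms]
  have "Lp_norm 2 (\<lambda>x. U (s + h) f x - U s f x) = Lp_norm 2 (U s (\<lambda>x. U h f x - f x))"
  proof (rule Lp2_norm_cong_AE)
    show "AE x in lborel. U (s + h) f x - U s f x = U s (\<lambda>x. U h f x - f x) x"
      using U_add[OF assms, of s h] U_diff[OF U_Lp2[OF assms, of h] assms, of s] by eventually_elim simp
  qed (use U_Lp2 L2.diff_in assms d in auto)
  also have "\<dots> = Lp_norm 2 (\<lambda>x. U h f x - f x)" by (rule U_norm[OF d])
  finally show ?thesis .
qed

text \<open>Needed for measurability in \<open>t\<close>: \<open>esssup\<close> of a non-measurable function is \<open>top\<close>.\<close>

lemma supev_U_continuous: assumes f: "f \<in> H1" shows "continuous_on UNIV (\<lambda>t. supev (U t f))"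
  unfolding continuous_on_def
proof
  fix s :: real
  note fL = H1_Lp2[OF f]
  let ?K = "2 * C2 * H1_norm f"
  have Hd: "H1_norm (\<lambda>x. U t f x - U s f x) \<le> ?K" for t
  proof -
    have "H1_norm (\<lambda>x. U t f x - U s f x) \<le> H1_norm (U t f) + H1_norm (U s f)"
      using HH.nrm_triangle[OF U_H1[OF f, of t] HH.diff_in[OF zero_H1 U_H1[OF f, of s]]]
        HH.nrm_diff_commute[OF zero_H1 U_H1[OF f, of s]] by simp
    then show ?thesis using U_H1_norm[OF f, of t] U_H1_norm[OF f, of s] by simp
  qed
  \<comment> \<open>Strong continuity of the group in \<open>L\<^sup>2\<close> is interpolated with
    the uniform \<open>H1\<close> bound to give continuity in the supremum norm.\<close>
  have "((\<lambda>h. supev (U (s + h) f) - supev (U s f)) \<longlongrightarrow> 0) (at 0)"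
  proof (rule Lim_null_comparison)
    have "norm (supev (U (s + h) f) - supev (U s f)) \<le> 2 * sqrt (Lp_norm 2 (\<lambda>x. U h f x - f x) * ?K)" for h
    proof -
      have "norm (supev (U (s + h) f) - supev (U s f)) \<le>
        2 * sqrt (Lp_norm 2 (\<lambda>x. U (s + h) f x - U s f x) * H1_norm (\<lambda>x. U (s + h) f x - U s f x))"
        using supev_diff_le[OF U_H1[OF f] U_H1[OF f]] by simp
      also have "\<dots> \<le> 2 * sqrt (Lp_norm 2 (\<lambda>x. U (s + h) f x - U s f x) * ?K)"
        by (intro mult_left_mono real_sqrt_le_mono Hd Lp2_norm_nonneg) simp
      finally show ?thesis unfolding U_norm_diff[OF fL] .
    qed
    then show "\<forall>\<^sub>F h in at 0. norm (supev (U (s + h) f) - supev (U s f)) \<le> 2 * sqrt (Lp_norm 2 (\<lambda>x. U h f x - f x) * ?K)" by simp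
    have "((\<lambda>h. 2 * sqrt (Lp_norm 2 (\<lambda>x. U h f x - f x) * ?K)) \<longlongrightarrow> 2 * sqrt (0 * ?K)) (at 0)"
      by (intro tendsto_intros U_cont fL)
    then show "((\<lambda>h. 2 * sqrt (Lp_norm 2 (\<lambda>x. U h f x - f x) * ?K)) \<longlongrightarrow> 0) (at 0)" by simp
  qed
  then have "((\<lambda>h. supev (U (s + h) f)) \<longlongrightarrow> supev (U s f)) (at 0)" by (simp add: LIM_zero_iff)
  then show "((\<lambda>t. supev (U t f)) \<longlongrightarrow> supev (U s f)) (at s within UNIV)"
    by (subst LIM_offset_zero_iff) auto
qed

definition supU :: "cfun \<Rightarrow> real" where "supU f = (SUP t. supev (U t f))"

lemma supev_U_le: assumes f: "f \<in> H1" shows "supev (U t f) \<le> 2 * C2 * H1_norm f"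
proof (rule supev_le)
  fix x
  show "cmod (ev (U t f) x) \<le> 2 * C2 * H1_norm f"
    using ev_le_H1_norm[OF U_H1[OF f, of t], of x] U_H1_norm[OF f, of t] by linarith
qed

lemma supU_bdd: "f \<in> H1 \<Longrightarrow> bdd_above (range (\<lambda>t. supev (U t f)))"
  using supev_U_le by (intro bdd_aboveI2[where M = "2 * C2 * H1_norm f"]) auto

lemma LinfLinf_le: assumes f: "f \<in> H1" shows "LinfLinf_norm (\<lambda>t. U t f) \<le> ereal (supU f)"
  unfolding LinfLinf_norm_def Linf_norm_H1[OF U_H1[OF f]]
proof (rule esssup_I)
  have "(\<lambda>t. supev (U t f)) \<in> borel_measurable borel"
    by (rule borel_measurable_continuous_onI[OF supev_U_continuous[OF f]])
  then show "(\<lambda>t. ereal (supev (U t f))) \<in> borel_measurable lborel" by simp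
  show "AE t in lborel. ereal (supev (U t f)) \<le> ereal (supU f)"
    unfolding supU_def by (intro AE_I2) (simp add: cSUP_upper[OF UNIV_I supU_bdd[OF f]])
qed

lemma supU_limit:
  assumes w: "bddH w" and L: "((\<lambda>n. H1_norm (w n)) \<longlongrightarrow> L) G"
  shows "\<exists>a. ((\<lambda>n. supU (w n)) \<longlongrightarrow> a) G \<and> a \<le> 2 * sqrt (lam w * (C2 * L))"
proof -
  note wH = bddH_D[OF w]
  obtain K where K: "K \<ge> 0" "\<And>n. H1_norm (w n) \<le> K" using bddH_ex[OF w] by blast
  have s0: "0 \<le> supU (w n)" for n
    unfolding supU_def using cSUP_upper[OF UNIV_I supU_bdd[OF wH[of n]], of 0] supev_nonneg[OF U_H1[OF wH[of n]], of 0] by linarith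
  have "supU (w n) \<le> 2 * C2 * K" for n
  proof -
    have "supU (w n) \<le> 2 * C2 * H1_norm (w n)" unfolding supU_def by (rule cSUP_least) (auto intro: supev_U_le wH)
    also have "\<dots> \<le> 2 * C2 * K" using K(2) C2_nonneg by (intro mult_left_mono) auto
    finally show ?thesis .
  qed
  then obtain a where a: "((\<lambda>n. supU (w n)) \<longlongrightarrow> a) G"
    using ultra_bounded_tendsto[OF Gu, of "\<lambda>n. supU (w n)" "2 * C2 * K"] s0 by auto
  have "\<exists>t x. supU (w n) - 1 / real (Suc n) < cmod (ev (U t (w n)) x)" for n
  proof -
    have "supU (w n) - 1 / real (Suc n) < (SUP t. supev (U t (w n)))" by (simp flip: supU_def)
    then obtain t where "supU (w n) - 1 / real (Suc n) < supev (U t (w n))"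
      using less_cSUP_iff[OF UNIV_not_empty supU_bdd[OF wH]] by blast
    then have "supU (w n) - 1 / real (Suc n) < (SUP x. cmod (ev (U t (w n)) x))" by (simp add: supev_def)
    then show ?thesis using less_cSUP_iff[OF UNIV_not_empty supev_bdd[OF U_H1[OF wH]]] by blast
  qed
  then obtain t x where tx: "\<And>n. supU (w n) - 1 / real (Suc n) < cmod (ev (U (t n) (w n)) (x n))" by metis
  \<comment> \<open>The nearly maximal point is moved to the origin. The sign is negative because
    \<open>sh\<close> translates by the opposite of its first argument.\<close>
  let ?v = "\<lambda>n. sh (- x n) (t n) (w n)"
  obtain \<psi> where \<psi>: "\<psi> \<in> H1" "wconv G ?v \<psi>" using wlims_ex[OF w, of "\<lambda>n. - x n" t] by blast
  have "((\<lambda>n. cmod (ev (?v n) 0)) \<longlongrightarrow> cmod (ev \<psi> 0)) G" by (intro tendsto_norm wconv_ev \<psi>)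
  moreover have "ev (?v n) 0 = ev (U (t n) (w n)) (x n)" for n
    by (simp add: sh_def H1_translate(3)[OF U_H1[OF wH]])
  ultimately have l1: "((\<lambda>n. cmod (ev (U (t n) (w n)) (x n))) \<longlongrightarrow> cmod (ev \<psi> 0)) G" by simp
  have "((\<lambda>n. 1 / real (Suc n)) \<longlongrightarrow> 0) G"
    using filterlim_mono[OF LIMSEQ_inverse_real_of_nat order_refl Gs] by (simp add: inverse_eq_divide)
  from tendsto_diff[OF a this] have l2: "((\<lambda>n. supU (w n) - 1 / real (Suc n)) \<longlongrightarrow> a) G" by simp
  have "a \<le> cmod (ev \<psi> 0)"
    by (rule tendsto_le[OF Gb l1 l2]) (intro always_eventually allI less_imp_le tx)
  also have "\<dots> \<le> 2 * sqrt (Lp_norm 2 \<psi> * H1_norm \<psi>)" by (rule ev_bound[OF \<psi>(1)])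
  also have "\<dots> \<le> 2 * sqrt (lam w * (C2 * L))"
  proof -
    have vb: "H1_norm (?v n) \<le> C2 * H1_norm (w n)" for n
      using U_H1_norm[OF wH] by (simp add: sh_def H1_translate U_H1[OF wH])
    have "H1_norm (?v n) \<le> C2 * K" for n
      using vb[of n] mult_left_mono[OF K(2)[of n] C2_nonneg] by linarith
    then obtain k where k: "((\<lambda>n. H1_norm (?v n)) \<longlongrightarrow> k) G"
      using ultra_bounded_tendsto[OF Gu, of "\<lambda>n. H1_norm (?v n)" "C2 * K"] by (auto simp: H1_norm_nonneg)
    have "H1_norm \<psi> \<le> k" by (rule wconv_norm_le[OF Gb \<psi>(2) bddH_sh[OF w] \<psi>(1) k])
    also have "k \<le> C2 * L" by (rule tendsto_le[OF Gb tendsto_mult_left[OF L] k]) (simp add: vb)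
    finally have "H1_norm \<psi> \<le> C2 * L" .
    then show ?thesis using lam_upper[OF w \<psi>(1,2)] lam_nonneg[OF w]
      by (intro mult_left_mono real_sqrt_le_mono mult_mono H1_norm_nonneg) auto
  qed
  finally show ?thesis using a by blast
qed

end

subsection \<open>Removing profiles\<close>

lemma Hm1_zero: "l \<in> Hm1 \<Longrightarrow> l (\<lambda>x. 0) = 0"
  using Hm1_diff[of l "\<lambda>x. 0" "\<lambda>x. 0"] zero_H1 by simp

context profile_setting
begin

definition prof :: "cfun \<Rightarrow> (nat \<Rightarrow> real) \<Rightarrow> (nat \<Rightarrow> real) \<Rightarrow> nat \<Rightarrow> cfun" where
  "prof \<psi> x t n = U (- t n) (translate (x n) \<psi>)"

lemma prof_H1: "\<psi> \<in> H1 \<Longrightarrow> prof \<psi> x t n \<in> H1"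
  by (simp add: prof_def U_H1 H1_translate)

lemma prof_H1_norm: "\<psi> \<in> H1 \<Longrightarrow> H1_norm (prof \<psi> x t n) \<le> C2 * H1_norm \<psi>"
  using U_H1_norm[of "translate (x n) \<psi>" "- t n"] by (simp add: prof_def H1_translate)

lemma prof_norm: "\<psi> \<in> Lp 2 \<Longrightarrow> Lp_norm 2 (prof \<psi> x t n) = Lp_norm 2 \<psi>"
  by (simp add: prof_def U_norm translate_Lp2 translate_L2_norm)

lemma bddH_prof: "\<psi> \<in> H1 \<Longrightarrow> bddH (prof \<psi> x t)"
  using prof_H1_norm by (intro bddH_I[where K = "C2 * H1_norm \<psi>"] prof_H1)

lemma prof_cj: "prof \<psi> x t n = translate (x n) (cj (x n) (- t n) \<psi>)"
  by (simp add: prof_def cj_alt)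

lemma sh_prof_far:
  assumes "r > 2" "assumption_A5 r U" and \<psi>: "\<psi> \<in> H1"
    and far: "filterlim (\<lambda>n. \<bar>t' n - t n\<bar> + \<bar>x' n - x n\<bar>) at_top G"
  shows "wconv G (\<lambda>n. sh (x' n) (t' n) (prof \<psi> x t n)) (\<lambda>x. 0)"
proof (rule wconv_cong[OF wconv_far[OF assms(1,2) \<psi>, of "\<lambda>n. t' n - t n" "\<lambda>n. x n - x' n" x]])
  show "filterlim (\<lambda>n. \<bar>t' n - t n\<bar> + \<bar>x n - x' n\<bar>) at_top G"
    using far by (simp add: abs_minus_commute[of "x _"])
  show "translate (x n - x' n) (cj (x n) (t' n - t n) \<psi>) \<in> H1" for n by (intro H1_translate cj_H1 \<psi>)
  show "sh (x' n) (t' n) (prof \<psi> x t n) \<in> H1" for n by (intro sh_H1 prof_H1 \<psi>)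
  show "AE y in lborel. translate (x n - x' n) (cj (x n) (t' n - t n) \<psi>) y = sh (x' n) (t' n) (prof \<psi> x t n) y" for n
    using sh_profile[OF H1_Lp2[OF \<psi>], of "x' n" "t' n" "t n" "x n"] unfolding prof_def by eventually_elim simp
qed (use zero_H1 in auto)

lemma sh_prof_self:
  assumes "\<psi> \<in> Lp 2" shows "AE y in lborel. sh (x n) (t n) (prof \<psi> x t n) y = \<psi> y"
proof -
  have "AE y in lborel. U 0 (translate (x n) \<psi>) y = translate (x n) \<psi> y" by (rule U_0[OF translate_Lp2[OF assms]])
  from AE_translate[OF this, of "- x n"] sh_profile[OF assms, of "x n" "t n" "t n" "x n"]
  show ?thesis unfolding prof_def cj_alt by eventually_elim (simp add: translate_def)
qed

lemma remove_bddH: "bddH w \<Longrightarrow> \<psi> \<in> H1 \<Longrightarrow> bddH (\<lambda>n y. w n y - prof \<psi> x t n y)"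
  by (intro bddH_diff bddH_prof)

lemma remove_self:
  assumes w: "bddH w" and \<psi>: "\<psi> \<in> H1" "wconv G (\<lambda>n. sh (x n) (t n) (w n)) \<psi>"
  shows "wconv G (\<lambda>n. sh (x n) (t n) (\<lambda>y. w n y - prof \<psi> x t n y)) (\<lambda>x. 0)"
proof (rule wconv_cong[OF wconv_diff[OF \<psi>(2) wconv_const[of G \<psi>] sh_H1[OF bddH_D[OF w]] \<psi>(1) \<psi>(1) \<psi>(1)]])
  fix n
  show "(\<lambda>y. sh (x n) (t n) (w n) y - \<psi> y) \<in> H1" by (rule HH.diff_in[OF sh_H1[OF bddH_D[OF w]] \<psi>(1)])
  show "sh (x n) (t n) (\<lambda>y. w n y - prof \<psi> x t n y) \<in> H1"
    by (rule sh_H1[OF bddH_D[OF remove_bddH[OF w \<psi>(1)]]])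
  show "AE y in lborel. sh (x n) (t n) (w n) y - \<psi> y = sh (x n) (t n) (\<lambda>y. w n y - prof \<psi> x t n y) y"
    using sh_diff[OF H1_Lp2[OF bddH_D[OF w]] H1_Lp2[OF prof_H1[OF \<psi>(1)]], of "x n" "t n" n x t n]
      sh_prof_self[OF H1_Lp2[OF \<psi>(1)], of x n t] by eventually_elim simp
qed (use \<psi> zero_H1 in \<open>auto intro: HH.diff_in\<close>)

text \<open>In coordinates far from its parameters the removed profile is weakly null. One direction
  preserves the vanishing limits at earlier parameters, the other makes limits of the new remainder
  limits of the old one.\<close>

lemma remove_far:
  assumes r: "r > 2" "assumption_A5 r U" and w: "bddH w" and \<psi>: "\<psi> \<in> H1"
    and far: "filterlim (\<lambda>n. \<bar>t' n - t n\<bar> + \<bar>x' n - x n\<bar>) at_top G" and \<phi>: "\<phi> \<in> H1"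
  shows "wconv G (\<lambda>n. sh (x' n) (t' n) (\<lambda>y. w n y - prof \<psi> x t n y)) \<phi> \<longleftrightarrow> wconv G (\<lambda>n. sh (x' n) (t' n) (w n)) \<phi>"
    (is "wconv G ?v \<phi> \<longleftrightarrow> wconv G ?u \<phi>")
proof -
  let ?p = "\<lambda>n. sh (x' n) (t' n) (prof \<psi> x t n)"
  have p: "wconv G ?p (\<lambda>x. 0)" by (rule sh_prof_far[OF r \<psi> far])
  have uH: "?u n \<in> H1" for n by (rule sh_H1[OF bddH_D[OF w]])
  have vH: "?v n \<in> H1" for n by (rule sh_H1[OF bddH_D[OF remove_bddH[OF w \<psi>]]])
  have pH: "?p n \<in> H1" for n by (intro sh_H1 prof_H1 \<psi>)
  have eq: "AE y in lborel. ?v n y = ?u n y - ?p n y" for n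
    by (rule sh_diff[OF H1_Lp2[OF bddH_D[OF w]] H1_Lp2[OF prof_H1[OF \<psi>]]])
  show ?thesis
  proof
    assume u: "wconv G ?u \<phi>"
    show "wconv G ?v \<phi>"
    proof (rule wconv_cong[OF wconv_diff[OF u p uH pH \<phi> zero_H1]])
      show "AE y in lborel. ?u n y - ?p n y = ?v n y" for n using eq[of n] by eventually_elim simp
    qed (use uH pH vH \<phi> zero_H1 in \<open>auto intro: HH.diff_in\<close>)
  next
    assume v: "wconv G ?v \<phi>"
    \<comment> \<open>Adding the profile back is expressed as subtracting its negative, so that the
      rule for differences of weak limits applies.\<close>
    have z: "(\<lambda>y. 0 - ?p n y) \<in> H1" for n by (rule HH.diff_in[OF zero_H1 pH])
    have z0: "(\<lambda>x. 0 - 0 :: complex) \<in> H1" using zero_H1 by simp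
    note q = wconv_diff[OF wconv_const p zero_H1 pH zero_H1 zero_H1]
    show "wconv G ?u \<phi>"
    proof (rule wconv_cong[OF wconv_diff[OF v q vH z \<phi> z0]])
      show "AE y in lborel. ?v n y - (0 - ?p n y) = ?u n y" for n using eq[of n] by eventually_elim simp
      show "(\<lambda>y. ?v n y - (0 - ?p n y)) \<in> H1" for n by (rule HH.diff_in[OF vH z])
    qed (use uH \<phi> in auto)
  qed
qed

text \<open>A weak limit of the new remainder at far parameters is one of the old remainder; at
  close parameters it is null, by comparison with the vanishing limit at the parameters of the
  removed profile.\<close>

lemma lam_remove:
  assumes r: "r > 2" "assumption_A5 r U" and w: "bddH w" and \<psi>: "\<psi> \<in> H1" "wconv G (\<lambda>n. sh (x n) (t n) (w n)) \<psi>"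
  shows "lam (\<lambda>n y. w n y - prof \<psi> x t n y) \<le> lam w" (is "lam ?w' \<le> _")
  unfolding lam_def[of ?w']
proof (rule cSUP_least)
  note w' = remove_bddH[OF w \<psi>(1), of x t]
  show "wlims ?w' \<noteq> {}" by (rule wlims_nonempty[OF w'])
  fix \<phi> assume "\<phi> \<in> wlims ?w'"
  then obtain x' t' where \<phi>: "\<phi> \<in> H1" "wconv G (\<lambda>n. sh (x' n) (t' n) (?w' n)) \<phi>" by (auto simp: wlims_def)
  show "Lp_norm 2 \<phi> \<le> lam w"
  proof (rule far_or_close[of t' t x' x])
    assume "filterlim (\<lambda>n. \<bar>t' n - t n\<bar> + \<bar>x' n - x n\<bar>) at_top G"
    then have "wconv G (\<lambda>n. sh (x' n) (t' n) (w n)) \<phi>" using remove_far[OF r w \<psi>(1) _ \<phi>(1)] \<phi>(2) by blast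
    then show ?thesis by (rule lam_upper[OF w \<phi>(1)])
  next
    fix sb yb assume c: "((\<lambda>n. t' n - t n) \<longlongrightarrow> sb) G" "((\<lambda>n. x n - x' n) \<longlongrightarrow> yb) G"
    have "Lp_norm 2 \<phi> \<le> Lp_norm 2 (\<lambda>x. 0)"
      by (rule close_norm_le[OF w' c remove_self[OF w \<psi>] zero_H1 \<phi>(2,1)])
    also have "\<dots> \<le> lam w" using lam_nonneg[OF w] by (simp add: Lp2_norm_eq)
    finally show ?thesis .
  qed
qed

lemma L2_inner_prof: "w \<in> Lp 2 \<Longrightarrow> \<psi> \<in> Lp 2 \<Longrightarrow> L2_inner w (prof \<psi> x t n) = L2_inner (sh (x n) (t n) w) \<psi>"
  using U_adj[of w "translate (x n) \<psi>" "t n"] by (simp add: prof_def sh_def translate_adj translate_Lp2)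

lemma L2_split:
  assumes w: "bddH w" and \<psi>: "\<psi> \<in> H1" "wconv G (\<lambda>n. sh (x n) (t n) (w n)) \<psi>"
  shows "((\<lambda>n. (Lp_norm 2 (w n))\<^sup>2 - ((Lp_norm 2 \<psi>)\<^sup>2 + (Lp_norm 2 (\<lambda>y. w n y - prof \<psi> x t n y))\<^sup>2)) \<longlongrightarrow> 0) G"
proof -
  note pL = H1_Lp2[OF \<psi>(1)]
  have "((\<lambda>n. L2_inner (sh (x n) (t n) (w n)) \<psi>) \<longlongrightarrow> L2_inner \<psi> \<psi>) G"
    by (rule wconv_inner[OF \<psi>(2) bddH_sh[OF w] \<psi>(1) pL])
  then have "((\<lambda>n. 2 * Re (L2_inner (sh (x n) (t n) (w n)) \<psi>) - 2 * (Lp_norm 2 \<psi>)\<^sup>2) \<longlongrightarrow> 2 * Re (L2_inner \<psi> \<psi>) - 2 * (Lp_norm 2 \<psi>)\<^sup>2) G"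
    by (intro tendsto_intros)
  moreover have "2 * Re (L2_inner \<psi> \<psi>) - 2 * (Lp_norm 2 \<psi>)\<^sup>2 = 0" using L2.nrm_sq[OF pL] by simp
  moreover have eq: "(Lp_norm 2 (w n))\<^sup>2 - ((Lp_norm 2 \<psi>)\<^sup>2 + (Lp_norm 2 (\<lambda>y. w n y - prof \<psi> x t n y))\<^sup>2)
     = 2 * Re (L2_inner (sh (x n) (t n) (w n)) \<psi>) - 2 * (Lp_norm 2 \<psi>)\<^sup>2" for n
    unfolding L2.nrm_diff[OF H1_Lp2[OF bddH_D[OF w]] H1_Lp2[OF prof_H1[OF \<psi>(1)]]]
      prof_norm[OF pL] L2_inner_prof[OF H1_Lp2[OF bddH_D[OF w]] pL] by simp
  ultimately show ?thesis unfolding eq by simp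
qed

lemma B_cong: assumes "u \<in> H1" "u' \<in> H1" "v \<in> H1" "AE x in lborel. u x = u' x" shows "B u v = B u' v"
  using Hm1_cong_AE[OF B_Hm1[OF assms(3)] assms(1,2,4)] B_sym[OF assms(1,3)] B_sym[OF assms(2,3)] by simp

text \<open>Invariance of the form moves the evolution onto \<open>w\<close>. What remains on the
  profile is a translated functional, of the kind that A3 makes precompact.\<close>

lemma B_prof:
  assumes w: "w \<in> H1" and \<psi>: "\<psi> \<in> H1"
  shows "B (prof \<psi> x t n) w = conj_translate_form (x n) B \<psi> (sh (x n) (t n) w)"
proof -
  note T = H1_translate(1)[OF \<psi>, of "x n"]
  have "B (prof \<psi> x t n) w = B (U (t n) (prof \<psi> x t n)) (U (t n) w)"
    by (rule B_inv[OF prof_H1[OF \<psi>] w, symmetric])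
  also have "\<dots> = B (translate (x n) \<psi>) (U (t n) w)"
  proof (rule B_cong[OF U_H1[OF prof_H1[OF \<psi>]] T U_H1[OF w]])
    show "AE y in lborel. U (t n) (prof \<psi> x t n) y = translate (x n) \<psi> y"
      using U_inv[OF H1_Lp2[OF T], of "- t n"] by (simp add: prof_def)
  qed
  also have "\<dots> = conj_translate_form (x n) B \<psi> (sh (x n) (t n) w)"
    by (simp add: conj_translate_form_def sh_def)
  finally show ?thesis .
qed

lemma B_prof_self: "\<psi> \<in> H1 \<Longrightarrow> B (prof \<psi> x t n) (prof \<psi> x t n) = B (translate (x n) \<psi>) (translate (x n) \<psi>)"
  by (simp add: prof_def B_inv H1_translate)

text \<open>Both cross terms pair the profile with the new remainder, whose weak limit in the
  coordinates of the profile is 0, while the functionals converge in norm by A3.\<close>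

lemma B_split:
  assumes w: "bddH w" and \<psi>: "\<psi> \<in> H1" "wconv G (\<lambda>n. sh (x n) (t n) (w n)) \<psi>"
  shows "((\<lambda>n. B (w n) (w n) - (B (translate (x n) \<psi>) (translate (x n) \<psi>) +
     B (\<lambda>y. w n y - prof \<psi> x t n y) (\<lambda>y. w n y - prof \<psi> x t n y))) \<longlongrightarrow> 0) G"
proof -
  let ?P = "prof \<psi> x t" and ?w' = "\<lambda>n y. w n y - prof \<psi> x t n y"
  have b': "bddH ?w'" by (rule remove_bddH[OF w \<psi>(1)])
  note wH = bddH_D[OF w] and w'H = bddH_D[OF b'] and PH = prof_H1[OF \<psi>(1)]
  obtain l where l: "l \<in> Hm1" "((\<lambda>n. Hm1_norm (\<lambda>v. conj_translate_form (x n) B \<psi> v - l v)) \<longlongrightarrow> 0) G"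
    using A3_limit[OF \<psi>(1)] by blast
  have "((\<lambda>n. conj_translate_form (x n) B \<psi> (sh (x n) (t n) (?w' n))) \<longlongrightarrow> l (\<lambda>x. 0)) G"
    by (rule wconv_pairing_strong[OF remove_self[OF w \<psi>] bddH_sh[OF b'] conj_form_Hm1[OF \<psi>(1)] l])
  then have c: "((\<lambda>n. B (?P n) (?w' n)) \<longlongrightarrow> 0) G"
    unfolding B_prof[OF w'H \<psi>(1)] Hm1_zero[OF l(1)] .
  from tendsto_cnj[OF c] have c': "((\<lambda>n. B (?w' n) (?P n)) \<longlongrightarrow> 0) G"
    using B_sym[OF w'H PH] by simp
  have "B (w n) (w n) - (B (translate (x n) \<psi>) (translate (x n) \<psi>) + B (?w' n) (?w' n)) = B (?P n) (?w' n) + B (?w' n) (?P n)" for n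
  proof -
    have d1: "B (?w' n) z = B (w n) z - B (?P n) z" if "z \<in> H1" for z
      using B_lin[OF wH PH that, of 1 n "-1" x t n] by simp
    have d2: "B z (?w' n) = B z (w n) - B z (?P n)" if "z \<in> H1" for z
      by (rule Hm1_diff[OF B_Hm1[OF that] wH PH])
    show ?thesis
      unfolding B_prof_self[OF \<psi>(1), of x t n, symmetric] d1[OF w'H] d1[OF PH] d2[OF wH] d2[OF PH] by simp
  qed
  moreover have "((\<lambda>n. B (?P n) (?w' n) + B (?w' n) (?P n)) \<longlongrightarrow> 0) G"
    using tendsto_add[OF c c'] by simp
  ultimately show ?thesis by simp
qed

text \<open>Dominated convergence fails along an ultrafilter, so a failure is moved to a sequence along which
  the values at all rational points converge.\<close>

lemma brezis_lieb_ultra: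
  assumes r: "r > 2" and v: "bddH v" and \<psi>: "\<psi> \<in> H1" "wconv G v \<psi>"
  shows "((\<lambda>n. Lr r (v n) - Lr r (\<lambda>x. v n x - \<psi> x) - Lr r \<psi>) \<longlongrightarrow> 0) G"
proof (rule ccontr)
  define E where "E = (\<lambda>n. Lr r (v n) - Lr r (\<lambda>x. v n x - \<psi> x) - Lr r \<psi>)"
  assume "\<not> ?thesis"
  then have "\<not> (E \<longlongrightarrow> 0) G" by (simp add: E_def)
  then obtain e where e: "e > 0" "\<not> eventually (\<lambda>n. \<bar>E n\<bar> < e) G"
    by (auto simp: tendsto_iff dist_real_def)
  then have evE: "eventually (\<lambda>n. \<not> \<bar>E n\<bar> < e) G" using ultra_cases[OF Gu] by blast
  define q where "q = (\<lambda>i::nat. real_of_rat (from_nat i))"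
  have "eventually (\<lambda>n. \<not> \<bar>E n\<bar> < e \<and> (\<forall>i\<in>{..j}. norm (ev (v n) (q i) - ev \<psi> (q i)) < 1 / real (Suc j))) G" for j
  proof (intro eventually_conj evE eventually_ball_finite ballI)
    fix i
    show "eventually (\<lambda>n. norm (ev (v n) (q i) - ev \<psi> (q i)) < 1 / real (Suc j)) G"
      using tendstoD[OF wconv_ev[OF \<psi>(2), of "q i"], of "1 / real (Suc j)"] by (simp add: dist_norm)
  qed simp
  from select[of "\<lambda>j n. \<not> \<bar>E n\<bar> < e \<and> (\<forall>i\<in>{..j}. norm (ev (v n) (q i) - ev \<psi> (q i)) < 1 / real (Suc j))", OF this]
  obtain \<sigma> where s: "strict_mono \<sigma>" "\<And>j. \<not> \<bar>E (\<sigma> j)\<bar> < e"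
    "\<And>i j. i \<le> j \<Longrightarrow> norm (ev (v (\<sigma> j)) (q i) - ev \<psi> (q i)) < 1 / real (Suc j)" by auto
  have bs: "bddH (\<lambda>j. v (\<sigma> j))" using v by (auto simp: bddH_def)
  have "(\<lambda>j. ev (v (\<sigma> j)) (real_of_rat p)) \<longlonglongrightarrow> ev \<psi> (real_of_rat p)" for p
  proof -
    obtain i where i: "q i = real_of_rat p" unfolding q_def by (metis from_nat_to_nat)
    have "(\<lambda>j. ev (v (\<sigma> j)) (q i) - ev \<psi> (q i)) \<longlonglongrightarrow> 0"
    proof (rule Lim_null_comparison[OF _ LIMSEQ_inverse_real_of_nat])
      show "\<forall>\<^sub>F j in sequentially. norm (ev (v (\<sigma> j)) (q i) - ev \<psi> (q i)) \<le> inverse (real (Suc j))"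
        using s(3) by (intro eventually_sequentiallyI[of i]) (simp add: inverse_eq_divide less_imp_le)
    qed
    then show ?thesis by (simp add: LIM_zero_iff i)
  qed
  then have "(\<lambda>j. ev (v (\<sigma> j)) y) \<longlonglongrightarrow> ev \<psi> y" for y by (rule ev_tendsto_of_rat[OF bs \<psi>(1)])
  from brezis_lieb[OF r bs \<psi>(1) this] have "(\<lambda>j. E (\<sigma> j)) \<longlonglongrightarrow> 0" by (simp add: E_def)
  from LIMSEQ_D[OF this e(1)] s(2) show False by auto
qed

lemma Lr_split:
  assumes r: "r > 2" "assumption_A5 r U" and w: "bddH w" and std: "gstd t"
    and \<psi>: "\<psi> \<in> H1" "wconv G (\<lambda>n. sh (x n) (t n) (w n)) \<psi>"
  shows "((\<lambda>n. Lr r (w n) - (Lr r (prof \<psi> x t n) + Lr r (\<lambda>y. w n y - prof \<psi> x t n y))) \<longlongrightarrow> 0) G"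
proof (cases "\<forall>n. t n = 0")
  case True
  let ?v = "\<lambda>n. translate (- x n) (w n)"
  have bv: "bddH ?v" by (rule bddH_translate[OF w])
  have wL: "w n \<in> Lp 2" for n by (rule H1_Lp2[OF bddH_D[OF w]])
  note pL = H1_Lp2[OF \<psi>(1)]
  have "wconv G ?v \<psi>"
  proof (rule wconv_cong[OF \<psi>(2)])
    show "AE y in lborel. sh (x n) (t n) (w n) y = ?v n y" for n
      using AE_translate[OF U_0[OF wL], of n "- x n"] True by (simp add: sh_def translate_def)
  qed (use sh_H1 bddH_D[OF w] bddH_D[OF bv] \<psi> in auto)
  from brezis_lieb_ultra[OF r(1) bv \<psi>(1) this]
  have "((\<lambda>n. Lr r (?v n) - Lr r (\<lambda>x. ?v n x - \<psi> x) - Lr r \<psi>) \<longlongrightarrow> 0) G" .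
  moreover have "Lr r (w n) - (Lr r (prof \<psi> x t n) + Lr r (\<lambda>y. w n y - prof \<psi> x t n y)) = Lr r (?v n) - Lr r (\<lambda>x. ?v n x - \<psi> x) - Lr r \<psi>" for n
  proof -
    have P: "AE y in lborel. prof \<psi> x t n y = translate (x n) \<psi> y"
      using U_0[OF translate_Lp2[OF pL], of "x n"] True by (simp add: prof_def)
    have "Lr r (prof \<psi> x t n) = Lr r (translate (x n) \<psi>)"
      by (rule Lr_cong_AE[OF H1_Lp2[OF prof_H1[OF \<psi>(1)]] translate_Lp2[OF pL] P])
    moreover have "Lr r (\<lambda>y. w n y - prof \<psi> x t n y) = Lr r (\<lambda>y. w n y - translate (x n) \<psi> y)"
    proof (rule Lr_cong_AE)
      show "AE y in lborel. w n y - prof \<psi> x t n y = w n y - translate (x n) \<psi> y" using P by eventually_elim simp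
    qed (use L2.diff_in[OF wL] H1_Lp2[OF prof_H1[OF \<psi>(1)]] translate_Lp2[OF pL] in auto)
    moreover have "Lr r (\<lambda>y. w n y - translate (x n) \<psi> y) = Lr r (\<lambda>x. ?v n x - \<psi> x)"
      using Lr_translate[of r "- x n" "\<lambda>y. w n y - translate (x n) \<psi> y"] by (simp add: translate_def)
    ultimately show ?thesis by (simp add: Lr_translate)
  qed
  ultimately show ?thesis by simp
next
  case False
  have t: "filterlim (\<lambda>n. \<bar>- t n\<bar>) at_top G"
  proof -
    consider "filterlim t at_top G" | "filterlim t at_bot G" using std False by (auto simp: gstd_def)
    then show ?thesis
    proof cases
      case 1
      then show ?thesis by (rule filterlim_at_top_mono) (auto intro!: always_eventually)
    next
      case 2
      then have "filterlim (\<lambda>n. - t n) at_top G" by (simp add: filterlim_uminus_at_top)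
      then show ?thesis by (rule filterlim_at_top_mono) (intro always_eventually allI abs_ge_self)
    qed
  qed
  have P0: "((\<lambda>n. Lr r (prof \<psi> x t n)) \<longlongrightarrow> 0) G"
    unfolding prof_cj Lr_translate by (rule A5_limit[OF r \<psi>(1) t])
  let ?w' = "\<lambda>n y. w n y - prof \<psi> x t n y"
  have b': "bddH ?w'" by (rule remove_bddH[OF w \<psi>(1)])
  have "((\<lambda>n. Lr r (w n) - Lr r (?w' n)) \<longlongrightarrow> 0) G"
  proof (rule tendstoI)
    fix e :: real assume e: "e > 0"
    obtain K where K: "K > 0" "\<And>n. Lr r (?w' n) \<le> K" using Lr_bounded[OF r(1) b'] by blast
    define d where "d = e / (2 * K)"
    have d: "d > 0" "d * K = e / 2" using e K by (auto simp: d_def)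
    obtain C where C: "C \<ge> 0" "\<And>a b :: complex. \<bar>cmod (a + b) powr r - cmod a powr r\<bar> \<le> d * cmod a powr r + C * cmod b powr r"
      using powr_perturbation[of r d] r(1) d by auto
    have "((\<lambda>n. e / 2 + C * Lr r (prof \<psi> x t n)) \<longlongrightarrow> e / 2 + C * 0) G" by (intro tendsto_intros P0)
    then have "eventually (\<lambda>n. e / 2 + C * Lr r (prof \<psi> x t n) < e) G" by (rule order_tendstoD) (use e in simp)
    then show "\<forall>\<^sub>F n in G. dist (Lr r (w n) - Lr r (?w' n)) 0 < e"
    proof eventually_elim
      case (elim n)
      have "\<bar>Lr r (w n) - Lr r (?w' n)\<bar> \<le> d * Lr r (?w' n) + C * Lr r (prof \<psi> x t n)"
        by (rule Lr_perturbation[OF r(1) bddH_D[OF b'] prof_H1[OF \<psi>(1)] bddH_D[OF w] _ C(2)]) simp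
      moreover have "d * Lr r (?w' n) \<le> e / 2" using mult_left_mono[OF K(2)[of n], of d] d by simp
      ultimately show ?case using elim by simp
    qed
  qed
  from tendsto_diff[OF this P0] show ?thesis by (simp add: algebra_simps)
qed

section \<open>Iterating the removal of profiles\<close>

type_synonym pdata = "cfun \<times> (nat \<Rightarrow> real) \<times> (nat \<Rightarrow> real)"

definition pr :: "pdata \<Rightarrow> nat \<Rightarrow> cfun" where "pr p = prof (fst p) (fst (snd p)) (snd (snd p))"

definition rem :: "(nat \<Rightarrow> cfun) \<Rightarrow> (nat \<Rightarrow> pdata) \<Rightarrow> nat \<Rightarrow> nat \<Rightarrow> cfun" where
  "rem v f J n = (\<lambda>y. v n y - (\<Sum>j = 1..J. pr (f j) n y))"

text \<open>The condition on the choice with index \<open>J\<close> involves \<open>f\<close> only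
  below \<open>J\<close>, as well-founded dependent choice requires. Profiles are numbered from 1,
  so \<open>J - 1\<close> of them have been removed before.\<close>

definition admissible :: "(nat \<Rightarrow> cfun) \<Rightarrow> (nat \<Rightarrow> pdata) \<Rightarrow> nat \<Rightarrow> pdata \<Rightarrow> bool" where
  "admissible v f J p \<longleftrightarrow> (case p of (\<psi>, x, t) \<Rightarrow> \<psi> \<in> H1 \<and> gstd x \<and> gstd t \<and>
     wconv G (\<lambda>n. sh (x n) (t n) (rem v f (J - 1) n)) \<psi> \<and> lam (rem v f (J - 1)) \<le> 2 * Lp_norm 2 \<psi> \<and>
     (\<forall>j\<in>{1..<J}. filterlim (\<lambda>n. \<bar>t n - snd (snd (f j)) n\<bar> + \<bar>x n - fst (snd (f j)) n\<bar>) at_top G))"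

lemma rem_0: "rem v f 0 = v" by (simp add: rem_def fun_eq_iff)

lemma rem_Suc: "rem v f (Suc J) = (\<lambda>n y. rem v f J n y - pr (f (Suc J)) n y)"
  by (simp add: rem_def fun_eq_iff)

text \<open>The vanishing limits at all earlier parameters have to be carried along, being the
  hypothesis under which the next parameters diverge from them; each further removal preserves them
  because its parameters are far away.\<close>

lemma rem_invariant:
  assumes r: "r > 2" "assumption_A5 r U" and v: "bddH v" and f: "\<And>j. 1 \<le> j \<Longrightarrow> j \<le> J \<Longrightarrow> admissible v f j (f j)"
  shows "bddH (rem v f J) \<and>
    (\<forall>j\<in>{1..J}. wconv G (\<lambda>n. sh (fst (snd (f j)) n) (snd (snd (f j)) n) (rem v f J n)) (\<lambda>x. 0))"
  using f
proof (induction J)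
  case 0
  then show ?case using v by (simp add: rem_0)
next
  case (Suc J)
  have IH: "bddH (rem v f J)" "\<And>j. j \<in> {1..J} \<Longrightarrow> wconv G (\<lambda>n. sh (fst (snd (f j)) n) (snd (snd (f j)) n) (rem v f J n)) (\<lambda>x. 0)"
    using Suc by auto
  obtain \<psi> x t where p: "f (Suc J) = (\<psi>, x, t)" by (metis surj_pair)
  have a: "\<psi> \<in> H1" "wconv G (\<lambda>n. sh (x n) (t n) (rem v f J n)) \<psi>"
    "\<And>j. j \<in> {1..J} \<Longrightarrow> filterlim (\<lambda>n. \<bar>t n - snd (snd (f j)) n\<bar> + \<bar>x n - fst (snd (f j)) n\<bar>) at_top G"
    using Suc.prems[of "Suc J"] unfolding admissible_def p by auto
  have R: "rem v f (Suc J) = (\<lambda>n y. rem v f J n y - prof \<psi> x t n y)" by (simp add: rem_Suc pr_def p)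
  have "bddH (rem v f (Suc J))" unfolding R by (rule remove_bddH[OF IH(1) a(1)])
  moreover have "wconv G (\<lambda>n. sh (fst (snd (f j)) n) (snd (snd (f j)) n) (rem v f (Suc J) n)) (\<lambda>x. 0)" if j: "j \<in> {1..Suc J}" for j
  proof (cases "j = Suc J")
    case True
    then show ?thesis unfolding R using remove_self[OF IH(1) a(1,2)] by (simp add: p)
  next
    case False
    then have j: "j \<in> {1..J}" using that by auto
    have far: "filterlim (\<lambda>n. \<bar>snd (snd (f j)) n - t n\<bar> + \<bar>fst (snd (f j)) n - x n\<bar>) at_top G"
      using a(3)[OF j] by (simp add: abs_minus_commute)
    show ?thesis unfolding R using remove_far[OF r IH(1) a(1) far zero_H1] IH(2)[OF j] by blast
  qed
  ultimately show ?case by blast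
qed

lemma profiles_exist:
  assumes r: "r > 2" "assumption_A5 r U" and v: "bddH v"
  shows "\<exists>f. \<forall>j\<ge>1. admissible v f j (f j)"
proof -
  have "\<exists>f. \<forall>J. J \<ge> 1 \<longrightarrow> admissible v f J (f J)"
  proof (rule dependent_wf_choice[OF wf_less_than, of "\<lambda>f J p. J \<ge> 1 \<longrightarrow> admissible v f J p"])
    fix f g :: "nat \<Rightarrow> pdata" and J p
    assume fg: "\<And>z. (z, J) \<in> less_than \<Longrightarrow> f z = g z"
    show "(J \<ge> 1 \<longrightarrow> admissible v f J p) = (J \<ge> 1 \<longrightarrow> admissible v g J p)"
    proof (cases "J \<ge> 1")
      case True
      have "rem v f (J - 1) = rem v g (J - 1)"
        unfolding rem_def using fg True by (intro ext arg_cong2[where f = "(-)"] sum.cong) auto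
      moreover have "f j = g j" if "j \<in> {1..<J}" for j using fg that by auto
      ultimately show ?thesis unfolding admissible_def by (auto split: prod.splits)
    qed simp
  next
    fix J and f :: "nat \<Rightarrow> pdata"
    assume A: "\<And>y. (y, J) \<in> less_than \<Longrightarrow> y \<ge> 1 \<longrightarrow> admissible v f y (f y)"
    show "\<exists>p. J \<ge> 1 \<longrightarrow> admissible v f J p"
    proof (cases "J \<ge> 1")
      case True
      have inv: "bddH (rem v f (J - 1))"
        "\<And>j. j \<in> {1..J - 1} \<Longrightarrow> wconv G (\<lambda>n. sh (fst (snd (f j)) n) (snd (snd (f j)) n) (rem v f (J - 1) n)) (\<lambda>x. 0)"
        using rem_invariant[OF r v, of "J - 1" f] A True by auto
      have inv2: "wconv G (\<lambda>n. sh (fst (snd (f j)) n) (snd (snd (f j)) n) (rem v f (J - 1) n)) (\<lambda>x. 0)" if "j \<in> {1..<J}" for j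
        using inv(2)[of j] that by auto
      from extraction[where xs = "\<lambda>j. fst (snd (f j))" and ts = "\<lambda>j. snd (snd (f j))",
          OF inv(1) finite_atLeastLessThan inv2]
      obtain \<psi> x t where "\<psi> \<in> H1" "gstd x" "gstd t" "wconv G (\<lambda>n. sh (x n) (t n) (rem v f (J - 1) n)) \<psi>"
        "lam (rem v f (J - 1)) \<le> 2 * Lp_norm 2 \<psi>"
        "\<forall>j\<in>{1..<J}. filterlim (\<lambda>n. \<bar>t n - snd (snd (f j)) n\<bar> + \<bar>x n - fst (snd (f j)) n\<bar>) at_top G" by blast
      then have "admissible v f J (\<psi>, x, t)" by (simp add: admissible_def)
      then show ?thesis by blast
    qed simp
  qed
  then show ?thesis by blast
qed

text \<open>The three asymptotic identities telescope: each removal splits the quantity of the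
  previous remainder, and the errors add up over finitely many stages.\<close>

lemma profile_decomposition_ultra:
  assumes r: "r > 2" "assumption_A5 r U" and v: "bddH v"
  shows "\<exists>\<psi> x t R. (\<forall>J n. R J n = (\<lambda>y. v n y - (\<Sum>j = 1..J. prof (\<psi> j) (x j) (t j) n y))) \<and>
    (\<forall>j\<ge>1. \<psi> j \<in> H1 \<and> gstd (x j) \<and> gstd (t j)) \<and> (\<forall>J. bddH (R J)) \<and>
    (\<forall>j\<ge>1. \<forall>k\<ge>1. j \<noteq> k \<longrightarrow> filterlim (\<lambda>n. \<bar>t j n - t k n\<bar> + \<bar>x j n - x k n\<bar>) at_top G) \<and>
    (\<forall>J. lam (R (Suc J)) \<le> lam (R J) \<and> lam (R J) \<le> 2 * Lp_norm 2 (\<psi> (Suc J)) \<and> Lp_norm 2 (\<psi> (Suc J)) \<le> lam (R J)) \<and>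
    (\<forall>J. ((\<lambda>n. (Lp_norm 2 (v n))\<^sup>2 - ((\<Sum>j = 1..J. (Lp_norm 2 (\<psi> j))\<^sup>2) + (Lp_norm 2 (R J n))\<^sup>2)) \<longlongrightarrow> 0) G) \<and>
    (\<forall>J. ((\<lambda>n. B (v n) (v n) - ((\<Sum>j = 1..J. B (translate (x j n) (\<psi> j)) (translate (x j n) (\<psi> j))) + B (R J n) (R J n))) \<longlongrightarrow> 0) G) \<and>
    (\<forall>J. ((\<lambda>n. Lr r (v n) - ((\<Sum>j = 1..J. Lr r (prof (\<psi> j) (x j) (t j) n)) + Lr r (R J n))) \<longlongrightarrow> 0) G)"
proof -
  obtain f where f: "\<And>j. j \<ge> 1 \<Longrightarrow> admissible v f j (f j)" using profiles_exist[OF assms] by blast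
  define \<psi> where "\<psi> = (\<lambda>j. fst (f j))"
  define x where "x = (\<lambda>j. fst (snd (f j)))"
  define t where "t = (\<lambda>j. snd (snd (f j)))"
  define R where "R = rem v f"
  have R: "R J n = (\<lambda>y. v n y - (\<Sum>j = 1..J. prof (\<psi> j) (x j) (t j) n y))" for J n
    by (simp add: R_def rem_def pr_def \<psi>_def x_def t_def)
  have R0: "R 0 = v" by (simp add: R_def rem_0)
  have RS: "R (Suc J) = (\<lambda>n y. R J n y - prof (\<psi> (Suc J)) (x (Suc J)) (t (Suc J)) n y)" for J
    by (simp add: R_def rem_Suc pr_def \<psi>_def x_def t_def)
  have bR: "bddH (R J)" for J unfolding R_def using rem_invariant[OF r v, of J f] f by auto
  have a: "\<psi> j \<in> H1" "gstd (x j)" "gstd (t j)" if "j \<ge> 1" for j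
    using f[OF that] by (auto simp: admissible_def \<psi>_def x_def t_def split: prod.splits)
  have w: "wconv G (\<lambda>n. sh (x (Suc J) n) (t (Suc J) n) (R J n)) (\<psi> (Suc J))"
    and l: "lam (R J) \<le> 2 * Lp_norm 2 (\<psi> (Suc J))" for J
    using f[of "Suc J"] by (auto simp: admissible_def \<psi>_def x_def t_def R_def split: prod.splits)
  have far: "filterlim (\<lambda>n. \<bar>t k n - t j n\<bar> + \<bar>x k n - x j n\<bar>) at_top G" if "1 \<le> j" "j < k" for j k
    using f[of k] that by (auto simp: admissible_def \<psi>_def x_def t_def split: prod.splits)
  have far': "filterlim (\<lambda>n. \<bar>t j n - t k n\<bar> + \<bar>x j n - x k n\<bar>) at_top G" if "1 \<le> j" "1 \<le> k" "j \<noteq> k" for j k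
  proof (cases "j < k")
    case True
    then show ?thesis using far[OF that(1) True] by (simp add: abs_minus_commute)
  next
    case False
    then show ?thesis using far[OF that(2), of j] that by simp
  qed
  have lm: "lam (R (Suc J)) \<le> lam (R J)" for J
    unfolding RS by (rule lam_remove[OF r bR a(1) w]) simp
  have lu: "Lp_norm 2 (\<psi> (Suc J)) \<le> lam (R J)" for J
    by (rule lam_upper[OF bR a(1) w]) simp
  have S1: "((\<lambda>n. (Lp_norm 2 (v n))\<^sup>2 - ((\<Sum>j = 1..J. (Lp_norm 2 (\<psi> j))\<^sup>2) + (Lp_norm 2 (R J n))\<^sup>2)) \<longlongrightarrow> 0) G" for J
  proof (induction J)
    case (Suc J)
    have "((\<lambda>n. (Lp_norm 2 (R J n))\<^sup>2 - ((Lp_norm 2 (\<psi> (Suc J)))\<^sup>2 + (Lp_norm 2 (R (Suc J) n))\<^sup>2)) \<longlongrightarrow> 0) G"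
      unfolding RS by (rule L2_split[OF bR a(1) w]) simp
    from tendsto_add[OF Suc this] show ?case by (simp add: algebra_simps)
  qed (simp add: R0)
  have S2: "((\<lambda>n. B (v n) (v n) - ((\<Sum>j = 1..J. B (translate (x j n) (\<psi> j)) (translate (x j n) (\<psi> j))) + B (R J n) (R J n))) \<longlongrightarrow> 0) G" for J
  proof (induction J)
    case (Suc J)
    have "((\<lambda>n. B (R J n) (R J n) - (B (translate (x (Suc J) n) (\<psi> (Suc J))) (translate (x (Suc J) n) (\<psi> (Suc J))) + B (R (Suc J) n) (R (Suc J) n))) \<longlongrightarrow> 0) G"
      unfolding RS by (rule B_split[OF bR a(1) w]) simp
    from tendsto_add[OF Suc this] show ?case by (simp add: algebra_simps)
  qed (simp add: R0)
  have S3: "((\<lambda>n. Lr r (v n) - ((\<Sum>j = 1..J. Lr r (prof (\<psi> j) (x j) (t j) n)) + Lr r (R J n))) \<longlongrightarrow> 0) G" for J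
  proof (induction J)
    case (Suc J)
    have "((\<lambda>n. Lr r (R J n) - (Lr r (prof (\<psi> (Suc J)) (x (Suc J)) (t (Suc J)) n) + Lr r (R (Suc J) n))) \<longlongrightarrow> 0) G"
      unfolding RS by (rule Lr_split[OF r bR a(3) a(1) w]) simp_all
    from tendsto_add[OF Suc this] show ?case by (simp add: algebra_simps)
  qed (simp add: R0)
  show ?thesis
    by (intro exI[of _ \<psi>] exI[of _ x] exI[of _ t] exI[of _ R] conjI allI impI R a bR far' lm l lu S1 S2 S3)
qed

end

subsection \<open>The profile decomposition\<close>

context profile_setting
begin

lemma af_Hm1: assumes f: "f \<in> H1" shows "(\<lambda>v. af f v) \<in> Hm1"
proof (rule Hm1_I)
  note l = B_Hm1[OF f] and l' = L2_inner_Hm1[OF H1_Lp2[OF f]]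
  show "af f (\<lambda>x. a * u x + b * v x) = cnj a * af f u + cnj b * af f v" if "u \<in> H1" "v \<in> H1" for a b u v
    by (rule AF.ip_lin2[OF that f])
  show "cmod (af f v) \<le> (Hm1_norm (B f) + c0 * Hm1_norm (\<lambda>v. L2_inner f v)) * H1_norm v" if v: "v \<in> H1" for v
  proof -
    have "cmod (af f v) \<le> cmod (B f v) + c0 * cmod (L2_inner f v)"
      unfolding af_def using norm_triangle_ineq[of "B f v" "of_real c0 * L2_inner f v"] const_signs(1) by (simp add: norm_mult)
    also have "\<dots> \<le> Hm1_norm (B f) * H1_norm v + c0 * (Hm1_norm (\<lambda>v. L2_inner f v) * H1_norm v)"
      using Hm1_bound[OF l v] Hm1_bound[OF l' v] const_signs(1) by (intro add_mono mult_left_mono) auto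
    finally show ?thesis by (simp add: algebra_simps)
  qed
qed

lemma gstd_abs: assumes "gstd t" "\<not> (\<forall>n. t n = 0)" shows "filterlim (\<lambda>n. \<bar>t n\<bar>) at_top G"
proof -
  consider "filterlim t at_top G" | "filterlim t at_bot G" using assms by (auto simp: gstd_def)
  then show ?thesis
  proof cases
    case 1
    then show ?thesis by (rule filterlim_at_top_mono) (intro always_eventually allI abs_ge_self)
  next
    case 2
    then have "filterlim (\<lambda>n. - t n) at_top G" by (simp add: filterlim_uminus_at_top)
    then show ?thesis by (rule filterlim_at_top_mono) (intro always_eventually allI abs_ge_minus_self)
  qed
qed

text \<open>The origin acts as one more pair of parameters, and parameters that are standard along
  \<open>G\<close> diverge from it unless both of them vanish identically.\<close>

lemma prof_wconv_0:
  assumes r: "r > 2" "assumption_A5 r U" and \<psi>: "\<psi> \<in> H1"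
    and std: "gstd x" "gstd t" and nz: "\<not> ((\<forall>n. t n = 0) \<and> (\<forall>n. x n = 0))"
  shows "wconv G (prof \<psi> x t) (\<lambda>x. 0)"
proof -
  have far: "filterlim (\<lambda>n. \<bar>0 - t n\<bar> + \<bar>0 - x n\<bar>) at_top G"
  proof (cases "\<forall>n. t n = 0")
    case True
    then show ?thesis using gstd_abs[OF std(1)] nz by simp
  next
    case False
    show ?thesis
      by (rule filterlim_at_top_mono[OF gstd_abs[OF std(2) False]]) simp
  qed
  show ?thesis
  proof (rule wconv_cong[OF sh_prof_far[OF r \<psi> far]])
    show "AE y in lborel. sh 0 0 (prof \<psi> x t n) y = prof \<psi> x t n y" for n
      using U_0[OF H1_Lp2[OF prof_H1[OF \<psi>]]] by (simp add: sh_def)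
  qed (use sh_H1 prof_H1[OF \<psi>] zero_H1 in auto)
qed

section \<open>Finite sums of profiles and uniform bounds\<close>

lemma sum_H1: "(\<And>j. q j \<in> H1) \<Longrightarrow> (\<lambda>y. \<Sum>j = a..(b::nat). q j y) \<in> H1"
proof (induction b)
  case 0
  then show ?case using zero_H1 by (cases "a = 0") auto
next
  case (Suc b)
  show ?case
  proof (cases "a \<le> Suc b")
    case True
    then show ?thesis using HH.lin[OF Suc.IH[OF Suc.prems] Suc.prems, of 1 1 "Suc b"] by simp
  next
    case False
    then show ?thesis using zero_H1 by simp
  qed
qed

lemma H1_norm_sum_le: "(\<And>j. q j \<in> H1) \<Longrightarrow> H1_norm (\<lambda>y. \<Sum>j = a..(b::nat). q j y) \<le> (\<Sum>j = a..b. H1_norm (q j))"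
proof (induction b)
  case 0
  then show ?case by (cases "a = 0") (auto simp: H1_norm_zero)
next
  case (Suc b)
  show ?case
  proof (cases "a \<le> Suc b")
    case True
    have T: "(\<lambda>y. \<Sum>j = a..b. q j y) \<in> H1" by (rule sum_H1[OF Suc.prems])
    show ?thesis using True HH.nrm_triangle[OF T Suc.prems[of "Suc b"]] Suc.IH[OF Suc.prems] by simp
  next
    case False
    then show ?thesis by (simp add: H1_norm_zero)
  qed
qed

lemma af_sum: "(\<And>j. q j \<in> H1) \<Longrightarrow> u \<in> H1 \<Longrightarrow> af u (\<lambda>y. \<Sum>j = a..(b::nat). q j y) = (\<Sum>j = a..b. af u (q j))"
proof (induction b)
  case 0
  then show ?case using Hm1_zero[OF af_Hm1[OF 0(2)]] by (cases "a = 0") auto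
next
  case (Suc b)
  show ?case
  proof (cases "a \<le> Suc b")
    case True
    have T: "(\<lambda>y. \<Sum>j = a..b. q j y) \<in> H1" by (rule sum_H1[OF Suc.prems(1)])
    show ?thesis
      using True AF.ip_lin2[OF T Suc.prems(1)[of "Suc b"] Suc.prems(2), of 1 1] Suc.IH[OF Suc.prems] by simp
  next
    case False
    then show ?thesis using Hm1_zero[OF af_Hm1[OF Suc.prems(2)]] by simp
  qed
qed

text \<open>The bound on a cross term depends only on the larger index \<open>j\<close>. Adding the
  term \<open>j\<close> creates at most \<open>j\<close> cross terms, each counted twice, which
  explains the error \<open>2 * (real j * \<delta> j)\<close>.\<close>

lemma almost_orthogonal:
  assumes q: "\<And>j. q j \<in> H1" and d: "\<And>j. \<delta> j \<ge> 0"
    and cr: "\<And>j k. 1 \<le> k \<Longrightarrow> k < j \<Longrightarrow> cmod (af (q j) (q k)) \<le> \<delta> j"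
  shows "(AF.nrm (\<lambda>y. \<Sum>j = Suc n..K. q j y))\<^sup>2 \<le> (\<Sum>j = 1..K. (AF.nrm (q j))\<^sup>2) + 2 * (\<Sum>j = 1..K. real j * \<delta> j)"
proof (induction K)
  case 0
  then show ?case using Hm1_zero[OF af_Hm1[OF zero_H1]] by (simp add: AF.nrm_def)
next
  case (Suc K)
  show ?case
  proof (cases "n \<le> K")
    case True
    let ?T = "\<lambda>y. \<Sum>j = Suc n..K. q j y"
    have T: "?T \<in> H1" by (rule sum_H1[OF q])
    have "(\<lambda>y. \<Sum>j = Suc n..Suc K. q j y) = (\<lambda>y. 1 * q (Suc K) y + 1 * ?T y)" using True by (auto simp: fun_eq_iff)
    then have "(AF.nrm (\<lambda>y. \<Sum>j = Suc n..Suc K. q j y))\<^sup>2 = (AF.nrm (q (Suc K)))\<^sup>2 + (AF.nrm ?T)\<^sup>2 + 2 * Re (af (q (Suc K)) ?T)"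
      using AF.nrm_lin[OF q T, of 1 "Suc K" 1] by simp
    also have "Re (af (q (Suc K)) ?T) \<le> cmod (\<Sum>j = Suc n..K. af (q (Suc K)) (q j))"
      unfolding af_sum[OF q q] by (rule complex_Re_le_cmod)
    also have "\<dots> \<le> (\<Sum>j = Suc n..K. \<delta> (Suc K))"
      by (rule order_trans[OF norm_sum sum_mono]) (auto intro: cr)
    also have "\<dots> \<le> real (Suc K) * \<delta> (Suc K)"
      using d[of "Suc K"] by (auto intro!: mult_right_mono)
    finally show ?thesis using Suc by (simp add: algebra_simps)
  next
    case False
    have "(\<lambda>y. \<Sum>j = Suc n..Suc K. q j y) = (\<lambda>y. \<Sum>j = Suc n..K. q j y)" using False by auto
    moreover have "0 \<le> (AF.nrm (q (Suc K)))\<^sup>2 + 2 * (real (Suc K) * \<delta> (Suc K))" using d[of "Suc K"] by simp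
    ultimately show ?thesis using Suc by simp
  qed
qed

text \<open>With \<open>L\<close> the limit of the \<open>H1\<close> norms of the given sequence
  along \<open>G\<close>, \<open>kappa * L\<close> bounds the norms of the profiles and the limiting
  norms of the remainders, by comparing \<open>m\<close> with \<open>M\<close> in the energy
  splitting. In \<open>kappa2\<close> the first summand comes from the energies of the profiles in a
  tail sum, and the 2 from their cross terms.\<close>

definition kappa :: real where "kappa = sqrt (M / m)"
definition kappa2 :: real where "kappa2 = sqrt ((M * C2\<^sup>2 * kappa\<^sup>2 + 2) / m)"
text \<open>The square root serves (b). The rest serves (e): \<open>kappa\<close> for the profile,
  \<open>kappa + 1\<close> for a remainder \<open>R i\<close> at a selected index of stage
  \<open>i\<close> or later, and \<open>kappa2 + C2 * kappa\<close> for the tail of profiles taken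
  at later indices.\<close>

definition Cst :: real where "Cst = 2 * sqrt (2 * C2 * kappa) + 2 * kappa + 1 + kappa2 + C2 * kappa"

lemma kappa_props: "kappa \<ge> 0" "kappa\<^sup>2 = M / m" "kappa2 \<ge> 0" "m * kappa2\<^sup>2 = M * C2\<^sup>2 * kappa\<^sup>2 + 2"
  using const_signs by (auto simp: kappa_def kappa2_def)

lemma Cst_props: "Cst > 0" "2 * sqrt (2 * C2 * kappa) \<le> Cst" "2 * kappa + 1 + kappa2 + C2 * kappa \<le> Cst"
proof -
  have "0 \<le> 2 * sqrt (2 * C2 * kappa)" "0 \<le> C2 * kappa" using kappa_props C2_nonneg by auto
  then show "Cst > 0" "2 * sqrt (2 * C2 * kappa) \<le> Cst" "2 * kappa + 1 + kappa2 + C2 * kappa \<le> Cst"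
    using kappa_props unfolding Cst_def by linarith+
qed

text \<open>Adding \<open>c0\<close> times the \<open>L\<^sup>2\<close> splitting to the energy
  splitting turns every term into the coercive quantity of A1. Its bounds are uniform in the
  translation, hence independent of the positions \<open>x j n\<close>.\<close>

lemma energy_eventually:
  assumes v: "bddH v" and \<psi>: "\<And>j. j \<ge> 1 \<Longrightarrow> \<psi> j \<in> H1" and R: "bddH R"
    and S1: "((\<lambda>n. (Lp_norm 2 (v n))\<^sup>2 - ((\<Sum>j = 1..J. (Lp_norm 2 (\<psi> j))\<^sup>2) + (Lp_norm 2 (R n))\<^sup>2)) \<longlongrightarrow> 0) G"
    and S2: "((\<lambda>n. B (v n) (v n) - ((\<Sum>j = 1..J. B (translate (x j n) (\<psi> j)) (translate (x j n) (\<psi> j))) + B (R n) (R n))) \<longlongrightarrow> 0) G"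
    and e: "e > 0"
  shows "eventually (\<lambda>n. m * (\<Sum>j = 1..J. (H1_norm (\<psi> j))\<^sup>2) + m * (H1_norm (R n))\<^sup>2 \<le> M * (H1_norm (v n))\<^sup>2 + e) G"
proof -
  let ?e1 = "\<lambda>n. (Lp_norm 2 (v n))\<^sup>2 - ((\<Sum>j = 1..J. (Lp_norm 2 (\<psi> j))\<^sup>2) + (Lp_norm 2 (R n))\<^sup>2)"
  let ?e2 = "\<lambda>n. B (v n) (v n) - ((\<Sum>j = 1..J. B (translate (x j n) (\<psi> j)) (translate (x j n) (\<psi> j))) + B (R n) (R n))"
  have "((\<lambda>n. Re (?e2 n) + c0 * ?e1 n) \<longlongrightarrow> Re 0 + c0 * 0) G" by (intro tendsto_intros S1 S2)
  then have "eventually (\<lambda>n. - e < Re (?e2 n) + c0 * ?e1 n) G" by (rule order_tendstoD) (use e in simp)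
  then show ?thesis
  proof eventually_elim
    case (elim n)
    let ?b = "\<lambda>j. Re (B (translate (x j n) (\<psi> j)) (translate (x j n) (\<psi> j))) + c0 * (Lp_norm 2 (\<psi> j))\<^sup>2"
    have full: "Re (B z z) + c0 * (Lp_norm 2 z)\<^sup>2 = Re (af z z)" if "z \<in> H1" for z
      using L2.nrm_sq[OF H1_Lp2[OF that]] by (simp add: af_def)
    have 1: "m * (\<Sum>j = 1..J. (H1_norm (\<psi> j))\<^sup>2) \<le> (\<Sum>j = 1..J. ?b j)"
      unfolding sum_distrib_left
    proof (rule sum_mono)
      fix j assume "j \<in> {1..J}"
      then show "m * (H1_norm (\<psi> j))\<^sup>2 \<le> ?b j" using coercive(1)[OF \<psi>, of j "x j n"] by (simp add: conj_translate_form_def)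
    qed
    have "Re (?e2 n) + c0 * ?e1 n = (Re (B (v n) (v n)) + c0 * (Lp_norm 2 (v n))\<^sup>2)
       - (\<Sum>j = 1..J. ?b j) - (Re (B (R n) (R n)) + c0 * (Lp_norm 2 (R n))\<^sup>2)"
      by (simp add: sum.distrib sum_distrib_left algebra_simps)
    also have "\<dots> = Re (af (v n) (v n)) - (\<Sum>j = 1..J. ?b j) - Re (af (R n) (R n))"
      using full[OF bddH_D[OF v]] full[OF bddH_D[OF R]] by simp
    finally show ?case using elim 1 af_bounds(2)[OF bddH_D[OF v], of n] af_bounds(1)[OF bddH_D[OF R], of n] by linarith
  qed
qed

lemma nat_le_2pow: "real j * (1/4) ^ j \<le> (1/2 :: real) ^ j"
proof -
  have "real j \<le> 2 ^ j" by (simp add: of_nat_less_two_power less_imp_le)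
  then have "real j * (1/4) ^ j \<le> 2 ^ j * (1/4) ^ j" by (rule mult_right_mono) simp
  also have "\<dots> = (1/2 :: real) ^ j" by (simp add: power_mult_distrib[symmetric])
  finally show ?thesis .
qed

lemma sum_half_le: "(\<Sum>j = 1..K. (1/2 :: real) ^ j) \<le> 1"
proof -
  have "(\<Sum>j = 1..K. (1/2 :: real) ^ j) = 1 - (1/2) ^ K" by (induction K) auto
  then show ?thesis by simp
qed

text \<open>Only the squares of the profile norms have a bounded sum, so the triangle inequality
  would lose a factor growing with the number of profiles; almost orthogonality in the energy form
  avoids this. The factor \<open>(1/4) ^ j\<close> absorbs the number of cross terms, leaving a
  geometric series. The predicate \<open>Z\<close> singles out the one profile that may fail to be
  weakly null.\<close>

lemma tail_bound:
  assumes L: "L > 0" and p: "\<And>j. p j \<in> H1" and pn: "\<And>j. j \<ge> 1 \<Longrightarrow> H1_norm (p j) \<le> C2 * h j"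
    and h: "\<And>j. h j \<ge> 0" "(\<Sum>j = 1..K. (h j)\<^sup>2) \<le> (kappa * L)\<^sup>2"
    and uniq: "\<And>j k. j \<ge> 1 \<Longrightarrow> k \<ge> 1 \<Longrightarrow> Z j \<Longrightarrow> Z k \<Longrightarrow> j = k"
    and cr: "\<And>j k. 1 \<le> k \<Longrightarrow> k < j \<Longrightarrow> \<not> Z j \<Longrightarrow> cmod (af (p j) (p k)) \<le> L\<^sup>2 * (1/4) ^ j"
  shows "H1_norm (\<lambda>y. \<Sum>j = Suc n..K. p j y) \<le> (kappa2 + C2 * kappa) * L"
proof -
  \<comment> \<open>The family is split: \<open>q\<close> replaces an exceptional profile by 0, and
    \<open>q0\<close> keeps nothing else.\<close>
  define q where "q = (\<lambda>j. if Z j then (\<lambda>_. 0) else p j)"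
  define q0 where "q0 = (\<lambda>j. if Z j then p j else (\<lambda>_. 0))"
  have qH: "q j \<in> H1" "q0 j \<in> H1" for j
    using p[of j] zero_H1 by (simp_all add: q_def q0_def)
  have af0: "af u (\<lambda>_. 0) = 0" if "u \<in> H1" for u using Hm1_zero[OF af_Hm1[OF that]] .
  have af0': "af (\<lambda>_. 0) u = 0" if "u \<in> H1" for u using AF.ip_cnj[OF that zero_H1] af0[OF that] by simp
  have hle: "h j \<le> kappa * L" if "j \<in> {1..K}" for j
  proof -
    have "(h j)\<^sup>2 \<le> (\<Sum>j = 1..K. (h j)\<^sup>2)" by (rule member_le_sum[OF that]) auto
    then have "(h j)\<^sup>2 \<le> (kappa * L)\<^sup>2" using h(2) by (rule order_trans)
    then show ?thesis by (rule power2_le_imp_le) (use kappa_props(1) L in simp)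
  qed
  have "(AF.nrm (\<lambda>y. \<Sum>j = Suc n..K. q j y))\<^sup>2 \<le> (\<Sum>j = 1..K. (AF.nrm (q j))\<^sup>2) + 2 * (\<Sum>j = 1..K. real j * (L\<^sup>2 * (1/4) ^ j))"
  proof (rule almost_orthogonal[OF qH(1)])
    show "0 \<le> L\<^sup>2 * (1/4) ^ j" for j :: nat by simp
    show "cmod (af (q j) (q k)) \<le> L\<^sup>2 * (1/4) ^ j" if "1 \<le> k" "k < j" for j k
      using cr[OF that] af0[OF p] af0'[OF p] af0[OF zero_H1] by (simp add: q_def)
  qed
  also have "(\<Sum>j = 1..K. (AF.nrm (q j))\<^sup>2) \<le> M * C2\<^sup>2 * kappa\<^sup>2 * L\<^sup>2"
  proof -
    have "(\<Sum>j = 1..K. (AF.nrm (q j))\<^sup>2) \<le> (\<Sum>j = 1..K. (M * C2\<^sup>2) * (h j)\<^sup>2)"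
    proof (rule sum_mono)
      fix j assume j: "j \<in> {1..K}"
      have "(AF.nrm (q j))\<^sup>2 \<le> M * (H1_norm (q j))\<^sup>2" using af_bounds(2)[OF qH(1)] AF.nrm_sq[OF qH(1)] by simp
      also have "H1_norm (q j) \<le> C2 * h j"
        using pn[of j] j h(1)[of j] C2_nonneg by (auto simp: q_def H1_norm_zero)
      then have "M * (H1_norm (q j))\<^sup>2 \<le> M * (C2 * h j)\<^sup>2"
        using const_signs(3) H1_norm_nonneg by (intro mult_left_mono power_mono) auto
      finally show "(AF.nrm (q j))\<^sup>2 \<le> (M * C2\<^sup>2) * (h j)\<^sup>2" by (simp add: power_mult_distrib)
    qed
    also have "\<dots> = (M * C2\<^sup>2) * (\<Sum>j = 1..K. (h j)\<^sup>2)" by (simp add: sum_distrib_left)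
    also have "\<dots> \<le> (M * C2\<^sup>2) * (kappa * L)\<^sup>2" using h(2) const_signs(3) by (intro mult_left_mono) auto
    finally show ?thesis by (simp add: power_mult_distrib)
  qed
  also have "(\<Sum>j = 1..K. real j * (L\<^sup>2 * (1/4) ^ j)) \<le> L\<^sup>2"
  proof -
    have "(\<Sum>j = 1..K. real j * (L\<^sup>2 * (1/4) ^ j)) \<le> (\<Sum>j = 1..K. L\<^sup>2 * (1/2) ^ j)"
    proof (rule sum_mono)
      fix j show "real j * (L\<^sup>2 * (1/4) ^ j) \<le> L\<^sup>2 * (1/2) ^ j"
        using mult_left_mono[OF nat_le_2pow[of j], of "L\<^sup>2"] by (simp add: mult_ac)
    qed
    also have "\<dots> = L\<^sup>2 * (\<Sum>j = 1..K. (1/2) ^ j)" by (simp add: sum_distrib_left)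
    also have "\<dots> \<le> L\<^sup>2 * 1" by (intro mult_left_mono sum_half_le) simp
    finally show ?thesis by simp
  qed
  finally have "(AF.nrm (\<lambda>y. \<Sum>j = Suc n..K. q j y))\<^sup>2 \<le> m * kappa2\<^sup>2 * L\<^sup>2"
    unfolding kappa_props(4) by (simp add: algebra_simps)
  moreover have "m * (H1_norm (\<lambda>y. \<Sum>j = Suc n..K. q j y))\<^sup>2 \<le> (AF.nrm (\<lambda>y. \<Sum>j = Suc n..K. q j y))\<^sup>2"
    using af_bounds(1)[OF sum_H1[OF qH(1)]] AF.nrm_sq[OF sum_H1[OF qH(1)]] by simp
  ultimately have "m * (H1_norm (\<lambda>y. \<Sum>j = Suc n..K. q j y))\<^sup>2 \<le> m * (kappa2 * L)\<^sup>2" by (simp add: power_mult_distrib)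
  then have "(H1_norm (\<lambda>y. \<Sum>j = Suc n..K. q j y))\<^sup>2 \<le> (kappa2 * L)\<^sup>2" using const_signs(2) by simp
  then have 1: "H1_norm (\<lambda>y. \<Sum>j = Suc n..K. q j y) \<le> kappa2 * L"
    by (rule power2_le_imp_le) (use kappa_props(3) L in simp)
  have 2: "H1_norm (\<lambda>y. \<Sum>j = Suc n..K. q0 j y) \<le> C2 * kappa * L"
  proof -
    have "H1_norm (\<lambda>y. \<Sum>j = Suc n..K. q0 j y) \<le> (\<Sum>j = Suc n..K. H1_norm (q0 j))" by (rule H1_norm_sum_le[OF qH(2)])
    also have "\<dots> \<le> C2 * kappa * L"
    proof (cases "\<exists>i\<in>{Suc n..K}. Z i")
      case True
      then obtain i where i: "i \<in> {Suc n..K}" "Z i" by blast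
      have "(\<Sum>j = Suc n..K. H1_norm (q0 j)) = (\<Sum>j \<in> {i}. H1_norm (q0 j))"
      proof (rule sum.mono_neutral_right)
        show "\<forall>j\<in>{Suc n..K} - {i}. H1_norm (q0 j) = 0"
          using uniq[of _ i] i by (auto simp: q0_def H1_norm_zero)
      qed (use i in auto)
      also have "\<dots> = H1_norm (p i)" using i by (simp add: q0_def)
      also have "\<dots> \<le> C2 * h i" using pn[of i] i by simp
      also have "\<dots> \<le> C2 * (kappa * L)" using hle[of i] i C2_nonneg by (intro mult_left_mono) auto
      finally show ?thesis by simp
    next
      case False
      then have "(\<Sum>j = Suc n..K. H1_norm (q0 j)) = 0" by (intro sum.neutral) (auto simp: q0_def H1_norm_zero)
      then show ?thesis using C2_nonneg kappa_props(1) L by simp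
    qed
    finally show ?thesis .
  qed
  have "(\<lambda>y. \<Sum>j = Suc n..K. p j y) = (\<lambda>y. (\<Sum>j = Suc n..K. q j y) + (\<Sum>j = Suc n..K. q0 j y))"
    unfolding sum.distrib[symmetric] by (intro ext sum.cong) (auto simp: q_def q0_def)
  moreover have "(\<lambda>y. \<Sum>j = Suc n..K. q j y) \<in> H1" "(\<lambda>y. \<Sum>j = Suc n..K. q0 j y) \<in> H1"
    by (rule sum_H1[OF qH(1)], rule sum_H1[OF qH(2)])
  note HH.nrm_triangle[OF this]
  ultimately show ?thesis using 1 2 by (simp add: algebra_simps)
qed

section \<open>Selection of the subsequence\<close>

lemma main_decomposition:
  fixes v :: "nat \<Rightarrow> cfun"
  assumes r: "r > 2" "assumption_A5 r U" and vH: "\<And>n. v n \<in> H1" and vb: "bdd_above (range (\<lambda>n. H1_norm (v n)))"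
  shows "\<exists>(\<sigma> :: nat \<Rightarrow> nat) (\<psi> :: nat \<Rightarrow> cfun) (t :: nat \<Rightarrow> nat \<Rightarrow> real) (x :: nat \<Rightarrow> nat \<Rightarrow> real).
      strict_mono \<sigma> \<and>
      (\<forall>j\<ge>1. \<psi> j \<in> H1 \<and> standard_seq (t j) \<and> standard_seq (x j)) \<and>
      (let u = (\<lambda>n. v (\<sigma> n));
           S = (SUP n. H1_norm (u n));
           R = remainder U u \<psi> t x
       in
        (\<forall>j\<ge>1. \<forall>k\<ge>1. j \<noteq> k \<longrightarrow>
           filterlim (\<lambda>n. \<bar>t j n - t k n\<bar> + \<bar>x j n - x k n\<bar>) at_top sequentially) \<and>
        (\<forall>J\<ge>1. limsup (\<lambda>n. LinfLinf_norm (\<lambda>s. U s (R J n)))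
                 \<le> ereal (Cst * (sqrt (Lp_norm 2 (\<psi> J)) * sqrt S))) \<and>
        (\<lambda>J. sqrt (Lp_norm 2 (\<psi> J)) * sqrt S) \<longlonglongrightarrow> 0 \<and>
        (\<forall>J\<ge>1.
           (\<lambda>n. (Lp_norm 2 (u n))\<^sup>2
                - ((\<Sum>j = 1..J. (Lp_norm 2 (\<psi> j))\<^sup>2) + (Lp_norm 2 (R J n))\<^sup>2)) \<longlonglongrightarrow> 0 \<and>
           (\<lambda>n. B (u n) (u n)
                - ((\<Sum>j = 1..J. B (translate (x j n) (\<psi> j)) (translate (x j n) (\<psi> j)))
                   + B (R J n) (R J n))) \<longlonglongrightarrow> 0 \<and>
           (\<lambda>n. Lp_norm r (u n) powr r
                - ((\<Sum>j = 1..J. Lp_norm r (profile U \<psi> t x j n) powr r)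
                   + Lp_norm r (R J n) powr r)) \<longlonglongrightarrow> 0) \<and>
        (\<forall>J\<ge>1. (AE y in lborel. \<psi> J y = 0) \<longrightarrow> (\<forall>j\<ge>J. AE y in lborel. \<psi> j y = 0)) \<and>
        (\<forall>j\<ge>1. \<forall>J\<ge>1. \<forall>n. H1_norm (\<psi> j) + H1_norm (R J n) \<le> Cst * S))"
proof -
  obtain K where K: "\<And>n. H1_norm (v n) \<le> K" using vb by (auto simp: bdd_above_def)
  have v: "bddH v" by (rule bddH_I[OF vH K])
  obtain L where L: "((\<lambda>n. H1_norm (v n)) \<longlongrightarrow> L) G"
    using ultra_bounded_tendsto[OF Gu, of "\<lambda>n. H1_norm (v n)" K] K by (auto simp: H1_norm_nonneg)
  have L0: "0 \<le> L" by (rule tendsto_le[OF Gb L tendsto_const]) (simp add: H1_norm_nonneg)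
  from profile_decomposition_ultra[OF r v]
  obtain \<psi> x t R where R: "\<And>J n. R J n = (\<lambda>y. v n y - (\<Sum>j = 1..J. prof (\<psi> j) (x j) (t j) n y))"
    and std: "\<And>j. j \<ge> 1 \<Longrightarrow> \<psi> j \<in> H1 \<and> gstd (x j) \<and> gstd (t j)" and bR: "\<And>J. bddH (R J)"
    and far: "\<And>j k. j \<ge> 1 \<Longrightarrow> k \<ge> 1 \<Longrightarrow> j \<noteq> k \<Longrightarrow> filterlim (\<lambda>n. \<bar>t j n - t k n\<bar> + \<bar>x j n - x k n\<bar>) at_top G"
    and lm: "\<And>J. lam (R (Suc J)) \<le> lam (R J) \<and> lam (R J) \<le> 2 * Lp_norm 2 (\<psi> (Suc J)) \<and> Lp_norm 2 (\<psi> (Suc J)) \<le> lam (R J)"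
    and S1: "\<And>J. ((\<lambda>n. (Lp_norm 2 (v n))\<^sup>2 - ((\<Sum>j = 1..J. (Lp_norm 2 (\<psi> j))\<^sup>2) + (Lp_norm 2 (R J n))\<^sup>2)) \<longlongrightarrow> 0) G"
    and S2: "\<And>J. ((\<lambda>n. B (v n) (v n) - ((\<Sum>j = 1..J. B (translate (x j n) (\<psi> j)) (translate (x j n) (\<psi> j))) + B (R J n) (R J n))) \<longlongrightarrow> 0) G"
    and S3: "\<And>J. ((\<lambda>n. Lr r (v n) - ((\<Sum>j = 1..J. Lr r (prof (\<psi> j) (x j) (t j) n)) + Lr r (R J n))) \<longlongrightarrow> 0) G"
    by blast
  have \<psi>H: "\<psi> j \<in> H1" if "j \<ge> 1" for j using std[OF that] by blast
  define p where "p = (\<lambda>j n. prof (\<psi> j) (x j) (t j) n)"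
  have pH: "p j n \<in> H1" if "j \<ge> 1" for j n unfolding p_def by (rule prof_H1[OF \<psi>H[OF that]])
  define h where "h = (\<lambda>j. H1_norm (\<psi> j))"
  have h0: "0 \<le> h j" for j by (simp add: h_def H1_norm_nonneg)
  have energy: "eventually (\<lambda>n. m * (\<Sum>j = 1..J. (h j)\<^sup>2) + m * (H1_norm (R J n))\<^sup>2 \<le> M * (H1_norm (v n))\<^sup>2 + e) G"
    if "e > 0" for J e
    unfolding h_def by (rule energy_eventually[OF v \<psi>H bR S1 S2 that])
  have "\<exists>k. ((\<lambda>n. H1_norm (R J n)) \<longlongrightarrow> k) G" for J
  proof -
    obtain KJ where "\<And>n. H1_norm (R J n) \<le> KJ" using bddH_ex[OF bR] by blast
    then show ?thesis using ultra_bounded_tendsto[OF Gu, of "\<lambda>n. H1_norm (R J n)" KJ] by (auto simp: H1_norm_nonneg)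
  qed
  then obtain k where k: "\<And>J. ((\<lambda>n. H1_norm (R J n)) \<longlongrightarrow> k J) G" by metis
  have k0: "0 \<le> k J" for J by (rule tendsto_le[OF Gb k tendsto_const]) (simp add: H1_norm_nonneg)
  \<comment> \<open>The slack \<open>e\<close> disappears in the limit along \<open>G\<close>. The
    bound is in terms of \<open>L\<close>, and \<open>L\<close> is at most the supremum over the
    subsequence still to be selected.\<close>
  have lim: "m * (\<Sum>j = 1..J. (h j)\<^sup>2) + m * (k J)\<^sup>2 \<le> M * L\<^sup>2" for J
  proof (rule field_le_epsilon)
    fix e :: real assume "e > 0"
    show "m * (\<Sum>j = 1..J. (h j)\<^sup>2) + m * (k J)\<^sup>2 \<le> M * L\<^sup>2 + e"
    proof (rule tendsto_le[OF Gb _ _ energy[OF \<open>e > 0\<close>, of J]])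
      show "((\<lambda>n. M * (H1_norm (v n))\<^sup>2 + e) \<longlongrightarrow> M * L\<^sup>2 + e) G" by (intro tendsto_intros L)
      show "((\<lambda>n. m * (\<Sum>j = 1..J. (h j)\<^sup>2) + m * (H1_norm (R J n))\<^sup>2) \<longlongrightarrow> m * (\<Sum>j = 1..J. (h j)\<^sup>2) + m * (k J)\<^sup>2) G"
        by (intro tendsto_intros k)
    qed
  qed
  have kL: "(kappa * L)\<^sup>2 = M * L\<^sup>2 / m" by (simp add: power_mult_distrib kappa_props)
  have hsum: "(\<Sum>j = 1..J. (h j)\<^sup>2) \<le> (kappa * L)\<^sup>2" for J
  proof -
    have "0 \<le> m * (k J)\<^sup>2" using const_signs(2) by simp
    then have "m * (\<Sum>j = 1..J. (h j)\<^sup>2) \<le> M * L\<^sup>2" using lim[of J] by linarith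
    then show ?thesis unfolding kL using const_signs(2) by (simp add: field_simps)
  qed
  have kle: "k J \<le> kappa * L" for J
  proof -
    have "0 \<le> m * (\<Sum>j = 1..J. (h j)\<^sup>2)" using const_signs(2) by (simp add: sum_nonneg)
    then have "m * (k J)\<^sup>2 \<le> M * L\<^sup>2" using lim[of J] by linarith
    then have "(k J)\<^sup>2 \<le> (kappa * L)\<^sup>2" unfolding kL using const_signs(2) by (simp add: field_simps)
    then show ?thesis by (rule power2_le_imp_le) (use kappa_props(1) L0 in simp)
  qed
  have hle: "h j \<le> kappa * L" if "j \<ge> 1" for j
  proof -
    have "(h j)\<^sup>2 \<le> (\<Sum>j = 1..j. (h j)\<^sup>2)" by (rule member_le_sum) (use that in auto)
    then have "(h j)\<^sup>2 \<le> (kappa * L)\<^sup>2" using hsum by (rule order_trans)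
    then show ?thesis by (rule power2_le_imp_le) (use kappa_props(1) L0 in simp)
  qed
  have "\<exists>a. ((\<lambda>n. supU (R J n)) \<longlongrightarrow> a) G \<and> a \<le> 2 * sqrt (lam (R J) * (C2 * k J))" for J
    by (rule supU_limit[OF bR k])
  then obtain a where a: "\<And>J. ((\<lambda>n. supU (R J n)) \<longlongrightarrow> a J) G" "\<And>J. a J \<le> 2 * sqrt (lam (R J) * (C2 * k J))" by metis
  define e1 where "e1 = (\<lambda>J n. (Lp_norm 2 (v n))\<^sup>2 - ((\<Sum>j = 1..J. (Lp_norm 2 (\<psi> j))\<^sup>2) + (Lp_norm 2 (R J n))\<^sup>2))"
  define e2 where "e2 = (\<lambda>J n. B (v n) (v n) - ((\<Sum>j = 1..J. B (translate (x j n) (\<psi> j)) (translate (x j n) (\<psi> j))) + B (R J n) (R J n)))"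
  define e3 where "e3 = (\<lambda>J n. Lr r (v n) - ((\<Sum>j = 1..J. Lr r (p j n)) + Lr r (R J n)))"
  define Z where "Z = (\<lambda>j. (\<forall>n. t j n = 0) \<and> (\<forall>n. x j n = 0))"
  \<comment> \<open>Divergence along \<open>G\<close> is recorded as explicit bounds by the stage
    \<open>j\<close>. Both implications are vacuous for a parameter that vanishes
    identically.\<close>
  define toinf where "toinf = (\<lambda>(s :: nat \<Rightarrow> real) j n. (filterlim s at_top G \<longrightarrow> real j \<le> s n) \<and> (filterlim s at_bot G \<longrightarrow> s n \<le> - real j))"
  \<comment> \<open>All that is required of the decomposition into \<open>i\<close> profiles at an
    index chosen in stage \<open>j\<close>. The energy bound is guarded by \<open>L > 0\<close>
    since its slack \<open>m * L\<^sup>2\<close> has to be positive.\<close>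
  define Good where "Good = (\<lambda>i j n. norm (e1 i n) < 1 / real (Suc j) \<and> norm (e2 i n) < 1 / real (Suc j) \<and>
     norm (e3 i n) < 1 / real (Suc j) \<and> supU (R i n) < a i + 1 / real (Suc j) \<and>
     (L > 0 \<longrightarrow> m * (H1_norm (R i n))\<^sup>2 \<le> M * (H1_norm (v n))\<^sup>2 + m * L\<^sup>2) \<and> toinf (t i) j n \<and> toinf (x i) j n)"
  define Far where "Far = (\<lambda>i k j n. i \<ge> 1 \<longrightarrow> k \<ge> 1 \<longrightarrow> i \<noteq> k \<longrightarrow> real j \<le> \<bar>t i n - t k n\<bar> + \<bar>x i n - x k n\<bar>)"
  define P where "P = (\<lambda>j n. norm (H1_norm (v n) - L) < 1 / real (Suc j) \<and> (\<forall>i\<in>{..j}. Good i j n) \<and> (\<forall>i\<in>{..j}. \<forall>k\<in>{..j}. Far i k j n))"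
  \<comment> \<open>When the index of stage \<open>j\<close> is chosen, the earlier profile
    \<open>k\<close> is frozen at its own index \<open>a'\<close>; the new profile tends weakly to 0
    and so becomes almost orthogonal to it in the energy form.\<close>
  define Q where "Q = (\<lambda>k a' j n. L > 0 \<longrightarrow> 1 \<le> k \<longrightarrow> \<not> Z j \<longrightarrow> cmod (af (p j n) (p k a')) < L\<^sup>2 * (1/4) ^ j)"
  have pos: "0 < 1 / real (Suc j)" for j by simp
  have small: "eventually (\<lambda>n. norm (f n) < 1 / real (Suc j)) G" if "(f \<longlongrightarrow> (0 :: 'z :: real_normed_vector)) G" for f j
    using tendstoD[OF that pos] by simp
  have ti: "eventually (\<lambda>n. toinf s j n) G" for s j
    unfolding toinf_def
  proof (intro eventually_conj)
    show "\<forall>\<^sub>F n in G. filterlim s at_top G \<longrightarrow> real j \<le> s n"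
      by (cases "filterlim s at_top G") (auto simp: filterlim_at_top)
    show "\<forall>\<^sub>F n in G. filterlim s at_bot G \<longrightarrow> s n \<le> - real j"
      by (cases "filterlim s at_bot G") (auto simp: filterlim_at_bot)
  qed
  have evGood: "eventually (\<lambda>n. Good i j n) G" for i j
    unfolding Good_def
  proof (intro eventually_conj ti)
    show "\<forall>\<^sub>F n in G. norm (e1 i n) < 1 / real (Suc j)" by (rule small) (unfold e1_def, rule S1)
    show "\<forall>\<^sub>F n in G. norm (e2 i n) < 1 / real (Suc j)" by (rule small) (unfold e2_def, rule S2)
    show "\<forall>\<^sub>F n in G. norm (e3 i n) < 1 / real (Suc j)" by (rule small) (unfold e3_def p_def, rule S3)
    show "\<forall>\<^sub>F n in G. supU (R i n) < a i + 1 / real (Suc j)" by (rule order_tendstoD(2)[OF a(1)]) simp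
    show "\<forall>\<^sub>F n in G. L > 0 \<longrightarrow> m * (H1_norm (R i n))\<^sup>2 \<le> M * (H1_norm (v n))\<^sup>2 + m * L\<^sup>2"
    proof (cases "L > 0")
      case True
      then have "m * L\<^sup>2 > 0" using const_signs(2) by simp
      from energy[OF this, of i] show ?thesis
      proof eventually_elim
        case (elim n)
        have "0 \<le> m * (\<Sum>j = 1..i. (h j)\<^sup>2)" using const_signs(2) by (simp add: sum_nonneg)
        with elim show ?case by linarith
      qed
    qed simp
  qed
  have evFar: "eventually (\<lambda>n. Far i k j n) G" for i k j
  proof (cases "i \<ge> 1 \<and> k \<ge> 1 \<and> i \<noteq> k")
    case True
    then have "eventually (\<lambda>n. real j \<le> \<bar>t i n - t k n\<bar> + \<bar>x i n - x k n\<bar>) G" using far by (simp add: filterlim_at_top)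
    then show ?thesis by eventually_elim (simp add: Far_def)
  next
    case False
    then show ?thesis by (auto simp: Far_def)
  qed
  have evP: "eventually (P j) G" for j
    unfolding P_def
  proof (intro eventually_conj eventually_ball_finite ballI finite_atMost evGood evFar)
    have "((\<lambda>n. H1_norm (v n) - L) \<longlongrightarrow> 0) G" using L by (simp add: LIM_zero_iff)
    then show "\<forall>\<^sub>F n in G. norm (H1_norm (v n) - L) < 1 / real (Suc j)" by (rule small)
  qed
  have evQ: "eventually (Q k a' j) G" if "k < j" for k a' j
  proof (cases "L > 0 \<and> 1 \<le> k \<and> \<not> Z j")
    case True
    then have j: "j \<ge> 1" and kk: "1 \<le> k" using that by auto
    have "wconv G (p j) (\<lambda>x. 0)"
      using prof_wconv_0[OF r \<psi>H[OF j], of "x j" "t j"] std[OF j] True by (simp add: p_def[abs_def] Z_def)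
    from tendsto_norm[OF wconv_D[OF this af_Hm1[OF pH[OF kk, of a']]]]
    have "((\<lambda>n. cmod (af (p k a') (p j n))) \<longlongrightarrow> 0) G" by (simp add: Hm1_zero[OF af_Hm1[OF pH[OF kk]]])
    moreover have "cmod (af (p k a') (p j n)) = cmod (af (p j n) (p k a'))" for n
      using AF.ip_cnj[OF pH[OF j, of n] pH[OF kk, of a']] by simp
    ultimately have "((\<lambda>n. cmod (af (p j n) (p k a'))) \<longlongrightarrow> 0) G" by simp
    then have "eventually (\<lambda>n. cmod (af (p j n) (p k a')) < L\<^sup>2 * (1/4) ^ j) G"
      by (rule order_tendstoD) (use True in simp)
    then show ?thesis by eventually_elim (simp add: Q_def)
  next
    case False
    then show ?thesis by (auto simp: Q_def)
  qed
  from filter_select[OF Gs Gb, of Q P, OF evQ evP]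
  obtain \<sigma> where sm: "strict_mono \<sigma>" and P: "\<And>j. P j (\<sigma> j)" and Q: "\<And>j k. k < j \<Longrightarrow> Q k (\<sigma> k) j (\<sigma> j)" by blast
  have Good: "Good i j (\<sigma> j)" if "i \<le> j" for i j using P[of j] that by (simp add: P_def)
  have Far: "Far i k j (\<sigma> j)" if "i \<le> j" "k \<le> j" for i k j using P[of j] that by (simp add: P_def)
  \<comment> \<open>\<open>max n j\<close> instead of \<open>n\<close> matters only for the bound \<open>Rb\<close> at all indices\<close>
  define t' where "t' = (\<lambda>j n. t j (\<sigma> (max n j)))"
  define x' where "x' = (\<lambda>j n. x j (\<sigma> (max n j)))"
  let ?u = "\<lambda>n. v (\<sigma> n)"
  let ?S = "SUP n. H1_norm (v (\<sigma> n))"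
  let ?R = "remainder U ?u \<psi> t' x'"
  have pfl: "profile U \<psi> t' x' j n = p j (\<sigma> (max n j))" for j n
    by (simp add: profile_def p_def prof_def t'_def x'_def)
  have RE: "?R J n = R J (\<sigma> n)" if "J \<le> n" for J n
    unfolding remainder_def R pfl using that by (intro ext arg_cong2[where f = "(-)"] sum.cong) (auto simp: p_def max_absorb1)
  have seq0: "(\<lambda>n. f n) \<longlonglongrightarrow> (0 :: 'z :: real_normed_vector)" if "\<And>n. n \<ge> J \<Longrightarrow> norm (f n) < 1 / real (Suc n)" for f J
    by (rule Lim_null_comparison[OF _ LIMSEQ_inverse_real_of_nat])
      (use that in \<open>auto intro!: eventually_sequentiallyI[of J] simp: inverse_eq_divide less_imp_le\<close>)
  have bS: "bdd_above (range (\<lambda>n. H1_norm (v (\<sigma> n))))" using K by (intro bdd_aboveI2[where M = K]) auto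
  have uS: "H1_norm (v (\<sigma> n)) \<le> ?S" for n by (rule cSUP_upper[OF UNIV_I bS])
  have LS: "L \<le> ?S"
  proof (rule tendsto_le[OF sequentially_bot tendsto_const])
    have "(\<lambda>n. H1_norm (v (\<sigma> n)) - L) \<longlonglongrightarrow> 0" by (rule seq0[of 0]) (use P in \<open>simp add: P_def\<close>)
    then show "(\<lambda>n. H1_norm (v (\<sigma> n))) \<longlonglongrightarrow> L" by (simp add: LIM_zero_iff)
    show "\<forall>\<^sub>F n in sequentially. H1_norm (v (\<sigma> n)) \<le> ?S" using uS by simp
  qed
  have Snn: "0 \<le> ?S" using L0 LS by simp
  have std_seq: "standard_seq (\<lambda>n. s (\<sigma> (max n j)))" if g: "gstd s" and ti: "\<And>n. n \<ge> j \<Longrightarrow> toinf s n (\<sigma> n)" for s j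
  proof -
    consider "filterlim s at_top G" | "filterlim s at_bot G" | "\<forall>n. s n = 0" using g by (auto simp: gstd_def)
    then show ?thesis
    proof cases
      case 1
      have "filterlim (\<lambda>n. s (\<sigma> (max n j))) at_top sequentially"
      proof (rule filterlim_at_top_mono[OF filterlim_real_sequentially], rule eventually_sequentiallyI[of j])
        fix n assume "j \<le> n"
        then show "real n \<le> s (\<sigma> (max n j))" using ti[of n] 1 by (simp add: toinf_def max_absorb1)
      qed
      then show ?thesis by (simp add: standard_seq_def)
    next
      case 2
      have "filterlim (\<lambda>n. - s (\<sigma> (max n j))) at_top sequentially"
      proof (rule filterlim_at_top_mono[OF filterlim_real_sequentially], rule eventually_sequentiallyI[of j])
        fix n assume "j \<le> n"
        then show "real n \<le> - s (\<sigma> (max n j))" using ti[of n] 2 by (simp add: toinf_def max_absorb1)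
      qed
      then show ?thesis by (simp add: standard_seq_def filterlim_uminus_at_top)
    qed (simp add: standard_seq_def)
  qed
  have C0: "\<forall>j\<ge>1. \<psi> j \<in> H1 \<and> standard_seq (t' j) \<and> standard_seq (x' j)"
  proof (intro allI impI conjI)
    fix j :: nat assume j: "j \<ge> 1"
    show "\<psi> j \<in> H1" by (rule \<psi>H[OF j])
    have g: "gstd (t j)" "gstd (x j)" using std[OF j] by auto
    show "standard_seq (t' j)" unfolding t'_def by (rule std_seq[OF g(1)]) (use Good in \<open>simp add: Good_def\<close>)
    show "standard_seq (x' j)" unfolding x'_def by (rule std_seq[OF g(2)]) (use Good in \<open>simp add: Good_def\<close>)
  qed
  have Ca: "\<forall>j\<ge>1. \<forall>k\<ge>1. j \<noteq> k \<longrightarrow> filterlim (\<lambda>n. \<bar>t' j n - t' k n\<bar> + \<bar>x' j n - x' k n\<bar>) at_top sequentially"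
  proof (intro allI impI)
    fix i k :: nat assume ik: "i \<ge> 1" "k \<ge> 1" "i \<noteq> k"
    show "filterlim (\<lambda>n. \<bar>t' i n - t' k n\<bar> + \<bar>x' i n - x' k n\<bar>) at_top sequentially"
    proof (rule filterlim_at_top_mono[OF filterlim_real_sequentially], rule eventually_sequentiallyI[of "max i k"])
      fix n assume n: "max i k \<le> n"
      then show "real n \<le> \<bar>t' i n - t' k n\<bar> + \<bar>x' i n - x' k n\<bar>"
        using Far[of i n k] ik by (simp add: Far_def t'_def x'_def max_absorb1)
    qed
  qed
  have Cb1: "\<forall>J\<ge>1. limsup (\<lambda>n. LinfLinf_norm (\<lambda>s. U s (?R J n))) \<le> ereal (Cst * (sqrt (Lp_norm 2 (\<psi> J)) * sqrt ?S))"
  proof (intro allI impI)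
    fix J :: nat assume J: "J \<ge> 1"
    have "limsup (\<lambda>n. LinfLinf_norm (\<lambda>s. U s (?R J n))) \<le> limsup (\<lambda>n. ereal (a J + inverse (real (Suc n))))"
    proof (rule Limsup_mono, rule eventually_sequentiallyI[of J])
      fix n assume n: "J \<le> n"
      have "LinfLinf_norm (\<lambda>s. U s (R J (\<sigma> n))) \<le> ereal (supU (R J (\<sigma> n)))" by (rule LinfLinf_le[OF bddH_D[OF bR]])
      also have "\<dots> \<le> ereal (a J + inverse (real (Suc n)))"
        using Good[OF n] by (simp add: Good_def inverse_eq_divide less_imp_le)
      finally show "LinfLinf_norm (\<lambda>s. U s (?R J n)) \<le> ereal (a J + inverse (real (Suc n)))" unfolding RE[OF n] .
    qed
    also have "\<dots> = ereal (a J)"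
    proof (rule lim_imp_Limsup)
      have "(\<lambda>n. a J + inverse (real (Suc n))) \<longlonglongrightarrow> a J + 0" by (intro tendsto_intros LIMSEQ_inverse_real_of_nat)
      then show "(\<lambda>n. ereal (a J + inverse (real (Suc n)))) \<longlonglongrightarrow> ereal (a J)" by simp
    qed simp
    also have "a J \<le> Cst * (sqrt (Lp_norm 2 (\<psi> J)) * sqrt ?S)"
    proof -
      obtain J' where J': "J = Suc J'" using J by (cases J) auto
      \<comment> \<open>Monotonicity of \<open>lam\<close> shifts the index:
        \<open>lam (R J)\<close> is at most \<open>lam (R (J - 1))\<close>, which the choice of the
        profile \<open>J\<close> controls by its norm.\<close>
      have lJ: "lam (R J) \<le> 2 * Lp_norm 2 (\<psi> J)" using lm[of J'] by (simp add: J')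
      have "a J \<le> 2 * sqrt (lam (R J) * (C2 * k J))" by (rule a(2))
      also have "\<dots> \<le> 2 * sqrt ((2 * Lp_norm 2 (\<psi> J)) * (C2 * (kappa * ?S)))"
      proof -
        have "k J \<le> kappa * ?S" using kle[of J] mult_left_mono[OF LS kappa_props(1)] by linarith
        then have "C2 * k J \<le> C2 * (kappa * ?S)" using C2_nonneg by (rule mult_left_mono)
        with lJ have "lam (R J) * (C2 * k J) \<le> (2 * Lp_norm 2 (\<psi> J)) * (C2 * (kappa * ?S))"
          by (rule mult_mono) (use k0[of J] C2_nonneg Lp2_norm_nonneg[of "\<psi> J"] in auto)
        then show ?thesis by (intro mult_left_mono real_sqrt_le_mono) simp_all
      qed
      also have "\<dots> = 2 * sqrt ((2 * C2 * kappa) * (Lp_norm 2 (\<psi> J) * ?S))" by (simp add: mult_ac)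
      also have "\<dots> = (2 * sqrt (2 * C2 * kappa)) * (sqrt (Lp_norm 2 (\<psi> J)) * sqrt ?S)" by (simp only: real_sqrt_mult mult_ac)
      also have "\<dots> \<le> Cst * (sqrt (Lp_norm 2 (\<psi> J)) * sqrt ?S)"
        using Cst_props(2) Snn Lp2_norm_nonneg by (intro mult_right_mono) auto
      finally show ?thesis .
    qed
    finally show "limsup (\<lambda>n. LinfLinf_norm (\<lambda>s. U s (?R J n))) \<le> ereal (Cst * (sqrt (Lp_norm 2 (\<psi> J)) * sqrt ?S))" by simp
  qed
  have Cb2: "(\<lambda>J. sqrt (Lp_norm 2 (\<psi> J)) * sqrt ?S) \<longlonglongrightarrow> 0"
  proof -
    have "summable (\<lambda>j. (h (Suc j))\<^sup>2)"
    proof (rule summableI_nonneg_bounded)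
      show "(\<Sum>j<n. (h (Suc j))\<^sup>2) \<le> (kappa * L)\<^sup>2" for n
        using hsum[of n] by (simp add: sum.atLeast1_atMost_eq)
    qed simp
    then have "(\<lambda>j. (h (Suc j))\<^sup>2) \<longlonglongrightarrow> 0" by (rule summable_LIMSEQ_zero)
    then have "(\<lambda>j. sqrt ((h (Suc j))\<^sup>2)) \<longlonglongrightarrow> sqrt 0" by (rule tendsto_real_sqrt)
    then have hl: "(\<lambda>j. h (Suc j)) \<longlonglongrightarrow> 0" using h0 by simp
    have "(\<lambda>j. Lp_norm 2 (\<psi> (Suc j))) \<longlonglongrightarrow> 0"
      by (rule Lim_null_comparison[OF _ hl]) (simp add: Lp2_norm_nonneg h_def L2_norm_le_H1_norm)
    then have "(\<lambda>j. Lp_norm 2 (\<psi> j)) \<longlonglongrightarrow> 0" by (rule LIMSEQ_imp_Suc)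
    then have "(\<lambda>j. sqrt (Lp_norm 2 (\<psi> j)) * sqrt ?S) \<longlonglongrightarrow> sqrt 0 * sqrt ?S" by (intro tendsto_intros)
    then show ?thesis by simp
  qed
  have Cc: "\<forall>J\<ge>1.
     (\<lambda>n. (Lp_norm 2 (v (\<sigma> n)))\<^sup>2 - ((\<Sum>j = 1..J. (Lp_norm 2 (\<psi> j))\<^sup>2) + (Lp_norm 2 (?R J n))\<^sup>2)) \<longlonglongrightarrow> 0 \<and>
     (\<lambda>n. B (v (\<sigma> n)) (v (\<sigma> n)) - ((\<Sum>j = 1..J. B (translate (x' j n) (\<psi> j)) (translate (x' j n) (\<psi> j))) + B (?R J n) (?R J n))) \<longlonglongrightarrow> 0 \<and>
     (\<lambda>n. Lp_norm r (v (\<sigma> n)) powr r - ((\<Sum>j = 1..J. Lp_norm r (profile U \<psi> t' x' j n) powr r) + Lp_norm r (?R J n) powr r)) \<longlonglongrightarrow> 0"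
  proof (intro allI impI conjI)
    fix J :: nat
    note gd = Good[unfolded Good_def]
    have mx: "\<sigma> (max n j) = \<sigma> n" if "J \<le> n" "j \<in> {1..J}" for n j using that by (simp add: max_absorb1)
    have rp: "r > 0" using r(1) by simp
    show "(\<lambda>n. (Lp_norm 2 (v (\<sigma> n)))\<^sup>2 - ((\<Sum>j = 1..J. (Lp_norm 2 (\<psi> j))\<^sup>2) + (Lp_norm 2 (?R J n))\<^sup>2)) \<longlonglongrightarrow> 0"
    proof (rule seq0[of J])
      fix n assume n: "J \<le> n"
      show "norm ((Lp_norm 2 (v (\<sigma> n)))\<^sup>2 - ((\<Sum>j = 1..J. (Lp_norm 2 (\<psi> j))\<^sup>2) + (Lp_norm 2 (?R J n))\<^sup>2)) < 1 / real (Suc n)"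
        using gd[OF n] unfolding RE[OF n] e1_def by blast
    qed
    show "(\<lambda>n. B (v (\<sigma> n)) (v (\<sigma> n)) - ((\<Sum>j = 1..J. B (translate (x' j n) (\<psi> j)) (translate (x' j n) (\<psi> j))) + B (?R J n) (?R J n))) \<longlonglongrightarrow> 0"
    proof (rule seq0[of J])
      fix n assume n: "J \<le> n"
      have "(\<Sum>j = 1..J. B (translate (x' j n) (\<psi> j)) (translate (x' j n) (\<psi> j))) = (\<Sum>j = 1..J. B (translate (x j (\<sigma> n)) (\<psi> j)) (translate (x j (\<sigma> n)) (\<psi> j)))"
        by (rule sum.cong) (simp_all add: x'_def mx[OF n])
      then show "norm (B (v (\<sigma> n)) (v (\<sigma> n)) - ((\<Sum>j = 1..J. B (translate (x' j n) (\<psi> j)) (translate (x' j n) (\<psi> j))) + B (?R J n) (?R J n))) < 1 / real (Suc n)"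
        using gd[OF n] unfolding RE[OF n] e2_def by simp
    qed
    show "(\<lambda>n. Lp_norm r (v (\<sigma> n)) powr r - ((\<Sum>j = 1..J. Lp_norm r (profile U \<psi> t' x' j n) powr r) + Lp_norm r (?R J n) powr r)) \<longlonglongrightarrow> 0"
      unfolding Lp_norm_powr[OF rp] pfl
    proof (rule seq0[of J])
      fix n assume n: "J \<le> n"
      have "(\<Sum>j = 1..J. Lr r (p j (\<sigma> (max n j)))) = (\<Sum>j = 1..J. Lr r (p j (\<sigma> n)))"
        by (rule sum.cong) (simp_all add: mx[OF n])
      then show "norm (Lr r (v (\<sigma> n)) - ((\<Sum>j = 1..J. Lr r (p j (\<sigma> (max n j)))) + Lr r (?R J n))) < 1 / real (Suc n)"
        using gd[OF n] unfolding RE[OF n] e3_def by simp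
    qed
  qed
  have Cd: "\<forall>J\<ge>1. (AE y in lborel. \<psi> J y = 0) \<longrightarrow> (\<forall>j\<ge>J. AE y in lborel. \<psi> j y = 0)"
  proof (intro allI impI)
    fix J j :: nat assume J: "J \<ge> 1" "AE y in lborel. \<psi> J y = 0" "J \<le> j"
    obtain J' where J': "J = Suc J'" using J(1) by (cases J) auto
    obtain j' where j': "j = Suc j'" using J(1,3) by (cases j) auto
    have "Lp_norm 2 (\<psi> J) = 0" using Lp2_norm_zero_iff[OF H1_Lp2[OF \<psi>H[OF J(1)]]] J(2) by blast
    then have "lam (R J') \<le> 0" using lm[of J'] by (simp add: J')
    moreover have "lam (R j') \<le> lam (R J')"
    proof (rule lift_Suc_antimono_le[of "\<lambda>J. lam (R J)"])
      show "lam (R (Suc i)) \<le> lam (R i)" for i using lm[of i] by blast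
      show "J' \<le> j'" using J(3) by (simp add: J' j')
    qed
    ultimately have "Lp_norm 2 (\<psi> j) \<le> 0" using lm[of j'] by (simp add: j')
    then have "Lp_norm 2 (\<psi> j) = 0" using Lp2_norm_nonneg[of "\<psi> j"] by simp
    then show "AE y in lborel. \<psi> j y = 0" using Lp2_norm_zero_iff[OF H1_Lp2[OF \<psi>H]] J by simp
  qed
  have dn: "H1_norm (\<lambda>y. f y - g y) \<le> H1_norm f + H1_norm g" if "f \<in> H1" "g \<in> H1" for f g
    using HH.nrm_diff_triangle[OF that(1) zero_H1 that(2)] HH.nrm_diff_commute[OF zero_H1 that(2)] by simp
  have pnorm: "H1_norm (p j n) \<le> C2 * h j" if "j \<ge> 1" for j n
    unfolding p_def h_def by (rule prof_H1_norm[OF \<psi>H[OF that]])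
  have Rb: "H1_norm (?R J n) \<le> (kappa + 1 + kappa2 + C2 * kappa) * ?S" for J n
  proof (cases "L > 0")
    case False
    \<comment> \<open>Without a positive \<open>L\<close> there is no slack for the selection
      conditions, but then all profiles have norm 0 and removing them changes no norm.\<close>
    then have "L = 0" using L0 by simp
    then have hz: "h j = 0" if "j \<ge> 1" for j using hle[OF that] h0[of j] by simp
    define q where "q = (\<lambda>j. if j = 0 then (\<lambda>_. 0) else p j (\<sigma> (max n j)))"
    have qH: "q j \<in> H1" for j using pH[of j] zero_H1 by (cases "j = 0") (auto simp: q_def)
    have Req: "?R J n = (\<lambda>y. v (\<sigma> n) y - (\<Sum>j = 1..J. q j y))"
      unfolding remainder_def pfl by (intro ext arg_cong2[where f = "(-)"] sum.cong) (auto simp: q_def)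
    have "H1_norm (\<lambda>y. \<Sum>j = 1..J. q j y) \<le> (\<Sum>j = 1..J. H1_norm (q j))" by (rule H1_norm_sum_le[OF qH])
    also have "\<dots> = 0"
    proof (rule sum.neutral, rule ballI)
      fix j assume "j \<in> {1..J}"
      then show "H1_norm (q j) = 0" using pnorm[of j "\<sigma> (max n j)"] hz[of j] H1_norm_nonneg[of "q j"] by (simp add: q_def)
    qed
    finally have q0: "H1_norm (\<lambda>y. \<Sum>j = 1..J. q j y) \<le> 0" .
    have "(\<lambda>y. \<Sum>j = 1..J. q j y) \<in> H1" by (rule sum_H1[OF qH])
    from dn[OF vH[of "\<sigma> n"] this] q0 have "H1_norm (?R J n) \<le> 1 * ?S" using uS[of n] by (simp add: Req)
    also have "\<dots> \<le> (kappa + 1 + kappa2 + C2 * kappa) * ?S"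
      using Snn kappa_props C2_nonneg by (intro mult_right_mono) auto
    finally show ?thesis .
  next
    case True
    \<comment> \<open>The slack \<open>m * L\<^sup>2\<close> in the energy bound accounts for the
      added 1 next to \<open>kappa\<close>.\<close>
    have small_index: "H1_norm (R i (\<sigma> j)) \<le> (kappa + 1) * ?S" if "i \<le> j" for i j
    proof -
      have "m * (H1_norm (R i (\<sigma> j)))\<^sup>2 \<le> M * (H1_norm (v (\<sigma> j)))\<^sup>2 + m * L\<^sup>2"
        using Good[OF that] True by (simp add: Good_def)
      also have "\<dots> \<le> M * ?S\<^sup>2 + m * ?S\<^sup>2"
        using uS[of j] LS L0 const_signs H1_norm_nonneg[of "v (\<sigma> j)"] by (intro add_mono mult_left_mono power_mono) auto
      also have "M * ?S\<^sup>2 + m * ?S\<^sup>2 = m * (kappa\<^sup>2 * ?S\<^sup>2 + ?S\<^sup>2)" using const_signs(2) by (simp add: kappa_props field_simps)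
      also have "\<dots> \<le> m * ((kappa + 1) * ?S)\<^sup>2"
      proof -
        have "0 \<le> 2 * kappa * ?S\<^sup>2" using kappa_props(1) by simp
        moreover have "((kappa + 1) * ?S)\<^sup>2 = kappa\<^sup>2 * ?S\<^sup>2 + ?S\<^sup>2 + 2 * kappa * ?S\<^sup>2"
          by (simp add: power2_eq_square algebra_simps)
        ultimately show ?thesis using const_signs(2) by (intro mult_left_mono) auto
      qed
      finally have "(H1_norm (R i (\<sigma> j)))\<^sup>2 \<le> ((kappa + 1) * ?S)\<^sup>2" using const_signs(2) by simp
      then show ?thesis by (rule power2_le_imp_le) (use kappa_props(1) Snn in simp)
    qed
    show ?thesis
    proof (cases "J \<le> n")
      case True
      have "H1_norm (?R J n) \<le> (kappa + 1) * ?S" unfolding RE[OF True] by (rule small_index[OF True])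
      also have "\<dots> \<le> (kappa + 1 + kappa2 + C2 * kappa) * ?S"
        using Snn kappa_props C2_nonneg by (intro mult_right_mono) auto
      finally show ?thesis .
    next
      case False
      \<comment> \<open>Nothing is known about the profile data at index 0, so the value there is
        set to 0 to have all \<open>q j\<close> in \<open>H1\<close>.\<close>
      define q where "q = (\<lambda>j. if j = 0 then (\<lambda>_. 0) else p j (\<sigma> j))"
      have qH: "q j \<in> H1" for j using pH[of j] zero_H1 by (cases "j = 0") (auto simp: q_def)
      \<comment> \<open>For \<open>n < J\<close>, the first \<open>n\<close> profiles are evaluated
        at the index \<open>\<sigma> n\<close> and combine to the remainder of stage
        \<open>n\<close>; each later profile \<open>j\<close> enters at its own index
        \<open>\<sigma> j\<close>, where it is almost orthogonal to its predecessors.\<close>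
      have Req: "?R J n = (\<lambda>y. R n (\<sigma> n) y - (\<Sum>j = Suc n..J. q j y))"
      proof
        fix y
        have "{1..J} = {1..n} \<union> {Suc n..J}" using False by auto
        then have "(\<Sum>j = 1..J. p j (\<sigma> (max n j)) y) = (\<Sum>j = 1..n. p j (\<sigma> (max n j)) y) + (\<Sum>j = Suc n..J. p j (\<sigma> (max n j)) y)"
          by (simp only:) (rule sum.union_disjoint, auto)
        also have "(\<Sum>j = 1..n. p j (\<sigma> (max n j)) y) = (\<Sum>j = 1..n. prof (\<psi> j) (x j) (t j) (\<sigma> n) y)"
          by (rule sum.cong) (auto simp: p_def max_absorb1)
        also have "(\<Sum>j = Suc n..J. p j (\<sigma> (max n j)) y) = (\<Sum>j = Suc n..J. q j y)"
          by (rule sum.cong) (auto simp: q_def max_absorb2)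
        finally show "?R J n y = R n (\<sigma> n) y - (\<Sum>j = Suc n..J. q j y)"
          unfolding remainder_def R pfl by simp
      qed
      have "H1_norm (\<lambda>y. \<Sum>j = Suc n..J. q j y) \<le> (kappa2 + C2 * kappa) * L"
      proof (rule tail_bound[OF True qH, where h = h and Z = Z])
        show "H1_norm (q j) \<le> C2 * h j" if "j \<ge> 1" for j using pnorm[OF that] that by (simp add: q_def)
        show "0 \<le> h j" for j by (rule h0)
        show "(\<Sum>j = 1..J. (h j)\<^sup>2) \<le> (kappa * L)\<^sup>2" by (rule hsum)
        show "j = k" if "j \<ge> 1" "k \<ge> 1" "Z j" "Z k" for j k
        proof (rule ccontr)
          assume "j \<noteq> k"
          then have "filterlim (\<lambda>n. \<bar>t j n - t k n\<bar> + \<bar>x j n - x k n\<bar>) at_top G" using far that by blast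
          then have "filterlim (\<lambda>n. 0 :: real) at_top G" using that by (simp add: Z_def)
          then have "eventually (\<lambda>n. (1 :: real) \<le> 0) G" by (simp only: filterlim_at_top)
          then show False using Gb by simp
        qed
        show "cmod (af (q j) (q k)) \<le> L\<^sup>2 * (1/4) ^ j" if "1 \<le> k" "k < j" "\<not> Z j" for j k
          using Q[OF that(2)] that True by (simp add: Q_def q_def less_imp_le)
      qed
      also have "\<dots> \<le> (kappa2 + C2 * kappa) * ?S" using LS kappa_props C2_nonneg by (intro mult_left_mono) auto
      finally have "H1_norm (\<lambda>y. \<Sum>j = Suc n..J. q j y) \<le> (kappa2 + C2 * kappa) * ?S" .
      moreover have "H1_norm (?R J n) \<le> H1_norm (R n (\<sigma> n)) + H1_norm (\<lambda>y. \<Sum>j = Suc n..J. q j y)"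
        unfolding Req by (rule dn[OF bddH_D[OF bR] sum_H1[OF qH]])
      ultimately show ?thesis using small_index[of n n] by (simp add: algebra_simps)
    qed
  qed
  have Ce: "\<forall>j\<ge>1. \<forall>J\<ge>1. \<forall>n. H1_norm (\<psi> j) + H1_norm (?R J n) \<le> Cst * ?S"
  proof (intro allI impI)
    fix j J n :: nat assume j: "j \<ge> 1"
    have "H1_norm (\<psi> j) \<le> kappa * ?S" using hle[OF j] mult_left_mono[OF LS kappa_props(1)] by (simp add: h_def)
    then have "H1_norm (\<psi> j) + H1_norm (?R J n) \<le> (2 * kappa + 1 + kappa2 + C2 * kappa) * ?S"
      using Rb[of J n] by (simp add: algebra_simps)
    also have "\<dots> \<le> Cst * ?S" using Cst_props(3) Snn by (rule mult_right_mono)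
    finally show "H1_norm (\<psi> j) + H1_norm (?R J n) \<le> Cst * ?S" .
  qed
  show ?thesis
    unfolding Let_def
    by (rule exI[of _ \<sigma>], rule exI[of _ \<psi>], rule exI[of _ t'], rule exI[of _ x'])
      (intro conjI sm C0 Ca Cb1 Cb2 Cc Cd Ce)
qed

end

text \<open>The constant is chosen before \<open>r\<close> and the sequence, which is why A5, the
  assumption depending on \<open>r\<close>, stands inside the quantifiers. Vanishing of a profile is
  understood almost everywhere, in accordance with the representation of function classes by
  functions.\<close>

theorem theorem2p5:
  fixes D :: "cfun set"
    and A :: "cfun \<Rightarrow> cfun"
    and B :: "cfun \<Rightarrow> cfun \<Rightarrow> complex"
    and U :: "real \<Rightarrow> cfun \<Rightarrow> cfun"
  assumes "assumption_A1 D A B"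
    and "schroedinger_group D A U"
    and "assumption_A2 U"
    and "assumption_A3 B"
    and "assumption_A4 U"
    and "assumption_A6 U"
  shows "\<exists>C>0. \<forall>(r::real) (v :: nat \<Rightarrow> cfun).
    2 < r \<longrightarrow> assumption_A5 r U \<longrightarrow>
    (\<forall>n. v n \<in> H1) \<longrightarrow> bdd_above (range (\<lambda>n. H1_norm (v n))) \<longrightarrow>
    (\<exists>(\<sigma> :: nat \<Rightarrow> nat) (\<psi> :: nat \<Rightarrow> cfun) (t :: nat \<Rightarrow> nat \<Rightarrow> real) (x :: nat \<Rightarrow> nat \<Rightarrow> real).
      strict_mono \<sigma> \<and>
      (\<forall>j\<ge>1. \<psi> j \<in> H1 \<and> standard_seq (t j) \<and> standard_seq (x j)) \<and>
      (let u = (\<lambda>n. v (\<sigma> n));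
           S = (SUP n. H1_norm (u n));
           R = remainder U u \<psi> t x
       in
        (\<forall>j\<ge>1. \<forall>k\<ge>1. j \<noteq> k \<longrightarrow>
           filterlim (\<lambda>n. \<bar>t j n - t k n\<bar> + \<bar>x j n - x k n\<bar>) at_top sequentially) \<and>
        (\<forall>J\<ge>1. limsup (\<lambda>n. LinfLinf_norm (\<lambda>s. U s (R J n)))
                 \<le> ereal (C * (sqrt (Lp_norm 2 (\<psi> J)) * sqrt S))) \<and>
        (\<lambda>J. sqrt (Lp_norm 2 (\<psi> J)) * sqrt S) \<longlonglongrightarrow> 0 \<and>
        (\<forall>J\<ge>1.
           (\<lambda>n. (Lp_norm 2 (u n))\<^sup>2
                - ((\<Sum>j = 1..J. (Lp_norm 2 (\<psi> j))\<^sup>2) + (Lp_norm 2 (R J n))\<^sup>2)) \<longlonglongrightarrow> 0 \<and>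
           (\<lambda>n. B (u n) (u n)
                - ((\<Sum>j = 1..J. B (translate (x j n) (\<psi> j)) (translate (x j n) (\<psi> j)))
                   + B (R J n) (R J n))) \<longlonglongrightarrow> 0 \<and>
           (\<lambda>n. Lp_norm r (u n) powr r
                - ((\<Sum>j = 1..J. Lp_norm r (profile U \<psi> t x j n) powr r)
                   + Lp_norm r (R J n) powr r)) \<longlonglongrightarrow> 0) \<and>
        (\<forall>J\<ge>1. (AE y in lborel. \<psi> J y = 0) \<longrightarrow> (\<forall>j\<ge>J. AE y in lborel. \<psi> j y = 0)) \<and>
        (\<forall>j\<ge>1. \<forall>J\<ge>1. \<forall>n. H1_norm (\<psi> j) + H1_norm (R J n) \<le> C * S)))"
proof -
  from assms(1) have sa: "selfadjoint D A" and Apos: "\<And>v. v \<in> D \<Longrightarrow> 0 \<le> Re (L2_inner (A v) v)"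
    and ext: "H1_extension D A B"
    and coer: "\<exists>c0>0. \<exists>m>0. \<exists>M>0. \<forall>z. \<forall>v\<in>H1.
        m * (H1_norm v)\<^sup>2 \<le> Re (conj_translate_form z B v v) + c0 * (Lp_norm 2 v)\<^sup>2 \<and>
        Re (conj_translate_form z B v v) + c0 * (Lp_norm 2 v)\<^sup>2 \<le> M * (H1_norm v)\<^sup>2"
    by (auto simp: assumption_A1_def)
  from coer obtain c0 m M :: real where c: "c0 > 0" "m > 0" "M > 0" and
    c': "\<And>z v. v \<in> H1 \<Longrightarrow> m * (H1_norm v)\<^sup>2 \<le> Re (conj_translate_form z B v v) + c0 * (Lp_norm 2 v)\<^sup>2"
      "\<And>z v. v \<in> H1 \<Longrightarrow> Re (conj_translate_form z B v v) + c0 * (Lp_norm 2 v)\<^sup>2 \<le> M * (H1_norm v)\<^sup>2"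
    by blast
  obtain C2' where C2': "\<And>t \<psi>. \<psi> \<in> H1 \<Longrightarrow> U t \<psi> \<in> H1 \<and> H1_norm (U t \<psi>) \<le> C2' * H1_norm \<psi>"
    using assms(3) unfolding assumption_A2_def by blast
  \<comment> \<open>The constants of A2 and of the boundedness of \<open>B\<close> carry no sign;
    enlarging them to at least 1 and 0 makes products of inequalities monotone.\<close>
  define C2 where "C2 = max 1 C2'"
  have U2: "H1_norm (U t \<psi>) \<le> C2 * H1_norm \<psi>" if "\<psi> \<in> H1" for t \<psi>
    using C2'[OF that, of t] mult_right_mono[of C2' C2 "H1_norm \<psi>"] H1_norm_nonneg[of \<psi>] by (simp add: C2_def)
  obtain CB' where CB': "\<And>u. u \<in> H1 \<Longrightarrow> Hm1_norm (B u) \<le> CB' * H1_norm u"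
    using ext unfolding H1_extension_def by blast
  have Bm: "B u \<in> Hm1" if "u \<in> H1" for u using ext that unfolding H1_extension_def by blast
  define CB where "CB = max 0 CB'"
  have Bb: "cmod (B u v) \<le> CB * H1_norm u * H1_norm v" if "u \<in> H1" "v \<in> H1" for u v
  proof -
    have "Hm1_norm (B u) \<le> CB * H1_norm u"
      using CB'[OF that(1)] mult_right_mono[of CB' CB "H1_norm u"] H1_norm_nonneg[of u] by (simp add: CB_def)
    then have "Hm1_norm (B u) * H1_norm v \<le> CB * H1_norm u * H1_norm v" using H1_norm_nonneg by (rule mult_right_mono)
    with Hm1_bound[OF Bm[OF that(1)] that(2)] show ?thesis by linarith
  qed
  obtain G where G: "G \<le> sequentially" "ultra G" using ultra_exists[OF sequentially_bot] by blast
  interpret profile_setting D A B U C2 c0 m M CB G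
    by unfold_locales
      (use sa Apos ext c c' U2 C2' Bb assms(2,4,5,6) G in \<open>auto simp: C2_def CB_def\<close>)
  show ?thesis
    by (intro exI[of _ Cst] conjI allI impI Cst_props(1) main_decomposition) auto
qed

end
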